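(* Let $N\ge 3$. There exist positive constants $C_0,C_1,C_2$, depending only on $N$, such that the following holds. Let $\rho>0$ and let $V:\mathbb{R}^N\to\mathbb{R}$ satisfy: $V=V_1+V_2$ and $W(x):=V(x)|x|=W_1(x)+W_2(x)$, with $V_1\in L^{N/2}(\mathbb{R}^N)$, $W_1\in L^{N}(\mathbb{R}^N)$, $V_2,W_2\in L^\infty(\mathbb{R}^N)$, $|V_2(x)|+|W_2(x)|\to 0$ as $|x|\to\infty$, and $$\inf\Big\{\int_{\mathbb{R}^N}(|\nabla\varphi|^2+V\varphi^2)\,dx:\ \varphi\in H^1(\mathbb{R}^N),\ \int_{\mathbb{R}^N}\varphi^2\,dx=1\Big\}<0.$$ (i) If $$\max\{\|V_1^-\|_{N/2},\ \rho^2\|V_2^-\|_\infty\}<C_0,$$ then the problem $$-\Delta U+V(x)U=\lambda U+|U|^{2^*-2}U\ \text{ in }\mathbb{R}^N,\qquad \int_{\mathbb{R}^N}U^2\,dx=\rho^2,$$ has a solution $(U,\lambda)\in H^1(\mathbb{R}^N)\times\mathbb{R}$ such that $U$ is a local minimizer of $E$ on $\mathcal{M}_\rho$, with negative energy $E(U)<0$ and negative multiplier $\lambda<0$, and $U$ can be chosen to be strictly positive almost everywhere in $\mathbb{R}^N$. (ii) If in addition $$\max\{\|[(N-4)V_1]^+\|_{N/2},\ \|W_1\|_N\}<C_1\quad\text{and}\quad \max\{\rho^2\|[(N-4)V_2]^+\|_\infty,\ \rho\|W_2\|_\infty\}<C_2,$$ then the solution $(U,\lambda)$, with $U$ a local minimizer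 of $E$ on $\mathcal{M}_\rho$, $E(U)<0$, $\lambda<0$ and $U$ strictly positive almost everywhere in $\mathbb{R}^N$, can be chosen so that $U$ is a normalized ground state.
   Context: $2^*:=\frac{2N}{N-2}$; $f^+=\max\{f,0\}$ and $f^-=\max\{-f,0\}$; $\|\cdot\|_p$ is the norm of $L^p(\mathbb{R}^N)$. The energy $E:H^1(\mathbb{R}^N)\to\mathbb{R}$ is $$E(U)=\frac12\int_{\mathbb{R}^N}|\nabla U|^2dx+\frac12\int_{\mathbb{R}^N}V(x)U^2dx-\frac1{2^*}\int_{\mathbb{R}^N}|U|^{2^*}dx,$$ and $\mathcal{M}_\rho=\{U\in H^1(\mathbb{R}^N):\int_{\mathbb{R}^N}U^2\,dx=\rho^2\}$. Solutions are understood in the weak sense; they correspond to critical points of $E$ constrained to $\mathcal{M}_\rho$, with $\lambda$ the Lagrange multiplier. A normalized ground state is a critical point $U_0$ of $E$ constrained to $\mathcal{M}_\rho$ such that $E(U_0)=\inf\{E(U):U\in\mathcal{M}_\rho,\ \nabla_{\mathcal{M}_\rho}E(U)=0\}$. *)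

theory Defs
  imports "HOL-Analysis.Analysis" "HOL-Probability.Essential_Supremum"
begin

text \<open>
  All function spaces consist of real-valued functions on \<^typ>\<open>real ^ 'n\<close> and not of classes modulo
  equality almost everywhere; every notion below except classical differentiability (used for test
  functions only) is invariant under changes on Lebesgue null sets. The space dimension is
  \<^term>\<open>CARD('n)\<close>.
\<close>

section \<open>Lebesgue spaces\<close>

definition Lp_space :: "real \<Rightarrow> (real ^ 'n \<Rightarrow> real) set" where
  "Lp_space p = {f \<in> borel_measurable lebesgue. integrable lebesgue (\<lambda>x. \<bar>f x\<bar> powr p)}"

definition Lp_norm :: "real \<Rightarrow> (real ^ 'n \<Rightarrow> real) \<Rightarrow> real" where
  "Lp_norm p f = (LINT x|lebesgue. \<bar>f x\<bar> powr p) powr (1 / p)"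

definition Linf_space :: "(real ^ 'n \<Rightarrow> real) set" where
  "Linf_space = {f \<in> borel_measurable lebesgue. esssup lebesgue (\<lambda>x. ereal \<bar>f x\<bar>) < \<infinity>}"

definition Linf_norm :: "(real ^ 'n \<Rightarrow> real) \<Rightarrow> real" where
  "Linf_norm f = real_of_ereal (esssup lebesgue (\<lambda>x. ereal \<bar>f x\<bar>))"

definition pos_part :: "(real ^ 'n \<Rightarrow> real) \<Rightarrow> real ^ 'n \<Rightarrow> real" where
  "pos_part f x = max (f x) 0"

definition neg_part :: "(real ^ 'n \<Rightarrow> real) \<Rightarrow> real ^ 'n \<Rightarrow> real" where
  "neg_part f x = max (- f x) 0"

section \<open>The Sobolev space of order one\<close>

definition partial_deriv :: "'n \<Rightarrow> (real ^ 'n \<Rightarrow> real) \<Rightarrow> real ^ 'n \<Rightarrow> real" where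
  "partial_deriv i f x = frechet_derivative f (at x) (axis i 1)"

primrec Ck :: "nat \<Rightarrow> (real ^ 'n \<Rightarrow> real) \<Rightarrow> bool" where
  "Ck 0 f \<longleftrightarrow> continuous_on UNIV f"
| "Ck (Suc k) f \<longleftrightarrow> (\<forall>x. f differentiable (at x)) \<and> (\<forall>i. Ck k (partial_deriv i f))"

definition test_functions :: "(real ^ 'n \<Rightarrow> real) set" where
  "test_functions = {\<phi>. (\<forall>k. Ck k \<phi>) \<and> compact (closure {x. \<phi> x \<noteq> 0})}"

definition is_weak_partial :: "'n \<Rightarrow> (real ^ 'n \<Rightarrow> real) \<Rightarrow> (real ^ 'n \<Rightarrow> real) \<Rightarrow> bool" where
  "is_weak_partial i U g \<longleftrightarrow>
    (\<forall>\<phi> \<in> test_functions.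
      (LINT x|lebesgue. U x * partial_deriv i \<phi> x) = - (LINT x|lebesgue. g x * \<phi> x))"

definition H1 :: "(real ^ 'n \<Rightarrow> real) set" where
  "H1 = {U \<in> Lp_space 2. \<forall>i. \<exists>g \<in> Lp_space 2. is_weak_partial i U g}"

text \<open>The choice below is determined up to a null set for functions in \<^const>\<open>H1\<close>, and
  otherwise meaningless.\<close>

definition weak_partial :: "'n \<Rightarrow> (real ^ 'n \<Rightarrow> real) \<Rightarrow> real ^ 'n \<Rightarrow> real" where
  "weak_partial i U = (SOME g. g \<in> Lp_space 2 \<and> is_weak_partial i U g)"

definition weak_grad :: "(real ^ 'n \<Rightarrow> real) \<Rightarrow> real ^ 'n \<Rightarrow> real ^ 'n" where
  "weak_grad U x = (\<chi> i. weak_partial i U x)"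

definition H1_norm :: "(real ^ 'n \<Rightarrow> real) \<Rightarrow> real" where
  "H1_norm U = sqrt ((LINT x|lebesgue. (norm (weak_grad U x))\<^sup>2) + (LINT x|lebesgue. (U x)\<^sup>2))"

section \<open>The constrained variational problem\<close>

definition crit_exp :: "nat \<Rightarrow> real" where
  "crit_exp N = 2 * real N / (real N - 2)"

definition energy :: "(real ^ 'n \<Rightarrow> real) \<Rightarrow> (real ^ 'n \<Rightarrow> real) \<Rightarrow> real" where
  "energy V U =
    1 / 2 * (LINT x|lebesgue. (norm (weak_grad U x))\<^sup>2)
    + 1 / 2 * (LINT x|lebesgue. V x * (U x)\<^sup>2)
    - 1 / crit_exp CARD('n) * (LINT x|lebesgue. \<bar>U x\<bar> powr crit_exp CARD('n))"

definition mass_sphere :: "real \<Rightarrow> (real ^ 'n \<Rightarrow> real) set" where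
  "mass_sphere \<rho> = {U \<in> H1. (LINT x|lebesgue. (U x)\<^sup>2) = \<rho>\<^sup>2}"

text \<open>Bottom of the quadratic form of the operator \<open>-\<Delta> + V\<close>, as an extended real, so that it is a
  genuine infimum without any boundedness requirement.\<close>

definition spectral_bottom :: "(real ^ 'n \<Rightarrow> real) \<Rightarrow> ereal" where
  "spectral_bottom V =
    (INF \<phi> \<in> {\<phi> \<in> H1. (LINT x|lebesgue. (\<phi> x)\<^sup>2) = 1}.
      ereal (LINT x|lebesgue. (norm (weak_grad \<phi> x))\<^sup>2 + V x * (\<phi> x)\<^sup>2))"

text \<open>Weak solutions of \<open>-\<Delta>U + V U = \<mu> U + |U|\<^bsup>2*-2\<^esup> U\<close> with mass \<open>\<rho>\<^sup>2\<close>.\<close>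

definition normalized_solution ::
    "(real ^ 'n \<Rightarrow> real) \<Rightarrow> real \<Rightarrow> (real ^ 'n \<Rightarrow> real) \<Rightarrow> real \<Rightarrow> bool" where
  "normalized_solution V \<rho> U \<mu> \<longleftrightarrow>
    U \<in> mass_sphere \<rho> \<and>
    (\<forall>\<phi> \<in> H1.
      (LINT x|lebesgue. weak_grad U x \<bullet> weak_grad \<phi> x) + (LINT x|lebesgue. V x * U x * \<phi> x) =
      \<mu> * (LINT x|lebesgue. U x * \<phi> x)
      + (LINT x|lebesgue. \<bar>U x\<bar> powr (crit_exp CARD('n) - 2) * U x * \<phi> x))"

text \<open>\<open>U\<close> is a critical point of the energy constrained to the sphere when the differential of the
  energy at \<open>U\<close> vanishes on the tangent space \<open>{\<phi> \<in> H1. \<integral> U \<phi> = 0}\<close>. Since the energy is of class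
  C1 on \<^const>\<open>H1\<close>, its differential is given by directional derivatives.\<close>

definition constrained_critical ::
    "(real ^ 'n \<Rightarrow> real) \<Rightarrow> real \<Rightarrow> (real ^ 'n \<Rightarrow> real) \<Rightarrow> bool" where
  "constrained_critical V \<rho> U \<longleftrightarrow>
    U \<in> mass_sphere \<rho> \<and>
    (\<forall>\<phi> \<in> H1. (LINT x|lebesgue. U x * \<phi> x) = 0 \<longrightarrow>
      ((\<lambda>t. energy V (\<lambda>x. U x + t * \<phi> x)) has_real_derivative 0) (at 0))"

definition normalized_ground_state ::
    "(real ^ 'n \<Rightarrow> real) \<Rightarrow> real \<Rightarrow> (real ^ 'n \<Rightarrow> real) \<Rightarrow> bool" where
  "normalized_ground_state V \<rho> U \<longleftrightarrow>
    constrained_critical V \<rho> U \<and>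
    ereal (energy V U) = (INF \<Phi> \<in> {\<Phi>. constrained_critical V \<rho> \<Phi>}. ereal (energy V \<Phi>))"

definition local_minimizer ::
    "(real ^ 'n \<Rightarrow> real) \<Rightarrow> real \<Rightarrow> (real ^ 'n \<Rightarrow> real) \<Rightarrow> bool" where
  "local_minimizer V \<rho> U \<longleftrightarrow>
    U \<in> mass_sphere \<rho> \<and>
    (\<exists>\<epsilon>>0. \<forall>\<Phi> \<in> mass_sphere \<rho>. H1_norm (\<lambda>x. \<Phi> x - U x) < \<epsilon> \<longrightarrow> energy V U \<le> energy V \<Phi>)"

end

theory Submission
  imports Defs "HOL-Library.Diagonal_Subsequence"
begin

text \<open>
  On the part of the mass sphere where the Dirichlet integral is below a small constant \<open>g\<close>, the
  Sobolev inequality makes the critical term negligible, so the energy is bounded below, positive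
  where the Dirichlet integral equals \<open>g\<close>, and negative somewhere because the bottom of the
  spectrum is negative. A minimizing sequence converges almost everywhere along a subsequence; by
  the Brezis-Lieb lemma the remainder only adds energy, and since the minimum is negative, scaling
  the limit up to full mass does not increase the energy. The minimizer is thus an interior one,
  hence a constrained critical point, and it may be replaced by its absolute value. Its positivity
  follows by testing the equation with \<open>\<phi>\<^sup>2 / (U + e)\<close>: this bounds \<open>\<nabla> log (U + e)\<close> in \<open>L\<^sup>2\<close> locally,
  and letting \<open>e\<close> tend to \<open>0\<close> shows that the indicator of the set where \<open>U > 0\<close> has vanishing
  distributional gradient.

  For the ground state property, testing the equation with \<open>U ((1 + t) x) - U x\<close> and dividing by \<open>t\<close>
  gives a one-sided Pohozaev inequality without any regularity theory. It shows that a critical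
  point of negative energy has Dirichlet integral at most \<open>g\<close>, so the minimizer above competes with
  all of them.

  The Sobolev inequality is obtained by truncating at the levels \<open>2^k\<close> and comparing each truncation with
  its averages over cubes.
\<close>

section \<open>The space of square integrable functions\<close>

text \<open>Two obstacles shape the proof. First, mass may escape to infinity, so the limit of a
  minimizing sequence may have too little of it. The escaping remainder is a difference of two
  functions with Dirichlet integral at most g, hence has Dirichlet integral at most 4g; the
  smallness of g is demanded at 4g so that this remainder has nonnegative energy. Second, nothing
  beyond H1 regularity is available. Difference quotients replace the chain rule: pointwise
  estimates on them pass to weak derivatives, since they converge to these in norm and their
  boundedness implies membership in H1. In the dilation argument the Dirichlet integral of the
  increment need not be of second order in t. It enters the equation with the favourable factor
  -1/2, and the quadratic remainder of the nonlinearity is arranged to cost at most +1/2 of it, so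
  the two cancel; this is why an inequality results. Combining it with negative energy leaves the
  potential with the coefficient (N-2)/4 - 1/2 = (N-4)/4, the origin of the factor N-4 in the
  hypotheses.\<close>

definition ip :: "(real ^ 'n \<Rightarrow> real) \<Rightarrow> (real ^ 'n \<Rightarrow> real) \<Rightarrow> real" where
  "ip f g = (LINT x|lebesgue. f x * g x)"

text \<open>On functions rather than classes this is a seminorm, vanishing on L2 exactly for the
  functions that are zero a.e. The a.e. congruence lemmas below take the place of a
  quotient.\<close>

definition nrm :: "(real ^ 'n \<Rightarrow> real) \<Rightarrow> real" where
  "nrm f = sqrt (ip f f)"

abbreviation L2 :: "(real ^ 'n \<Rightarrow> real) set" where
  "L2 \<equiv> Lp_space 2"

lemma L2_iff: "f \<in> L2 \<longleftrightarrow> f \<in> borel_measurable lebesgue \<and> integrable lebesgue (\<lambda>x. (f x)\<^sup>2)"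
proof -
  have "\<bar>f x\<bar> powr 2 = (f x)\<^sup>2" for x
    by (cases "f x = 0") auto
  then show ?thesis unfolding Lp_space_def by simp
qed

lemma L2_meas [measurable_dest]: "f \<in> L2 \<Longrightarrow> f \<in> borel_measurable lebesgue"
  by (simp add: L2_iff)

lemma L2_mult_integrable:
  assumes "f \<in> L2" "g \<in> L2"
  shows "integrable lebesgue (\<lambda>x. f x * g x)"
proof (rule Bochner_Integration.integrable_bound)
  show "integrable lebesgue (\<lambda>x. (f x)\<^sup>2 + (g x)\<^sup>2)"
    using assms by (auto simp: L2_iff)
  show "(\<lambda>x. f x * g x) \<in> borel_measurable lebesgue"
    using assms by (auto simp: L2_iff)
  show "AE x in lebesgue. norm (f x * g x) \<le> norm ((f x)\<^sup>2 + (g x)\<^sup>2)"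
  proof (rule AE_I2)
    fix x
    have "2 * \<bar>f x\<bar> * \<bar>g x\<bar> \<le> (f x)\<^sup>2 + (g x)\<^sup>2"
      using sum_squares_bound[of "\<bar>f x\<bar>" "\<bar>g x\<bar>"] by simp
    moreover have "0 \<le> \<bar>f x\<bar> * \<bar>g x\<bar>" by simp
    ultimately have "\<bar>f x\<bar> * \<bar>g x\<bar> \<le> (f x)\<^sup>2 + (g x)\<^sup>2" by linarith
    then show "norm (f x * g x) \<le> norm ((f x)\<^sup>2 + (g x)\<^sup>2)"
      by (simp add: abs_mult)
  qed
qed

lemma L2_cmult [intro]: "f \<in> L2 \<Longrightarrow> (\<lambda>x. c * f x) \<in> L2"
  by (auto simp: L2_iff power_mult_distrib)

lemma L2_uminus [intro]: "f \<in> L2 \<Longrightarrow> (\<lambda>x. - f x) \<in> L2"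
  by (auto simp: L2_iff)

lemma L2_zero [simp, intro]: "(\<lambda>x. 0) \<in> L2"
  by (auto simp: L2_iff)

lemma L2_add [intro]:
  assumes "f \<in> L2" "g \<in> L2"
  shows "(\<lambda>x. f x + g x) \<in> L2"
proof -
  have "integrable lebesgue (\<lambda>x. (f x)\<^sup>2 + (g x)\<^sup>2 + 2 * (f x * g x))"
    using assms L2_mult_integrable[OF assms] by (auto simp: L2_iff)
  then show ?thesis using assms
    by (auto simp: L2_iff power2_sum algebra_simps)
qed

lemma L2_diff [intro]: "f \<in> L2 \<Longrightarrow> g \<in> L2 \<Longrightarrow> (\<lambda>x. f x - g x) \<in> L2"
  using L2_add[of f "\<lambda>x. - g x"] by auto

lemma L2_divide [intro]: "f \<in> L2 \<Longrightarrow> (\<lambda>x. f x / c) \<in> L2"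
  using L2_cmult[of f "inverse c"] by (simp add: field_simps)

lemma L2_bound:
  assumes "f \<in> L2" "g \<in> borel_measurable lebesgue" "AE x in lebesgue. \<bar>g x\<bar> \<le> \<bar>f x\<bar>"
  shows "g \<in> L2"
  unfolding L2_iff
proof (rule conjI[OF assms(2) Bochner_Integration.integrable_bound[where f = "\<lambda>x. (f x)\<^sup>2"]])
  show "integrable lebesgue (\<lambda>x. (f x)\<^sup>2)" using assms by (auto simp: L2_iff)
  show "(\<lambda>x. (g x)\<^sup>2) \<in> borel_measurable lebesgue" using assms by simp
  show "AE x in lebesgue. norm ((g x)\<^sup>2) \<le> norm ((f x)\<^sup>2)"
    using assms(3) by eventually_elim (simp add: abs_le_square_iff)
qed

lemma L2_bounded_mult:
  assumes "f \<in> L2" "g \<in> borel_measurable lebesgue" "\<And>x. \<bar>g x\<bar> \<le> C"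
  shows "(\<lambda>x. g x * f x) \<in> L2"
proof (rule L2_bound[of "\<lambda>x. C * f x"])
  show "(\<lambda>x. C * f x) \<in> L2" using assms by auto
  show "(\<lambda>x. g x * f x) \<in> borel_measurable lebesgue" using assms L2_meas by auto
  show "AE x in lebesgue. \<bar>g x * f x\<bar> \<le> \<bar>C * f x\<bar>"
  proof (rule AE_I2)
    fix x show "\<bar>g x * f x\<bar> \<le> \<bar>C * f x\<bar>"
      using assms(3)[of x] by (auto simp: abs_mult intro!: mult_right_mono)
  qed
qed

lemma L2_abs [intro]: "f \<in> L2 \<Longrightarrow> (\<lambda>x. \<bar>f x\<bar>) \<in> L2"
  by (rule L2_bound[of f]) (auto dest: L2_meas)

lemma ip_commute: "ip f g = ip g f"
  unfolding ip_def by (simp add: mult.commute)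

lemma ip_add_left: "f \<in> L2 \<Longrightarrow> g \<in> L2 \<Longrightarrow> h \<in> L2 \<Longrightarrow> ip (\<lambda>x. f x + g x) h = ip f h + ip g h"
  using Bochner_Integration.integral_add[OF L2_mult_integrable[of f h] L2_mult_integrable[of g h]]
  by (simp only: ip_def distrib_right)

lemma ip_diff_left: "f \<in> L2 \<Longrightarrow> g \<in> L2 \<Longrightarrow> h \<in> L2 \<Longrightarrow> ip (\<lambda>x. f x - g x) h = ip f h - ip g h"
  using Bochner_Integration.integral_diff[OF L2_mult_integrable[of f h] L2_mult_integrable[of g h]]
  by (simp only: ip_def left_diff_distrib)

lemma ip_cmult_left: "ip (\<lambda>x. c * f x) h = c * ip f h"
  unfolding ip_def by (simp add: mult.assoc)

lemma ip_add_right: "f \<in> L2 \<Longrightarrow> g \<in> L2 \<Longrightarrow> h \<in> L2 \<Longrightarrow> ip h (\<lambda>x. f x + g x) = ip h f + ip h g"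
  using ip_add_left[of f g h] by (simp add: ip_commute[of h])

lemma ip_diff_right: "f \<in> L2 \<Longrightarrow> g \<in> L2 \<Longrightarrow> h \<in> L2 \<Longrightarrow> ip h (\<lambda>x. f x - g x) = ip h f - ip h g"
  using ip_diff_left[of f g h] by (simp add: ip_commute[of h])

lemma ip_cmult_right: "ip h (\<lambda>x. c * f x) = c * ip h f"
  using ip_cmult_left[of c f h] by (simp add: ip_commute[of h])

lemma ip_self_nonneg [simp]: "0 \<le> ip f f"
  unfolding ip_def by (rule Bochner_Integration.integral_nonneg) simp

lemma nrm_nonneg [simp]: "0 \<le> nrm f"
  unfolding nrm_def by simp

lemma nrm_sq: "(nrm f)\<^sup>2 = ip f f"
  unfolding nrm_def by simp

lemma nrm_sq_int: "(nrm f)\<^sup>2 = (LINT x|lebesgue. (f x)\<^sup>2)"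
  unfolding nrm_sq ip_def by (simp add: power2_eq_square)

lemma nrm_cmult: "nrm (\<lambda>x. c * f x) = \<bar>c\<bar> * nrm f"
  unfolding nrm_def ip_cmult_left ip_cmult_right
  by (simp add: real_sqrt_mult mult.assoc[symmetric])

lemma nrm_zero [simp]: "nrm (\<lambda>x. 0) = 0"
  unfolding nrm_def ip_def by simp

lemma nrm_minus_commute: "nrm (\<lambda>x. f x - g x) = nrm (\<lambda>x. g x - f x)"
  using nrm_cmult[of "-1" "\<lambda>x. g x - f x"] by simp

lemma ip_cong_AE:
  assumes "AE x in lebesgue. f x = f' x" "AE x in lebesgue. g x = g' x"
    "f \<in> borel_measurable lebesgue" "f' \<in> borel_measurable lebesgue"
    "g \<in> borel_measurable lebesgue" "g' \<in> borel_measurable lebesgue"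
  shows "ip f g = ip f' g'"
  unfolding ip_def
proof (rule integral_cong_AE)
  show "AE x in lebesgue. f x * g x = f' x * g' x"
    using assms(1,2) by eventually_elim simp
qed (use assms in auto)

lemma nrm_cong_AE:
  assumes "AE x in lebesgue. f x = f' x"
    "f \<in> borel_measurable lebesgue" "f' \<in> borel_measurable lebesgue"
  shows "nrm f = nrm f'"
  unfolding nrm_def using ip_cong_AE[OF assms(1) assms(1)] assms by simp

lemma nrm_mono:
  assumes "f \<in> L2" "g \<in> borel_measurable lebesgue" "AE x in lebesgue. \<bar>g x\<bar> \<le> \<bar>f x\<bar>"
  shows "nrm g \<le> nrm f"
proof -
  have "g \<in> L2" using L2_bound assms by blast
  then have "ip g g \<le> ip f f"
    unfolding ip_def using assms
    by (intro integral_mono_AE L2_mult_integrable)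
       (auto simp: power2_eq_square[symmetric] abs_le_square_iff)
  then show ?thesis unfolding nrm_def by simp
qed

lemma nrm_eq_0:
  assumes "f \<in> L2" "nrm f = 0"
  shows "AE x in lebesgue. f x = 0"
proof -
  have "(LINT x|lebesgue. (f x)\<^sup>2) = 0" using assms(2) nrm_sq_int[of f] by simp
  then have "AE x in lebesgue. (f x)\<^sup>2 = 0"
    using assms(1) integral_nonneg_eq_0_iff_AE[of lebesgue "\<lambda>x. (f x)\<^sup>2"] by (auto simp: L2_iff)
  then show ?thesis by simp
qed

lemma nrm_AE_0: "w \<in> L2 \<Longrightarrow> AE x in lebesgue. w x = 0 \<Longrightarrow> nrm w = 0"
  using nrm_cong_AE[of w "\<lambda>x. 0"] L2_meas by fastforce

lemma nrm_sq_add: "f \<in> L2 \<Longrightarrow> g \<in> L2 \<Longrightarrow> (nrm (\<lambda>x. f x + g x))\<^sup>2 = (nrm f)\<^sup>2 + 2 * ip f g + (nrm g)\<^sup>2"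
  by (simp add: nrm_sq ip_add_left ip_add_right L2_add ip_commute[of g f])

lemma nrm_sq_diff: "f \<in> L2 \<Longrightarrow> g \<in> L2 \<Longrightarrow> (nrm (\<lambda>x. f x - g x))\<^sup>2 = (nrm f)\<^sup>2 - 2 * ip f g + (nrm g)\<^sup>2"
  by (simp add: nrm_sq ip_diff_left ip_diff_right L2_diff ip_commute[of g f])

lemma ip_le_nrm:
  assumes "f \<in> L2" "g \<in> L2"
  shows "\<bar>ip f g\<bar> \<le> nrm f * nrm g"
proof (cases "nrm g = 0")
  case True
  have "ip f g = ip f (\<lambda>x. 0)"
    using nrm_eq_0[OF assms(2) True] assms by (intro ip_cong_AE) (auto dest: L2_meas)
  then show ?thesis using True by (simp add: ip_def)
next
  case False
  then have p: "nrm g > 0" by (simp add: less_le)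
  \<comment> \<open>The minimizer of the norm of f - t g; expanding the square there gives the
    Cauchy-Schwarz inequality.\<close>
  define t where "t = ip f g / (nrm g)\<^sup>2"
  have "0 \<le> (nrm (\<lambda>x. f x - t * g x))\<^sup>2" by simp
  also have "\<dots> = (nrm f)\<^sup>2 - 2 * (t * ip f g) + t\<^sup>2 * (nrm g)\<^sup>2"
    using assms by (subst nrm_sq_diff) (auto simp: ip_cmult_right nrm_cmult power_mult_distrib)
  also have "\<dots> = (nrm f)\<^sup>2 - (ip f g)\<^sup>2 / (nrm g)\<^sup>2"
    using p unfolding t_def by (simp add: field_simps power2_eq_square)
  finally have "(ip f g)\<^sup>2 \<le> (nrm f * nrm g)\<^sup>2"
    using p by (simp add: field_simps power_mult_distrib)
  then show ?thesis using abs_le_square_iff[of "ip f g" "nrm f * nrm g"] by simp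
qed

lemma nrm_triangle:
  assumes "f \<in> L2" "g \<in> L2"
  shows "nrm (\<lambda>x. f x + g x) \<le> nrm f + nrm g"
proof -
  have "(nrm (\<lambda>x. f x + g x))\<^sup>2 \<le> (nrm f + nrm g)\<^sup>2"
    using ip_le_nrm[OF assms] unfolding nrm_sq_add[OF assms] power2_sum by (simp add: abs_le_iff)
  then show ?thesis by (rule power2_le_imp_le) simp
qed

lemma nrm_triangle_diff:
  assumes "f \<in> L2" "g \<in> L2"
  shows "nrm (\<lambda>x. f x - g x) \<le> nrm f + nrm g"
  using nrm_triangle[OF assms(1) L2_uminus[OF assms(2)]] nrm_cmult[of "-1" g] by simp

lemma nrm_triangle3:
  assumes "f \<in> L2" "g \<in> L2" "h \<in> L2"
  shows "nrm (\<lambda>x. f x - h x) \<le> nrm (\<lambda>x. f x - g x) + nrm (\<lambda>x. g x - h x)"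
  using nrm_triangle[of "\<lambda>x. f x - g x" "\<lambda>x. g x - h x"] assms by auto

lemma nrm_diff_abs:
  assumes "f \<in> L2" "g \<in> L2"
  shows "\<bar>nrm f - nrm g\<bar> \<le> nrm (\<lambda>x. f x - g x)"
  using nrm_triangle[OF L2_diff[OF assms] assms(2)]
    nrm_triangle[OF L2_diff[OF assms(2,1)] assms(1)] nrm_minus_commute[of f g] by simp

section \<open>Continuity of pairing and norm, Fatou bounds, completeness\<close>

lemma tendsto_ip:
  assumes "\<And>n. f n \<in> L2" "g \<in> L2" "h \<in> L2" "((\<lambda>n. nrm (\<lambda>x. f n x - g x)) \<longlongrightarrow> 0) F"
  shows "((\<lambda>n. ip (f n) h) \<longlongrightarrow> ip g h) F"
proof (rule LIM_zero_cancel, rule Lim_null_comparison)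
  show "\<forall>\<^sub>F n in F. norm (ip (f n) h - ip g h) \<le> nrm (\<lambda>x. f n x - g x) * nrm h"
    using ip_le_nrm[OF L2_diff[OF assms(1,2)] assms(3)]
    by (simp add: ip_diff_left[OF assms(1,2,3)])
  show "((\<lambda>n. nrm (\<lambda>x. f n x - g x) * nrm h) \<longlongrightarrow> 0) F"
    using tendsto_mult_left_zero[OF assms(4)] .
qed

lemma tendsto_nrm:
  assumes "\<And>n. f n \<in> L2" "g \<in> L2" "((\<lambda>n. nrm (\<lambda>x. f n x - g x)) \<longlongrightarrow> 0) F"
  shows "((\<lambda>n. nrm (f n)) \<longlongrightarrow> nrm g) F"
  by (rule LIM_zero_cancel, rule Lim_null_comparison[OF _ assms(3)])
     (use nrm_diff_abs[OF assms(1,2)] in simp)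

lemma nn_integral_sq:
  "f \<in> L2 \<Longrightarrow> (\<integral>\<^sup>+x. ennreal ((f x)\<^sup>2) \<partial>lebesgue) = ennreal ((nrm f)\<^sup>2)"
  unfolding nrm_sq_int by (rule nn_integral_eq_integral) (auto simp: L2_iff)

text \<open>Fatou's lemma for squares: norm bounds survive a.e. limits without any convergence of
  norms. Both the completeness of L2 and the membership of limits in H1 rest on it.\<close>

lemma L2_fatou:
  assumes "\<And>n. f n \<in> L2" "\<And>n. nrm (f n) \<le> C" "g \<in> borel_measurable lebesgue"
    "AE x in lebesgue. (\<lambda>n. f n x) \<longlonglongrightarrow> g x"
  shows "g \<in> L2 \<and> nrm g \<le> C"
proof -
  have [measurable]: "f n \<in> borel_measurable lebesgue" for n using assms(1) by (rule L2_meas)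
  have C0: "0 \<le> C" using assms(2)[of 0] nrm_nonneg order_trans by blast
  have "(\<integral>\<^sup>+x. ennreal ((g x)\<^sup>2) \<partial>lebesgue) = (\<integral>\<^sup>+x. liminf (\<lambda>n. ennreal ((f n x)\<^sup>2)) \<partial>lebesgue)"
  proof (rule nn_integral_cong_AE)
    show "AE x in lebesgue. ennreal ((g x)\<^sup>2) = liminf (\<lambda>n. ennreal ((f n x)\<^sup>2))"
      using assms(4)
    proof eventually_elim
      case (elim x)
      then have "(\<lambda>n. ennreal ((f n x)\<^sup>2)) \<longlonglongrightarrow> ennreal ((g x)\<^sup>2)"
        by (intro tendsto_ennrealI tendsto_power)
      then show ?case using lim_imp_Liminf trivial_limit_sequentially by metis
    qed
  qed
  also have "\<dots> \<le> liminf (\<lambda>n. \<integral>\<^sup>+x. ennreal ((f n x)\<^sup>2) \<partial>lebesgue)"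
    by (intro nn_integral_liminf) measurable
  also have "\<dots> = liminf (\<lambda>n. ennreal ((nrm (f n))\<^sup>2))"
    using assms(1) nn_integral_sq by metis
  also have "\<dots> \<le> ennreal (C\<^sup>2)"
    using assms(2) by (intro Liminf_le always_eventually allI ennreal_leI power_mono) auto
  finally have le: "(\<integral>\<^sup>+x. ennreal ((g x)\<^sup>2) \<partial>lebesgue) \<le> ennreal (C\<^sup>2)" .
  have "integrable lebesgue (\<lambda>x. (g x)\<^sup>2)"
    using assms(3) le by (intro integrableI_bounded) (auto simp: le_less_trans)
  then have g: "g \<in> L2" using assms(3) by (simp add: L2_iff)
  then have "(nrm g)\<^sup>2 \<le> C\<^sup>2" using le nn_integral_sq[OF g] by simp
  then show ?thesis using g power2_le_imp_le[OF _ C0] by blast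
qed

text \<open>Riesz-Fischer. The a.e. convergent subsequence is kept in the conclusion because the
  nonlinear and potential terms are later handled through pointwise limits.\<close>

lemma L2_complete:
  assumes "\<And>n. f n \<in> L2" "\<And>e. e > 0 \<Longrightarrow> \<exists>N. \<forall>m\<ge>N. \<forall>n\<ge>N. nrm (\<lambda>x. f m x - f n x) < e"
  obtains g r where "g \<in> L2" "(\<lambda>n. nrm (\<lambda>x. f n x - g x)) \<longlonglongrightarrow> 0" "strict_mono (r :: nat \<Rightarrow> nat)"
    "AE x in lebesgue. (\<lambda>n. f (r n) x) \<longlonglongrightarrow> g x"
proof -
  obtain N where N: "\<And>e m n. e > 0 \<Longrightarrow> m \<ge> N e \<Longrightarrow> n \<ge> N e \<Longrightarrow> nrm (\<lambda>x. f m x - f n x) < e"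
    using assms(2) by metis
  \<comment> \<open>Consecutive chosen terms differ by at most \<open>(1/2) ^ k\<close> in norm; the
    \<open>Suc s\<close> inside the maximum keeps the indices strictly increasing.\<close>
  define r where "r = rec_nat (N 1) (\<lambda>k s. max (Suc s) (N ((1/2) ^ Suc k)))"
  have rS: "r (Suc k) = max (Suc (r k)) (N ((1/2) ^ Suc k))" for k unfolding r_def by simp
  have r: "strict_mono r" by (rule strict_monoI_Suc) (simp add: rS)
  have rN: "r k \<ge> N ((1/2) ^ k)" for k
    by (cases k) (simp add: r_def, simp add: rS)
  \<comment> \<open>Squared norms of \<open>d k\<close> are at most \<open>(1/4) ^ k\<close>, so the
    series of squares stays integrable after weighting by \<open>2 ^ k\<close>. Its pointwise
    finiteness forces \<open>d k x\<close> below \<open>(1 / sqrt 2) ^ k\<close> eventually, hence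
    absolute summability.\<close>
  define d where "d k x = f (r (Suc k)) x - f (r k) x" for k x
  have d: "d k \<in> L2" for k unfolding d_def using assms(1) by auto
  have [measurable]: "d k \<in> borel_measurable lebesgue" "f k \<in> borel_measurable lebesgue" for k
    using d assms(1) by (auto dest: L2_meas)
  have dn: "nrm (d k) \<le> (1/2) ^ k" for k
    using N[of "(1/2)^k" "r (Suc k)" "r k"] rN[of k] strict_monoD[OF r, of k "Suc k"]
    unfolding d_def by (simp add: less_imp_le order_trans)
  have "(\<integral>\<^sup>+x. (\<Sum>k. ennreal (2 ^ k * (d k x)\<^sup>2)) \<partial>lebesgue) = (\<Sum>k. \<integral>\<^sup>+x. ennreal (2 ^ k * (d k x)\<^sup>2) \<partial>lebesgue)"
    by (intro nn_integral_suminf) measurable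
  also have "\<dots> = (\<Sum>k. ennreal (2 ^ k * (nrm (d k))\<^sup>2))"
    using d L2_meas by (intro suminf_cong)
      (simp add: ennreal_mult nn_integral_cmult nn_integral_sq L2_meas)
  also have "\<dots> \<le> (\<Sum>k. ennreal ((1/2) ^ k))"
  proof (intro suminf_le ennreal_leI)
    fix k
    have "(nrm (d k))\<^sup>2 \<le> ((1/2) ^ k)\<^sup>2" using dn by (intro power_mono) auto
    then have "2 ^ k * (nrm (d k))\<^sup>2 \<le> 2 ^ k * ((1/2) ^ k)\<^sup>2" by simp
    also have "\<dots> = (1/2 :: real) ^ k"
      by (simp add: power2_eq_square power_divide)
    finally show "2 ^ k * (nrm (d k))\<^sup>2 \<le> (1/2) ^ k" .
  qed auto
  also have "\<dots> = ennreal (\<Sum>k. (1/2) ^ k)"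
    by (intro suminf_ennreal2) (auto simp: summable_geometric)
  also have "\<dots> < \<infinity>" by simp
  finally have fin: "(\<integral>\<^sup>+x. (\<Sum>k. ennreal (2 ^ k * (d k x)\<^sup>2)) \<partial>lebesgue) \<noteq> \<infinity>" by simp
  have "AE x in lebesgue. (\<Sum>k. ennreal (2 ^ k * (d k x)\<^sup>2)) \<noteq> \<infinity>"
    by (intro nn_integral_PInf_AE fin) measurable
  then have conv: "AE x in lebesgue. convergent (\<lambda>k. f (r k) x)"
  proof eventually_elim
    case (elim x)
    then have s: "summable (\<lambda>k. 2 ^ k * (d k x)\<^sup>2)"
      by (intro summable_suminf_not_top) auto
    have "(\<lambda>k. 2 ^ k * (d k x)\<^sup>2) \<longlonglongrightarrow> 0" using summable_LIMSEQ_zero[OF s] .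
    then have ev: "\<forall>\<^sub>F k in sequentially. 2 ^ k * (d k x)\<^sup>2 < 1"
      by (rule order_tendstoD) simp
    have "summable (\<lambda>k. d k x)"
    proof (rule summable_comparison_test_ev)
      show "\<forall>\<^sub>F k in sequentially. norm (d k x) \<le> (1 / sqrt 2) ^ k"
        using ev
      proof eventually_elim
        case (elim k)
        have sq2: "((1 / sqrt 2) ^ k)\<^sup>2 = (1 / 2 :: real) ^ k"
          by (simp add: power2_eq_square power_mult_distrib[symmetric])
        from elim have "(d k x)\<^sup>2 \<le> ((1 / sqrt 2) ^ k)\<^sup>2"
          by (simp only: sq2) (simp add: power_divide field_simps)
        then show ?case using abs_le_square_iff[of "d k x" "(1 / sqrt 2) ^ k"] by simp
      qed
      show "summable (\<lambda>k. (1 / sqrt 2 :: real) ^ k)"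
        by (rule summable_geometric) simp
    qed
    then have "convergent (\<lambda>k. \<Sum>j<k. d j x)" by (simp add: summable_iff_convergent)
    moreover have "(\<Sum>j<k. d j x) = f (r k) x - f (r 0) x" for k
      unfolding d_def by (rule sum_lessThan_telescope)
    ultimately have "convergent (\<lambda>k. f (r k) x - f (r 0) x)" by simp
    then show ?case using convergent_add_const_iff[of "- f (r 0) x" "\<lambda>k. f (r k) x"] by simp
  qed
  define g where "g x = lim (\<lambda>k. f (r k) x)" for x
  have gm: "g \<in> borel_measurable lebesgue"
    unfolding g_def by measurable
  have ae: "AE x in lebesgue. (\<lambda>k. f (r k) x) \<longlonglongrightarrow> g x"
    using conv by eventually_elim (simp add: g_def convergent_LIMSEQ_iff)
  \<comment> \<open>Fatou along a tail of the subsequence: \<open>f m\<close> minus its terms has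
    norm at most e and tends a.e. to \<open>f m - g\<close>.\<close>
  have bd: "(\<lambda>x. f m x - g x) \<in> L2 \<and> nrm (\<lambda>x. f m x - g x) \<le> e" if "e > 0" "m \<ge> N e" for m e
  proof (rule L2_fatou[where f = "\<lambda>k x. f m x - f (r (k + N e)) x"])
    show "(\<lambda>x. f m x - f (r (k + N e)) x) \<in> L2" for k using assms(1) by auto
    have "r (k + N e) \<ge> N e" for k using seq_suble[OF r, of "k + N e"] by linarith
    then show "nrm (\<lambda>x. f m x - f (r (k + N e)) x) \<le> e" for k
      using N[OF that(1,2)] by (simp add: less_imp_le)
    show "(\<lambda>x. f m x - g x) \<in> borel_measurable lebesgue" using gm assms(1)[of m] L2_meas by simp
    show "AE x in lebesgue. (\<lambda>k. f m x - f (r (k + N e)) x) \<longlonglongrightarrow> f m x - g x"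
      using ae
      by eventually_elim (intro tendsto_diff tendsto_const LIMSEQ_ignore_initial_segment[where f = "\<lambda>k. f (r k) _"])
  qed
  have g: "g \<in> L2" using L2_diff[OF assms(1)[of "N 1"] conjunct1[OF bd[of 1 "N 1"]]] by simp
  have "(\<lambda>n. nrm (\<lambda>x. f n x - g x)) \<longlonglongrightarrow> 0"
  proof (rule LIMSEQ_I)
    fix e :: real assume e: "0 < e"
    then have "nrm (\<lambda>x. f n x - g x) < e" if "n \<ge> N (e/2)" for n
      using bd[of "e/2" n] that by auto
    then show "\<exists>no. \<forall>n\<ge>no. norm (nrm (\<lambda>x. f n x - g x) - 0) < e" by auto
  qed
  then show ?thesis using that g r ae by blast
qed

lemma nrm_tendsto_AE_subseq:
  assumes "\<And>n. f n \<in> L2" "g \<in> L2" "(\<lambda>n. nrm (\<lambda>x. f n x - g x)) \<longlonglongrightarrow> 0"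
  obtains r where "strict_mono (r :: nat \<Rightarrow> nat)" "AE x in lebesgue. (\<lambda>n. f (r n) x) \<longlonglongrightarrow> g x"
proof -
  have "\<exists>N. \<forall>m\<ge>N. \<forall>n\<ge>N. nrm (\<lambda>x. f m x - f n x) < e" if e: "e > 0" for e
  proof -
    obtain N where N: "\<And>n. n \<ge> N \<Longrightarrow> nrm (\<lambda>x. f n x - g x) < e/2"
      using LIMSEQ_D[OF assms(3), of "e/2"] e by auto
    have "nrm (\<lambda>x. f m x - f n x) < e" if "m \<ge> N" "n \<ge> N" for m n
      using nrm_triangle3[OF assms(1)[of m] assms(2) assms(1)[of n]] N[OF that(1)] N[OF that(2)]
        nrm_minus_commute[of g "f n"] by simp
    then show ?thesis by blast
  qed
  from L2_complete[OF assms(1) this] obtain g' r where g': "g' \<in> L2"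
    "(\<lambda>n. nrm (\<lambda>x. f n x - g' x)) \<longlonglongrightarrow> 0" "strict_mono (r :: nat \<Rightarrow> nat)"
    "AE x in lebesgue. (\<lambda>n. f (r n) x) \<longlonglongrightarrow> g' x" by auto
  have "(\<lambda>n. nrm (\<lambda>x. f n x - g x) + nrm (\<lambda>x. f n x - g' x)) \<longlonglongrightarrow> 0 + 0"
    by (intro tendsto_add assms g')
  moreover have "nrm (\<lambda>x. g x - g' x) \<le> nrm (\<lambda>x. f n x - g x) + nrm (\<lambda>x. f n x - g' x)" for n
    using nrm_triangle3[OF assms(2) assms(1)[of n] g'(1)] nrm_minus_commute[of g "f n"] by simp
  ultimately have "nrm (\<lambda>x. g x - g' x) \<le> 0"
    by (intro LIMSEQ_le_const) auto
  then have "nrm (\<lambda>x. g x - g' x) = 0" using nrm_nonneg[of "\<lambda>x. g x - g' x"] by linarith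
  then have "AE x in lebesgue. g x = g' x"
    using nrm_eq_0[OF L2_diff[OF assms(2) g'(1)]] by simp
  with g'(4) have "AE x in lebesgue. (\<lambda>n. f (r n) x) \<longlonglongrightarrow> g x" by eventually_elim simp
  then show ?thesis using that g'(3) by blast
qed

lemma parallelogram_mid:
  assumes "f \<in> L2" "g \<in> L2"
  shows "(nrm (\<lambda>x. f x - g x))\<^sup>2 = 2 * (nrm f)\<^sup>2 + 2 * (nrm g)\<^sup>2 - 4 * (nrm (\<lambda>x. (f x + g x) / 2))\<^sup>2"
proof -
  have "(nrm (\<lambda>x. (f x + g x) / 2))\<^sup>2 = (nrm (\<lambda>x. f x + g x))\<^sup>2 / 4"
  proof -
    have "nrm (\<lambda>x. (f x + g x) / 2) = nrm (\<lambda>x. f x + g x) / 2"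
      using nrm_cmult[of "1/2" "\<lambda>x. f x + g x"] by simp
    then show ?thesis by (simp only: power_divide) simp
  qed
  then show ?thesis using nrm_sq_add[OF assms] nrm_sq_diff[OF assms] by simp
qed

text \<open>Near-minimisers of the norm over a decreasing sequence of convex sets form a Cauchy sequence.
  This replaces both the projection theorem and weak compactness.\<close>

lemma nested_convex_minimizers:
  assumes K: "\<And>n. K n \<subseteq> L2" "\<And>n. K n \<noteq> {}" "\<And>n m. n \<le> m \<Longrightarrow> K m \<subseteq> K n"
    and mid: "\<And>n f g. f \<in> K n \<Longrightarrow> g \<in> K n \<Longrightarrow> (\<lambda>x. (f x + g x) / 2) \<in> K n"
    and bd: "\<And>n f. f \<in> K n \<Longrightarrow> (INF h\<in>K n. (nrm h)\<^sup>2) \<le> C"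
  obtains w k where "w \<in> L2" "\<And>n :: nat. k n \<in> K n" "(\<lambda>n. nrm (\<lambda>x. k n x - w x)) \<longlonglongrightarrow> 0"
    "\<And>n. (nrm (k n))\<^sup>2 < (INF h\<in>K n. (nrm h)\<^sup>2) + 1 / (real n + 1)"
proof -
  define d where "d n = (INF h\<in>K n. (nrm h)\<^sup>2)" for n
  have bb: "bdd_below ((\<lambda>h. (nrm h)\<^sup>2) ` K n)" for n by (rule bdd_belowI[of _ 0]) auto
  have dle: "d n \<le> (nrm h)\<^sup>2" if "h \<in> K n" for n h
    unfolding d_def by (rule cINF_lower[OF bb that])
  \<comment> \<open>The infima increase because the sets shrink, and they stay below C; hence they
    converge.\<close>
  have dmono: "d n \<le> d m" if "n \<le> m" for n m
    unfolding d_def by (rule cINF_superset_mono[OF K(2) bb K(3)[OF that]]) simp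
  have dC: "d n \<le> C" for n using bd K(2)[of n] unfolding d_def by blast
  have "\<bar>d n\<bar> \<le> \<bar>C\<bar> + \<bar>d 0\<bar>" for n using dC[of n] dmono[of 0 n] by linarith
  then have "Bseq d" by (intro BseqI'[of d "\<bar>C\<bar> + \<bar>d 0\<bar>"]) simp
  then have "convergent d" using dmono by (intro Bseq_mono_convergent) auto
  then have dC: "Cauchy d" by (simp add: Cauchy_convergent_iff)
  have "\<exists>h\<in>K n. (nrm h)\<^sup>2 < d n + 1 / (real n + 1)" for n
  proof -
    have "d n < d n + 1 / (real n + 1)" by simp
    then show ?thesis unfolding d_def using cINF_less_iff[OF K(2) bb] by blast
  qed
  then obtain k where k: "\<And>n. k n \<in> K n" "\<And>n. (nrm (k n))\<^sup>2 < d n + 1 / (real n + 1)" by metis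
  have kL: "k n \<in> L2" for n using k K by blast
  \<comment> \<open>Both functions lie in the larger set \<open>K n\<close>, hence so does their
    midpoint, whose squared norm is at least \<open>d n\<close>. The parallelogram identity turns
    this into closeness.\<close>
  have key: "(nrm (\<lambda>x. k m x - k n x))\<^sup>2 \<le> 2 * \<bar>d m - d n\<bar> + 4 / (real n + 1)" if "n \<le> m" for m n
  proof -
    have "(\<lambda>x. (k m x + k n x) / 2) \<in> K n" using mid k K(3)[OF that] by blast
    then have "d n \<le> (nrm (\<lambda>x. (k m x + k n x) / 2))\<^sup>2" by (rule dle)
    moreover have "1 / (real m + 1) \<le> 1 / (real n + 1)" using that by (simp add: frac_le)
    moreover have "D \<le> 2 * \<bar>x - y\<bar> + 4 * b" if "D = 2 * A + 2 * B - 4 * M" "y \<le> M" "A < x + a" "B < y + b" "a \<le> b"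
      for A B D M x y a b :: real using that by argo
    ultimately have "(nrm (\<lambda>x. k m x - k n x))\<^sup>2 \<le> 2 * \<bar>d m - d n\<bar> + 4 * (1 / (real n + 1))"
      using parallelogram_mid[OF kL kL, of m n] k(2)[of m] k(2)[of n] by presburger
    then show ?thesis by simp
  qed
  have "\<exists>N. \<forall>m\<ge>N. \<forall>n\<ge>N. nrm (\<lambda>x. k m x - k n x) < e" if e: "e > 0" for e
  proof -
    obtain N1 where N1: "\<And>m n. m \<ge> N1 \<Longrightarrow> n \<ge> N1 \<Longrightarrow> \<bar>d m - d n\<bar> < e\<^sup>2 / 4"
      using CauchyD[OF dC, of "e\<^sup>2/4"] e by auto
    obtain N2 :: nat where N2: "real N2 > 8 / e\<^sup>2" using reals_Archimedean2 by blast
    have small: "4 / (real n + 1) < e\<^sup>2 / 2" if "n \<ge> N2" for n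
    proof -
      have "8 / e\<^sup>2 < real n + 1" using that N2 by linarith
      then show ?thesis using e by (simp add: field_simps)
    qed
    have *: "nrm (\<lambda>x. k m x - k n x) < e" if "m \<ge> n" "n \<ge> N1 + N2" for m n
    proof -
      have "(nrm (\<lambda>x. k m x - k n x))\<^sup>2 < e\<^sup>2"
        using key[OF that(1)] N1[of m n] small[of n] that by auto
      then show ?thesis using e by (simp add: power_less_imp_less_base)
    qed
    have "nrm (\<lambda>x. k m x - k n x) < e" if "n \<ge> N1 + N2" "m \<ge> N1 + N2" for m n
      using *[of n m] *[of m n] that nrm_minus_commute[of "k m" "k n"] by (cases "n \<le> m") auto
    then show ?thesis by blast
  qed
  from L2_complete[OF kL this] obtain w where "w \<in> L2" "(\<lambda>n. nrm (\<lambda>x. k n x - w x)) \<longlonglongrightarrow> 0"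
    by blast
  then show ?thesis using that k unfolding d_def by blast
qed

text \<open>Near-minimizers of the distance from f to S give differences converging to some w, and a
  first variation shows w orthogonal to S. So w vanishes a.e. and the distance is zero.\<close>

lemma L2_dense_subspace:
  assumes S: "S \<subseteq> L2" "(\<lambda>x. 0) \<in> S" "\<And>f g. f \<in> S \<Longrightarrow> g \<in> S \<Longrightarrow> (\<lambda>x. f x + g x) \<in> S"
    "\<And>f c. f \<in> S \<Longrightarrow> (\<lambda>x. c * f x) \<in> S"
    and orth: "\<And>w. w \<in> L2 \<Longrightarrow> (\<And>s. s \<in> S \<Longrightarrow> ip w s = 0) \<Longrightarrow> AE x in lebesgue. w x = 0"
    and f: "f \<in> L2" and e: "e > 0"
  obtains s where "s \<in> S" "nrm (\<lambda>x. f x - s x) < e"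
proof -
  define K where "K n = {\<lambda>x. f x - s x | s. s \<in> S}" for n :: nat
  define d where "d = (INF h\<in>K 0. (nrm h)\<^sup>2)"
  have KK: "K n = K 0" for n unfolding K_def ..
  have fK: "f \<in> K 0" unfolding K_def using S(2) by force
  have bb: "bdd_below ((\<lambda>h. (nrm h)\<^sup>2) ` K n)" for n by (rule bdd_belowI[of _ 0]) auto
  have KL: "K n \<subseteq> L2" for n unfolding K_def using S f by blast
  obtain w k where w: "w \<in> L2" "\<And>n :: nat. k n \<in> K n" "(\<lambda>n. nrm (\<lambda>x. k n x - w x)) \<longlonglongrightarrow> 0"
    "\<And>n. (nrm (k n))\<^sup>2 < (INF h\<in>K n. (nrm h)\<^sup>2) + 1 / (real n + 1)"
  proof (rule nested_convex_minimizers[of K "(nrm f)\<^sup>2"])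
    show "K n \<subseteq> L2" for n by (rule KL)
    show "K n \<noteq> {}" for n using fK KK by blast
    show "K m \<subseteq> K n" for m n using KK[of m] KK[of n] by simp
    show "(\<lambda>x. (u x + v x) / 2) \<in> K n" if uv: "u \<in> K n" "v \<in> K n" for n u v
    proof -
      obtain s t where st: "s \<in> S" "t \<in> S" "u = (\<lambda>x. f x - s x)" "v = (\<lambda>x. f x - t x)"
        using uv unfolding K_def by auto
      have "(\<lambda>x. (1/2) * (s x + t x)) \<in> S" using st by (intro S)
      then have "(\<lambda>x. f x - (1/2) * (s x + t x)) \<in> K n" unfolding K_def by auto
      then show ?thesis unfolding st by (simp add: field_simps)
    qed
    show "(INF h\<in>K n. (nrm h)\<^sup>2) \<le> (nrm f)\<^sup>2" for n
      using cINF_lower[OF bb[of n]] fK KK by blast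
  qed blast
  have lim: "(\<lambda>n. nrm (k n)) \<longlonglongrightarrow> nrm w"
    using w KL by (intro tendsto_nrm) auto
  have wd: "(nrm w)\<^sup>2 \<le> d"
  proof (rule LIMSEQ_le)
    show "(\<lambda>n. (nrm (k n))\<^sup>2) \<longlonglongrightarrow> (nrm w)\<^sup>2" using lim by (intro tendsto_power)
    show "(\<lambda>n. d + 1 / (real n + 1)) \<longlonglongrightarrow> d"
      using tendsto_add[OF tendsto_const[of d] lim_1_over_real_power[of 1]] LIMSEQ_inverse_real_of_nat_add[of d]
      by (simp add: inverse_eq_divide add.commute)
    show "\<exists>N. \<forall>n\<ge>N. (nrm (k n))\<^sup>2 \<le> d + 1 / (real n + 1)"
      using w(4) KK unfolding d_def by (metis less_imp_le)
  qed
  have "ip w s = 0" if s: "s \<in> S" for s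
  proof (rule ccontr)
    assume nz: "ip w s \<noteq> 0"
    have sL: "s \<in> L2" using s S by blast
    \<comment> \<open>S need not be closed, so w itself may lie outside \<open>K 0\<close>. The
      variation is therefore performed on \<open>k n\<close> and passed to the limit.\<close>
    have ineq: "0 \<le> 2 * t * ip w s + t\<^sup>2 * (nrm s)\<^sup>2" for t
    proof -
      have "d \<le> (nrm (\<lambda>x. k n x + t * s x))\<^sup>2" for n
      proof -
        obtain a where a: "a \<in> S" "k n = (\<lambda>x. f x - a x)" using w(2)[of n] unfolding K_def by auto
        have "(\<lambda>x. a x + (- t) * s x) \<in> S" using a s by (intro S)
        then have "(\<lambda>x. f x - (a x + (- t) * s x)) \<in> K 0" unfolding K_def by auto
        then have "(\<lambda>x. k n x + t * s x) \<in> K 0" unfolding a(2) by (simp add: algebra_simps)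
        then show ?thesis unfolding d_def by (rule cINF_lower[OF bb])
      qed
      moreover have "(\<lambda>n. (nrm (\<lambda>x. k n x + t * s x))\<^sup>2) \<longlonglongrightarrow> (nrm (\<lambda>x. w x + t * s x))\<^sup>2"
        using w KL sL by (intro tendsto_power tendsto_nrm L2_add L2_cmult) (auto simp: subset_iff)
      ultimately have "d \<le> (nrm (\<lambda>x. w x + t * s x))\<^sup>2"
        by (intro LIMSEQ_le_const) auto
      also have "\<dots> = (nrm w)\<^sup>2 + 2 * t * ip w s + t\<^sup>2 * (nrm s)\<^sup>2"
        using w(1) sL by (subst nrm_sq_add) (auto simp: ip_cmult_right nrm_cmult power_mult_distrib)
      finally show ?thesis using wd by linarith
    qed
    \<comment> \<open>Upper bound for the quadratic coefficient; the added 1 keeps it positive when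
      s has norm zero. The quadratic with leading coefficient B is minimal at
      \<open>t = - ip w s / B\<close> and negative there.\<close>
    define B where "B = (nrm s)\<^sup>2 + 1"
    have B: "B > 0" "(nrm s)\<^sup>2 < B" unfolding B_def by (auto simp: add_nonneg_pos)
    have "0 \<le> 2 * (- ip w s / B) * ip w s + (- ip w s / B)\<^sup>2 * (nrm s)\<^sup>2" by (rule ineq)
    also have "\<dots> \<le> 2 * (- ip w s / B) * ip w s + (- ip w s / B)\<^sup>2 * B"
      using B by (intro add_left_mono mult_left_mono) auto
    also have "\<dots> = - ((ip w s)\<^sup>2 / B)" using B by (simp add: field_simps power2_eq_square)
    finally show False using nz B by (simp add: divide_le_0_iff)
  qed
  then have "AE x in lebesgue. w x = 0" using orth w(1) by blast
  then have "nrm w = 0" using w(1) nrm_AE_0 by blast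
  then have "(\<lambda>n. nrm (k n)) \<longlonglongrightarrow> 0" using lim by simp
  then obtain n where "nrm (k n) < e" using LIMSEQ_D[of _ 0 e] e by fastforce
  moreover obtain a where "a \<in> S" "k n = (\<lambda>x. f x - a x)" using w(2)[of n] unfolding K_def by auto
  ultimately show ?thesis using that by auto
qed

text \<open>\<open>K n\<close> plays the closed convex hull of a tail of v: the ball of radius C cut
  down by every two-sided linear bound valid on that tail. A limit of near-minimizers inherits all
  bounds that hold eventually. No subsequence is extracted; w is identified only against those g for
  which the pairings converge.\<close>

lemma L2_weak_limit:
  assumes v: "\<And>n. v n \<in> L2" "\<And>n. nrm (v n) \<le> C"
  obtains w where "w \<in> L2" "nrm w \<le> C" "\<And>g l. g \<in> L2 \<Longrightarrow> (\<lambda>n. ip (v n) g) \<longlonglongrightarrow> l \<Longrightarrow> ip w g = l"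
proof -
  have C0: "0 \<le> C" using v(2)[of 0] nrm_nonneg order_trans by blast
  define K where "K n = {h \<in> L2. nrm h \<le> C \<and>
    (\<forall>g\<in>L2. \<forall>a b. (\<forall>m\<ge>n. a \<le> ip (v m) g \<and> ip (v m) g \<le> b) \<longrightarrow> a \<le> ip h g \<and> ip h g \<le> b)}" for n
  have vK: "v n \<in> K n" for n unfolding K_def using v by auto
  have bb: "bdd_below ((\<lambda>h. (nrm h)\<^sup>2) ` K n)" for n by (rule bdd_belowI[of _ 0]) auto
  obtain w k where w: "w \<in> L2" "\<And>n :: nat. k n \<in> K n" "(\<lambda>n. nrm (\<lambda>x. k n x - w x)) \<longlonglongrightarrow> 0"
  proof (rule nested_convex_minimizers[of K "C\<^sup>2"])
    show "K n \<subseteq> L2" for n unfolding K_def by blast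
    show "K n \<noteq> {}" for n using vK by blast
    show "K m \<subseteq> K n" if "n \<le> m" for m n
    proof
      fix h assume h: "h \<in> K m"
      have "\<forall>i\<ge>m. a \<le> ip (v i) g \<and> ip (v i) g \<le> b" if "\<forall>i\<ge>n. a \<le> ip (v i) g \<and> ip (v i) g \<le> b" for a b g
        using that \<open>n \<le> m\<close> by auto
      then show "h \<in> K n" using h unfolding K_def by blast
    qed
    show "(\<lambda>x. (f x + g x) / 2) \<in> K n" if fg: "f \<in> K n" "g \<in> K n" for n f g
    proof -
      have L: "f \<in> L2" "g \<in> L2" using fg unfolding K_def by auto
      have ipm: "ip (\<lambda>x. (f x + g x) / 2) h = (ip f h + ip g h) / 2" if "h \<in> L2" for h
        using ip_cmult_left[of "1/2" "\<lambda>x. f x + g x" h] ip_add_left[OF L that] by simp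
      have "nrm (\<lambda>x. (f x + g x) / 2) = nrm (\<lambda>x. f x + g x) / 2"
        using nrm_cmult[of "1/2" "\<lambda>x. f x + g x"] by simp
      moreover have "nrm (\<lambda>x. f x + g x) \<le> C + C"
        using nrm_triangle[OF L] fg unfolding K_def by fastforce
      ultimately have "nrm (\<lambda>x. (f x + g x) / 2) \<le> C" by simp
      moreover have "a \<le> ip (\<lambda>x. (f x + g x) / 2) h \<and> ip (\<lambda>x. (f x + g x) / 2) h \<le> b"
        if h: "h \<in> L2" "\<forall>m\<ge>n. a \<le> ip (v m) h \<and> ip (v m) h \<le> b" for h a b
      proof -
        have "a \<le> ip f h \<and> ip f h \<le> b" "a \<le> ip g h \<and> ip g h \<le> b"
          using fg[unfolded K_def mem_Collect_eq, THEN conjunct2, THEN conjunct2] h by metis+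
        then show ?thesis unfolding ipm[OF h(1)] by simp
      qed
      moreover have "(\<lambda>x. (f x + g x) / 2) \<in> L2" using L by auto
      ultimately show ?thesis unfolding K_def mem_Collect_eq by blast
    qed
    show "(INF h\<in>K n. (nrm h)\<^sup>2) \<le> C\<^sup>2" for n
    proof -
      have "(INF h\<in>K n. (nrm h)\<^sup>2) \<le> (nrm (v n))\<^sup>2" by (rule cINF_lower[OF bb vK])
      also have "\<dots> \<le> C\<^sup>2" using v(2) by (intro power_mono) auto
      finally show ?thesis .
    qed
  qed blast
  have kL: "k n \<in> L2" for n using w(2)[of n] unfolding K_def by blast
  have "nrm w \<le> C"
    using tendsto_nrm[OF kL w(1,3)] w(2) unfolding K_def by (intro LIMSEQ_le_const2) auto
  \<comment> \<open>Once the pairings with v stay within e/2 of l, membership in \<open>K n\<close>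
    imposes the same bounds on \<open>k n\<close>.\<close>
  moreover have "ip w g = l" if g: "g \<in> L2" and l: "(\<lambda>n. ip (v n) g) \<longlonglongrightarrow> l" for g l
  proof -
    have "(\<lambda>n. ip (k n) g) \<longlonglongrightarrow> l"
    proof (rule LIMSEQ_I)
      fix e :: real assume e: "0 < e"
      obtain N where N: "\<And>n. n \<ge> N \<Longrightarrow> \<bar>ip (v n) g - l\<bar> < e/2"
        using LIMSEQ_D[OF l, of "e/2"] e by auto
      have "norm (ip (k n) g - l) < e" if "n \<ge> N" for n
      proof -
        have "\<forall>m\<ge>n. l - e/2 \<le> ip (v m) g \<and> ip (v m) g \<le> l + e/2"
          using N that by (smt (verit) le_trans)
        then have "l - e/2 \<le> ip (k n) g \<and> ip (k n) g \<le> l + e/2"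
          using w(2)[of n, unfolded K_def mem_Collect_eq, THEN conjunct2, THEN conjunct2] g by metis
        then show ?thesis using e by auto
      qed
      then show "\<exists>no. \<forall>n\<ge>no. norm (ip (k n) g - l) < e" by blast
    qed
    then show ?thesis using tendsto_ip[OF kL w(1) g w(3)] LIMSEQ_unique by blast
  qed
  ultimately show ?thesis using that w(1) by blast
qed

text \<open>Otherwise a subsequence has pairings with g converging to a nonzero number. Its weak
  limit annihilates S, hence vanishes a.e., and so does its pairing with g.\<close>

lemma L2_weak_tendsto_0:
  assumes v: "\<And>n. v n \<in> L2" "\<And>n. nrm (v n) \<le> C"
    and S: "S \<subseteq> L2" "\<And>w. w \<in> L2 \<Longrightarrow> (\<And>s. s \<in> S \<Longrightarrow> ip w s = 0) \<Longrightarrow> AE x in lebesgue. w x = 0"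
    and lim: "\<And>s. s \<in> S \<Longrightarrow> (\<lambda>n. ip (v n) s) \<longlonglongrightarrow> 0"
    and g: "g \<in> L2"
  shows "(\<lambda>n. ip (v n) g) \<longlonglongrightarrow> 0"
proof (rule ccontr)
  assume "\<not> ?thesis"
  then obtain e where e: "e > 0" "\<And>N. \<exists>n\<ge>N. \<bar>ip (v n) g\<bar> \<ge> e"
    unfolding LIMSEQ_iff by (auto simp: not_less)
  obtain r where r: "strict_mono (r :: nat \<Rightarrow> nat)" "\<And>n. \<bar>ip (v (r n)) g\<bar> \<ge> e"
  proof -
    have "infinite {n. \<bar>ip (v n) g\<bar> \<ge> e}" unfolding infinite_nat_iff_unbounded_le using e(2) by blast
    then show ?thesis using that infinite_enumerate by blast
  qed
  have "\<bar>ip (v (r n)) g\<bar> \<le> C * nrm g" for n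
    using ip_le_nrm[OF v(1) g] mult_right_mono[OF v(2), of "nrm g"] nrm_nonneg order_trans by blast
  then have "bounded (range (\<lambda>n. ip (v (r n)) g))" by (auto simp: bounded_iff)
  then obtain l q where q: "strict_mono (q :: nat \<Rightarrow> nat)" "(\<lambda>n. ip (v (r (q n))) g) \<longlonglongrightarrow> l"
    using bounded_imp_convergent_subsequence unfolding o_def by blast
  have "e \<le> \<bar>l\<bar>"
    using tendsto_rabs[OF q(2)] r(2) by (intro LIMSEQ_le_const[where X = "\<lambda>n. \<bar>ip (v (r (q n))) g\<bar>"]) auto
  obtain w where w: "w \<in> L2" "\<And>g l. g \<in> L2 \<Longrightarrow> (\<lambda>n. ip (v (r (q n))) g) \<longlonglongrightarrow> l \<Longrightarrow> ip w g = l"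
    by (rule L2_weak_limit[of "\<lambda>n. v (r (q n))" C]) (use v in auto)
  have "ip w s = 0" if "s \<in> S" for s
  proof (rule w(2))
    show "s \<in> L2" using that S by blast
    have "((\<lambda>n. ip (v n) s) \<circ> (r \<circ> q)) \<longlonglongrightarrow> 0"
      by (intro LIMSEQ_subseq_LIMSEQ lim that strict_mono_o r q)
    then show "(\<lambda>n. ip (v (r (q n))) s) \<longlonglongrightarrow> 0" by (simp add: o_def)
  qed
  then have "AE x in lebesgue. w x = 0" using S(2) w(1) by blast
  then have "ip w g = ip (\<lambda>x. 0) g" using w(1) g L2_meas by (intro ip_cong_AE) auto
  also have "\<dots> = 0" by (simp add: ip_def)
  finally have "l = 0" using w(2)[OF g q(2)] by simp
  with \<open>e \<le> \<bar>l\<bar>\<close> e show False by simp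
qed

section \<open>Test functions\<close>

lemma partial_deriv_eqI: "(f has_derivative f') (at x) \<Longrightarrow> partial_deriv i f x = f' (axis i 1)"
  unfolding partial_deriv_def by (simp add: frechet_derivative_at[symmetric])

lemma partial_deriv_add:
  assumes "\<forall>x. f differentiable (at x)" "\<forall>x. g differentiable (at x)"
  shows "partial_deriv i (\<lambda>x. f x + g x) = (\<lambda>x. partial_deriv i f x + partial_deriv i g x)"
proof
  fix x
  obtain f' g' where *: "(f has_derivative f') (at x)" "(g has_derivative g') (at x)"
    using assms unfolding differentiable_def by blast
  show "partial_deriv i (\<lambda>x. f x + g x) x = partial_deriv i f x + partial_deriv i g x"
    using partial_deriv_eqI[OF has_derivative_add[OF *]] partial_deriv_eqI[OF *(1)] partial_deriv_eqI[OF *(2)]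
    by simp
qed

lemma partial_deriv_mult:
  assumes "\<forall>x. f differentiable (at x)" "\<forall>x. g differentiable (at x)"
  shows "partial_deriv i (\<lambda>x. f x * g x) = (\<lambda>x. f x * partial_deriv i g x + partial_deriv i f x * g x)"
proof
  fix x
  obtain f' g' where *: "(f has_derivative f') (at x)" "(g has_derivative g') (at x)"
    using assms unfolding differentiable_def by blast
  show "partial_deriv i (\<lambda>x. f x * g x) x = f x * partial_deriv i g x + partial_deriv i f x * g x"
    using partial_deriv_eqI[OF has_derivative_mult[OF *]] partial_deriv_eqI[OF *(1)] partial_deriv_eqI[OF *(2)]
    by simp
qed

lemma partial_deriv_const: "partial_deriv i (\<lambda>x. c) = (\<lambda>x. 0)"
  using partial_deriv_eqI[OF has_derivative_const] by fast

lemma has_derivative_affine: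
  fixes f :: "real ^ 'n \<Rightarrow> real"
  assumes "(f has_derivative f') (at (c *\<^sub>R x + a))"
  shows "((\<lambda>x. f (c *\<^sub>R x + a)) has_derivative (\<lambda>h. f' (c *\<^sub>R h))) (at x)"
proof -
  have "((\<lambda>x. c *\<^sub>R x + a) has_derivative (\<lambda>h. c *\<^sub>R h)) (at x)"
    by (auto intro!: derivative_eq_intros)
  from has_derivative_compose[OF this assms] show ?thesis .
qed

lemma partial_deriv_affine:
  assumes "\<forall>x. f differentiable (at x)"
  shows "partial_deriv i (\<lambda>x. f (c *\<^sub>R x + a)) = (\<lambda>x. c * partial_deriv i f (c *\<^sub>R x + a))"
proof
  fix x
  obtain f' where *: "(f has_derivative f') (at (c *\<^sub>R x + a))"
    using assms unfolding differentiable_def by blast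
  have "f' (c *\<^sub>R axis i 1) = c * f' (axis i 1)"
    using linear_scale[OF has_derivative_linear[OF *]] by simp
  then show "partial_deriv i (\<lambda>x. f (c *\<^sub>R x + a)) x = c * partial_deriv i f (c *\<^sub>R x + a)"
    using partial_deriv_eqI[OF has_derivative_affine[OF *]] partial_deriv_eqI[OF *] by simp
qed

lemma Ck_Suc_imp: "Ck (Suc k) f \<Longrightarrow> Ck k f"
proof (induction k arbitrary: f)
  case 0
  then show ?case
    by (auto intro!: continuous_at_imp_continuous_on differentiable_imp_continuous_within)
next
  case (Suc k)
  then show ?case by (simp del: Ck.simps(2) add: Ck.simps(2)[of "Suc k"] Ck.simps(2)[of k])
qed

lemma Ck_const: "Ck k (\<lambda>x. c)"
  by (induction k arbitrary: c) (simp_all add: partial_deriv_const)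

lemma Ck_add: "Ck k f \<Longrightarrow> Ck k g \<Longrightarrow> Ck k (\<lambda>x. f x + g x)"
proof (induction k arbitrary: f g)
  case 0 then show ?case by (auto intro: continuous_intros)
next
  case (Suc k)
  then show ?case by (simp add: partial_deriv_add)
qed

lemma Ck_mult: "Ck k f \<Longrightarrow> Ck k g \<Longrightarrow> Ck k (\<lambda>x. f x * g x)"
proof (induction k arbitrary: f g)
  case 0 then show ?case by (auto intro: continuous_intros)
next
  case (Suc k)
  have "Ck k f" "Ck k g" using Suc.prems Ck_Suc_imp by blast+
  with Suc show ?case by (simp add: partial_deriv_mult Ck_add)
qed

lemma Ck_cmult: "Ck k f \<Longrightarrow> Ck k (\<lambda>x. c * f x)"
  using Ck_mult[OF Ck_const] .

lemma Ck_prod: "(\<And>i. i \<in> I \<Longrightarrow> Ck k (f i)) \<Longrightarrow> Ck k (\<lambda>x. \<Prod>i\<in>I. f i x)"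
  by (induction I rule: infinite_finite_induct) (auto intro: Ck_const Ck_mult)

lemma Ck_affine: "Ck k f \<Longrightarrow> Ck k (\<lambda>x. f (c *\<^sub>R x + a))"
proof (induction k arbitrary: f)
  case 0
  then have "continuous_on UNIV (f \<circ> (\<lambda>x. c *\<^sub>R x + a))"
    by (intro continuous_on_compose continuous_intros) (auto intro: continuous_on_subset)
  then show ?case by (simp add: o_def)
next
  case (Suc k)
  have "(\<lambda>x. f (c *\<^sub>R x + a)) differentiable (at x)" for x
    using Suc.prems has_derivative_affine unfolding Ck.simps differentiable_def by blast
  with Suc show ?case by (simp add: partial_deriv_affine Ck_cmult)
qed

lemma Ck_coord: "Ck k (\<lambda>x::real ^ 'n. x $ j)"
proof -
  have d: "((\<lambda>x. x $ j) has_derivative (\<lambda>h. h $ j)) (at x)" for x :: "real ^ 'n"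
    by (rule bounded_linear_imp_has_derivative[OF bounded_linear_vec_nth])
  have "partial_deriv i (\<lambda>x. x $ j) = (\<lambda>x. axis i 1 $ j)" for i :: 'n
    using partial_deriv_eqI[OF d] by fast
  then show ?thesis
    using d by (cases k) (auto simp: Ck_const differentiable_def intro!: continuous_intros)
qed

text \<open>The standard flat function \<open>exp (- 1 / s)\<close> together with its quotients by
  powers of s. The powers make the family closed under differentiation, so smoothness of all members
  follows by one induction on the order.\<close>

definition theta :: "nat \<Rightarrow> real \<Rightarrow> real" where
  "theta m s = (if s \<le> 0 then 0 else exp (- 1 / s) / s ^ m)"

lemma theta_tendsto: "(theta m \<longlongrightarrow> 0) (at 0)"
proof -
  have "((\<lambda>s. (inverse s) ^ m / exp (inverse s)) \<longlongrightarrow> (0::real)) (at_right 0)"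
    using filterlim_compose[OF tendsto_power_div_exp_0 filterlim_inverse_at_top_right] .
  then have "(theta m \<longlongrightarrow> 0) (at_right 0)"
    by (rule Lim_transform_eventually)
       (auto simp: eventually_at_filter theta_def exp_minus field_simps)
  moreover have "(theta m \<longlongrightarrow> 0) (at_left 0)"
    by (rule tendsto_eventually) (auto simp: eventually_at_filter theta_def)
  ultimately show ?thesis by (rule filterlim_split_at_real[rotated])
qed

lemma theta_deriv: "(theta m has_real_derivative (theta (m + 2) s - real m * theta (m + 1) s)) (at s)"
proof (cases "s = 0")
  case True
  \<comment> \<open>At the origin the difference quotient of \<open>theta m\<close> is
    \<open>theta (m + 1)\<close> on both sides.\<close>
  have "((\<lambda>h. (theta m (0 + h) - theta m 0) / h) \<longlongrightarrow> 0) (at 0)"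
    by (rule Lim_transform_eventually[OF theta_tendsto[of "m + 1"]])
       (auto simp: eventually_at_filter theta_def)
  then show ?thesis using True by (simp add: DERIV_def theta_def)
next
  case False
  show ?thesis
  proof (cases "s < 0")
    case True
    have "((\<lambda>s. 0) has_real_derivative 0) (at s)" by simp
    moreover have "\<forall>\<^sub>F x in nhds s. 0 = theta m x"
      using eventually_nhds_in_open[of "{..<0}" s] True by (auto elim!: eventually_mono simp: theta_def)
    ultimately have "(theta m has_real_derivative 0) (at s)"
      using DERIV_cong_ev[of s s "\<lambda>s. 0" "theta m" 0 0] by simp
    moreover have "theta (m + 2) s - real m * theta (m + 1) s = 0" using True by (simp add: theta_def)
    ultimately show ?thesis by metis
  next
    case nl: False
    with False have s: "s > 0" by simp
    have "((\<lambda>s. exp (- 1 / s) / s ^ m) has_real_derivative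
        (exp (- 1 / s) * (1 / s ^ 2) * s ^ m - exp (- 1 / s) * (real m * s ^ (m - 1))) / (s ^ m * s ^ m)) (at s)"
      using s by (auto intro!: derivative_eq_intros simp: power2_eq_square)
    moreover have "\<forall>\<^sub>F x in nhds s. exp (- 1 / x) / x ^ m = theta m x"
      using eventually_nhds_in_open[of "{0<..}" s] s by (auto elim!: eventually_mono simp: theta_def)
    moreover have "(exp (- 1 / s) * (1 / s ^ 2) * s ^ m - exp (- 1 / s) * (real m * s ^ (m - 1))) / (s ^ m * s ^ m)
      = theta (m + 2) s - real m * theta (m + 1) s"
    proof (cases m)
      case 0 then show ?thesis using s by (simp add: theta_def power2_eq_square)
    next
      case (Suc k)
      have "(e * (1 / s ^ 2) * (s * p) - e * (n * p)) / ((s * p) * (s * p)) = e / (s * (s * (s * p))) - n * (e / (s * (s * p)))"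
        if "p > 0" for e n p :: real
        using s that by (simp add: field_simps power2_eq_square)
      from this[of "s ^ k" "exp (- 1 / s)" "real m"] show ?thesis
        using s Suc by (simp add: theta_def)
    qed
    ultimately show ?thesis
      using DERIV_cong_ev[of s s "\<lambda>s. exp (- 1 / s) / s ^ m" "theta m"
          "theta (m + 2) s - real m * theta (m + 1) s" "theta (m + 2) s - real m * theta (m + 1) s"] by simp
  qed
qed

lemma Ck_theta_coord: "Ck k (\<lambda>x::real ^ 'n. theta m (x $ j))"
proof (induction k arbitrary: m)
  case 0
  have "continuous_on UNIV (theta m)"
    using theta_deriv by (meson DERIV_isCont continuous_at_imp_continuous_on)
  then have "continuous_on UNIV (theta m \<circ> (\<lambda>x::real ^ 'n. x $ j))"
    by (intro continuous_on_compose continuous_intros) (auto intro: continuous_on_subset)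
  then show ?case by (simp add: o_def)
next
  case (Suc k)
  have d: "((\<lambda>x. theta m (x $ j)) has_derivative (\<lambda>h. (theta (m + 2) (x $ j) - real m * theta (m + 1) (x $ j)) * h $ j)) (at x)"
    for x :: "real ^ 'n"
    using has_derivative_compose[OF bounded_linear_imp_has_derivative[OF bounded_linear_vec_nth]
        theta_deriv[THEN has_field_derivative_imp_has_derivative]] by blast
  have "partial_deriv i (\<lambda>x. theta m (x $ j)) =
      (\<lambda>x. (theta (m + 2) (x $ j) + (- real m) * theta (m + 1) (x $ j)) * axis i 1 $ j)" for i :: 'n
    using partial_deriv_eqI[OF d] by (auto simp: fun_eq_iff)
  moreover have "Ck k (\<lambda>x. (theta (m + 2) (x $ j) + (- real m) * theta (m + 1) (x $ j)) * axis i 1 $ j)" for i :: 'n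
    by (intro Ck_mult Ck_add Ck_const Suc.IH)
  ultimately show ?case using d by (simp add: differentiable_def) blast
qed

text \<open>Smooth, with values in [0, 1] and zero outside the open box. Inside, every factor has
  the form \<open>exp (- 1 / (n * c))\<close> with c > 0, so the bumps tend to the indicator of the
  open box as n grows.\<close>

definition bump :: "nat \<Rightarrow> real ^ 'n \<Rightarrow> real ^ 'n \<Rightarrow> real ^ 'n \<Rightarrow> real" where
  "bump n a b x = (\<Prod>i\<in>UNIV. theta 0 (real n * (x $ i - a $ i)) * theta 0 (real n * (b $ i - x $ i)))"

lemma theta0_bounds: "0 \<le> theta 0 s" "theta 0 s \<le> 1"
  by (auto simp: theta_def)

lemma bump_bounds: "0 \<le> bump n a b x" "bump n a b x \<le> 1"
  unfolding bump_def by (auto intro!: prod_nonneg prod_le_1 mult_nonneg_nonneg mult_le_one theta0_bounds)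

lemma bump_outside: "x \<notin> box a b \<Longrightarrow> bump n a b x = 0"
proof -
  assume "x \<notin> box a b"
  then obtain i where "x $ i \<le> a $ i \<or> b $ i \<le> x $ i" by (auto simp: mem_box_cart not_less)
  then have "theta 0 (real n * (x $ i - a $ i)) * theta 0 (real n * (b $ i - x $ i)) = 0"
    by (auto simp: theta_def mult_le_0_iff zero_less_mult_iff)
  then show ?thesis unfolding bump_def by (intro prod_zero) auto
qed

lemma bump_inside:
  assumes "x \<in> box a b"
  shows "(\<lambda>n. bump n a b x) \<longlonglongrightarrow> 1"
proof -
  have t: "(\<lambda>n. theta 0 (real n * s)) \<longlonglongrightarrow> 1" if "s > 0" for s
  proof -
    have "(\<lambda>n. exp (- (1 / s) * inverse (real n))) \<longlonglongrightarrow> exp (- (1 / s) * 0)"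
      by (intro tendsto_exp tendsto_mult tendsto_const LIMSEQ_inverse_real_of_nat lim_inverse_n)
    then have "(\<lambda>n. exp (- (1 / s) * inverse (real n))) \<longlonglongrightarrow> 1" by simp
    then show ?thesis
      by (rule Lim_transform_eventually)
         (use that in \<open>auto intro!: eventually_sequentiallyI[of 1] simp: theta_def field_simps mult_le_0_iff\<close>)
  qed
  have "(\<lambda>n. bump n a b x) \<longlonglongrightarrow> (\<Prod>i\<in>(UNIV::'a set). 1 * 1)"
    unfolding bump_def by (intro tendsto_prod tendsto_mult t) (use assms in \<open>auto simp: mem_box_cart\<close>)
  then show ?thesis by simp
qed

lemma test_functionsI:
  assumes "\<And>k. Ck k f" "\<And>x. x \<notin> cbox a b \<Longrightarrow> f x = 0"
  shows "f \<in> test_functions"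
proof -
  have "{x. f x \<noteq> 0} \<subseteq> cbox a b" using assms(2) by blast
  then have "closure {x. f x \<noteq> 0} \<subseteq> cbox a b" by (intro closure_minimal) auto
  then have "compact (closure {x. f x \<noteq> 0})"
    using compact_cbox closed_closure compact_Int_closed[of "cbox a b" "closure {x. f x \<noteq> 0}"]
    by (simp add: inf.absorb2)
  then show ?thesis unfolding test_functions_def using assms(1) by simp
qed

lemma bump_test: "bump n a b \<in> test_functions"
proof (rule test_functionsI)
  show "Ck k (bump n a b)" for k
  proof -
    have "Ck k (\<lambda>x. theta 0 ((real n *\<^sub>R x + - (real n *\<^sub>R a)) $ i) * theta 0 (((- real n) *\<^sub>R x + real n *\<^sub>R b) $ i))" for i
      using Ck_mult[OF Ck_affine[OF Ck_theta_coord[of k 0 i], of "real n" "- (real n *\<^sub>R a)"]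
          Ck_affine[OF Ck_theta_coord[of k 0 i], of "- real n" "real n *\<^sub>R b"]] .
    then have "Ck k (\<lambda>x. \<Prod>i\<in>UNIV. theta 0 ((real n *\<^sub>R x + - (real n *\<^sub>R a)) $ i) * theta 0 (((- real n) *\<^sub>R x + real n *\<^sub>R b) $ i))"
      by (intro Ck_prod)
    then show ?thesis unfolding bump_def[abs_def] by (simp add: algebra_simps)
  qed
  show "x \<notin> cbox a b \<Longrightarrow> bump n a b x = 0" for x
    using bump_outside box_subset_cbox by blast
qed

section \<open>Test functions: support, boundedness, closure properties\<close>

lemma test_Ck: "f \<in> test_functions \<Longrightarrow> Ck k f"
  unfolding test_functions_def by blast

lemma test_differentiable: "f \<in> test_functions \<Longrightarrow> f differentiable (at x)"
  using test_Ck[of f "Suc 0"] by simp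

lemma test_continuous: "f \<in> test_functions \<Longrightarrow> continuous_on UNIV f"
  using test_Ck[of f 0] by simp

lemma test_support:
  assumes "f \<in> test_functions"
  obtains R where "R > 0" "\<And>x. norm x > R \<Longrightarrow> f x = 0"
proof -
  have "bounded (closure {x. f x \<noteq> 0})"
    using assms compact_imp_bounded unfolding test_functions_def by blast
  then obtain R where R: "\<And>x. x \<in> closure {x. f x \<noteq> 0} \<Longrightarrow> norm x \<le> R" by (auto simp: bounded_iff)
  have "f x = 0" if "norm x > max R 1" for x
    using R[of x] that closure_subset[of "{x. f x \<noteq> 0}"] by (auto)
  then show ?thesis using that[of "max R 1"] by auto
qed

lemma test_cI:
  assumes "\<And>k. Ck k f" "\<And>x. norm x > R \<Longrightarrow> f x = 0"
  shows "f \<in> test_functions"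
proof -
  have "bounded {x. f x \<noteq> 0}"
    using assms(2) unfolding bounded_iff by (metis (mono_tags, lifting) mem_Collect_eq not_le)
  then have "compact (closure {x. f x \<noteq> 0})" by (simp add: compact_closure)
  then show ?thesis unfolding test_functions_def using assms(1) by simp
qed

lemma test_mult_Ck:
  assumes "f \<in> test_functions" "\<And>k. Ck k g"
  shows "(\<lambda>x. g x * f x) \<in> test_functions"
proof -
  obtain R where R: "\<And>x. norm x > R \<Longrightarrow> f x = 0" by (rule test_support[OF assms(1)]) blast
  show ?thesis
    by (rule test_cI[of "\<lambda>x. g x * f x" R]) (use R Ck_mult[OF assms(2) test_Ck[OF assms(1)]] in auto)
qed

lemma test_cmult: "f \<in> test_functions \<Longrightarrow> (\<lambda>x. c * f x) \<in> test_functions"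
  by (intro test_mult_Ck Ck_const)

lemma test_zero: "(\<lambda>x. 0) \<in> test_functions"
  by (rule test_cI[of _ 0]) (auto intro: Ck_const)

lemma test_add:
  assumes "f \<in> test_functions" "g \<in> test_functions"
  shows "(\<lambda>x. f x + g x) \<in> test_functions"
proof -
  obtain R where R: "\<And>x. norm x > R \<Longrightarrow> f x = 0" by (rule test_support[OF assms(1)]) blast
  obtain S where S: "\<And>x. norm x > S \<Longrightarrow> g x = 0" by (rule test_support[OF assms(2)]) blast
  show ?thesis
    by (rule test_cI[of "\<lambda>x. f x + g x" "max R S"]) (use R S Ck_add[OF test_Ck[OF assms(1)] test_Ck[OF assms(2)]] in auto)
qed

lemma test_affine:
  fixes f :: "real ^ 'n \<Rightarrow> real"
  assumes "f \<in> test_functions" "c \<noteq> 0"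
  shows "(\<lambda>x. f (c *\<^sub>R x + a)) \<in> test_functions"
proof -
  obtain R where R: "\<And>x. norm x > R \<Longrightarrow> f x = 0" by (rule test_support[OF assms(1)]) blast
  show ?thesis
  proof (rule test_cI)
    show "Ck k (\<lambda>x. f (c *\<^sub>R x + a))" for k using Ck_affine test_Ck assms(1) by blast
    fix x :: "real ^ 'n" assume "norm x > (R + norm a) / \<bar>c\<bar>"
    then have "\<bar>c\<bar> * norm x > R + norm a" using assms(2) by (simp add: field_simps)
    moreover have "norm (c *\<^sub>R x) \<le> norm (c *\<^sub>R x + a) + norm a"
      using norm_triangle_ineq4[of "c *\<^sub>R x + a" a] by simp
    ultimately show "f (c *\<^sub>R x + a) = 0" by (intro R) simp
  qed
qed

lemma partial_deriv_test:
  assumes "f \<in> test_functions"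
  shows "partial_deriv i f \<in> test_functions"
proof -
  obtain R where R: "\<And>x. norm x > R \<Longrightarrow> f x = 0" by (rule test_support[OF assms(1)]) blast
  show ?thesis
  proof (rule test_cI)
    show "Ck k (partial_deriv i f)" for k using test_Ck[OF assms, of "Suc k"] by simp
    fix x :: "real ^ 'a" assume x: "norm x > R"
    have "\<forall>\<^sub>F y in nhds x. y \<in> {y. norm y > R}"
      by (intro eventually_nhds_in_open open_Collect_less continuous_intros) (use x in auto)
    then have ev: "\<forall>\<^sub>F y in at x. 0 = f y"
      unfolding eventually_at_filter by eventually_elim (simp add: R)
    have "((\<lambda>y. 0 :: real) has_derivative (\<lambda>h. 0)) (at x)" by simp
    then have "(f has_derivative (\<lambda>h. 0)) (at x)"
      by (rule has_derivative_transform_eventually[OF _ ev]) (use R x in auto)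
    then show "partial_deriv i f x = 0" using partial_deriv_eqI by metis
  qed
qed

lemma continuous_lebesgue_measurable: "continuous_on UNIV f \<Longrightarrow> f \<in> borel_measurable lebesgue"
  by (intro measurable_completion) (simp add: borel_measurable_continuous_onI)

lemma test_meas: "f \<in> test_functions \<Longrightarrow> f \<in> borel_measurable lebesgue"
  by (intro continuous_lebesgue_measurable test_continuous)

lemma test_bounded:
  assumes "f \<in> test_functions"
  obtains B where "B > 0" "\<And>x. \<bar>f x\<bar> \<le> B"
proof -
  obtain R where R: "R > 0" "\<And>x. norm x > R \<Longrightarrow> f x = 0" by (rule test_support[OF assms(1)]) blast
  have "compact (f ` cball 0 R)"
    by (intro compact_continuous_image continuous_on_subset[OF test_continuous[OF assms]]) auto
  then obtain B where B: "B > 0" "\<And>x. x \<in> f ` cball 0 R \<Longrightarrow> norm x \<le> B"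
    using compact_imp_bounded bounded_pos by metis
  have "\<bar>f x\<bar> \<le> B" for x
    using B R(2)[of x] by (cases "norm x > R") (auto simp: not_less)
  then show ?thesis using that B by blast
qed

text \<open>A common home for L2 functions and bounded ones. Indicators of sets of infinite measure
  occur in the positivity argument and are only locally integrable.\<close>

definition loc_integrable :: "(real ^ 'n \<Rightarrow> real) \<Rightarrow> bool" where
  "loc_integrable f \<longleftrightarrow> f \<in> borel_measurable lebesgue \<and> (\<forall>R. integrable lebesgue (\<lambda>x. indicator (cball 0 R) x * f x))"

lemma loc_integrable_mult_bounded:
  assumes f: "loc_integrable f" and g: "g \<in> borel_measurable lebesgue" "\<And>x. \<bar>g x\<bar> \<le> B" "\<And>x. norm x > R \<Longrightarrow> g x = 0"
  shows "integrable lebesgue (\<lambda>x. f x * g x)"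
proof (rule Bochner_Integration.integrable_bound[where f = "\<lambda>x. B * (indicator (cball 0 R) x * f x)"])
  show "integrable lebesgue (\<lambda>x. B * (indicator (cball 0 R) x * f x))"
    using f unfolding loc_integrable_def by auto
  show "(\<lambda>x. f x * g x) \<in> borel_measurable lebesgue" using f g unfolding loc_integrable_def by auto
  show "AE x in lebesgue. norm (f x * g x) \<le> norm (B * (indicator (cball 0 R) x * f x))"
  proof (rule AE_I2)
    fix x
    have "\<bar>f x\<bar> * \<bar>g x\<bar> \<le> \<bar>f x\<bar> * B" using g(2) by (intro mult_left_mono) auto
    moreover have "0 \<le> B" using g(2)[of 0] by linarith
    ultimately show "norm (f x * g x) \<le> norm (B * (indicator (cball 0 R) x * f x))"
      using g(3)[of x] by (auto simp: abs_mult indicator_def mult.commute)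
  qed
qed

lemma loc_integrable_test:
  assumes "loc_integrable f" "\<phi> \<in> test_functions"
  shows "integrable lebesgue (\<lambda>x. f x * \<phi> x)"
proof -
  obtain R where R: "\<And>x. norm x > R \<Longrightarrow> \<phi> x = 0" by (rule test_support[OF assms(2)]) blast
  obtain B where B: "\<And>x. \<bar>\<phi> x\<bar> \<le> B" by (rule test_bounded[OF assms(2)]) blast
  show ?thesis by (rule loc_integrable_mult_bounded[OF assms(1) test_meas[OF assms(2)] B R])
qed

lemma indicator_cball_L2: "(\<lambda>x. indicator (cball 0 R :: (real ^ 'n) set) x) \<in> L2"
proof -
  have "emeasure lebesgue (cball 0 R :: (real ^ 'n) set) < \<infinity>"
    using emeasure_bounded_finite[OF bounded_cball] by simp
  then have "integrable lebesgue (\<lambda>x. indicator (cball 0 R :: (real ^ 'n) set) x :: real)"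
    by (intro integrable_real_indicator) auto
  moreover have "(indicator A x)\<^sup>2 = (indicator A x :: real)" for A and x :: "real ^ 'n"
    by (auto simp: indicator_def)
  moreover have "(\<lambda>x. indicator (cball 0 R :: (real ^ 'n) set) x :: real) \<in> borel_measurable lebesgue"
    by (intro borel_measurable_indicator) auto
  ultimately show ?thesis by (simp only: L2_iff)
qed

lemma L2_loc_integrable: "f \<in> L2 \<Longrightarrow> loc_integrable f"
  unfolding loc_integrable_def using L2_mult_integrable[OF indicator_cball_L2] by (auto dest: L2_meas)

lemma test_L2:
  assumes "f \<in> test_functions"
  shows "f \<in> L2"
proof -
  obtain R where R: "\<And>x. norm x > R \<Longrightarrow> f x = 0" by (rule test_support[OF assms]) blast
  obtain B where B: "\<And>x. \<bar>f x\<bar> \<le> B" by (rule test_bounded[OF assms]) blast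
  have "(\<lambda>x. f x * indicator (cball 0 R) x) \<in> L2"
    by (rule L2_bounded_mult[OF indicator_cball_L2 test_meas[OF assms] B])
  moreover have "f x * indicator (cball 0 R) x = f x" for x using R[of x] by (auto simp: indicator_def)
  ultimately show ?thesis by simp
qed

text \<open>As \<open>ennreal\<close> sends negative reals to 0, the two densities are the positive
  and the negative part of f. The measures agree on open boxes, an intersection-stable generator,
  hence are equal; then so are the densities a.e., and one of the two is always 0.\<close>

lemma integral_box_zero_imp:
  fixes f :: "real ^ 'n \<Rightarrow> real"
  assumes f: "integrable lborel f" and z: "\<And>a b. (LINT x|lborel. f x * indicator (box a b) x) = 0"
  shows "AE x in lborel. f x = 0"
proof -
  have [measurable]: "f \<in> borel_measurable lborel" using f by simp
  have P: "density lborel (\<lambda>x. ennreal (f x)) = density lborel (\<lambda>x. ennreal (- f x))"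
  proof (rule measure_eqI_generator_eq)
    let ?E = "range (\<lambda>(a, b). box a b :: (real ^ 'n) set)"
    show "Int_stable ?E" by (auto simp: Int_stable_def box_Int_box)
    show "?E \<subseteq> Pow UNIV" "sets (density lborel (\<lambda>x. ennreal (f x))) = sigma_sets UNIV ?E"
      "sets (density lborel (\<lambda>x. ennreal (- f x))) = sigma_sets UNIV ?E"
      by (simp_all add: borel_eq_box)
    let ?A = "\<lambda>n::nat. box (- (real n *\<^sub>R One)) (real n *\<^sub>R One) :: (real ^ 'n) set"
    show "range ?A \<subseteq> ?E" "(\<Union>i. ?A i) = UNIV" unfolding UN_box_eq_UNIV by auto
    have em: "emeasure (density lborel (\<lambda>x. ennreal (g x))) (box a b) = ennreal (LINT x|lborel. max 0 (g x * indicator (box a b) x))"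
      if g: "integrable lborel g" for g :: "real ^ 'n \<Rightarrow> real" and a b
    proof -
      have [measurable]: "g \<in> borel_measurable lborel" using g by simp
      have i: "integrable lborel (\<lambda>x. max 0 (g x * indicator (box a b) x))"
        using integrable_mult_indicator[OF _ g, of "box a b"] by (intro integrable_max) (auto simp: mult.commute)
      have "emeasure (density lborel (\<lambda>x. ennreal (g x))) (box a b) = (\<integral>\<^sup>+x. ennreal (g x) * indicator (box a b) x \<partial>lborel)"
        by (rule emeasure_density) auto
      also have "\<dots> = (\<integral>\<^sup>+x. ennreal (max 0 (g x * indicator (box a b) x)) \<partial>lborel)"
        by (intro nn_integral_cong) (auto simp: indicator_def max_def ennreal_neg)
      also have "\<dots> = ennreal (LINT x|lborel. max 0 (g x * indicator (box a b) x))"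
        by (rule nn_integral_eq_integral[OF i]) auto
      finally show ?thesis .
    qed
    show "emeasure (density lborel (\<lambda>x. ennreal (f x))) (?A i) \<noteq> \<infinity>" for i using em[OF f] by simp
    fix X assume "X \<in> ?E"
    then obtain a b where X: "X = box a b" by auto
    have i: "integrable lborel (\<lambda>x. f x * indicator (box a b) x)"
      using integrable_mult_indicator[OF _ f, of "box a b"] by (simp add: mult.commute)
    have "(LINT x|lborel. max 0 (f x * indicator (box a b) x)) - (LINT x|lborel. max 0 (- f x * indicator (box a b) x))
       = (LINT x|lborel. max 0 (f x * indicator (box a b) x) - max 0 (- (f x * indicator (box a b) x)))"
      using i by (subst Bochner_Integration.integral_diff) auto
    also have "\<dots> = (LINT x|lborel. f x * indicator (box a b) x)"
      by (intro Bochner_Integration.integral_cong) auto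
    finally show "emeasure (density lborel (\<lambda>x. ennreal (f x))) X = emeasure (density lborel (\<lambda>x. ennreal (- f x))) X"
      unfolding X using em[OF f, of a b] em[of "\<lambda>x. - f x" a b] f z[of a b] by simp
  qed
  have "(AE x in lborel. ennreal (f x) = ennreal (- f x))"
    using sigma_finite_measure.density_unique_iff[OF sigma_finite_lborel, of "\<lambda>x. ennreal (f x)" "\<lambda>x. ennreal (- f x)"] P by simp
  then show ?thesis
  proof eventually_elim
    case (elim x)
    then show ?case
      by (metis ennreal_eq_0_iff ennreal_neg linear neg_le_0_iff_le order_antisym)
  qed
qed

text \<open>Bumps approximate box indicators, so all integrals of f over boxes vanish; a Borel
  representative is then zero by uniqueness of measures on boxes.\<close>

lemma fundamental_lemma:
  assumes f: "loc_integrable f" and z: "\<And>\<phi>. \<phi> \<in> test_functions \<Longrightarrow> (LINT x|lebesgue. f x * \<phi> x) = 0"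
  shows "AE x in lebesgue. f x = 0"
proof -
  have fm: "f \<in> borel_measurable lebesgue" using f unfolding loc_integrable_def by blast
  obtain g where g[measurable]: "g \<in> borel_measurable lborel" and fg: "AE x in lborel. f x = g x"
    using completion_ex_borel_measurable_real[OF fm] by blast
  have gm: "g \<in> borel_measurable lebesgue" by (rule measurable_completion[OF g])
  have fg': "AE x in lebesgue. f x = g x" using fg by (rule AE_completion)
  have boxz: "(LINT x|lebesgue. f x * indicator (box a b) x) = 0" for a b
  proof -
    obtain R where R: "box a b \<subseteq> cball 0 R"
      using bounded_box[of a b] unfolding bounded_iff by (auto simp: subset_iff)
    have "(\<lambda>n. LINT x|lebesgue. f x * bump n a b x) \<longlonglongrightarrow> (LINT x|lebesgue. f x * indicator (box a b) x)"
    proof (rule integral_dominated_convergence[where w = "\<lambda>x. \<bar>indicator (cball 0 R) x * f x\<bar>"])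
      show "(\<lambda>x. f x * indicator (box a b) x) \<in> borel_measurable lebesgue"
        using fm by (intro borel_measurable_times borel_measurable_indicator) auto
      show "(\<lambda>x. f x * bump n a b x) \<in> borel_measurable lebesgue" for n
        by (intro borel_measurable_times fm test_meas bump_test)
      show "integrable lebesgue (\<lambda>x. \<bar>indicator (cball 0 R) x * f x\<bar>)"
        using f unfolding loc_integrable_def by simp
      show "AE x in lebesgue. (\<lambda>n. f x * bump n a b x) \<longlonglongrightarrow> f x * indicator (box a b) x"
      proof (rule AE_I2)
        fix x show "(\<lambda>n. f x * bump n a b x) \<longlonglongrightarrow> f x * indicator (box a b) x"
          using tendsto_mult[OF tendsto_const bump_inside[of x a b], of "f x"] bump_outside[of x a b]
          by (cases "x \<in> box a b") auto
      qed
      show "AE x in lebesgue. norm (f x * bump n a b x) \<le> \<bar>indicator (cball 0 R) x * f x\<bar>" for n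
      proof (rule AE_I2)
        fix x show "norm (f x * bump n a b x) \<le> \<bar>indicator (cball 0 R) x * f x\<bar>"
          using R bump_bounds[of n a b x] bump_outside[of x a b n]
          by (cases "x \<in> box a b") (auto simp: abs_mult mult_left_le indicator_def subset_iff)
      qed
    qed
    moreover have "(LINT x|lebesgue. f x * bump n a b x) = 0" for n by (rule z[OF bump_test])
    ultimately show ?thesis by (simp add: LIMSEQ_const_iff)
  qed
  \<comment> \<open>Cutting down to a large cube makes g integrable on the whole space, and an
    intersection of boxes is a box, so the vanishing of box integrals survives the cut.\<close>
  have "AE x in lborel. g x * indicator (box (- (real n *\<^sub>R One)) (real n *\<^sub>R One)) x = 0" for n :: nat
  proof (rule integral_box_zero_imp)
    let ?B = "box (- (real n *\<^sub>R One)) (real n *\<^sub>R One) :: (real ^ 'a) set"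
    obtain R where R: "?B \<subseteq> cball 0 R"
      using bounded_box[of "- (real n *\<^sub>R One)" "real n *\<^sub>R One :: real ^ 'a"] unfolding bounded_iff by (auto simp: subset_iff)
    have im: "(indicator ?B :: _ \<Rightarrow> real) \<in> borel_measurable lebesgue"
      by (intro borel_measurable_indicator) auto
    have "integrable lebesgue (\<lambda>x. f x * indicator ?B x)"
      by (rule loc_integrable_mult_bounded[OF f im, of 1 R]) (use R in \<open>auto simp: indicator_def subset_iff\<close>)
    then have "integrable lebesgue (\<lambda>x. g x * indicator ?B x)"
      using fg' by (subst integrable_cong_AE[of _ _ "\<lambda>x. f x * indicator ?B x"])
        (auto elim!: eventually_mono intro!: borel_measurable_times im fm gm)
    then show "integrable lborel (\<lambda>x. g x * indicator ?B x)" by (subst (asm) integrable_completion) auto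
    fix a b
    obtain c d where cd: "?B \<inter> box a b = box c d" unfolding box_Int_box by blast
    have ind: "g x * indicator ?B x * indicator (box a b) x = g x * indicator (box c d) x" for x
      unfolding cd[symmetric] by (simp add: indicator_inter_arith mult.assoc)
    have "(LINT x|lborel. g x * indicator (box c d) x) = (LINT x|lebesgue. g x * indicator (box c d) x)"
      by (rule integral_completion[symmetric]) simp
    also have "\<dots> = (LINT x|lebesgue. f x * indicator (box c d) x)"
      using fg' by (intro integral_cong_AE)
        (auto elim!: eventually_mono intro!: borel_measurable_times borel_measurable_indicator fm gm)
    finally show "(LINT x|lborel. g x * indicator ?B x * indicator (box a b) x) = 0"
      unfolding ind using boxz by simp
  qed
  then have "AE x in lborel. \<forall>n::nat. g x * indicator (box (- (real n *\<^sub>R One)) (real n *\<^sub>R One)) x = 0"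
    unfolding AE_all_countable by blast
  then have "AE x in lborel. g x = 0"
  proof eventually_elim
    case (elim x)
    have "x \<in> (\<Union>i::nat. box (- (real i *\<^sub>R One)) (real i *\<^sub>R One))" unfolding UN_box_eq_UNIV by simp
    then obtain n :: nat where "x \<in> box (- (real n *\<^sub>R One)) (real n *\<^sub>R One)" by (rule UN_E)
    then show ?case using spec[OF elim, of n] by simp
  qed
  with fg have "AE x in lborel. f x = 0" by eventually_elim simp
  then show ?thesis by (rule AE_completion)
qed

lemma L2_orth_weighted_test:
  assumes w: "w \<in> L2" and c: "continuous_on UNIV c" "\<And>x. c x \<noteq> 0"
    and z: "\<And>\<phi>. \<phi> \<in> test_functions \<Longrightarrow> ip w (\<lambda>x. c x * \<phi> x) = 0"
  shows "AE x in lebesgue. w x = 0"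
proof -
  have cm: "c \<in> borel_measurable lebesgue" by (rule continuous_lebesgue_measurable[OF c(1)])
  have "loc_integrable (\<lambda>x. w x * c x)"
    unfolding loc_integrable_def
  proof (intro conjI allI)
    show "(\<lambda>x. w x * c x) \<in> borel_measurable lebesgue" using L2_meas[OF w] cm by simp
    fix R
    have "compact (c ` cball 0 R)"
      by (intro compact_continuous_image continuous_on_subset[OF c(1)]) auto
    then obtain B where B: "B > 0" "\<And>x. x \<in> c ` cball 0 R \<Longrightarrow> norm x \<le> B"
      using compact_imp_bounded bounded_pos by metis
    have "(\<lambda>x. indicator (cball 0 R) x * c x) \<in> borel_measurable lebesgue"
      using cm by (intro borel_measurable_times borel_measurable_indicator) auto
    then have "integrable lebesgue (\<lambda>x. w x * (indicator (cball 0 R) x * c x))"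
      by (rule loc_integrable_mult_bounded[OF L2_loc_integrable[OF w], of _ B R])
        (use B in \<open>auto simp: indicator_def\<close>)
    then show "integrable lebesgue (\<lambda>x. indicator (cball 0 R) x * (w x * c x))"
      by (simp add: mult.left_commute)
  qed
  then have "AE x in lebesgue. w x * c x = 0"
    by (rule fundamental_lemma) (use z in \<open>simp add: ip_def mult.assoc\<close>)
  then show ?thesis using c(2) by simp
qed

lemma test_mult_L2:
  assumes "continuous_on UNIV c" "\<phi> \<in> test_functions"
  shows "(\<lambda>x. c x * \<phi> x) \<in> L2"
proof -
  have cm: "c \<in> borel_measurable lebesgue" by (rule continuous_lebesgue_measurable[OF assms(1)])
  obtain R where R: "\<And>x. norm x > R \<Longrightarrow> \<phi> x = 0" by (rule test_support[OF assms(2)]) blast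
  have "compact (c ` cball 0 R)"
    by (intro compact_continuous_image continuous_on_subset[OF assms(1)]) auto
  then obtain B where B: "B > 0" "\<And>x. x \<in> c ` cball 0 R \<Longrightarrow> norm x \<le> B"
    using compact_imp_bounded bounded_pos by metis
  have "(\<lambda>x. indicator (cball 0 R) x * c x) \<in> borel_measurable lebesgue"
    using cm by (intro borel_measurable_times borel_measurable_indicator) auto
  then have "(\<lambda>x. (indicator (cball 0 R) x * c x) * \<phi> x) \<in> L2"
    by (rule L2_bounded_mult[OF test_L2[OF assms(2)], of _ B]) (use B in \<open>auto simp: indicator_def\<close>)
  moreover have "(indicator (cball 0 R) x * c x) * \<phi> x = c x * \<phi> x" for x
    using R[of x] by (auto simp: indicator_def)
  ultimately show ?thesis by simp
qed

text \<open>If w is orthogonal to all products of c with test functions then \<open>w * c\<close>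
  vanishes a.e., hence w does. With the weight \<open>sqrt (1 + (norm x)^2)\<close>, one test
  function approximates a function and its product with \<open>norm x\<close> at once;
  \<open>dil_diff_bound\<close> relies on this.\<close>

lemma test_dense_weighted:
  assumes c: "continuous_on UNIV c" "\<And>x. c x \<noteq> 0" and f: "f \<in> L2" and e: "e > 0"
  obtains \<phi> where "\<phi> \<in> test_functions" "nrm (\<lambda>x. f x - c x * \<phi> x) < e"
proof -
  let ?S = "(\<lambda>\<phi> x. c x * \<phi> x) ` test_functions"
  obtain s where "s \<in> ?S" "nrm (\<lambda>x. f x - s x) < e"
  proof (rule L2_dense_subspace[OF _ _ _ _ _ f e, of ?S])
    show "?S \<subseteq> L2" using test_mult_L2[OF c(1)] by blast
    show "(\<lambda>x. 0) \<in> ?S" using test_zero by force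
    show "(\<lambda>x. u x + v x) \<in> ?S" if uv: "u \<in> ?S" "v \<in> ?S" for u v
    proof -
      obtain a b where ab: "a \<in> test_functions" "b \<in> test_functions" "u = (\<lambda>x. c x * a x)" "v = (\<lambda>x. c x * b x)"
        using uv by auto
      show ?thesis
        by (rule image_eqI[OF _ test_add[OF ab(1,2)]]) (simp add: ab distrib_left)
    qed
    show "(\<lambda>x. k * u x) \<in> ?S" if u: "u \<in> ?S" for u k
    proof -
      obtain a where a: "a \<in> test_functions" "u = (\<lambda>x. c x * a x)" using u by auto
      show ?thesis
        by (rule image_eqI[OF _ test_cmult[OF a(1), of k]]) (simp add: a mult.left_commute)
    qed
    show "AE x in lebesgue. w x = 0" if "w \<in> L2" "\<And>s. s \<in> ?S \<Longrightarrow> ip w s = 0" for w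
      using L2_orth_weighted_test[OF that(1) c] that(2) by blast
  qed blast
  then show ?thesis using that by auto
qed

lemma test_dense:
  assumes "f \<in> L2" "e > 0"
  obtains \<phi> where "\<phi> \<in> test_functions" "nrm (\<lambda>x. f x - \<phi> x) < e"
  using test_dense_weighted[of "\<lambda>x. 1" f e] assms by (auto intro: continuous_intros)

lemma L2_orth_test:
  assumes "w \<in> L2" "\<And>\<phi>. \<phi> \<in> test_functions \<Longrightarrow> ip w \<phi> = 0"
  shows "AE x in lebesgue. w x = 0"
  by (rule fundamental_lemma[OF L2_loc_integrable[OF assms(1)]]) (use assms(2) in \<open>simp add: ip_def\<close>)

text \<open>Pairing f with a test function close to f itself nearly produces the squared norm. This
  duality turns estimates of pairings into norm bounds.\<close>

lemma nrm_le_test: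
  assumes f: "f \<in> L2" and C: "0 \<le> C" "\<And>\<phi>. \<phi> \<in> test_functions \<Longrightarrow> \<bar>ip f \<phi>\<bar> \<le> C * nrm \<phi>"
  shows "nrm f \<le> C"
proof -
  have "(nrm f)\<^sup>2 \<le> C * nrm f + e * (nrm f + C)" if e: "e > 0" for e
  proof -
    obtain \<phi> where p: "\<phi> \<in> test_functions" "nrm (\<lambda>x. f x - \<phi> x) < e" by (rule test_dense[OF f e])
    have pL: "\<phi> \<in> L2" by (rule test_L2[OF p(1)])
    have "(nrm f)\<^sup>2 = ip f \<phi> + ip f (\<lambda>x. f x - \<phi> x)"
      using ip_diff_right[OF f pL f] by (simp add: nrm_sq)
    also have "\<dots> \<le> C * nrm \<phi> + nrm f * e"
      using C(2)[OF p(1)] ip_le_nrm[OF f L2_diff[OF f pL]] p(2)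
        mult_left_mono[of "nrm (\<lambda>x. f x - \<phi> x)" e "nrm f"] by (simp add: abs_le_iff)
    also have "nrm \<phi> \<le> nrm f + e" using nrm_diff_abs[OF f pL] p(2) by linarith
    then have "C * nrm \<phi> \<le> C * (nrm f + e)" using C(1) by (intro mult_left_mono)
    finally show ?thesis by (simp add: algebra_simps)
  qed
  then have *: "(nrm f)\<^sup>2 - C * nrm f \<le> e * (nrm f + C)" if "e > 0" for e using that by fastforce
  have "((\<lambda>e. e * (nrm f + C)) \<longlongrightarrow> 0 * (nrm f + C)) (at_right 0)" by (intro tendsto_intros)
  then have "(nrm f)\<^sup>2 - C * nrm f \<le> 0 * (nrm f + C)"
    by (rule tendsto_lowerbound) (use * in \<open>auto simp: eventually_at_filter\<close>)
  then have "(nrm f)\<^sup>2 \<le> C * nrm f" by simp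
  then show ?thesis using C(1) nrm_nonneg[of f]
    by (cases "nrm f = 0") (auto simp: power2_eq_square)
qed

section \<open>Affine changes of variables\<close>

lemma
  fixes a :: "real ^ 'n"
  assumes c: "c \<noteq> 0"
  shows lebesgue_affine_vec: "lebesgue = density (distr lebesgue lebesgue (\<lambda>x. c *\<^sub>R x + a)) (\<lambda>_. ennreal (\<bar>c\<bar> ^ CARD('n)))"
    and affine_measurable: "(\<lambda>x. c *\<^sub>R x + a) \<in> lebesgue \<rightarrow>\<^sub>M lebesgue"
proof -
  have eq: "(\<lambda>x. a + (\<Sum>j\<in>Basis. (c * (x \<bullet> j)) *\<^sub>R j)) = (\<lambda>x. c *\<^sub>R x + a)"
    unfolding scaleR_scaleR[symmetric] scaleR_sum_right[symmetric] euclidean_representation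
    by (simp add: add.commute)
  have card: "(\<Prod>j\<in>(Basis :: (real ^ 'n) set). \<bar>c\<bar>) = \<bar>c\<bar> ^ CARD('n)" by simp
  show "lebesgue = density (distr lebesgue lebesgue (\<lambda>x. c *\<^sub>R x + a)) (\<lambda>_. ennreal (\<bar>c\<bar> ^ CARD('n)))"
    using lebesgue_affine_euclidean[of "\<lambda>_. c" a] c unfolding eq card by simp
  show "(\<lambda>x. c *\<^sub>R x + a) \<in> lebesgue \<rightarrow>\<^sub>M lebesgue"
    using lebesgue_affine_measurable[of "\<lambda>_. c" a] c unfolding eq by simp
qed

lemma affine_borel_measurable:
  fixes f :: "real ^ 'n \<Rightarrow> 'b::topological_space"
  assumes "f \<in> borel_measurable lebesgue" "c \<noteq> 0"
  shows "(\<lambda>x. f (c *\<^sub>R x + a)) \<in> borel_measurable lebesgue"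
  using measurable_compose[OF affine_measurable[OF assms(2)] assms(1)] .

lemma affine_AE:
  fixes a :: "real ^ 'n"
  assumes c: "c \<noteq> 0" and P: "AE x in lebesgue. P x"
  shows "AE x in lebesgue. P (c *\<^sub>R x + a)"
proof -
  have "AE x in density (distr lebesgue lebesgue (\<lambda>x. c *\<^sub>R x + a)) (\<lambda>_. ennreal (\<bar>c\<bar> ^ CARD('n))). P x"
    using P unfolding lebesgue_affine_vec[OF c, of a, symmetric] .
  then have "AE x in distr lebesgue lebesgue (\<lambda>x. c *\<^sub>R x + a). P x"
    using c by (subst (asm) AE_density) auto
  then show ?thesis by (rule AE_distrD[OF affine_measurable[OF c]])
qed

lemma
  fixes f :: "real ^ 'n \<Rightarrow> real"
  assumes c: "c \<noteq> 0" and f: "f \<in> borel_measurable lebesgue"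
  shows affine_integrable_iff: "integrable lebesgue (\<lambda>x. f (c *\<^sub>R x + a)) \<longleftrightarrow> integrable lebesgue f"
    and affine_integral: "(LINT x|lebesgue. f (c *\<^sub>R x + a)) = (LINT x|lebesgue. f x) / \<bar>c\<bar> ^ CARD('n)"
proof -
  let ?D = "distr lebesgue lebesgue (\<lambda>x. c *\<^sub>R x + a)"
  have fD: "f \<in> borel_measurable ?D" using f by simp
  have "integrable lebesgue f \<longleftrightarrow> integrable (density ?D (\<lambda>_. ennreal (\<bar>c\<bar> ^ CARD('n)))) f"
    using lebesgue_affine_vec[OF c, of a] by simp
  also have "\<dots> \<longleftrightarrow> integrable ?D (\<lambda>x. \<bar>c\<bar> ^ CARD('n) *\<^sub>R f x)"
    by (rule integrable_density) (use fD in auto)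
  also have "\<dots> \<longleftrightarrow> integrable ?D f" using c by simp
  also have "\<dots> \<longleftrightarrow> integrable lebesgue (\<lambda>x. f (c *\<^sub>R x + a))"
    by (rule integrable_distr_eq[OF affine_measurable[OF c] f])
  finally show "integrable lebesgue (\<lambda>x. f (c *\<^sub>R x + a)) \<longleftrightarrow> integrable lebesgue f" by simp
  have "(LINT x|lebesgue. f x) = (LINT x|density ?D (\<lambda>_. ennreal (\<bar>c\<bar> ^ CARD('n))). f x)"
    using lebesgue_affine_vec[OF c, of a] by simp
  also have "\<dots> = (LINT x|?D. \<bar>c\<bar> ^ CARD('n) *\<^sub>R f x)"
    by (rule integral_density) (use fD in auto)
  also have "\<dots> = \<bar>c\<bar> ^ CARD('n) * (LINT x|lebesgue. f (c *\<^sub>R x + a))"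
    using integral_distr[OF affine_measurable[OF c] f, of a] by simp
  finally show "(LINT x|lebesgue. f (c *\<^sub>R x + a)) = (LINT x|lebesgue. f x) / \<bar>c\<bar> ^ CARD('n)"
    using c by simp
qed

lemma affine_L2:
  assumes c: "c \<noteq> 0" and f: "f \<in> L2"
  shows "(\<lambda>x. f (c *\<^sub>R x + a)) \<in> L2"
  using affine_borel_measurable[OF L2_meas[OF f] c] affine_integrable_iff[OF c, of "\<lambda>x. (f x)\<^sup>2"] f
  by (auto simp: L2_iff)

lemma affine_ip:
  fixes f :: "real ^ 'n \<Rightarrow> real"
  assumes c: "c \<noteq> 0" and f: "f \<in> L2" "g \<in> L2"
  shows "ip (\<lambda>x. f (c *\<^sub>R x + a)) (\<lambda>x. g (c *\<^sub>R x + a)) = ip f g / \<bar>c\<bar> ^ CARD('n)"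
  unfolding ip_def using affine_integral[OF c, of "\<lambda>x. f x * g x"] f L2_meas by simp

section \<open>Translations and differentiation under the integral sign\<close>

lemma tr_meas: "f \<in> borel_measurable lebesgue \<Longrightarrow> (\<lambda>x::real ^ 'n. f (x + h)) \<in> borel_measurable lebesgue"
  using affine_borel_measurable[of f 1 h] by simp

lemma tr_L2: "f \<in> L2 \<Longrightarrow> (\<lambda>x. f (x + h)) \<in> L2"
  using affine_L2[of 1 f h] by simp

lemma tr_ip: "f \<in> L2 \<Longrightarrow> g \<in> L2 \<Longrightarrow> ip (\<lambda>x. f (x + h)) (\<lambda>x. g (x + h)) = ip f g"
  using affine_ip[of 1 f g h] by simp

lemma tr_nrm: "f \<in> L2 \<Longrightarrow> nrm (\<lambda>x. f (x + h)) = nrm f"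
  unfolding nrm_def by (simp add: tr_ip)

lemma tr_ip_adj: "f \<in> L2 \<Longrightarrow> g \<in> L2 \<Longrightarrow> ip (\<lambda>x. f (x + h)) g = ip f (\<lambda>x. g (x - h))"
  using tr_ip[of f "\<lambda>x. g (x - h)" h] tr_L2[of g "- h"] by simp

lemma test_tr_continuous:
  fixes \<phi> :: "real ^ 'n \<Rightarrow> real"
  assumes p: "\<phi> \<in> test_functions"
  shows "((\<lambda>h. nrm (\<lambda>x. \<phi> (x + h) - \<phi> x)) \<longlongrightarrow> 0) (at 0)"
proof -
  obtain R where R: "R > 0" "\<And>x. norm x > R \<Longrightarrow> \<phi> x = 0" by (rule test_support[OF p]) blast
  let ?I = "\<lambda>x :: real ^ 'n. indicator (cball 0 (R + 1)) x :: real"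
  define K where "K = nrm ?I + 1"
  have K: "K > 0" unfolding K_def using nrm_nonneg[of ?I] by linarith
  have uc: "uniformly_continuous_on (cball 0 (R + 2)) \<phi>"
    by (intro compact_uniformly_continuous continuous_on_subset[OF test_continuous[OF p]]) auto
  show ?thesis
  proof (rule tendstoI)
    fix e :: real assume e: "e > 0"
    obtain d where d: "d > 0" "\<And>x y. x \<in> cball 0 (R + 2) \<Longrightarrow> y \<in> cball 0 (R + 2) \<Longrightarrow> dist y x < d \<Longrightarrow> dist (\<phi> y) (\<phi> x) < e / K"
      using uc e K unfolding uniformly_continuous_on_def by (metis divide_pos_pos)
    have "nrm (\<lambda>x. \<phi> (x + h) - \<phi> x) < e" if h: "norm h < min d 1" for h
    proof -
      have pt: "\<bar>\<phi> (x + h) - \<phi> x\<bar> \<le> \<bar>(e / K) * ?I x\<bar>" for x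
      proof (cases "norm x \<le> R + 1")
        case True
        have "norm (x + h) \<le> R + 2" using norm_triangle_ineq[of x h] True h by simp
        then have "\<bar>\<phi> (x + h) - \<phi> x\<bar> < e / K" using d(2)[of x "x + h"] True h by (simp add: dist_norm norm_minus_commute add.commute[of h x])
        then show ?thesis using True e K by simp
      next
        case False
        have "norm x \<le> norm (x + h) + norm h" using norm_triangle_ineq4[of "x + h" h] by simp
        then have "norm (x + h) > R" using False h by simp
        then show ?thesis using False R by simp
      qed
      have IL: "(\<lambda>x. (e / K) * ?I x) \<in> L2" by (intro L2_cmult indicator_cball_L2)
      have "nrm (\<lambda>x. \<phi> (x + h) - \<phi> x) \<le> nrm (\<lambda>x. (e / K) * ?I x)"
        by (rule nrm_mono[OF IL L2_meas[OF L2_diff[OF tr_L2 ]] AE_I2[OF pt]]) (intro test_L2 p)+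
      also have "\<dots> = (e / K) * nrm ?I" using e K by (simp only: nrm_cmult) simp
      also have "\<dots> < (e / K) * K" unfolding K_def using e K by (intro mult_strict_left_mono) (auto simp: K_def)
      finally show ?thesis using K by simp
    qed
    then have "\<forall>h. norm h < min d 1 \<longrightarrow> nrm (\<lambda>x. \<phi> (x + h) - \<phi> x) < e" by blast
    then show "\<forall>\<^sub>F h in at 0. dist (nrm (\<lambda>x. \<phi> (x + h) - \<phi> x)) 0 < e"
      unfolding eventually_at using d(1) by (intro exI[of _ "min d 1"]) auto
  qed
qed

text \<open>Translations are isometries, so density reduces the claim to test functions, where
  uniform continuity on a compact set applies.\<close>

lemma tr_continuous:
  assumes f: "f \<in> L2"
  shows "((\<lambda>h. nrm (\<lambda>x. f (x + h) - f x)) \<longlongrightarrow> 0) (at 0)"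
proof (rule tendstoI)
  fix e :: real assume e: "e > 0"
  obtain \<phi> where p: "\<phi> \<in> test_functions" "nrm (\<lambda>x. f x - \<phi> x) < e / 3"
    by (rule test_dense[OF f, of "e/3"]) (use e in auto)
  have pL: "\<phi> \<in> L2" by (rule test_L2[OF p(1)])
  have "\<forall>\<^sub>F h in at 0. dist (nrm (\<lambda>x. \<phi> (x + h) - \<phi> x)) 0 < e / 3"
    by (rule tendstoD[OF test_tr_continuous[OF p(1)]]) (use e in simp)
  then show "\<forall>\<^sub>F h in at 0. dist (nrm (\<lambda>x. f (x + h) - f x)) 0 < e"
  proof eventually_elim
    case (elim h)
    have "nrm (\<lambda>x. f (x + h) - f x) \<le> nrm (\<lambda>x. f (x + h) - \<phi> (x + h)) + nrm (\<lambda>x. \<phi> (x + h) - f x)"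
      by (intro nrm_triangle3 tr_L2 f pL)
    also have "nrm (\<lambda>x. \<phi> (x + h) - f x) \<le> nrm (\<lambda>x. \<phi> (x + h) - \<phi> x) + nrm (\<lambda>x. \<phi> x - f x)"
      by (intro nrm_triangle3 tr_L2 f pL)
    also have "nrm (\<lambda>x. f (x + h) - \<phi> (x + h)) = nrm (\<lambda>x. f x - \<phi> x)"
      using tr_nrm[OF L2_diff[OF f pL]] by simp
    finally show ?case using p(2) elim nrm_minus_commute[of f \<phi>] by simp
  qed
qed

text \<open>The mean value theorem bounds all difference quotients by b, and dominated convergence
  is applied along an arbitrary null sequence.\<close>

lemma DERIV_integral:
  fixes k k' :: "real \<Rightarrow> 'a \<Rightarrow> real"
  assumes d: "d > 0"
    and der: "\<And>s x. \<bar>s - s0\<bar> < d \<Longrightarrow> x \<in> space M \<Longrightarrow> ((\<lambda>s. k s x) has_real_derivative k' s x) (at s)"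
    and bd: "\<And>s x. \<bar>s - s0\<bar> < d \<Longrightarrow> x \<in> space M \<Longrightarrow> \<bar>k' s x\<bar> \<le> b x"
    and b: "integrable M b" and k: "\<And>s. \<bar>s - s0\<bar> < d \<Longrightarrow> integrable M (k s)"
    and m: "k' s0 \<in> borel_measurable M"
  shows "((\<lambda>s. LINT x|M. k s x) has_real_derivative (LINT x|M. k' s0 x)) (at s0)"
  unfolding DERIV_def
proof (subst tendsto_at_iff_sequentially, intro allI impI)
  fix X :: "nat \<Rightarrow> real" assume X: "\<forall>i. X i \<in> UNIV - {0}" "X \<longlonglongrightarrow> 0"
  obtain N where N: "\<And>n. n \<ge> N \<Longrightarrow> \<bar>X n\<bar> < d" using LIMSEQ_D[OF X(2) d] by auto
  have X0: "X n \<noteq> 0" for n using X(1) by auto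
  define q where "q n x = (k (s0 + X (n + N)) x - k s0 x) / X (n + N)" for n x
  have "(\<lambda>n. LINT x|M. q n x) \<longlonglongrightarrow> (LINT x|M. k' s0 x)"
  proof (rule integral_dominated_convergence[where w = b])
    show "k' s0 \<in> borel_measurable M" by (rule m)
    show "q n \<in> borel_measurable M" for n
      unfolding q_def[abs_def] using k[of s0] k[of "s0 + X (n + N)"] N[of "n + N"] d by simp
    show "integrable M b" by (rule b)
    show "AE x in M. (\<lambda>n. q n x) \<longlonglongrightarrow> k' s0 x"
    proof (rule AE_I2)
      fix x assume x: "x \<in> space M"
      have "((\<lambda>h. (k (s0 + h) x - k s0 x) / h) \<longlongrightarrow> k' s0 x) (at 0)"
        using der[of s0 x] d x by (simp add: DERIV_def)
      then have "((\<lambda>h. (k (s0 + h) x - k s0 x) / h) \<circ> X) \<longlonglongrightarrow> k' s0 x"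
        using X unfolding tendsto_at_iff_sequentially by blast
      from LIMSEQ_ignore_initial_segment[OF this, of N] show "(\<lambda>n. q n x) \<longlonglongrightarrow> k' s0 x"
        unfolding q_def by (simp add: o_def)
    qed
    show "AE x in M. norm (q n x) \<le> b x" for n
    proof (rule AE_I2)
      fix x assume x: "x \<in> space M"
      define h where "h = X (n + N)"
      have h: "h \<noteq> 0" "\<bar>h\<bar> < d" unfolding h_def using X0 N by auto
      obtain z where z: "\<bar>z - s0\<bar> < d" "k (s0 + h) x - k s0 x = h * k' z x"
      proof (cases "h > 0")
        case True
        have "\<exists>z. s0 < z \<and> z < s0 + h \<and> k (s0 + h) x - k s0 x = (s0 + h - s0) * k' z x"
          by (rule MVT2) (use True h der x in auto)
        then obtain z where "s0 < z" "z < s0 + h" "k (s0 + h) x - k s0 x = (s0 + h - s0) * k' z x" by blast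
        then show ?thesis using that[of z] True h by auto
      next
        case False
        have "\<exists>z. s0 + h < z \<and> z < s0 \<and> k s0 x - k (s0 + h) x = (s0 - (s0 + h)) * k' z x"
          by (rule MVT2) (use False h der x in auto)
        then obtain z where "s0 + h < z" "z < s0" "k s0 x - k (s0 + h) x = (s0 - (s0 + h)) * k' z x" by blast
        then show ?thesis using that[of z] False h by (auto simp: algebra_simps)
      qed
      then show "norm (q n x) \<le> b x"
        unfolding q_def h_def[symmetric] using h bd[OF z(1) x] by simp
    qed
  qed
  moreover have "(LINT x|M. q n x) = ((\<lambda>h. ((LINT x|M. k (s0 + h) x) - (LINT x|M. k s0 x)) / h) \<circ> X) (n + N)" for n
    unfolding q_def o_def using k[of s0] k[of "s0 + X (n + N)"] N[of "n + N"] d by simp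
  ultimately have "(\<lambda>n. ((\<lambda>h. ((LINT x|M. k (s0 + h) x) - (LINT x|M. k s0 x)) / h) \<circ> X) (n + N)) \<longlonglongrightarrow> (LINT x|M. k' s0 x)"
    by simp
  then show "((\<lambda>h. ((LINT x|M. k (s0 + h) x) - (LINT x|M. k s0 x)) / h) \<circ> X) \<longlonglongrightarrow> (LINT x|M. k' s0 x)"
    by (rule LIMSEQ_offset)
qed

section \<open>Difference quotients\<close>

text \<open>At \<open>h = 0\<close> division by zero yields the zero function, so norm bounds can be
  stated for every h.\<close>

definition dq :: "'n \<Rightarrow> real \<Rightarrow> (real ^ 'n \<Rightarrow> real) \<Rightarrow> real ^ 'n \<Rightarrow> real" where
  "dq i h f x = (f (x + axis i h) - f x) / h"

lemma axis_scale: "axis i h = h *\<^sub>R (axis i 1 :: real ^ 'n)"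
  by (simp add: vec_eq_iff axis_def)

lemma norm_axis_real [simp]: "norm (axis i h :: real ^ 'n) = \<bar>h\<bar>"
  by (simp add: axis_scale[of i h])

lemma axis_zero [simp]: "axis i 0 = (0 :: real ^ 'n)"
  by (simp add: vec_eq_iff axis_def)

lemma axis_uminus: "axis i (- h) = - (axis i h :: real ^ 'n)"
  by (simp add: vec_eq_iff axis_def)

lemma axis_tendsto: "filterlim (\<lambda>h. axis i h :: real ^ 'n) (at 0) (at 0)"
proof -
  have "((\<lambda>h. h *\<^sub>R (axis i 1 :: real ^ 'n)) \<longlongrightarrow> 0 *\<^sub>R axis i 1) (at 0)" by (intro tendsto_intros)
  then have "((\<lambda>h. axis i h :: real ^ 'n) \<longlongrightarrow> 0) (at 0)" unfolding axis_scale[symmetric] axis_zero .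
  then show ?thesis
    unfolding filterlim_at by (auto simp: eventually_at_filter axis_eq_0_iff)
qed

lemma dq_L2: "f \<in> L2 \<Longrightarrow> dq i h f \<in> L2"
  unfolding dq_def[abs_def] by (intro L2_divide L2_diff tr_L2)

lemma test_line_deriv:
  assumes "\<phi> \<in> test_functions"
  shows "((\<lambda>s. \<phi> (x + axis i (c * s))) has_real_derivative c * partial_deriv i \<phi> (x + axis i (c * s))) (at s)"
proof -
  obtain D where D: "(\<phi> has_derivative D) (at (x + axis i (c * s)))"
    using test_differentiable[OF assms] unfolding differentiable_def by blast
  have "((\<lambda>s. x + (c * s) *\<^sub>R axis i 1) has_derivative (\<lambda>t. (c * t) *\<^sub>R axis i 1)) (at s)"
    by (auto intro!: derivative_eq_intros)
  then have "((\<lambda>s. x + axis i (c * s)) has_derivative (\<lambda>t. axis i (c * t))) (at s)"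
    unfolding axis_scale[symmetric] .
  from has_derivative_compose[OF this D]
  have "((\<lambda>s. \<phi> (x + axis i (c * s))) has_derivative (\<lambda>t. D (axis i (c * t)))) (at s)" .
  moreover have "D (axis i (c * t)) = c * partial_deriv i \<phi> (x + axis i (c * s)) * t" for t
    using linear_scale[OF has_derivative_linear[OF D], of "c * t" "axis i 1"] partial_deriv_eqI[OF D]
    by (simp add: axis_scale[symmetric])
  ultimately show ?thesis by (simp add: has_field_derivative_def)
qed

text \<open>The translation is carried by the smooth factor, so U is never differentiated. A
  multiple of the absolute value of U on a slightly enlarged ball dominates.\<close>

lemma loc_translate_deriv:
  assumes U: "loc_integrable U" and p: "\<phi> \<in> test_functions"
  shows "((\<lambda>s. LINT x|lebesgue. U x * \<phi> (x - axis i s)) has_real_derivative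
    - (LINT x|lebesgue. U x * partial_deriv i \<phi> (x - axis i s))) (at s)"
proof -
  have dp: "partial_deriv i \<phi> \<in> test_functions" by (rule partial_deriv_test[OF p])
  obtain R where R: "\<And>x. norm x > R \<Longrightarrow> partial_deriv i \<phi> x = 0" by (rule test_support[OF dp]) blast
  obtain B where B: "B > 0" "\<And>x. \<bar>partial_deriv i \<phi> x\<bar> \<le> B" by (rule test_bounded[OF dp]) blast
  let ?b = "\<lambda>x. B * \<bar>indicator (cball 0 (R + \<bar>s\<bar> + 1)) x * U x\<bar>"
  have trm: "x - axis i t = 1 *\<^sub>R x + axis i (- t)" for x :: "real ^ 'a" and t by (simp add: axis_uminus)
  have "((\<lambda>s. LINT x|lebesgue. U x * \<phi> (x - axis i s)) has_real_derivative
      (LINT x|lebesgue. U x * (- partial_deriv i \<phi> (x - axis i s)))) (at s)"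
  proof (rule DERIV_integral[where d = 1 and b = ?b])
    show "((\<lambda>s. U x * \<phi> (x - axis i s)) has_real_derivative U x * - partial_deriv i \<phi> (x - axis i t)) (at t)" for t x
      using DERIV_cmult[OF test_line_deriv[OF p, of x i "-1" t], of "U x"] by (simp add: axis_uminus)
    show "\<bar>U x * - partial_deriv i \<phi> (x - axis i t)\<bar> \<le> ?b x" if t: "\<bar>t - s\<bar> < 1" for t x
    proof (cases "norm x \<le> R + \<bar>s\<bar> + 1")
      case True then show ?thesis
        using mult_left_mono[OF B(2), of "\<bar>U x\<bar>"] by (simp add: abs_mult mult.commute)
    next
      case False
      have "norm x \<le> norm (x - axis i t) + \<bar>t\<bar>" using norm_triangle_ineq[of "x - axis i t" "axis i t"] by simp
      then have "norm (x - axis i t) > R" using False t by linarith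
      then show ?thesis using R B by simp
    qed
    show "integrable lebesgue ?b" using U unfolding loc_integrable_def by auto
    show "integrable lebesgue (\<lambda>x. U x * \<phi> (x - axis i t))" for t
      unfolding trm by (intro loc_integrable_test U test_affine p) simp
    have "partial_deriv i \<phi> \<in> borel_measurable lebesgue" by (rule test_meas[OF dp])
    then have "(\<lambda>x. partial_deriv i \<phi> (x - axis i s)) \<in> borel_measurable lebesgue"
      unfolding trm by (rule affine_borel_measurable) simp
    then show "(\<lambda>x. U x * - partial_deriv i \<phi> (x - axis i s)) \<in> borel_measurable lebesgue"
      using U unfolding loc_integrable_def by (intro borel_measurable_times borel_measurable_uminus) auto
  qed simp
  then show ?thesis by simp
qed

lemma test_translate_deriv:
  assumes "U \<in> L2" "\<phi> \<in> test_functions"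
  shows "((\<lambda>s. ip U (\<lambda>x. \<phi> (x - axis i s))) has_real_derivative - ip U (\<lambda>x. partial_deriv i \<phi> (x - axis i s))) (at s)"
  unfolding ip_def by (rule loc_translate_deriv[OF L2_loc_integrable[OF assms(1)] assms(2)])

lemma partial_deriv_tr:
  assumes "\<phi> \<in> test_functions"
  shows "partial_deriv i (\<lambda>x. \<phi> (x + a)) = (\<lambda>x. partial_deriv i \<phi> (x + a))"
  using partial_deriv_affine[of \<phi> i 1 a] test_differentiable[OF assms] by simp

lemma weak_partial_ip: "is_weak_partial i U g \<longleftrightarrow> (\<forall>\<phi>\<in>test_functions. ip U (partial_deriv i \<phi>) = - ip g \<phi>)"
  unfolding is_weak_partial_def ip_def by simp

text \<open>The left pairing is a difference quotient of \<open>F\<close>, the pairing of U with the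
  translated test function. The weak derivative computes the derivative of \<open>F\<close>, and the
  mean value theorem supplies z.\<close>

lemma dq_ip_test:
  assumes U: "U \<in> L2" and g: "g \<in> L2" "is_weak_partial i U g" and p: "\<phi> \<in> test_functions" and h: "h \<noteq> 0"
  obtains z where "\<bar>z\<bar> < \<bar>h\<bar>" "ip (dq i h U) \<phi> = ip (\<lambda>x. g (x + axis i z)) \<phi>"
proof -
  define F where "F s = ip U (\<lambda>x. \<phi> (x - axis i s))" for s
  have pL: "\<phi> \<in> L2" by (rule test_L2[OF p])
  have D: "(F has_real_derivative ip (\<lambda>x. g (x + axis i s)) \<phi>) (at s)" for s
  proof -
    have "ip U (\<lambda>x. partial_deriv i \<phi> (x - axis i s)) = ip U (partial_deriv i (\<lambda>x. \<phi> (x + - axis i s)))"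
      using partial_deriv_tr[OF p, of i "- axis i s"] by simp
    also have "\<dots> = - ip g (\<lambda>x. \<phi> (x + - axis i s))"
      using g(2) test_affine[OF p, of 1 "- axis i s"] unfolding weak_partial_ip by simp
    also have "\<dots> = - ip (\<lambda>x. g (x + axis i s)) \<phi>"
      using tr_ip_adj[OF g(1) pL] by simp
    finally show ?thesis using test_translate_deriv[OF U p, of i s] unfolding F_def by simp
  qed
  have eq: "ip (dq i h U) \<phi> = (F h - F 0) / h"
  proof -
    have "ip (dq i h U) \<phi> = ip (\<lambda>x. (1 / h) * (U (x + axis i h) - U x)) \<phi>"
      unfolding dq_def[abs_def] by simp
    also have "\<dots> = (ip (\<lambda>x. U (x + axis i h)) \<phi> - ip U \<phi>) / h"
      unfolding ip_cmult_left using ip_diff_left[OF tr_L2[OF U] U pL] by simp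
    also have "\<dots> = (F h - F 0) / h"
      unfolding F_def using tr_ip_adj[OF U pL, of "axis i h"] by simp
    finally show ?thesis .
  qed
  show ?thesis
  proof (cases "h > 0")
    case True
    have "\<exists>z. 0 < z \<and> z < h \<and> F h - F 0 = (h - 0) * ip (\<lambda>x. g (x + axis i z)) \<phi>"
      by (rule MVT2) (use True D in auto)
    then obtain z where "0 < z" "z < h" "F h - F 0 = (h - 0) * ip (\<lambda>x. g (x + axis i z)) \<phi>" by blast
    then show ?thesis using that[of z] eq h by auto
  next
    case False
    have "\<exists>z. h < z \<and> z < 0 \<and> F 0 - F h = (0 - h) * ip (\<lambda>x. g (x + axis i z)) \<phi>"
      by (rule MVT2) (use False h D in auto)
    then obtain z where z: "h < z" "z < 0" "F 0 - F h = (0 - h) * ip (\<lambda>x. g (x + axis i z)) \<phi>" by blast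
    then have "F h - F 0 = h * ip (\<lambda>x. g (x + axis i z)) \<phi>" by (simp add: algebra_simps)
    then show ?thesis using that[of z] eq h z by auto
  qed
qed

lemma dq_nrm_le:
  assumes U: "U \<in> L2" and g: "g \<in> L2" "is_weak_partial i U g"
  shows "nrm (dq i h U) \<le> nrm g"
proof (cases "h = 0")
  case True
  then have "dq i h U = (\<lambda>x. 0)" unfolding dq_def by auto
  then show ?thesis by simp
next
  case False
  show ?thesis
  proof (rule nrm_le_test[OF dq_L2[OF U] nrm_nonneg])
    fix \<phi> :: "real ^ 'a \<Rightarrow> real" assume p: "\<phi> \<in> test_functions"
    obtain z where "ip (dq i h U) \<phi> = ip (\<lambda>x. g (x + axis i z)) \<phi>"
      by (rule dq_ip_test[OF U g p False])
    then show "\<bar>ip (dq i h U) \<phi>\<bar> \<le> nrm g * nrm \<phi>"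
      using ip_le_nrm[OF tr_L2[OF g(1)] test_L2[OF p]] tr_nrm[OF g(1)] by metis
  qed
qed

text \<open>The point z of \<open>dq_ip_test\<close> depends on the test function, but its size is
  below that of h. Continuity of translations of g therefore gives a bound uniform in the test
  function, and duality upgrades it to convergence in norm.\<close>

lemma dq_tendsto:
  assumes U: "U \<in> L2" and g: "g \<in> L2" "is_weak_partial i U g"
  shows "((\<lambda>h. nrm (\<lambda>x. dq i h U x - g x)) \<longlongrightarrow> 0) (at 0)"
proof (rule tendstoI)
  fix e :: real assume e: "e > 0"
  have "((\<lambda>h. nrm (\<lambda>x. g (x + axis i h) - g x)) \<longlongrightarrow> 0) (at 0)"
    using filterlim_compose[OF tr_continuous[OF g(1)] axis_tendsto] .
  then have "\<forall>\<^sub>F h in at 0. dist (nrm (\<lambda>x. g (x + axis i h) - g x)) 0 < e / 2"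
    by (rule tendstoD) (use e in simp)
  then obtain d where d: "d > 0" "\<And>h. h \<noteq> 0 \<Longrightarrow> \<bar>h\<bar> < d \<Longrightarrow> nrm (\<lambda>x. g (x + axis i h) - g x) < e / 2"
    unfolding eventually_at by auto
  have d': "nrm (\<lambda>x. g (x + axis i h) - g x) \<le> e / 2" if "\<bar>h\<bar> < d" for h
    using d(2)[of h] that e by (cases "h = 0") (auto simp: less_imp_le)
  have "nrm (\<lambda>x. dq i h U x - g x) \<le> e / 2" if h: "h \<noteq> 0" "\<bar>h\<bar> < d" for h
  proof (rule nrm_le_test)
    show "(\<lambda>x. dq i h U x - g x) \<in> L2" by (intro L2_diff dq_L2 U g)
    show "0 \<le> e / 2" using e by simp
    fix \<phi> :: "real ^ 'a \<Rightarrow> real" assume p: "\<phi> \<in> test_functions"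
    have pL: "\<phi> \<in> L2" by (rule test_L2[OF p])
    obtain z where z: "\<bar>z\<bar> < \<bar>h\<bar>" "ip (dq i h U) \<phi> = ip (\<lambda>x. g (x + axis i z)) \<phi>"
      by (rule dq_ip_test[OF U g p h(1)])
    have "ip (\<lambda>x. dq i h U x - g x) \<phi> = ip (\<lambda>x. g (x + axis i z) - g x) \<phi>"
      using ip_diff_left[OF dq_L2[OF U] g(1) pL] ip_diff_left[OF tr_L2[OF g(1)] g(1) pL] z(2) by metis
    also have "\<bar>\<dots>\<bar> \<le> nrm (\<lambda>x. g (x + axis i z) - g x) * nrm \<phi>"
      by (rule ip_le_nrm[OF L2_diff[OF tr_L2[OF g(1)] g(1)] pL])
    also have "\<dots> \<le> e / 2 * nrm \<phi>" using d'[of z] z(1) h by (intro mult_right_mono) auto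
    finally show "\<bar>ip (\<lambda>x. dq i h U x - g x) \<phi>\<bar> \<le> e / 2 * nrm \<phi>" .
  qed
  then show "\<forall>\<^sub>F h in at 0. dist (nrm (\<lambda>x. dq i h U x - g x)) 0 < e"
    unfolding eventually_at using d(1) e by (intro exI[of _ d]) fastforce
qed

text \<open>A weak limit of the quotients along a null sequence is a weak derivative: on test
  functions the quotient can be moved to the smooth factor, where it converges.\<close>

lemma dq_bounded_imp_weak_partial:
  assumes U: "U \<in> L2" and b: "\<And>h. h \<noteq> 0 \<Longrightarrow> nrm (dq i h U) \<le> C"
  obtains g where "g \<in> L2" "is_weak_partial i U g"
proof -
  define h where "h n = inverse (real (Suc n))" for n
  have h: "h n \<noteq> 0" for n unfolding h_def by simp
  have hlim: "filterlim h (at 0) sequentially"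
    unfolding h_def filterlim_at using LIMSEQ_inverse_real_of_nat by auto
  obtain w where w: "w \<in> L2" "\<And>g l. g \<in> L2 \<Longrightarrow> (\<lambda>n. ip (dq i (h n) U) g) \<longlonglongrightarrow> l \<Longrightarrow> ip w g = l"
    by (rule L2_weak_limit[of "\<lambda>n. dq i (h n) U" C]) (use dq_L2[OF U] b h in auto)
  have "is_weak_partial i U w"
    unfolding weak_partial_ip
  proof
    fix \<phi> :: "real ^ 'a \<Rightarrow> real" assume p: "\<phi> \<in> test_functions"
    have pL: "\<phi> \<in> L2" by (rule test_L2[OF p])
    define F where "F s = ip U (\<lambda>x. \<phi> (x - axis i s))" for s
    have "(F has_real_derivative - ip U (partial_deriv i \<phi>)) (at 0)"
      using test_translate_deriv[OF U p, of i 0] unfolding F_def by simp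
    then have "((\<lambda>s. (F s - F 0) / s) \<longlongrightarrow> - ip U (partial_deriv i \<phi>)) (at 0)" by (simp add: DERIV_def)
    from filterlim_compose[OF this hlim]
    have "(\<lambda>n. (F (h n) - F 0) / h n) \<longlonglongrightarrow> - ip U (partial_deriv i \<phi>)" .
    moreover have "ip (dq i t U) \<phi> = (F t - F 0) / t" for t
    proof -
      have "ip (dq i t U) \<phi> = ip (\<lambda>x. (1 / t) * (U (x + axis i t) - U x)) \<phi>"
        unfolding dq_def[abs_def] by simp
      also have "\<dots> = (ip (\<lambda>x. U (x + axis i t)) \<phi> - ip U \<phi>) / t"
        unfolding ip_cmult_left using ip_diff_left[OF tr_L2[OF U] U pL] by simp
      also have "\<dots> = (F t - F 0) / t"
        unfolding F_def using tr_ip_adj[OF U pL, of "axis i t"] by simp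
      finally show ?thesis .
    qed
    ultimately have "ip w \<phi> = - ip U (partial_deriv i \<phi>)" using w(2)[OF pL] by simp
    then show "ip U (partial_deriv i \<phi>) = - ip w \<phi>" by simp
  qed
  then show ?thesis using that w(1) by blast
qed

section \<open>The Sobolev space\<close>

text \<open>The Dirichlet form, written by coordinates so that it reduces to \<open>ip\<close>;
  \<open>weak_grad_inner_integral\<close> identifies it with the integral of the inner product of
  the gradients.\<close>

definition grip :: "(real ^ 'n \<Rightarrow> real) \<Rightarrow> (real ^ 'n \<Rightarrow> real) \<Rightarrow> real" where
  "grip U \<phi> = (\<Sum>i\<in>UNIV. ip (weak_partial i U) (weak_partial i \<phi>))"

definition gr :: "(real ^ 'n \<Rightarrow> real) \<Rightarrow> real" where
  "gr U = grip U U"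

lemma H1_L2: "U \<in> H1 \<Longrightarrow> U \<in> L2"
  by (simp add: H1_def)

lemma H1_meas: "U \<in> H1 \<Longrightarrow> U \<in> borel_measurable lebesgue"
  by (intro L2_meas H1_L2)

lemma weak_partial_props:
  assumes "g \<in> L2" "is_weak_partial i U g"
  shows "weak_partial i U \<in> L2" "is_weak_partial i U (weak_partial i U)"
proof -
  have "\<exists>g. g \<in> Lp_space 2 \<and> is_weak_partial i U g" using assms by blast
  from someI_ex[OF this] show "weak_partial i U \<in> L2" "is_weak_partial i U (weak_partial i U)"
    unfolding weak_partial_def by auto
qed

lemma wp_L2: "U \<in> H1 \<Longrightarrow> weak_partial i U \<in> L2"
  unfolding H1_def using weak_partial_props(1) by blast

lemma wp_is: "U \<in> H1 \<Longrightarrow> is_weak_partial i U (weak_partial i U)"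
  unfolding H1_def using weak_partial_props(2) by blast

lemma wp_unique:
  assumes g: "g \<in> L2" "is_weak_partial i U g"
  shows "AE x in lebesgue. weak_partial i U x = g x"
proof -
  note w = weak_partial_props[OF g]
  have "AE x in lebesgue. weak_partial i U x - g x = 0"
  proof (rule L2_orth_test)
    show "(\<lambda>x. weak_partial i U x - g x) \<in> L2" by (intro L2_diff w g)
    fix \<phi> :: "real ^ 'a \<Rightarrow> real" assume p: "\<phi> \<in> test_functions"
    then show "ip (\<lambda>x. weak_partial i U x - g x) \<phi> = 0"
      using w(2) g(2) ip_diff_left[OF w(1) g(1) test_L2[OF p]] unfolding weak_partial_ip by simp
  qed
  then show ?thesis by simp
qed

lemma wp_ip:
  assumes g: "g \<in> L2" "is_weak_partial i U g" and f: "f \<in> L2"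
  shows "ip (weak_partial i U) f = ip g f"
  using wp_unique[OF g] weak_partial_props(1)[OF g] g f
  by (intro ip_cong_AE) (auto dest: L2_meas)

lemma is_weak_partial_add:
  assumes "U \<in> L2" "V \<in> L2" "g \<in> L2" "h \<in> L2" "is_weak_partial i U g" "is_weak_partial i V h"
  shows "is_weak_partial i (\<lambda>x. U x + V x) (\<lambda>x. g x + h x)"
  unfolding weak_partial_ip
proof
  fix \<phi> :: "real ^ 'a \<Rightarrow> real" assume p: "\<phi> \<in> test_functions"
  show "ip (\<lambda>x. U x + V x) (partial_deriv i \<phi>) = - ip (\<lambda>x. g x + h x) \<phi>"
    using assms(5,6) p ip_add_left[OF assms(1,2) test_L2[OF partial_deriv_test[OF p]]]
      ip_add_left[OF assms(3,4) test_L2[OF p]] unfolding weak_partial_ip by simp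
qed

lemma is_weak_partial_cmult:
  assumes "is_weak_partial i U g"
  shows "is_weak_partial i (\<lambda>x. c * U x) (\<lambda>x. c * g x)"
  using assms unfolding weak_partial_ip ip_cmult_left by simp

lemma H1I: "U \<in> L2 \<Longrightarrow> (\<And>i. g i \<in> L2) \<Longrightarrow> (\<And>i. is_weak_partial i U (g i)) \<Longrightarrow> U \<in> H1"
  unfolding H1_def by blast

lemma H1_add:
  assumes "U \<in> H1" "V \<in> H1"
  shows "(\<lambda>x. U x + V x) \<in> H1"
  by (rule H1I[of _ "\<lambda>i x. weak_partial i U x + weak_partial i V x"])
     (use assms in \<open>auto intro: H1_L2 wp_L2 wp_is is_weak_partial_add\<close>)

lemma H1_cmult: "U \<in> H1 \<Longrightarrow> (\<lambda>x. c * U x) \<in> H1"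
  by (rule H1I[of _ "\<lambda>i x. c * weak_partial i U x"])
     (auto intro: H1_L2 wp_L2 wp_is is_weak_partial_cmult)

lemma H1_diff: "U \<in> H1 \<Longrightarrow> V \<in> H1 \<Longrightarrow> (\<lambda>x. U x - V x) \<in> H1"
  using H1_add[OF _ H1_cmult[of V "-1"], of U] by simp

lemma wp_add_ip:
  assumes "U \<in> H1" "V \<in> H1" "f \<in> L2"
  shows "ip (weak_partial i (\<lambda>x. U x + V x)) f = ip (weak_partial i U) f + ip (weak_partial i V) f"
proof -
  have "ip (weak_partial i (\<lambda>x. U x + V x)) f = ip (\<lambda>x. weak_partial i U x + weak_partial i V x) f"
    by (intro wp_ip L2_add is_weak_partial_add wp_L2 wp_is H1_L2 assms)
  also have "\<dots> = ip (weak_partial i U) f + ip (weak_partial i V) f"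
    by (intro ip_add_left wp_L2 assms)
  finally show ?thesis .
qed

lemma wp_cmult_ip:
  assumes "U \<in> H1" "f \<in> L2"
  shows "ip (weak_partial i (\<lambda>x. c * U x)) f = c * ip (weak_partial i U) f"
proof -
  have "ip (weak_partial i (\<lambda>x. c * U x)) f = ip (\<lambda>x. c * weak_partial i U x) f"
    by (intro wp_ip L2_cmult is_weak_partial_cmult wp_L2 wp_is assms)
  then show ?thesis by (simp add: ip_cmult_left)
qed

lemma grip_commute: "grip U \<phi> = grip \<phi> U"
  unfolding grip_def by (simp add: ip_commute)

lemma grip_add_left: "U \<in> H1 \<Longrightarrow> V \<in> H1 \<Longrightarrow> W \<in> H1 \<Longrightarrow> grip (\<lambda>x. U x + V x) W = grip U W + grip V W"
  unfolding grip_def by (simp add: wp_add_ip wp_L2 sum.distrib)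

lemma grip_cmult_left: "U \<in> H1 \<Longrightarrow> W \<in> H1 \<Longrightarrow> grip (\<lambda>x. c * U x) W = c * grip U W"
  unfolding grip_def by (simp add: wp_cmult_ip wp_L2 sum_distrib_left)

lemma grip_diff_left: "U \<in> H1 \<Longrightarrow> V \<in> H1 \<Longrightarrow> W \<in> H1 \<Longrightarrow> grip (\<lambda>x. U x - V x) W = grip U W - grip V W"
  using grip_add_left[of U "\<lambda>x. (-1) * V x" W] grip_cmult_left[of V W "-1"] H1_cmult[of V "-1"] by simp

lemma grip_add_right: "U \<in> H1 \<Longrightarrow> V \<in> H1 \<Longrightarrow> W \<in> H1 \<Longrightarrow> grip W (\<lambda>x. U x + V x) = grip W U + grip W V"
  using grip_add_left[of U V W] by (simp add: grip_commute[of W])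

lemma grip_cmult_right: "U \<in> H1 \<Longrightarrow> W \<in> H1 \<Longrightarrow> grip W (\<lambda>x. c * U x) = c * grip W U"
  using grip_cmult_left[of U W c] by (simp add: grip_commute[of W])

lemma grip_diff_right: "U \<in> H1 \<Longrightarrow> V \<in> H1 \<Longrightarrow> W \<in> H1 \<Longrightarrow> grip W (\<lambda>x. U x - V x) = grip W U - grip W V"
  using grip_diff_left[of U V W] by (simp add: grip_commute[of W])

section \<open>The Dirichlet form as a positive semidefinite quadratic form\<close>

lemma gr_eq_nrm: "gr U = (\<Sum>i\<in>UNIV. (nrm (weak_partial i U))\<^sup>2)"
  unfolding gr_def grip_def by (simp add: nrm_sq)

lemma gr_nonneg [simp]: "0 \<le> gr U"
  unfolding gr_eq_nrm by (intro sum_nonneg) simp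

lemma gr_add: "U \<in> H1 \<Longrightarrow> V \<in> H1 \<Longrightarrow> gr (\<lambda>x. U x + V x) = gr U + 2 * grip U V + gr V"
  unfolding gr_def by (simp add: grip_add_left grip_add_right H1_add grip_commute[of V U])

lemma gr_diff: "U \<in> H1 \<Longrightarrow> V \<in> H1 \<Longrightarrow> gr (\<lambda>x. U x - V x) = gr U - 2 * grip U V + gr V"
  unfolding gr_def by (simp add: grip_diff_left grip_diff_right H1_diff grip_commute[of V U])

lemma gr_cmult: "U \<in> H1 \<Longrightarrow> gr (\<lambda>x. c * U x) = c\<^sup>2 * gr U"
  unfolding gr_def by (simp add: grip_cmult_left grip_cmult_right H1_cmult power2_eq_square)

lemma gr_unique:
  assumes "\<And>i. g i \<in> L2" "\<And>i. is_weak_partial i U (g i)"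
  shows "gr U = (\<Sum>i\<in>UNIV. (nrm (g i))\<^sup>2)"
  unfolding gr_eq_nrm
  using nrm_cong_AE[OF wp_unique[OF assms] L2_meas[OF weak_partial_props(1)[OF assms]] L2_meas[OF assms(1)]]
  by simp

lemma grip_le:
  assumes "U \<in> H1" "V \<in> H1"
  shows "\<bar>grip U V\<bar> \<le> sqrt (gr U) * sqrt (gr V)"
proof -
  have *: "2 * s * t * grip U V \<le> s\<^sup>2 * gr U + t\<^sup>2 * gr V" for s t
  proof -
    have "0 \<le> gr (\<lambda>x. s * U x - t * V x)" by simp
    also have "\<dots> = s\<^sup>2 * gr U - 2 * (s * (t * grip U V)) + t\<^sup>2 * gr V"
      using assms by (simp add: gr_diff H1_cmult gr_cmult grip_cmult_left grip_cmult_right)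
    finally show ?thesis by (simp add: mult.assoc)
  qed
  have discr: "(grip U V)\<^sup>2 \<le> gr U * gr V"
  proof (cases "gr V = 0")
    case True
    have "grip U V = 0"
    proof (rule ccontr)
      assume nz: "grip U V \<noteq> 0"
      \<comment> \<open>With \<open>gr V = 0\<close> the form is affine in t; this t makes the left
        side \<open>gr U + 1\<close>, exceeding the right side \<open>gr U\<close>.\<close>
      show False using *[of 1 "(gr U + 1) / (2 * grip U V)"] True nz by simp
    qed
    then show ?thesis using True by simp
  next
    case False
    then have p: "gr V > 0" using gr_nonneg[of V] by linarith
    have "2 * (grip U V)\<^sup>2 / gr V \<le> gr U + (grip U V)\<^sup>2 / gr V"
      using *[of 1 "grip U V / gr V"] p by (simp add: power2_eq_square field_simps)
    then have "(grip U V)\<^sup>2 / gr V \<le> gr U" by simp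
    then show ?thesis using p by (simp add: field_simps)
  qed
  have "\<bar>grip U V\<bar> = sqrt ((grip U V)\<^sup>2)" by simp
  also have "\<dots> \<le> sqrt (gr U * gr V)" using discr by (rule real_sqrt_le_mono)
  finally show ?thesis by (simp add: real_sqrt_mult)
qed

lemma gr_triangle:
  assumes "U \<in> H1" "V \<in> H1"
  shows "sqrt (gr (\<lambda>x. U x + V x)) \<le> sqrt (gr U) + sqrt (gr V)"
proof (rule real_le_lsqrt)
  show "0 \<le> sqrt (gr U) + sqrt (gr V)" by simp
  show "gr (\<lambda>x. U x + V x) \<le> (sqrt (gr U) + sqrt (gr V))\<^sup>2"
    using grip_le[OF assms] by (simp add: gr_add[OF assms] power2_sum abs_le_iff)
qed

lemma
  assumes "U \<in> H1" "V \<in> H1"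
  shows weak_grad_inner_integrable: "integrable lebesgue (\<lambda>x. weak_grad U x \<bullet> weak_grad V x)"
    and weak_grad_inner_integral: "(LINT x|lebesgue. weak_grad U x \<bullet> weak_grad V x) = grip U V"
proof -
  have eq: "weak_grad U x \<bullet> weak_grad V x = (\<Sum>i\<in>UNIV. weak_partial i U x * weak_partial i V x)" for x
    unfolding weak_grad_def inner_vec_def by simp
  have i: "integrable lebesgue (\<lambda>x. weak_partial i U x * weak_partial i V x)" for i
    by (intro L2_mult_integrable wp_L2 assms)
  show "integrable lebesgue (\<lambda>x. weak_grad U x \<bullet> weak_grad V x)" unfolding eq using i by simp
  show "(LINT x|lebesgue. weak_grad U x \<bullet> weak_grad V x) = grip U V"
    unfolding eq grip_def ip_def using i by (intro Bochner_Integration.integral_sum) auto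
qed

lemma
  assumes "U \<in> H1"
  shows weak_grad_integrable: "integrable lebesgue (\<lambda>x. (norm (weak_grad U x))\<^sup>2)"
    and weak_grad_integral: "(LINT x|lebesgue. (norm (weak_grad U x))\<^sup>2) = gr U"
  unfolding power2_norm_eq_inner gr_def
  by (rule weak_grad_inner_integrable[OF assms assms], rule weak_grad_inner_integral[OF assms assms])

text \<open>This exhibits the Dirichlet integral as a limit of integrals of finite differences, so
  pointwise inequalities between increments become inequalities between Dirichlet integrals.\<close>

lemma gr_dq_tendsto:
  assumes U: "U \<in> H1"
  shows "((\<lambda>h. \<Sum>i\<in>UNIV. (nrm (dq i h U))\<^sup>2) \<longlongrightarrow> gr U) (at 0)"
  unfolding gr_eq_nrm
  by (intro tendsto_sum tendsto_power tendsto_nrm dq_tendsto dq_L2 wp_L2 wp_is H1_L2 U)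

lemma H1_dq:
  assumes U: "U \<in> L2" and b: "\<And>i h. h \<noteq> 0 \<Longrightarrow> nrm (dq i h U) \<le> C i"
  shows "U \<in> H1"
  unfolding H1_def using U dq_bounded_imp_weak_partial[OF U b] by blast

section \<open>Lipschitz compositions and increments\<close>

lemma lipschitz_meas:
  fixes T :: "real \<Rightarrow> real"
  assumes T: "\<And>a b. \<bar>T a - T b\<bar> \<le> L * \<bar>a - b\<bar>"
  shows "T \<in> borel_measurable borel"
proof -
  have "continuous_on UNIV T"
  proof (rule continuous_at_imp_continuous_on, rule ballI)
    fix x
    have "((\<lambda>y. T y - T x) \<longlongrightarrow> 0) (at x)"
    proof (rule Lim_null_comparison)
      show "\<forall>\<^sub>F y in at x. norm (T y - T x) \<le> L * \<bar>y - x\<bar>" using T by simp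
      have "((\<lambda>y. L * \<bar>y - x\<bar>) \<longlongrightarrow> L * \<bar>x - x\<bar>) (at x)" by (intro tendsto_intros)
      then show "((\<lambda>y. L * \<bar>y - x\<bar>) \<longlongrightarrow> 0) (at x)" by simp
    qed
    then show "isCont T x" unfolding isCont_def by (rule LIM_zero_cancel)
  qed
  then show ?thesis by (rule borel_measurable_continuous_onI)
qed

lemma lipschitz_comp_L2:
  assumes U: "U \<in> L2" and T: "\<And>a b. \<bar>T a - T b\<bar> \<le> L * \<bar>a - b\<bar>" "T 0 = 0"
  shows "(\<lambda>x. T (U x)) \<in> L2"
proof (rule L2_bound[of "\<lambda>x. L * U x"])
  show "(\<lambda>x. L * U x) \<in> L2" using U by (rule L2_cmult)
  show "(\<lambda>x. T (U x)) \<in> borel_measurable lebesgue"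
    using measurable_compose[OF L2_meas[OF U] lipschitz_meas[OF T(1)]] .
  show "AE x in lebesgue. \<bar>T (U x)\<bar> \<le> \<bar>L * U x\<bar>"
  proof (rule AE_I2)
    fix x
    have "\<bar>T (U x)\<bar> \<le> L * \<bar>U x\<bar>" using T(1)[of "U x" 0] T(2) by simp
    also have "\<dots> \<le> \<bar>L\<bar> * \<bar>U x\<bar>" by (intro mult_right_mono) auto
    finally show "\<bar>T (U x)\<bar> \<le> \<bar>L * U x\<bar>" by (simp add: abs_mult)
  qed
qed

text \<open>Difference quotients of the composition are at most L times those of U, so no
  differentiability of T enters.\<close>

lemma lipschitz_comp_H1:
  assumes U: "U \<in> H1" and T: "\<And>a b. \<bar>T a - T b\<bar> \<le> L * \<bar>a - b\<bar>" "T 0 = 0"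
  shows "(\<lambda>x. T (U x)) \<in> H1"
proof (rule H1_dq)
  show TL: "(\<lambda>x. T (U x)) \<in> L2" by (rule lipschitz_comp_L2[OF H1_L2[OF U] T])
  fix i and h :: real assume "h \<noteq> 0"
  have "nrm (dq i h (\<lambda>x. T (U x))) \<le> nrm (\<lambda>x. L * dq i h U x)"
  proof (rule nrm_mono)
    show "(\<lambda>x. L * dq i h U x) \<in> L2" by (intro L2_cmult dq_L2 H1_L2 U)
    show "dq i h (\<lambda>x. T (U x)) \<in> borel_measurable lebesgue" by (intro L2_meas dq_L2 TL)
    show "AE x in lebesgue. \<bar>dq i h (\<lambda>x. T (U x)) x\<bar> \<le> \<bar>L * dq i h U x\<bar>"
    proof (rule AE_I2)
      fix x
      have "\<bar>T (U (x + axis i h)) - T (U x)\<bar> \<le> L * \<bar>U (x + axis i h) - U x\<bar>" by (rule T(1))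
      also have "\<dots> \<le> \<bar>L\<bar> * \<bar>U (x + axis i h) - U x\<bar>" by (intro mult_right_mono) auto
      finally have "\<bar>T (U (x + axis i h)) - T (U x)\<bar> \<le> \<bar>L * (U (x + axis i h) - U x)\<bar>" by (simp add: abs_mult)
      then show "\<bar>dq i h (\<lambda>x. T (U x)) x\<bar> \<le> \<bar>L * dq i h U x\<bar>"
        unfolding dq_def by (simp add: divide_right_mono)
    qed
  qed
  also have "\<dots> = \<bar>L\<bar> * nrm (dq i h U)" by (rule nrm_cmult)
  also have "\<dots> \<le> \<bar>L\<bar> * nrm (weak_partial i U)"
    by (intro mult_left_mono dq_nrm_le H1_L2 wp_L2 wp_is U) auto
  finally show "nrm (dq i h (\<lambda>x. T (U x))) \<le> \<bar>L\<bar> * nrm (weak_partial i U)" .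
qed

text \<open>The pointwise inequality for increments is integrated and passed to the limit h to 0.
  For the dyadic truncations it says that the pieces together cost no more Dirichlet energy than U;
  for a single map it is the usual contraction property.\<close>

lemma gr_lipschitz_sum:
  assumes U: "U \<in> H1" and K: "finite K" and T0: "\<And>k. k \<in> K \<Longrightarrow> T k 0 = 0"
    and T: "\<And>a b. (\<Sum>k\<in>K. (T k a - T k b)\<^sup>2) \<le> (a - b)\<^sup>2"
  shows "(\<Sum>k\<in>K. gr (\<lambda>x. T k (U x))) \<le> gr U"
proof -
  have T1: "\<bar>T k a - T k b\<bar> \<le> 1 * \<bar>a - b\<bar>" if "k \<in> K" for k a b
  proof -
    have "(T k a - T k b)\<^sup>2 \<le> (\<Sum>k\<in>K. (T k a - T k b)\<^sup>2)" using K that by (intro member_le_sum) auto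
    then show ?thesis using T[of a b] abs_le_square_iff[of "T k a - T k b" "a - b"] by simp
  qed
  have TH: "(\<lambda>x. T k (U x)) \<in> H1" if "k \<in> K" for k
    by (rule lipschitz_comp_H1[OF U T1[OF that] T0[OF that]])
  show ?thesis
  proof (rule tendsto_le[OF _ gr_dq_tendsto[OF U]])
    show "((\<lambda>h. \<Sum>k\<in>K. \<Sum>i\<in>UNIV. (nrm (dq i h (\<lambda>x. T k (U x))))\<^sup>2) \<longlongrightarrow> (\<Sum>k\<in>K. gr (\<lambda>x. T k (U x)))) (at 0)"
      by (intro tendsto_sum gr_dq_tendsto TH)
    show "\<forall>\<^sub>F h in at 0. (\<Sum>k\<in>K. \<Sum>i\<in>UNIV. (nrm (dq i h (\<lambda>x. T k (U x))))\<^sup>2) \<le> (\<Sum>i\<in>UNIV. (nrm (dq i h U))\<^sup>2)"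
    proof (intro always_eventually allI)
      fix h :: real
      have "(\<Sum>k\<in>K. (nrm (dq i h (\<lambda>x. T k (U x))))\<^sup>2) \<le> (nrm (dq i h U))\<^sup>2" for i
      proof -
        have i1: "integrable lebesgue (\<lambda>x. (dq i h (\<lambda>x. T k (U x)) x)\<^sup>2)" if "k \<in> K" for k
          using dq_L2[OF H1_L2[OF TH[OF that]]] by (simp add: L2_iff)
        have i2: "integrable lebesgue (\<lambda>x. (dq i h U x)\<^sup>2)"
          using dq_L2[OF H1_L2[OF U]] by (simp add: L2_iff)
        have "(\<Sum>k\<in>K. (nrm (dq i h (\<lambda>x. T k (U x))))\<^sup>2) = (LINT x|lebesgue. (\<Sum>k\<in>K. (dq i h (\<lambda>x. T k (U x)) x)\<^sup>2))"
          unfolding nrm_sq_int using i1 by (intro Bochner_Integration.integral_sum[symmetric]) auto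
        also have "\<dots> \<le> (LINT x|lebesgue. (dq i h U x)\<^sup>2)"
        proof (rule integral_mono)
          show "integrable lebesgue (\<lambda>x. \<Sum>k\<in>K. (dq i h (\<lambda>x. T k (U x)) x)\<^sup>2)" using i1 by auto
          show "integrable lebesgue (\<lambda>x. (dq i h U x)\<^sup>2)" by (rule i2)
          fix x
          show "(\<Sum>k\<in>K. (dq i h (\<lambda>x. T k (U x)) x)\<^sup>2) \<le> (dq i h U x)\<^sup>2"
            using T[of "U (x + axis i h)" "U x"]
            by (simp add: dq_def power_divide sum_divide_distrib[symmetric] divide_right_mono)
        qed
        finally show ?thesis unfolding nrm_sq_int .
      qed
      then have "(\<Sum>i\<in>UNIV. \<Sum>k\<in>K. (nrm (dq i h (\<lambda>x. T k (U x))))\<^sup>2) \<le> (\<Sum>i\<in>UNIV. (nrm (dq i h U))\<^sup>2)"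
        by (intro sum_mono)
      then show "(\<Sum>k\<in>K. \<Sum>i\<in>UNIV. (nrm (dq i h (\<lambda>x. T k (U x))))\<^sup>2) \<le> (\<Sum>i\<in>UNIV. (nrm (dq i h U))\<^sup>2)"
        by (subst sum.swap)
    qed
  qed simp
qed

lemma abs_H1:
  assumes "U \<in> H1"
  shows "(\<lambda>x. \<bar>U x\<bar>) \<in> H1" "gr (\<lambda>x. \<bar>U x\<bar>) \<le> gr U"
proof -
  have *: "\<bar>\<bar>a\<bar> - \<bar>b\<bar>\<bar> \<le> 1 * \<bar>a - b\<bar>" for a b :: real by simp
  show "(\<lambda>x. \<bar>U x\<bar>) \<in> H1" by (rule lipschitz_comp_H1[OF assms *]) simp
  have "(\<bar>a\<bar> - \<bar>b\<bar>)\<^sup>2 \<le> (a - b)\<^sup>2" for a b :: real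
    using * abs_le_square_iff[of "\<bar>a\<bar> - \<bar>b\<bar>" "a - b"] by simp
  then show "gr (\<lambda>x. \<bar>U x\<bar>) \<le> gr U"
    using gr_lipschitz_sum[OF assms, of "{()}" "\<lambda>_ a. \<bar>a\<bar>"] by simp
qed

lemma tr_diff_axis:
  assumes U: "U \<in> H1"
  shows "nrm (\<lambda>x. U (x + axis i h) - U x) \<le> \<bar>h\<bar> * nrm (weak_partial i U)"
proof (cases "h = 0")
  case False
  have "(\<lambda>x. U (x + axis i h) - U x) = (\<lambda>x. h * dq i h U x)" unfolding dq_def using False by simp
  then show ?thesis
    using mult_left_mono[OF dq_nrm_le[OF H1_L2[OF U] wp_L2[OF U] wp_is[OF U]], of "\<bar>h\<bar>"]
    by (simp add: nrm_cmult)
qed simp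

text \<open>The shift by v is performed one coordinate at a time, each stage costing a single
  partial derivative; Cauchy-Schwarz over the coordinates produces the dimension factor.\<close>

lemma tr_diff_le:
  assumes U: "U \<in> H1" and v: "\<And>i. \<bar>v $ i\<bar> \<le> r"
  shows "(nrm (\<lambda>x. U (x + v) - U x))\<^sup>2 \<le> r\<^sup>2 * real CARD('n) * gr (U :: real ^ 'n \<Rightarrow> real)"
proof -
  have UL: "U \<in> L2" by (rule H1_L2[OF U])
  have "nrm (\<lambda>x. U (x + (\<Sum>i\<in>I. axis i (v $ i))) - U x) \<le> (\<Sum>i\<in>I. \<bar>v $ i\<bar> * nrm (weak_partial i U))" for I
  proof (induction I rule: infinite_finite_induct)
    case (insert j I)
    let ?w = "\<Sum>i\<in>I. axis i (v $ i)"
    have "nrm (\<lambda>x. U (x + (axis j (v $ j) + ?w)) - U x)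
        \<le> nrm (\<lambda>x. U (x + (axis j (v $ j) + ?w)) - U (x + ?w)) + nrm (\<lambda>x. U (x + ?w) - U x)"
      by (intro nrm_triangle3 tr_L2 UL)
    also have "nrm (\<lambda>x. U (x + (axis j (v $ j) + ?w)) - U (x + ?w)) = nrm (\<lambda>x. U (x + axis j (v $ j)) - U x)"
      using tr_nrm[OF L2_diff[OF tr_L2[OF UL, of "axis j (v $ j)"] UL], of ?w] by (simp add: ac_simps)
    also have "\<dots> \<le> \<bar>v $ j\<bar> * nrm (weak_partial j U)" by (rule tr_diff_axis[OF U])
    finally show ?case using insert by simp
  qed auto
  from this[of UNIV] have "nrm (\<lambda>x. U (x + v) - U x) \<le> (\<Sum>i\<in>UNIV. \<bar>v $ i\<bar> * nrm (weak_partial i U))"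
  proof -
    have "(\<Sum>i\<in>UNIV. axis i (v $ i)) = v" by (simp add: vec_eq_iff axis_def)
    then show ?thesis using \<open>nrm (\<lambda>x. U (x + (\<Sum>i\<in>UNIV. axis i (v $ i))) - U x) \<le> _\<close> by simp
  qed
  also have "\<dots> \<le> (\<Sum>i\<in>UNIV. r * nrm (weak_partial i U))"
    using v by (intro sum_mono mult_right_mono) auto
  finally have "(nrm (\<lambda>x. U (x + v) - U x))\<^sup>2 \<le> (r * (\<Sum>i\<in>UNIV. nrm (weak_partial i U)))\<^sup>2"
    by (intro power_mono) (simp_all add: sum_distrib_left)
  also have "\<dots> = r\<^sup>2 * (\<Sum>i\<in>UNIV. nrm (weak_partial i U) * 1)\<^sup>2" by (simp add: power_mult_distrib)
  also have "\<dots> \<le> r\<^sup>2 * ((\<Sum>i\<in>UNIV. (nrm (weak_partial i U))\<^sup>2) * (\<Sum>i\<in>(UNIV :: 'n set). 1\<^sup>2))"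
    by (intro mult_left_mono Cauchy_Schwarz_ineq_sum) simp
  finally show ?thesis by (simp add: gr_eq_nrm ac_simps)
qed

section \<open>Averages over cubes\<close>

definition cube :: "real \<Rightarrow> (real ^ 'n) set" where
  "cube r = cbox 0 (\<chi> i. r)"

text \<open>The mean of U over the cube with lower corner x. It is defined at every point and, for
  L2 functions, depends only on the a.e. class of U, so pointwise convergence of averages is
  meaningful.\<close>

definition avg :: "real \<Rightarrow> (real ^ 'n \<Rightarrow> real) \<Rightarrow> real ^ 'n \<Rightarrow> real" where
  "avg r U x = (LINT h|lebesgue. indicator (cube r) h * U (x + h)) / r ^ CARD('n)"

lemma cube_meas [measurable]: "cube r \<in> sets borel" "cube r \<in> sets lebesgue"
  unfolding cube_def by auto

lemma cube_measure:
  assumes "r \<ge> 0"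
  shows "measure lebesgue (cube r :: (real ^ 'n) set) = r ^ CARD('n)" "emeasure lebesgue (cube r :: (real ^ 'n) set) = ennreal (r ^ CARD('n))"
proof -
  have ne: "cbox 0 (\<chi> i. r) \<noteq> ({} :: (real ^ 'n) set)" using assms by (simp add: interval_ne_empty_cart)
  show m: "measure lebesgue (cube r :: (real ^ 'n) set) = r ^ CARD('n)"
    unfolding cube_def using content_cbox_cart[OF ne] by simp
  have "emeasure lebesgue (cube r :: (real ^ 'n) set) \<noteq> \<infinity>"
    unfolding cube_def using emeasure_lborel_cbox_finite[of "0 :: real ^ 'n" "\<chi> i. r"] by simp
  then show "emeasure lebesgue (cube r :: (real ^ 'n) set) = ennreal (r ^ CARD('n))"
    using m by (simp add: emeasure_eq_ennreal_measure)
qed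

lemma cube_L2: "(\<lambda>x :: real ^ 'n. indicator (cube r) x) \<in> L2"
proof -
  have "(indicator (cube r) :: real ^ 'n \<Rightarrow> real) \<in> borel_measurable lebesgue"
    by (intro borel_measurable_indicator cube_meas)
  moreover have "integrable lebesgue (\<lambda>x :: real ^ 'n. (indicator (cube r) x :: real)\<^sup>2)"
  proof -
    have "emeasure lebesgue (cube r :: (real ^ 'n) set) < \<infinity>"
      unfolding cube_def using emeasure_lborel_cbox_finite[of "0 :: real ^ 'n" "\<chi> i. r"] by simp
    then have "integrable lebesgue (\<lambda>x :: real ^ 'n. indicator (cube r) x :: real)"
      by (intro integrable_real_indicator cube_meas)
    moreover have "(indicator (cube r) x)\<^sup>2 = (indicator (cube r) x :: real)" for x :: "real ^ 'n"
      by (auto simp: indicator_def)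
    ultimately show ?thesis by presburger
  qed
  ultimately show ?thesis by (simp only: L2_iff)
qed

lemma cube_nrm: "r \<ge> 0 \<Longrightarrow> (nrm (\<lambda>x :: real ^ 'n. indicator (cube r) x))\<^sup>2 = r ^ CARD('n)"
proof -
  assume r: "r \<ge> 0"
  have "(indicator (cube r) x)\<^sup>2 = (indicator (cube r) x :: real)" for x :: "real ^ 'n"
    by (auto simp: indicator_def)
  then show ?thesis unfolding nrm_sq_int using cube_measure(1)[OF r, where 'n = 'n] by simp
qed

lemma avg_eq_ip: "avg r U x = ip (\<lambda>h. indicator (cube r) h) (\<lambda>h. U (x + h)) / r ^ CARD('n)"
  for U :: "real ^ 'n \<Rightarrow> real"
  unfolding avg_def ip_def ..

lemma tr_L2': "f \<in> L2 \<Longrightarrow> (\<lambda>h. f (x + h)) \<in> L2"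
  using tr_L2[of f x] by (simp add: add.commute)

lemma tr_AE: "AE x in lebesgue. P x \<Longrightarrow> AE x in lebesgue. P (x + a)" for a :: "real ^ 'n"
  using affine_AE[of 1 P a] by simp

lemma tr_AE': "AE x in lebesgue. P x \<Longrightarrow> AE x in lebesgue. P (a + x)" for a :: "real ^ 'n"
  using tr_AE[of P a] by (simp add: add.commute)

lemma avg_cong_AE:
  assumes "AE x in lebesgue. U x = U' x" "U \<in> L2" "U' \<in> L2"
  shows "avg r U x = avg r U' x"
  unfolding avg_eq_ip using tr_AE'[OF assms(1), of x] L2_meas[OF cube_L2]
    L2_meas[OF tr_L2'[OF assms(2)]] L2_meas[OF tr_L2'[OF assms(3)]]
  by (subst ip_cong_AE[of _ "\<lambda>h. indicator (cube r) h" "\<lambda>h. U (x + h)" "\<lambda>h. U' (x + h)"]) auto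

lemma avg_borel:
  fixes U :: "real ^ 'n \<Rightarrow> real"
  assumes [measurable]: "U \<in> borel_measurable borel"
  shows "avg r U \<in> borel_measurable lborel"
proof -
  have eq: "(LINT h|lebesgue. indicator (cube r) h * U (x + h)) = (LINT h|lborel. indicator (cube r) h * U (x + h))" for x
    by (rule integral_completion) measurable
  have "(\<lambda>x. LINT h|lborel. indicator (cube r) h * U (x + h)) \<in> borel_measurable lborel"
    by (rule lborel.borel_measurable_lebesgue_integral) measurable
  then show ?thesis unfolding avg_def[abs_def] eq by measurable
qed

text \<open>Fubini requires joint measurability of \<open>U (x + h)\<close> in x and h, which is at
  hand for Borel U. Averages do not notice the change of representative.\<close>

lemma L2_borel_rep:
  assumes "U \<in> L2"
  obtains U' where "U' \<in> borel_measurable borel" "AE x in lebesgue. U x = U' x" "U' \<in> L2"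
proof -
  obtain U' where U': "U' \<in> borel_measurable lborel" "AE x in lborel. U x = U' x"
    using completion_ex_borel_measurable_real[OF L2_meas[OF assms]] by blast
  have ae: "AE x in lebesgue. U x = U' x" using U'(2) by (rule AE_completion)
  have "U' \<in> L2"
    by (rule L2_bound[OF assms measurable_completion[OF U'(1)]]) (use ae in \<open>auto elim!: eventually_mono\<close>)
  then show ?thesis using that U' ae by simp
qed

lemma avg_meas:
  assumes "U \<in> L2"
  shows "avg r U \<in> borel_measurable lebesgue"
proof -
  obtain U' where U': "U' \<in> borel_measurable borel" "AE x in lebesgue. U x = U' x" "U' \<in> L2"
    by (rule L2_borel_rep[OF assms])
  have "avg r U = avg r U'" using avg_cong_AE[OF U'(2) assms U'(3)] by auto
  then show ?thesis using measurable_completion[OF avg_borel[OF U'(1)]] by simp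
qed

text \<open>U minus its average is, up to sign, the average of the increments over the cube.
  Jensen's inequality and Fubini bound its norm by the worst increment.\<close>

lemma avg_diff_borel:
  fixes U :: "real ^ 'n \<Rightarrow> real"
  assumes U: "U \<in> L2" and B[measurable]: "U \<in> borel_measurable borel" and r: "r > 0"
    and C: "\<And>v. v \<in> cube r \<Longrightarrow> (nrm (\<lambda>x. U (x + v) - U x))\<^sup>2 \<le> C"
  shows "(\<lambda>x. U x - avg r U x) \<in> L2 \<and> (nrm (\<lambda>x. U x - avg r U x))\<^sup>2 \<le> C"
proof -
  let ?I = "\<lambda>h :: real ^ 'n. indicator (cube r) h :: real"
  let ?V = "r ^ CARD('n)"
  have V: "?V > 0" using r by simp
  have C0: "0 \<le> C"
  proof -
    have "0 \<in> (cube r :: (real ^ 'n) set)" unfolding cube_def using r by (simp add: mem_box_cart)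
    from C[OF this] show ?thesis by (rule order_trans[OF zero_le_power2])
  qed
  have [measurable]: "avg r U \<in> borel_measurable borel" using avg_borel[OF B] by simp
  define D where "D x h = ?I h * (U (x + h) - U x)" for x h
  have D_L2: "D x \<in> L2" for x
    unfolding D_def[abs_def] right_diff_distrib
  proof (intro L2_diff)
    show "(\<lambda>h. ?I h * U (x + h)) \<in> L2"
      by (rule L2_bounded_mult[OF tr_L2'[OF U] L2_meas[OF cube_L2], of _ 1]) (simp add: indicator_def)
    show "(\<lambda>h. ?I h * U x) \<in> L2" using L2_cmult[OF cube_L2, of "U x" r] by (simp add: mult.commute)
  qed
  \<comment> \<open>Jensen's inequality in the form of Cauchy-Schwarz against the indicator of the
    cube.\<close>
  have pt: "ennreal ((U x - avg r U x)\<^sup>2) \<le> (\<integral>\<^sup>+h. ennreal ((D x h)\<^sup>2) \<partial>lborel) / ennreal ?V" for x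
  proof -
    have ii: "ip ?I (\<lambda>h. ?I h * f h) = ip ?I f" for f
      unfolding ip_def by (intro Bochner_Integration.integral_cong) (auto simp: indicator_def)
    have "ip ?I (D x) = ip ?I (\<lambda>h. U (x + h)) - U x * ?V"
    proof -
      have "D x = (\<lambda>h. ?I h * U (x + h) - U x * ?I h)" unfolding D_def by (simp add: algebra_simps)
      moreover have "(\<lambda>h. ?I h * U (x + h)) \<in> L2"
        by (rule L2_bounded_mult[OF tr_L2'[OF U] L2_meas[OF cube_L2], of _ 1]) (simp add: indicator_def)
      ultimately have "ip ?I (D x) = ip ?I (\<lambda>h. ?I h * U (x + h)) - U x * ip ?I ?I"
        using ip_diff_right[OF _ L2_cmult[OF cube_L2] cube_L2] by (simp add: ip_cmult_right)
      then show ?thesis using cube_nrm[of r, where 'n = 'n] r by (simp add: nrm_sq ii)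
    qed
    then have "U x - avg r U x = - ip ?I (D x) / ?V"
      unfolding avg_eq_ip using V r by (simp add: diff_divide_distrib)
    then have "(U x - avg r U x)\<^sup>2 = (ip ?I (D x))\<^sup>2 / ?V\<^sup>2" by (simp add: power_divide)
    also have "\<dots> \<le> (nrm ?I * nrm (D x))\<^sup>2 / ?V\<^sup>2"
    proof (intro divide_right_mono)
      have "\<bar>ip ?I (D x)\<bar>\<^sup>2 \<le> (nrm ?I * nrm (D x))\<^sup>2"
        by (intro power_mono ip_le_nrm cube_L2 D_L2) simp
      then show "(ip ?I (D x))\<^sup>2 \<le> (nrm ?I * nrm (D x))\<^sup>2" by simp
    qed simp
    also have "\<dots> = (nrm (D x))\<^sup>2 / ?V"
      unfolding power_mult_distrib cube_nrm[OF less_imp_le[OF r]] using V by (simp add: power2_eq_square[of "r ^ _"])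
    finally have "ennreal ((U x - avg r U x)\<^sup>2) \<le> ennreal ((nrm (D x))\<^sup>2 / ?V)" by (rule ennreal_leI)
    also have "\<dots> = (\<integral>\<^sup>+h. ennreal ((D x h)\<^sup>2) \<partial>lebesgue) / ennreal ?V"
      using V by (simp add: nn_integral_sq[OF D_L2] divide_ennreal)
    finally show ?thesis by (simp add: nn_integral_completion)
  qed
  have "(\<integral>\<^sup>+x. ennreal ((U x - avg r U x)\<^sup>2) \<partial>lborel) \<le> (\<integral>\<^sup>+x. (\<integral>\<^sup>+h. ennreal ((D x h)\<^sup>2) \<partial>lborel) / ennreal ?V \<partial>lborel)"
    by (intro nn_integral_mono pt)
  also have "\<dots> = (\<integral>\<^sup>+x. (\<integral>\<^sup>+h. ennreal ((D x h)\<^sup>2) \<partial>lborel) \<partial>lborel) / ennreal ?V"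
    unfolding D_def by (intro nn_integral_divide) measurable
  also have "(\<integral>\<^sup>+x. (\<integral>\<^sup>+h. ennreal ((D x h)\<^sup>2) \<partial>lborel) \<partial>lborel) = (\<integral>\<^sup>+h. (\<integral>\<^sup>+x. ennreal ((D x h)\<^sup>2) \<partial>lborel) \<partial>lborel)"
    unfolding D_def by (rule lborel_pair.Fubini') measurable
  also have "\<dots> \<le> (\<integral>\<^sup>+h. ennreal C * indicator (cube r :: (real ^ 'n) set) h \<partial>lborel)"
  proof (intro nn_integral_mono)
    fix h :: "real ^ 'n"
    show "(\<integral>\<^sup>+x. ennreal ((D x h)\<^sup>2) \<partial>lborel) \<le> ennreal C * indicator (cube r) h"
    proof (cases "h \<in> cube r")
      case True
      have "(\<integral>\<^sup>+x. ennreal ((D x h)\<^sup>2) \<partial>lborel) = (\<integral>\<^sup>+x. ennreal ((U (x + h) - U x)\<^sup>2) \<partial>lebesgue)"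
        using True by (simp add: D_def nn_integral_completion)
      also have "\<dots> = ennreal ((nrm (\<lambda>x. U (x + h) - U x))\<^sup>2)"
        by (intro nn_integral_sq L2_diff tr_L2 U)
      also have "\<dots> \<le> ennreal C" by (intro ennreal_leI C True)
      finally show ?thesis using True by simp
    qed (simp add: D_def)
  qed
  also have "\<dots> = ennreal C * emeasure lborel (cube r :: (real ^ 'n) set)"
    by (rule nn_integral_cmult_indicator) simp
  also have "\<dots> = ennreal C * ennreal ?V"
    using cube_measure(2)[of r, where 'n = 'n] r by simp
  finally have le: "(\<integral>\<^sup>+x. ennreal ((U x - avg r U x)\<^sup>2) \<partial>lborel) \<le> ennreal C"
    using V C0 r by (simp add: divide_right_mono_ennreal ennreal_mult[symmetric] divide_ennreal)
  have m: "(\<lambda>x. U x - avg r U x) \<in> borel_measurable lebesgue"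
    by (intro measurable_completion) simp
  have "integrable lebesgue (\<lambda>x. (U x - avg r U x)\<^sup>2)"
    using m le by (intro integrableI_bounded) (auto simp: nn_integral_completion le_less_trans)
  then have L: "(\<lambda>x. U x - avg r U x) \<in> L2" using m by (simp add: L2_iff)
  then show ?thesis using le nn_integral_sq[OF L] C0 by (simp add: nn_integral_completion)
qed

text \<open>Averages the increment bound of \<open>tr_diff_le\<close>. Letting r tend to 0 yields
  compactness later; tuning r to the size of a level set yields the Sobolev inequality.\<close>

lemma pseudo_poincare:
  fixes U :: "real ^ 'n \<Rightarrow> real"
  assumes U: "U \<in> H1" and r: "r > 0"
  shows "(\<lambda>x. U x - avg r U x) \<in> L2" "(nrm (\<lambda>x. U x - avg r U x))\<^sup>2 \<le> r\<^sup>2 * real CARD('n) * gr U"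
proof -
  have UL: "U \<in> L2" by (rule H1_L2[OF U])
  obtain W where W: "W \<in> borel_measurable borel" "AE x in lebesgue. U x = W x" "W \<in> L2"
    by (rule L2_borel_rep[OF UL])
  have *: "(\<lambda>x. W x - avg r W x) \<in> L2 \<and> (nrm (\<lambda>x. W x - avg r W x))\<^sup>2 \<le> r\<^sup>2 * real CARD('n) * gr U"
  proof (rule avg_diff_borel[OF W(3,1) r])
    fix v :: "real ^ 'n" assume v: "v \<in> cube r"
    have "nrm (\<lambda>x. W (x + v) - W x) = nrm (\<lambda>x. U (x + v) - U x)"
    proof (rule nrm_cong_AE)
      show "AE x in lebesgue. W (x + v) - W x = U (x + v) - U x"
        using W(2) tr_AE[OF W(2), of v] by eventually_elim simp
    qed (intro L2_meas L2_diff tr_L2 W UL)+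
    then show "(nrm (\<lambda>x. W (x + v) - W x))\<^sup>2 \<le> r\<^sup>2 * real CARD('n) * gr U"
      using tr_diff_le[OF U, of v r] v unfolding cube_def by (simp add: mem_box_cart)
  qed
  have ae: "AE x in lebesgue. W x - avg r W x = U x - avg r U x"
    using W(2) avg_cong_AE[OF W(2) UL W(3), of r] by (auto elim!: eventually_mono)
  have m: "(\<lambda>x. U x - avg r U x) \<in> borel_measurable lebesgue"
    by (intro borel_measurable_diff L2_meas UL avg_meas)
  show "(\<lambda>x. U x - avg r U x) \<in> L2"
    by (rule L2_bound[OF conjunct1[OF *] m]) (use ae in \<open>auto elim!: eventually_mono\<close>)
  show "(nrm (\<lambda>x. U x - avg r U x))\<^sup>2 \<le> r\<^sup>2 * real CARD('n) * gr U"
    using * nrm_cong_AE[OF ae L2_meas[OF conjunct1[OF *]] m] by simp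
qed

lemma avg_le:
  fixes U :: "real ^ 'n \<Rightarrow> real"
  assumes "U \<in> L2" "r > 0"
  shows "\<bar>avg r U x\<bar> \<le> nrm U * sqrt (r ^ CARD('n)) / r ^ CARD('n)"
proof -
  have "nrm (\<lambda>h :: real ^ 'n. indicator (cube r) h) = sqrt (r ^ CARD('n))"
    using cube_nrm[of r, where 'n = 'n] assms(2) real_sqrt_unique nrm_nonneg by (metis less_imp_le)
  moreover have "nrm (\<lambda>h. U (x + h)) = nrm U" using tr_nrm[OF assms(1), of x] by (simp add: add.commute)
  ultimately show ?thesis
    using ip_le_nrm[OF cube_L2 tr_L2'[OF assms(1), of x], of r] assms(2)
    unfolding avg_eq_ip by (simp add: abs_divide divide_right_mono mult.commute)
qed

section \<open>The Sobolev inequality\<close>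

text \<open>The distribution function of f. For f in L2 and t > 0 the superlevel set has finite
  measure, so the convention that \<open>measure\<close> is 0 on infinite sets does not
  interfere.\<close>

definition level :: "(real ^ 'n \<Rightarrow> real) \<Rightarrow> real \<Rightarrow> real" where
  "level f t = measure lebesgue {x. t \<le> f x}"

lemma level_set: fixes f :: "real ^ 'n \<Rightarrow> real" shows "f \<in> borel_measurable lebesgue \<Longrightarrow> {x. t \<le> f x} \<in> sets lebesgue"
  using borel_measurable_le[of "\<lambda>x. t" lebesgue f] by simp

lemma level_indicator:
  assumes f: "f \<in> L2" and t: "t > 0"
  shows "emeasure lebesgue {x. t \<le> f x} < \<infinity>" "t\<^sup>2 * level f t \<le> (nrm f)\<^sup>2"
proof -
  let ?S = "{x. t \<le> f x}"
  have S: "?S \<in> sets lebesgue" by (rule level_set[OF L2_meas[OF f]])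
  have "ennreal (t\<^sup>2) * emeasure lebesgue ?S = (\<integral>\<^sup>+x. ennreal (t\<^sup>2) * indicator ?S x \<partial>lebesgue)"
    by (rule nn_integral_cmult_indicator[OF S, symmetric])
  also have "\<dots> \<le> (\<integral>\<^sup>+x. ennreal ((f x)\<^sup>2) \<partial>lebesgue)"
    using t by (intro nn_integral_mono) (auto simp: indicator_def intro!: ennreal_leI power_mono)
  also have "\<dots> = ennreal ((nrm f)\<^sup>2)" by (rule nn_integral_sq[OF f])
  finally have le: "ennreal (t\<^sup>2) * emeasure lebesgue ?S \<le> ennreal ((nrm f)\<^sup>2)" .
  show fin: "emeasure lebesgue ?S < \<infinity>"
  proof (rule ccontr)
    assume "\<not> ?thesis"
    then have "emeasure lebesgue ?S = \<infinity>" by (metis infinity_ennreal_def top.not_eq_extremum)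
    then show False using le t by (simp add: ennreal_mult_top top_unique)
  qed
  then have "emeasure lebesgue ?S = ennreal (level f t)"
    unfolding level_def by (simp add: emeasure_eq_ennreal_measure)
  then show "t\<^sup>2 * level f t \<le> (nrm f)\<^sup>2"
    using le by (simp add: ennreal_mult[symmetric] level_def)
qed

lemma level_nonneg [simp]: "0 \<le> level f t"
  unfolding level_def by simp

text \<open>The slice of a between heights s and 2s, lowered to start at 0: it is 0 below s,
  \<open>a - s\<close> in between, and s above 2s. Slices at dyadic heights telescope.\<close>

definition trunc :: "real \<Rightarrow> real \<Rightarrow> real" where
  "trunc s a = min a (2 * s) - min a s"

lemma trunc_lip: "\<bar>trunc s a - trunc s b\<bar> \<le> 2 * \<bar>a - b\<bar>"
  unfolding trunc_def min_def by (smt (verit))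

lemma trunc_H1: "f \<in> H1 \<Longrightarrow> s > 0 \<Longrightarrow> (\<lambda>x. trunc s (f x)) \<in> H1"
  by (rule lipschitz_comp_H1[OF _ trunc_lip]) (auto simp: trunc_def)

text \<open>Chebyshev for the slice minus its averages. Where f is at least 2s the slice equals s,
  while its averages over sufficiently large cubes are at most s/4, so the difference exceeds s/2;
  the pseudo-Poincare inequality bounds its norm.\<close>

lemma level_step:
  fixes f :: "real ^ 'n \<Rightarrow> real"
  assumes f: "f \<in> H1" and s: "s > 0"
  shows "level f (2 * s) \<le> 4 * real CARD('n) / s\<^sup>2 * (4 * level f s) powr (2 / real CARD('n)) * gr (\<lambda>x. trunc s (f x))"
proof -
  let ?N = "CARD('n)"
  let ?g = "\<lambda>x. trunc s (f x)"
  have fL: "f \<in> L2" by (rule H1_L2[OF f])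
  have gH: "?g \<in> H1" by (rule trunc_H1[OF f s])
  have S: "{x. t \<le> f x} \<in> sets lebesgue" for t by (rule level_set[OF L2_meas[OF fL]])
  have mono: "level f (2 * s) \<le> level f s"
    unfolding level_def
    by (rule measure_mono_fmeasurable) (use S level_indicator(1)[OF fL s] s in \<open>auto simp: fmeasurable_def\<close>)
  show ?thesis
  proof (cases "level f s = 0")
    case True
    then have "level f (2 * s) = 0" using mono level_nonneg[of f "2 * s"] by linarith
    then show ?thesis using True by simp
  next
    case False
    then have m: "level f s > 0" using level_nonneg[of f s] by linarith
    \<comment> \<open>The cube then has volume four times the measure of the set where f is at least
      s. The slice lives on that set and is at most s, so its averages are at most s/4.\<close>
    define r where "r = (4 * level f s) powr (1 / real ?N)"
    have r: "r > 0" unfolding r_def using m by simp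
    have rN: "r ^ ?N = 4 * level f s"
      unfolding r_def using m by (simp add: powr_power)
    have r2: "r\<^sup>2 = (4 * level f s) powr (2 / real ?N)"
      unfolding r_def using m by (simp add: powr_power)
    have av: "avg r ?g x \<le> s / 4" for x
    proof -
      have gi: "integrable lebesgue (\<lambda>h. s * indicator {y. s \<le> f y} (x + h))"
      proof -
        have "integrable lebesgue (\<lambda>y. indicator {y. s \<le> f y} y :: real)"
          by (intro integrable_real_indicator S level_indicator(1)[OF fL s])
        then have "integrable lebesgue (\<lambda>y. indicator {y. s \<le> f y} (1 *\<^sub>R y + x) :: real)"
          by (subst affine_integrable_iff) (use S in auto)
        then show ?thesis by (simp add: add.commute)
      qed
      have "(LINT h|lebesgue. indicator (cube r) h * ?g (x + h)) \<le> (LINT h|lebesgue. s * indicator {y. s \<le> f y} (x + h))"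
      proof (rule integral_mono[OF _ gi])
        show "integrable lebesgue (\<lambda>h. indicator (cube r) h * ?g (x + h))"
          by (rule L2_mult_integrable[OF cube_L2 tr_L2'[OF H1_L2[OF gH]]])
        show "indicator (cube r) h * ?g (x + h) \<le> s * indicator {y. s \<le> f y} (x + h)" for h
          using s by (auto simp: indicator_def trunc_def min_def)
      qed
      also have "\<dots> = s * level f s"
      proof -
        have "(LINT h|lebesgue. indicator {y. s \<le> f y} (1 *\<^sub>R h + x) :: real) = (LINT y|lebesgue. indicator {y. s \<le> f y} y) / \<bar>1\<bar> ^ ?N"
          by (rule affine_integral) (use S in auto)
        then show ?thesis unfolding level_def by (simp add: add.commute)
      qed
      finally show ?thesis unfolding avg_def rN using m by (simp add: field_simps)
    qed
    have gL: "(\<lambda>x. ?g x - avg r ?g x) \<in> L2" by (rule pseudo_poincare(1)[OF gH r])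
    have "(s / 2)\<^sup>2 * level f (2 * s) = (LINT x|lebesgue. (s / 2)\<^sup>2 * indicator {x. 2 * s \<le> f x} x)"
      unfolding level_def using S by simp
    also have "\<dots> \<le> (LINT x|lebesgue. (?g x - avg r ?g x)\<^sup>2)"
    proof (rule integral_mono)
      show "integrable lebesgue (\<lambda>x. (s / 2)\<^sup>2 * indicator {x. 2 * s \<le> f x} x)"
        using level_indicator(1)[OF fL, of "2 * s"] s S by (intro integrable_mult_right integrable_real_indicator) auto
      show "integrable lebesgue (\<lambda>x. (?g x - avg r ?g x)\<^sup>2)" using gL by (simp add: L2_iff)
      show "(s / 2)\<^sup>2 * indicator {x. 2 * s \<le> f x} x \<le> (?g x - avg r ?g x)\<^sup>2" for x
      proof (cases "2 * s \<le> f x")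
        case True
        then have "?g x = s" using s by (simp add: trunc_def)
        then have "s / 2 \<le> ?g x - avg r ?g x" using av[of x] s by linarith
        then have "(s / 2)\<^sup>2 \<le> (?g x - avg r ?g x)\<^sup>2" using s by (intro power_mono) auto
        then show ?thesis using True by simp
      qed simp
    qed
    also have "\<dots> \<le> r\<^sup>2 * real ?N * gr ?g" using pseudo_poincare(2)[OF gH r] by (simp add: nrm_sq_int)
    finally show ?thesis unfolding r2 using s by (simp add: field_simps power2_eq_square)
  qed
qed

text \<open>The constant of the recursion between consecutive dyadic levels in
  \<open>sobolev_pos\<close>: the first factor comes from doubling the height, the others from
  \<open>level_step\<close>.\<close>

definition sob0 :: "nat \<Rightarrow> real" where
  "sob0 N = 2 powr crit_exp N * (4 * real N) * 4 powr (2 / real N)"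

text \<open>The constant of the Sobolev inequality in integral form. The extra power of 2 arises
  from replacing f on a dyadic band by the lower end of the band; the exponent comes from absorbing
  the sublinear term.\<close>

definition sobK :: "nat \<Rightarrow> real" where
  "sobK N = 2 powr crit_exp N * sob0 N powr (crit_exp N / 2)"

lemma crit_exp_facts:
  assumes "N \<ge> 3"
  shows "crit_exp N > 2" "crit_exp N - 2 = 2 / real N * crit_exp N" "1 / (1 - 2 / real N) = crit_exp N / 2"
    "crit_exp N * (1 - 2 / real N) = 2" "0 < crit_exp N"
proof -
  have N: "real N \<ge> 3" using assms by simp
  show "crit_exp N > 2" unfolding crit_exp_def using N by (simp add: field_simps)
  then show "0 < crit_exp N" by simp
  show "crit_exp N - 2 = 2 / real N * crit_exp N" unfolding crit_exp_def using N by (simp add: field_simps)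
  show "1 / (1 - 2 / real N) = crit_exp N / 2" unfolding crit_exp_def using N by (simp add: field_simps)
  show "crit_exp N * (1 - 2 / real N) = 2" unfolding crit_exp_def using N by (simp add: field_simps)
qed

text \<open>Each slice is a monotone function, so for ordered arguments all increments have the same
  sign and the sum of squares is at most the square of the sum. That sum telescopes to the increment
  of a clipped identity.\<close>

lemma sum_trunc_lip:
  fixes a b :: real and M :: nat
  shows "(\<Sum>k\<in>{- int M ..< int M}. (trunc (2 powi k) a - trunc (2 powi k) b)\<^sup>2) \<le> (a - b)\<^sup>2"
proof -
  have tel: "(\<Sum>k\<in>{- int M ..< int M}. trunc (2 powi k) a) = min a (2 powi (int M)) - min a (2 powi (- int M))" for a :: real
  proof (induction M)
    case (Suc M)
    have *: "{- int (Suc M) ..< int (Suc M)} = insert (- int (Suc M)) (insert (int M) {- int M ..< int M})" by auto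
    have "trunc (2 powi (int M)) a = min a (2 powi (int (Suc M))) - min a (2 powi (int M))"
      unfolding trunc_def by (simp add: power_int_add)
    moreover have "trunc (2 powi (- int (Suc M))) a = min a (2 powi (- int M)) - min a (2 powi (- int (Suc M)))"
    proof -
      have "2 * (2 powi (- int (Suc M))) = (2 powi (- int M) :: real)"
        using power_int_add[of "2::real" "1" "- int (Suc M)"] by simp
      then show ?thesis unfolding trunc_def by simp
    qed
    ultimately show ?case unfolding * using Suc by (subst sum.insert; simp)+
  qed simp
  have main: "(\<Sum>k\<in>{- int M ..< int M}. (trunc (2 powi k) a - trunc (2 powi k) b)\<^sup>2) \<le> (a - b)\<^sup>2" if ab: "b \<le> a" for a b :: real
  proof -
    let ?d = "\<lambda>k. trunc (2 powi k) a - trunc (2 powi k) b"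
    have d0: "0 \<le> ?d k" for k
    proof -
      have "(0::real) < 2 powi k" by (simp add: zero_less_power_int)
      then show ?thesis using ab unfolding trunc_def min_def by (smt (verit))
    qed
    have sq: "(\<Sum>k\<in>K. (d k)\<^sup>2) \<le> (\<Sum>k\<in>K. d k)\<^sup>2" if "finite K" "\<And>k. 0 \<le> d k"
      for K and d :: "int \<Rightarrow> real"
      using that(1)
    proof (induction K rule: finite_induct)
      case (insert x F)
      have "0 \<le> 2 * d x * (\<Sum>k\<in>F. d k)" using that(2) by (simp add: sum_nonneg)
      then show ?case using insert by (simp add: power2_sum)
    qed simp
    have S: "(\<Sum>k\<in>{- int M ..< int M}. ?d k) = (min a (2 powi (int M)) - min a (2 powi (- int M))) - (min b (2 powi (int M)) - min b (2 powi (- int M)))"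
      unfolding sum_subtractf tel ..
    have "(2::real) powi (- int M) \<le> 2 powi (int M)" by (intro power_int_increasing) auto
    then have "(\<Sum>k\<in>{- int M ..< int M}. ?d k) \<le> a - b" unfolding S using ab unfolding min_def by (smt (verit))
    moreover have "0 \<le> (\<Sum>k\<in>{- int M ..< int M}. ?d k)" using d0 by (intro sum_nonneg)
    ultimately have "(\<Sum>k\<in>{- int M ..< int M}. ?d k)\<^sup>2 \<le> (a - b)\<^sup>2" by (intro power_mono)
    then show ?thesis using sq[of "{- int M ..< int M}" ?d] d0 by simp
  qed
  show ?thesis
  proof (cases "b \<le> a")
    case False
    then show ?thesis using main[of a b] by (simp add: power2_commute[of "trunc _ a"] power2_commute[of a])
  qed (rule main)
qed

text \<open>A crude bound using A shows that S converges. In the limit the terms \<open>a n\<close>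
  disappear, so the final bound is free of A; this is what rids the Sobolev inequality of the L2
  norm.\<close>

lemma sublinear_limit:
  fixes S a :: "nat \<Rightarrow> real"
  assumes S: "incseq S" "\<And>n. 0 \<le> S n" and a: "a \<longlonglongrightarrow> 0" "\<And>n. a n \<le> A" "0 \<le> A"
    and K: "0 \<le> K" and \<beta>: "0 < \<beta>" "\<beta> < 1" and le: "\<And>n. S n \<le> a n + K * S n powr \<beta>"
  shows "S n \<le> K powr (1 / (1 - \<beta>))"
proof -
  have bd: "S n \<le> max 1 ((A + K) powr (1 / (1 - \<beta>)))" for n
  proof (cases "S n \<le> 1")
    case False
    then have p: "S n > 1" by simp
    have "1 \<le> S n powr \<beta>" using p \<beta> by (simp add: ge_one_powr_ge_zero)
    then have "a n \<le> A * S n powr \<beta>" using a(2)[of n] a(3) mult_left_mono[of 1 "S n powr \<beta>" A] by simp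
    then have "S n \<le> (A + K) * S n powr \<beta>" using le[of n] by (simp add: distrib_right)
    moreover have "S n = S n powr (1 - \<beta>) * S n powr \<beta>" using p by (simp add: powr_add[symmetric])
    ultimately have "S n powr (1 - \<beta>) \<le> A + K"
      using p by (metis less_trans mult_le_cancel_right_pos powr_gt_zero zero_less_one less_irrefl)
    then have "(S n powr (1 - \<beta>)) powr (1 / (1 - \<beta>)) \<le> (A + K) powr (1 / (1 - \<beta>))"
      using \<beta> by (intro powr_mono2) auto
    then show ?thesis using p \<beta> by (simp add: powr_powr)
  qed simp
  obtain L where L: "S \<longlonglongrightarrow> L" "\<And>n. S n \<le> L"
    using incseq_convergent[OF S(1)] bd by metis
  have L0: "0 \<le> L" using L(2)[of 0] S(2)[of 0] by simp
  have "L \<le> 0 + K * L powr \<beta>"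
  proof (rule LIMSEQ_le[OF L(1)])
    show "(\<lambda>n. a n + K * S n powr \<beta>) \<longlonglongrightarrow> 0 + K * L powr \<beta>"
      using \<beta> S(2) by (intro tendsto_add a tendsto_mult tendsto_const tendsto_powr2 L) auto
  qed (use le in auto)
  have "L \<le> K powr (1 / (1 - \<beta>))"
  proof (cases "L = 0")
    case False
    with L0 have p: "L > 0" by simp
    have "L = L powr (1 - \<beta>) * L powr \<beta>" using p by (simp add: powr_add[symmetric])
    then have "L powr (1 - \<beta>) \<le> K" using \<open>L \<le> 0 + K * L powr \<beta>\<close> p
      by (metis add_0 mult_le_cancel_right_pos powr_gt_zero less_irrefl)
    then have "(L powr (1 - \<beta>)) powr (1 / (1 - \<beta>)) \<le> K powr (1 / (1 - \<beta>))"
      using \<beta> by (intro powr_mono2) auto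
    then show ?thesis using p \<beta> by (simp add: powr_powr)
  qed simp
  then show ?thesis using L(2)[of n] by linarith
qed

text \<open>Summing the recursion of \<open>level_step\<close> over dyadic levels bounds the sum by
  a sublinear power of itself times the Dirichlet integral, because the slices share a single
  Dirichlet integral by \<open>gr_lipschitz_sum\<close>.\<close>

lemma sobolev_pos:
  fixes f :: "real ^ 'n \<Rightarrow> real"
  assumes N: "CARD('n) \<ge> 3" and f: "f \<in> H1" and f0: "\<And>x. 0 \<le> f x"
  shows "(\<integral>\<^sup>+x. ennreal (f x powr crit_exp CARD('n)) \<partial>lebesgue) \<le> ennreal (sobK CARD('n) * gr f powr (crit_exp CARD('n) / 2))"
proof -
  let ?N = "CARD('n)"
  define p where "p = crit_exp ?N"
  define \<beta> where "\<beta> = 2 / real ?N"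
  note pf = crit_exp_facts[OF N, folded p_def \<beta>_def]
  have \<beta>: "0 < \<beta>" "\<beta> < 1" unfolding \<beta>_def using N by (auto simp: field_simps)
  have fL: "f \<in> L2" by (rule H1_L2[OF f])
  have [measurable]: "f \<in> borel_measurable lebesgue" by (rule L2_meas[OF fL])
  \<comment> \<open>Up to constants, the contribution of the band around height
    \<open>2 powi k\<close> to the integral of \<open>f powr p\<close>.\<close>
  define A where "A k = (2 powi k) powr p * level f (2 powi k)" for k :: int
  have A0: "0 \<le> A k" for k unfolding A_def by simp
  define G where "G k = gr (\<lambda>x. trunc (2 powi k) (f x))" for k :: int
  have G0: "0 \<le> G k" for k unfolding G_def by simp
  have step: "A (k + 1) \<le> sob0 ?N * A k powr \<beta> * G k" for k
  proof -
    define s where "s = (2::real) powi k"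
    have s: "s > 0" unfolding s_def by (simp add: zero_less_power_int)
    have s2: "2 powi (k + 1) = 2 * s" unfolding s_def by (simp add: power_int_add)
    \<comment> \<open>The powers of s match because \<open>p - 2 = \<beta> * p\<close>; this is
      where p has to be the critical exponent.\<close>
    have "s powr p / s\<^sup>2 = s powr (p - 2)" using s by (simp add: powr_diff)
    also have "\<dots> = (s powr p) powr \<beta>" unfolding pf(2) by (simp add: powr_powr mult.commute)
    finally have e: "s powr p / s\<^sup>2 = (s powr p) powr \<beta>" .
    have "A (k + 1) = 2 powr p * s powr p * level f (2 * s)"
      unfolding A_def s2 using s by (simp add: powr_mult)
    also have "\<dots> \<le> 2 powr p * s powr p * (4 * real ?N / s\<^sup>2 * (4 * level f s) powr \<beta> * G k)"
      unfolding G_def s_def[symmetric] \<beta>_def by (intro mult_left_mono level_step[OF f s]) auto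
    also have "\<dots> = 2 powr p * (4 * real ?N) * 4 powr \<beta> * ((s powr p / s\<^sup>2) * level f s powr \<beta>) * G k"
      by (simp add: powr_mult)
    also have "\<dots> = sob0 ?N * A k powr \<beta> * G k"
      unfolding e sob0_def A_def s_def[symmetric] p_def[symmetric] \<beta>_def[symmetric] by (simp add: powr_mult)
    finally show ?thesis .
  qed
  have sob0: "0 \<le> sob0 ?N" unfolding sob0_def by simp
  \<comment> \<open>Finite symmetric sums, so that nothing presupposes finiteness of the full sum.
    The price is the boundary term at the lowest level \<open>- int M\<close>.\<close>
  define S where "S M = (\<Sum>k\<in>{- int M .. int M}. A k)" for M :: nat
  have S0: "0 \<le> S M" for M unfolding S_def by (intro sum_nonneg A0)
  have Smono: "incseq S"
    unfolding S_def by (intro monoI sum_mono2) (auto intro: A0)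
  have recS: "S M \<le> A (- int M) + (sob0 ?N * gr f) * S M powr \<beta>" for M
  proof -
    have "{- int M .. int M} = insert (- int M) ((\<lambda>k. k + 1) ` {- int M ..< int M})"
    proof -
      have "k \<in> (\<lambda>k. k + 1) ` {- int M ..< int M}" if "- int M < k" "k \<le> int M" for k
        using that by (intro image_eqI[of _ _ "k - 1"]) auto
      then show ?thesis by force
    qed
    moreover have "sum A ((\<lambda>k. k + 1) ` {- int M ..< int M}) = (\<Sum>k\<in>{- int M ..< int M}. A (k + 1))"
      by (subst sum.reindex) (auto simp: o_def)
    moreover have "sum A (insert (- int M) ((\<lambda>k. k + 1) ` {- int M ..< int M}))
        = A (- int M) + sum A ((\<lambda>k. k + 1) ` {- int M ..< int M})"
      by (rule sum.insert) auto
    ultimately have "S M = A (- int M) + (\<Sum>k\<in>{- int M ..< int M}. A (k + 1))"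
      unfolding S_def by simp
    also have "(\<Sum>k\<in>{- int M ..< int M}. A (k + 1)) \<le> (\<Sum>k\<in>{- int M ..< int M}. sob0 ?N * S M powr \<beta> * G k)"
    proof (rule sum_mono)
      fix k assume k: "k \<in> {- int M ..< int M}"
      have "A k \<le> S M" unfolding S_def using k A0 by (intro member_le_sum) auto
      then have "A k powr \<beta> \<le> S M powr \<beta>" using A0 \<beta> by (intro powr_mono2) auto
      then have "sob0 ?N * A k powr \<beta> * G k \<le> sob0 ?N * S M powr \<beta> * G k"
        using sob0 G0 by (intro mult_right_mono mult_left_mono) auto
      then show "A (k + 1) \<le> sob0 ?N * S M powr \<beta> * G k" using step[of k] by linarith
    qed
    also have "\<dots> = sob0 ?N * S M powr \<beta> * (\<Sum>k\<in>{- int M ..< int M}. G k)" by (simp add: sum_distrib_left)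
    also have "\<dots> \<le> sob0 ?N * S M powr \<beta> * gr f"
    proof (intro mult_left_mono)
      show "(\<Sum>k\<in>{- int M ..< int M}. G k) \<le> gr f"
        unfolding G_def by (rule gr_lipschitz_sum[OF f _ _ sum_trunc_lip]) (auto simp: trunc_def)
    qed (use sob0 in simp)
    finally show ?thesis by (simp add: ac_simps)
  qed
  \<comment> \<open>Chebyshev in L2 bounds the lowest term; since p > 2 it decays geometrically as
    the level goes down.\<close>
  have Asmall: "A (- int M) \<le> (nrm f)\<^sup>2 * (2 powr (2 - p)) ^ M" for M
  proof -
    define s where "s = (2::real) powi (- int M)"
    have s: "s > 0" unfolding s_def by (simp add: zero_less_power_int)
    have "A (- int M) = s powr (p - 2) * (s\<^sup>2 * level f s)"
      unfolding A_def s_def[symmetric] using s by (simp add: powr_diff)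
    also have "\<dots> \<le> s powr (p - 2) * (nrm f)\<^sup>2"
      by (intro mult_left_mono level_indicator(2)[OF fL s]) simp
    also have "s powr (p - 2) = (2 powr (2 - p)) ^ M"
    proof -
      have "s = 2 powr (- real M)" unfolding s_def by (simp add: power_int_minus powr_minus powr_realpow)
      then show ?thesis by (simp add: powr_powr powr_realpow[symmetric] algebra_simps)
    qed
    finally show ?thesis by (simp add: mult.commute)
  qed
  have q: "0 < 2 powr (2 - p)" "2 powr (2 - p) < 1" using pf(1) powr_less_one[of 2 "2 - p"] by auto
  have SL: "S M \<le> (sob0 ?N * gr f) powr (p / 2)" for M
    unfolding pf(3)[symmetric]
  proof (rule sublinear_limit[OF Smono S0 _ _ _ _ \<beta> recS])
    show "A (- int n) \<le> (nrm f)\<^sup>2" for n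
    proof -
      have "(2 powr (2 - p)) ^ n \<le> 1" using q by (simp add: power_le_one)
      then have "(nrm f)\<^sup>2 * (2 powr (2 - p)) ^ n \<le> (nrm f)\<^sup>2 * 1" by (intro mult_left_mono) auto
      then show ?thesis using Asmall[of n] by simp
    qed
    show "(\<lambda>M. A (- int M)) \<longlonglongrightarrow> 0"
    proof (rule tendsto_sandwich[OF _ _ tendsto_const])
      show "\<forall>\<^sub>F n in sequentially. 0 \<le> A (- int n)" using A0 by simp
      show "\<forall>\<^sub>F n in sequentially. A (- int n) \<le> (nrm f)\<^sup>2 * (2 powr (2 - p)) ^ n" using Asmall by simp
      show "(\<lambda>n. (nrm f)\<^sup>2 * (2 powr (2 - p)) ^ n) \<longlonglongrightarrow> 0"
        using q by (intro tendsto_mult_right_zero LIMSEQ_realpow_zero) auto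
    qed
    show "0 \<le> (nrm f)\<^sup>2" "0 \<le> sob0 ?N * gr f" using sob0 by auto
  qed
  let ?B = "2 powr p * (sob0 ?N * gr f) powr (p / 2)"
  \<comment> \<open>Only finitely many dyadic bands meet this truncation, so it is bounded by
    finitely many terms; Fatou then removes the truncation.\<close>
  define F where "F M x = f x powr p * indicator {x. 2 powi (- int M) \<le> f x \<and> f x < 2 powi (int M + 1)} x" for M x
  have FM: "(\<integral>\<^sup>+x. ennreal (F M x) \<partial>lebesgue) \<le> ennreal ?B" for M
  proof -
    let ?L = "\<lambda>k. {x. 2 powi k \<le> f x}"
    have Lm: "?L k \<in> sets lebesgue" for k by (rule level_set) simp
    have le: "F M x \<le> (\<Sum>k\<in>{- int M .. int M}. 2 powr p * (2 powi k) powr p * indicator (?L k) x)" for x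
    proof (cases "2 powi (- int M) \<le> f x \<and> f x < 2 powi (int M + 1)")
      case True
      have fx: "f x > 0" using True by (smt (verit) zero_less_power_int)
      define k where "k = \<lfloor>log 2 (f x)\<rfloor>"
      have k: "2 powi k \<le> f x" "f x < 2 powi (k + 1)"
      proof -
        have e: "(2::real) powi j = 2 powr real_of_int j" for j by (rule powr_real_of_int'[symmetric]) auto
        have "real_of_int k \<le> log 2 (f x)" unfolding k_def by simp
        then show "2 powi k \<le> f x" unfolding e using fx by (simp add: le_log_iff)
        have "log 2 (f x) < real_of_int (k + 1)" unfolding k_def by linarith
        then show "f x < 2 powi (k + 1)" unfolding e using fx by (simp add: log_less_iff)
      qed
      have kM: "- int M \<le> k" "k \<le> int M"
      proof -
        have "(2::real) powi (- int M) < 2 powi (k + 1)" using True k by linarith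
        then have "- int M < k + 1" using power_int_increasing[of "k + 1" "- int M" "2::real"] by linarith
        then show "- int M \<le> k" by simp
        have "(2::real) powi k < 2 powi (int M + 1)" using True k by linarith
        then have "k < int M + 1" using power_int_increasing[of "int M + 1" k "2::real"] by linarith
        then show "k \<le> int M" by simp
      qed
      have "F M x = f x powr p" unfolding F_def using True by simp
      also have "\<dots> \<le> (2 * 2 powi k) powr p" using k fx pf(5) by (intro powr_mono2) (auto simp: power_int_add)
      also have "\<dots> = 2 powr p * (2 powi k) powr p * indicator (?L k) x" using k by (simp add: powr_mult)
      also have "\<dots> \<le> (\<Sum>k\<in>{- int M .. int M}. 2 powr p * (2 powi k) powr p * indicator (?L k) x)"
        using kM by (intro member_le_sum) auto
      finally show ?thesis .
    next
      case False
      then show ?thesis unfolding F_def by (auto intro!: sum_nonneg)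
    qed
    have "(\<integral>\<^sup>+x. ennreal (F M x) \<partial>lebesgue) \<le> (\<integral>\<^sup>+x. ennreal (\<Sum>k\<in>{- int M .. int M}. 2 powr p * (2 powi k) powr p * indicator (?L k) x) \<partial>lebesgue)"
      by (intro nn_integral_mono ennreal_leI le)
    also have "\<dots> = (\<integral>\<^sup>+x. (\<Sum>k\<in>{- int M .. int M}. ennreal (2 powr p * (2 powi k) powr p) * indicator (?L k) x) \<partial>lebesgue)"
      by (intro nn_integral_cong) (auto simp: sum_ennreal[symmetric] ennreal_mult ennreal_indicator intro!: sum.cong)
    also have "\<dots> = (\<Sum>k\<in>{- int M .. int M}. ennreal (2 powr p * (2 powi k) powr p) * emeasure lebesgue (?L k))"
      using Lm by (subst nn_integral_sum) (simp_all only: nn_integral_cmult_indicator[OF Lm], simp_all)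
    also have "\<dots> = (\<Sum>k\<in>{- int M .. int M}. ennreal (2 powr p * A k))"
    proof (intro sum.cong refl)
      fix k
      have "emeasure lebesgue (?L k) = ennreal (level f (2 powi k))"
        using level_indicator(1)[OF fL, of "2 powi k"] unfolding level_def
        by (simp add: emeasure_eq_ennreal_measure zero_less_power_int)
      then show "ennreal (2 powr p * (2 powi k) powr p) * emeasure lebesgue (?L k) = ennreal (2 powr p * A k)"
        unfolding A_def by (simp add: ennreal_mult[symmetric] mult.assoc)
    qed
    also have "\<dots> = ennreal (2 powr p * S M)"
      unfolding S_def using A0 by (simp add: sum_ennreal sum_distrib_left)
    also have "\<dots> \<le> ennreal ?B" by (intro ennreal_leI mult_left_mono SL) simp
    finally show ?thesis .
  qed
  have conv: "(\<lambda>M. ennreal (F M x)) \<longlonglongrightarrow> ennreal (f x powr p)" for x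
  proof (cases "f x = 0")
    case True
    then have "F M x = 0" for M unfolding F_def using pf(5) by simp
    then show ?thesis using True by simp
  next
    case False
    then have fx: "f x > 0" using f0[of x] by simp
    have "\<forall>\<^sub>F M in sequentially. 2 powi (- int M) \<le> f x"
    proof -
      have "(\<lambda>M. (1 / 2 :: real) ^ M) \<longlonglongrightarrow> 0" by (intro LIMSEQ_realpow_zero) auto
      then have "\<forall>\<^sub>F M in sequentially. (1 / 2) ^ M < f x" using fx by (rule order_tendstoD)
      then show ?thesis by eventually_elim (simp add: power_int_minus power_one_over inverse_eq_divide)
    qed
    moreover have "\<forall>\<^sub>F M in sequentially. f x < 2 powi (int M + 1)"
    proof -
      obtain n where n: "f x < 2 ^ n" using real_arch_pow[of 2 "f x"] by auto
      show ?thesis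
      proof (rule eventually_sequentiallyI[of n])
        fix M assume "n \<le> M"
        then have "(2::real) ^ n \<le> 2 ^ (M + 1)" by (intro power_increasing) auto
        moreover have "2 powi (int M + 1) = (2::real) ^ (M + 1)" by (simp add: power_int_add)
        ultimately show "f x < 2 powi (int M + 1)" using n by simp
      qed
    qed
    ultimately have "\<forall>\<^sub>F M in sequentially. ennreal (F M x) = ennreal (f x powr p)"
      by eventually_elim (simp add: F_def)
    then show ?thesis by (rule tendsto_eventually)
  qed
  have "(\<integral>\<^sup>+x. ennreal (f x powr p) \<partial>lebesgue) = (\<integral>\<^sup>+x. liminf (\<lambda>M. ennreal (F M x)) \<partial>lebesgue)"
    by (intro nn_integral_cong) (use conv lim_imp_Liminf[OF trivial_limit_sequentially] in metis)
  also have "\<dots> \<le> liminf (\<lambda>M. \<integral>\<^sup>+x. ennreal (F M x) \<partial>lebesgue)"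
    unfolding F_def by (intro nn_integral_liminf) measurable
  also have "\<dots> \<le> ennreal ?B"
    using FM by (intro Liminf_le always_eventually allI) simp_all
  also have "?B = sobK ?N * gr f powr (p / 2)"
    unfolding sobK_def p_def[symmetric] using sob0 by (simp add: powr_mult)
  finally show ?thesis unfolding p_def .
qed

lemma sobolev:
  fixes U :: "real ^ 'n \<Rightarrow> real"
  assumes N: "CARD('n) \<ge> 3" and U: "U \<in> H1"
  shows "integrable lebesgue (\<lambda>x. \<bar>U x\<bar> powr crit_exp CARD('n))"
    and "(LINT x|lebesgue. \<bar>U x\<bar> powr crit_exp CARD('n)) \<le> sobK CARD('n) * gr U powr (crit_exp CARD('n) / 2)"
proof -
  let ?p = "crit_exp CARD('n)"
  have [measurable]: "U \<in> borel_measurable lebesgue" by (rule H1_meas[OF U])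
  have K: "0 \<le> sobK CARD('n)" unfolding sobK_def by simp
  have "(\<integral>\<^sup>+x. ennreal (\<bar>U x\<bar> powr ?p) \<partial>lebesgue) \<le> ennreal (sobK CARD('n) * gr (\<lambda>x. \<bar>U x\<bar>) powr (?p / 2))"
    using sobolev_pos[OF N abs_H1(1)[OF U]] by simp
  also have "\<dots> \<le> ennreal (sobK CARD('n) * gr U powr (?p / 2))"
    using abs_H1(2)[OF U] crit_exp_facts(5)[OF N] K by (intro ennreal_leI mult_left_mono powr_mono2) auto
  finally have le: "(\<integral>\<^sup>+x. ennreal (\<bar>U x\<bar> powr ?p) \<partial>lebesgue) \<le> ennreal (sobK CARD('n) * gr U powr (?p / 2))" .
  show i: "integrable lebesgue (\<lambda>x. \<bar>U x\<bar> powr ?p)"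
    using le by (intro integrableI_bounded) (auto simp: le_less_trans)
  have "ennreal (LINT x|lebesgue. \<bar>U x\<bar> powr ?p) \<le> ennreal (sobK CARD('n) * gr U powr (?p / 2))"
    using le by (subst nn_integral_eq_integral[OF i, symmetric]) auto
  then show "(LINT x|lebesgue. \<bar>U x\<bar> powr ?p) \<le> sobK CARD('n) * gr U powr (?p / 2)"
    using K by (subst (asm) ennreal_le_iff) auto
qed

section \<open>Convergence tools\<close>

text \<open>A form of the Vitali argument: the part of \<open>f n\<close> above a small multiple of
  \<open>g n\<close> is dominated by one integrable function, and the rest has small integral since
  those of \<open>g n\<close> are bounded. The Brezis-Lieb lemma and both weak convergence
  statements below are instances.\<close>

lemma integral_tendsto_0_eps:
  fixes f g :: "nat \<Rightarrow> 'a \<Rightarrow> real"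
  assumes f: "\<And>n. integrable M (f n)" "\<And>n x. 0 \<le> f n x" "AE x in M. (\<lambda>n. f n x) \<longlonglongrightarrow> 0"
    and g: "\<And>n. integrable M (g n)" "\<And>n x. 0 \<le> g n x" "\<And>n. (LINT x|M. g n x) \<le> C"
    and h: "\<And>e. e > 0 \<Longrightarrow> \<exists>h. integrable M h \<and> (\<forall>n x. f n x \<le> e * g n x + h x)"
  shows "(\<lambda>n. LINT x|M. f n x) \<longlonglongrightarrow> 0"
proof (rule LIMSEQ_I)
  fix e :: real assume e: "e > 0"
  have C: "0 \<le> C" using g(3)[of 0] Bochner_Integration.integral_nonneg[of M "g 0"] g(2) by (meson order_trans)
  \<comment> \<open>Makes the share of \<open>g n\<close> cost less than e/2; the
    \<open>C + 1\<close> covers the case C = 0.\<close>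
  define d where "d = e / (2 * (C + 1))"
  have d: "d > 0" "d * C < e / 2" unfolding d_def using e C by (auto simp: field_simps)
  obtain h where h: "integrable M h" "\<And>n x. f n x \<le> d * g n x + h x"
    using assms(7)[OF d(1)] by blast
  define q where "q n x = max (f n x - d * g n x) 0" for n x
  have q: "integrable M (q n)" for n unfolding q_def using f(1) g(1) by auto
  have "(\<lambda>n. LINT x|M. q n x) \<longlonglongrightarrow> (LINT x|M. 0)"
  proof (rule integral_dominated_convergence[where w = "\<lambda>x. \<bar>h x\<bar>"])
    show "q n \<in> borel_measurable M" for n using q by auto
    show "integrable M (\<lambda>x. \<bar>h x\<bar>)" using h(1) by simp
    show "AE x in M. norm (q n x) \<le> \<bar>h x\<bar>" for n
      using h(2)[of n] unfolding q_def by (intro AE_I2) (smt (verit) real_norm_def)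
    show "AE x in M. (\<lambda>n. q n x) \<longlonglongrightarrow> 0"
      using f(3)
    proof eventually_elim
      case (elim x)
      show ?case
        by (rule tendsto_sandwich[OF _ _ tendsto_const elim])
           (use d f(2) g(2) in \<open>auto simp: q_def\<close>)
    qed
  qed simp
  then obtain N where N: "\<And>n. n \<ge> N \<Longrightarrow> \<bar>LINT x|M. q n x\<bar> < e / 2"
    using LIMSEQ_D[of _ 0 "e / 2"] e by fastforce
  have "\<bar>LINT x|M. f n x\<bar> < e" if n: "n \<ge> N" for n
  proof -
    have qg: "integrable M (\<lambda>x. q n x + d * g n x)" using q g(1) by auto
    have "(LINT x|M. f n x) \<le> (LINT x|M. q n x + d * g n x)"
      by (rule integral_mono[OF f(1) qg]) (simp add: q_def)
    also have "\<dots> = (LINT x|M. q n x) + d * (LINT x|M. g n x)" using q g(1) by simp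
    also have "\<dots> \<le> (LINT x|M. q n x) + d * C" using d g(3)[of n] by simp
    finally have "(LINT x|M. f n x) < e" using N[OF n] d by linarith
    moreover have "0 \<le> (LINT x|M. f n x)" using f(2) by (intro Bochner_Integration.integral_nonneg) auto
    ultimately show ?thesis by simp
  qed
  then show "\<exists>no. \<forall>n\<ge>no. norm ((LINT x|M. f n x) - 0) < e" by auto
qed

text \<open>Young's inequality after normalizing both factors. If one of them vanishes a.e. no
  normalization is possible, but then the product vanishes a.e. too.\<close>

lemma holder:
  fixes f g :: "'a \<Rightarrow> real"
  assumes q: "q > 1" "q' > 1" "1 / q + 1 / q' = 1"
    and m: "f \<in> borel_measurable M" "g \<in> borel_measurable M"
    and i: "integrable M (\<lambda>x. \<bar>f x\<bar> powr q)" "integrable M (\<lambda>x. \<bar>g x\<bar> powr q')"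
  shows "integrable M (\<lambda>x. f x * g x)"
    "(LINT x|M. \<bar>f x * g x\<bar>) \<le> (LINT x|M. \<bar>f x\<bar> powr q) powr (1 / q) * (LINT x|M. \<bar>g x\<bar> powr q') powr (1 / q')"
proof -
  show fg: "integrable M (\<lambda>x. f x * g x)"
  proof (rule Bochner_Integration.integrable_bound)
    show "integrable M (\<lambda>x. \<bar>f x\<bar> powr q / q + \<bar>g x\<bar> powr q' / q')" using i by auto
    show "AE x in M. norm (f x * g x) \<le> norm (\<bar>f x\<bar> powr q / q + \<bar>g x\<bar> powr q' / q')"
    proof (rule AE_I2)
      fix x
      have "\<bar>f x\<bar> * \<bar>g x\<bar> \<le> \<bar>f x\<bar> powr q / q + \<bar>g x\<bar> powr q' / q'"
        by (rule Youngs_inequality[OF q]) auto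
      then show "norm (f x * g x) \<le> norm (\<bar>f x\<bar> powr q / q + \<bar>g x\<bar> powr q' / q')"
        by (simp add: abs_mult)
    qed
  qed (use m in simp)
  let ?A = "LINT x|M. \<bar>f x\<bar> powr q" and ?B = "LINT x|M. \<bar>g x\<bar> powr q'"
  have A0: "0 \<le> ?A" and B0: "0 \<le> ?B" by (auto intro!: Bochner_Integration.integral_nonneg)
  have zero: "(LINT x|M. \<bar>f x * g x\<bar>) = 0" if "AE x in M. f x * g x = 0"
  proof -
    have "(LINT x|M. \<bar>f x * g x\<bar>) = (LINT x|M. 0)"
      using that m by (intro integral_cong_AE) auto
    then show ?thesis by simp
  qed
  show "(LINT x|M. \<bar>f x * g x\<bar>) \<le> ?A powr (1 / q) * ?B powr (1 / q')"
  proof (cases "?A = 0 \<or> ?B = 0")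
    case True
    have "AE x in M. f x * g x = 0"
    proof (cases "?A = 0")
      case True
      then have "AE x in M. \<bar>f x\<bar> powr q = 0" using integral_nonneg_eq_0_iff_AE[OF i(1)] by simp
      then show ?thesis by eventually_elim simp
    next
      case False
      then have "AE x in M. \<bar>g x\<bar> powr q' = 0" using True integral_nonneg_eq_0_iff_AE[OF i(2)] by simp
      then show ?thesis by eventually_elim simp
    qed
    then show ?thesis using zero by simp
  next
    case False
    then have A: "?A > 0" and B: "?B > 0" using A0 B0 by linarith+
    define a where "a = ?A powr (1 / q)"
    define b where "b = ?B powr (1 / q')"
    have a: "a > 0" "a powr q = ?A" unfolding a_def using A q by (auto simp: powr_powr)
    have b: "b > 0" "b powr q' = ?B" unfolding b_def using B q by (auto simp: powr_powr)
    have "(LINT x|M. \<bar>f x * g x\<bar> / (a * b)) \<le> (LINT x|M. \<bar>f x\<bar> powr q / (q * ?A) + \<bar>g x\<bar> powr q' / (q' * ?B))"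
    proof (rule integral_mono)
      show "integrable M (\<lambda>x. \<bar>f x * g x\<bar> / (a * b))" using fg by auto
      show "integrable M (\<lambda>x. \<bar>f x\<bar> powr q / (q * ?A) + \<bar>g x\<bar> powr q' / (q' * ?B))" using i by auto
      fix x
      have "(\<bar>f x\<bar> / a) * (\<bar>g x\<bar> / b) \<le> (\<bar>f x\<bar> / a) powr q / q + (\<bar>g x\<bar> / b) powr q' / q'"
        by (rule Youngs_inequality[OF q]) (use a b in auto)
      then show "\<bar>f x * g x\<bar> / (a * b) \<le> \<bar>f x\<bar> powr q / (q * ?A) + \<bar>g x\<bar> powr q' / (q' * ?B)"
        using a b by (simp add: powr_divide abs_mult mult.commute)
    qed
    also have "\<dots> = 1 / q + 1 / q'" using i A B q by simp
    finally have "(LINT x|M. \<bar>f x * g x\<bar>) / (a * b) \<le> 1" using q by simp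
    then show ?thesis unfolding a_def[symmetric] b_def[symmetric] using a b by (simp add: field_simps)
  qed
qed

lemma young_eps:
  assumes q: "q > 1" "q' > 1" "1 / q + 1 / q' = (1::real)" and e: "e > 0"
  obtains C where "C > 0" "\<And>a b. 0 \<le> a \<Longrightarrow> 0 \<le> b \<Longrightarrow> a * b \<le> C * a powr q + e * b powr q'"
proof -
  define d where "d = (q' * e) powr (1 / q')"
  have d: "d > 0" "d powr q' = q' * e" unfolding d_def using q e by (auto simp: powr_powr)
  show ?thesis
  proof (rule that)
    show "1 / (q * d powr q) > 0" using q d by simp
    fix a b :: real assume ab: "0 \<le> a" "0 \<le> b"
    have "(a / d) * (d * b) \<le> (a / d) powr q / q + (d * b) powr q' / q'"
      by (rule Youngs_inequality[OF q]) (use ab d in auto)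
    then show "a * b \<le> 1 / (q * d powr q) * a powr q + e * b powr q'"
      using d ab q by (simp add: powr_divide powr_mult mult.commute)
  qed
qed

text \<open>N/2 and half the critical exponent are conjugate, so a weight in the Lebesgue space of
  exponent N/2 pairs with squares of functions in the critical space.\<close>

lemma crit_conj:
  assumes "N \<ge> 3"
  shows "real N / 2 > 1" "crit_exp N / 2 > 1" "1 / (real N / 2) + 1 / (crit_exp N / 2) = 1"
  using assms unfolding crit_exp_def by (auto simp: field_simps)

lemma sq_powr_half: "\<bar>(a::real)\<^sup>2\<bar> powr (p / 2) = \<bar>a\<bar> powr p"
proof (cases "a = 0")
  case False
  have "\<bar>a\<^sup>2\<bar> = \<bar>a\<bar> powr 2" using False by simp
  then have "\<bar>a\<^sup>2\<bar> powr (p / 2) = (\<bar>a\<bar> powr 2) powr (p / 2)" by (simp only:)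
  then show ?thesis by (simp only: powr_powr) simp
qed simp

definition lp :: "(real ^ 'n \<Rightarrow> real) \<Rightarrow> real" where
  "lp U = (LINT x|lebesgue. \<bar>U x\<bar> powr crit_exp CARD('n))"

abbreviation Lcrit :: "(real ^ 'n \<Rightarrow> real) set" where
  "Lcrit \<equiv> Lp_space (crit_exp CARD('n))"

lemma lp_nonneg [simp]: "0 \<le> lp U"
  unfolding lp_def by (rule Bochner_Integration.integral_nonneg) simp

lemma Lcrit_sq:
  fixes w :: "real ^ 'n \<Rightarrow> real"
  assumes "w \<in> Lcrit"
  shows "(\<lambda>x. (w x)\<^sup>2) \<in> borel_measurable lebesgue" "integrable lebesgue (\<lambda>x. \<bar>(w x)\<^sup>2\<bar> powr (crit_exp CARD('n) / 2))"
    "(LINT x|lebesgue. \<bar>(w x)\<^sup>2\<bar> powr (crit_exp CARD('n) / 2)) = lp w"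
  using assms unfolding Lp_space_def lp_def sq_powr_half by auto

lemma holder_sq:
  fixes a w :: "real ^ 'n \<Rightarrow> real"
  assumes N: "CARD('n) \<ge> 3" and a: "a \<in> Lp_space (real CARD('n) / 2)" and w: "w \<in> Lcrit"
  shows "integrable lebesgue (\<lambda>x. a x * (w x)\<^sup>2)"
    "(LINT x|lebesgue. \<bar>a x\<bar> * (w x)\<^sup>2) \<le> Lp_norm (real CARD('n) / 2) a * lp w powr (2 / crit_exp CARD('n))"
proof -
  note c = crit_conj[OF N]
  have am: "a \<in> borel_measurable lebesgue" "integrable lebesgue (\<lambda>x. \<bar>a x\<bar> powr (real CARD('n) / 2))"
    using a unfolding Lp_space_def by auto
  show "integrable lebesgue (\<lambda>x. a x * (w x)\<^sup>2)"
    by (rule holder(1)[OF c am(1) Lcrit_sq(1)[OF w] am(2) Lcrit_sq(2)[OF w]])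
  show "(LINT x|lebesgue. \<bar>a x\<bar> * (w x)\<^sup>2) \<le> Lp_norm (real CARD('n) / 2) a * lp w powr (2 / crit_exp CARD('n))"
    using holder(2)[OF c am(1) Lcrit_sq(1)[OF w] am(2) Lcrit_sq(2)[OF w]]
    unfolding Lcrit_sq(3)[OF w] Lp_norm_def by (simp add: abs_mult)
qed

text \<open>Young's inequality with a small constant supplies the splitting needed for
  \<open>integral_tendsto_0_eps\<close>: a small part of the critical power of \<open>w n\<close>
  plus a fixed integrable power of the weight.\<close>

lemma weighted_sq_tendsto_0:
  fixes a :: "real ^ 'n \<Rightarrow> real"
  assumes N: "CARD('n) \<ge> 3" and a: "a \<in> Lp_space (real CARD('n) / 2)" and w: "\<And>n. w n \<in> Lcrit" "\<And>n. lp (w n) \<le> C"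
    and lim: "AE x in lebesgue. (\<lambda>n. w n x) \<longlonglongrightarrow> 0"
  shows "(\<lambda>n. LINT x|lebesgue. \<bar>a x\<bar> * (w n x)\<^sup>2) \<longlonglongrightarrow> 0"
proof (rule integral_tendsto_0_eps[where g = "\<lambda>n x. \<bar>w n x\<bar> powr crit_exp CARD('n)" and C = C])
  show "integrable lebesgue (\<lambda>x. \<bar>a x\<bar> * (w n x)\<^sup>2)" for n
    using integrable_abs[OF holder_sq(1)[OF N a w(1), of n]] by (simp add: abs_mult)
  show "AE x in lebesgue. (\<lambda>n. \<bar>a x\<bar> * (w n x)\<^sup>2) \<longlonglongrightarrow> 0"
    using lim
  proof eventually_elim
    case (elim x)
    have "(\<lambda>n. \<bar>a x\<bar> * (w n x)\<^sup>2) \<longlonglongrightarrow> \<bar>a x\<bar> * 0\<^sup>2" by (intro tendsto_intros elim)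
    then show ?case by simp
  qed
  show "integrable lebesgue (\<lambda>x. \<bar>w n x\<bar> powr crit_exp CARD('n))" for n
    using w(1)[of n] unfolding Lp_space_def by simp
  show "(LINT x|lebesgue. \<bar>w n x\<bar> powr crit_exp CARD('n)) \<le> C" for n using w(2)[of n] unfolding lp_def .
  fix e :: real assume e: "e > 0"
  obtain K where K: "K > 0" "\<And>a b. 0 \<le> a \<Longrightarrow> 0 \<le> b \<Longrightarrow> a * b \<le> K * a powr (real CARD('n) / 2) + e * b powr (crit_exp CARD('n) / 2)"
    using young_eps[OF crit_conj[OF N] e] by blast
  show "\<exists>h. integrable lebesgue h \<and> (\<forall>n x. \<bar>a x\<bar> * (w n x)\<^sup>2 \<le> e * \<bar>w n x\<bar> powr crit_exp CARD('n) + h x)"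
  proof (intro exI conjI allI)
    show "integrable lebesgue (\<lambda>x. K * \<bar>a x\<bar> powr (real CARD('n) / 2))"
      using a unfolding Lp_space_def by auto
    fix n x
    show "\<bar>a x\<bar> * (w n x)\<^sup>2 \<le> e * \<bar>w n x\<bar> powr crit_exp CARD('n) + K * \<bar>a x\<bar> powr (real CARD('n) / 2)"
      using K(2)[of "\<bar>a x\<bar>" "(w n x)\<^sup>2"] sq_powr_half[of "w n x" "crit_exp CARD('n)"] by simp
  qed
qed auto

section \<open>Brezis-Lieb splitting and weak convergence from a.e. convergence\<close>

lemma tendsto_abs_powr:
  fixes f :: "'a \<Rightarrow> real"
  assumes "(f \<longlongrightarrow> a) F" "p > 0"
  shows "((\<lambda>n. \<bar>f n\<bar> powr p) \<longlongrightarrow> \<bar>a\<bar> powr p) F"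
  using assms by (intro tendsto_powr2 tendsto_rabs tendsto_const) auto

text \<open>If a is at most a small fraction d of b, continuity of the power at 1 makes the change
  at most e times the power of b. Otherwise b, and with it the whole difference, is controlled by
  a.\<close>

lemma brezis_lieb_pointwise:
  assumes p: "p \<ge> (1::real)" and e: "e > 0"
  obtains C where "C > 0" "\<And>a b. \<bar>\<bar>a + b\<bar> powr p - \<bar>b\<bar> powr p\<bar> \<le> e * \<bar>b\<bar> powr p + C * \<bar>a\<bar> powr p"
proof -
  have "((\<lambda>d. (1 + d) powr p) \<longlongrightarrow> (1 + 0) powr p) (at_right (0::real))"
    using p by (intro tendsto_intros) auto
  then have e1: "\<forall>\<^sub>F d in at_right (0::real). (1 + d) powr p < 1 + e"
    by (rule order_tendstoD) (use e in simp)
  have "((\<lambda>d. (1 - d) powr p) \<longlongrightarrow> (1 - 0) powr p) (at_right (0::real))"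
    using p by (intro tendsto_intros) auto
  then have e2: "\<forall>\<^sub>F d in at_right (0::real). (1 - d) powr p > 1 - e"
    by (rule order_tendstoD) (use e in simp)
  have e3: "\<forall>\<^sub>F d in at_right (0::real). 0 < d \<and> d < 1"
    by (auto simp: eventually_at_right_field intro: exI[of _ 1])
  obtain d where d: "(1 + d) powr p < 1 + e" "(1 - d) powr p > 1 - e" "0 < d" "d < 1"
    using eventually_happens[OF eventually_conj[OF e1 eventually_conj[OF e2 e3]]] trivial_limit_at_right_real by auto
  define C where "C = (1 + 1 / d) powr p + (1 / d) powr p"
  show ?thesis
  proof (rule that)
    have "1 + 1 / d > 0" using d by (simp add: add_pos_pos)
    then show "C > 0" unfolding C_def using d by (intro add_pos_pos) auto
    fix a b :: real
    show "\<bar>\<bar>a + b\<bar> powr p - \<bar>b\<bar> powr p\<bar> \<le> e * \<bar>b\<bar> powr p + C * \<bar>a\<bar> powr p"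
    proof (cases "\<bar>a\<bar> < d * \<bar>b\<bar>")
      case True
      have lo: "(1 - d) * \<bar>b\<bar> \<le> \<bar>a + b\<bar>" and hi: "\<bar>a + b\<bar> \<le> (1 + d) * \<bar>b\<bar>"
        using True by (auto simp: algebra_simps)
      have "\<bar>a + b\<bar> powr p \<le> ((1 + d) * \<bar>b\<bar>) powr p" using hi p by (intro powr_mono2) auto
      also have "\<dots> = (1 + d) powr p * \<bar>b\<bar> powr p" using d by (simp add: powr_mult)
      also have "\<dots> \<le> (1 + e) * \<bar>b\<bar> powr p" using d by (intro mult_right_mono) auto
      finally have 1: "\<bar>a + b\<bar> powr p - \<bar>b\<bar> powr p \<le> e * \<bar>b\<bar> powr p" by (simp add: algebra_simps)
      have "(1 - e) * \<bar>b\<bar> powr p \<le> (1 - d) powr p * \<bar>b\<bar> powr p" using d by (intro mult_right_mono) auto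
      also have "\<dots> = ((1 - d) * \<bar>b\<bar>) powr p" using d by (simp add: powr_mult)
      also have "\<dots> \<le> \<bar>a + b\<bar> powr p" using lo p d by (intro powr_mono2) auto
      finally have 2: "\<bar>b\<bar> powr p - \<bar>a + b\<bar> powr p \<le> e * \<bar>b\<bar> powr p" by (simp add: algebra_simps)
      have "0 \<le> C * \<bar>a\<bar> powr p" unfolding C_def by simp
      then show ?thesis using 1 2 by linarith
    next
      case False
      then have b: "\<bar>b\<bar> \<le> 1 / d * \<bar>a\<bar>" using d by (simp add: field_simps)
      then have ab: "\<bar>a + b\<bar> \<le> (1 + 1 / d) * \<bar>a\<bar>" by (simp add: algebra_simps)
      have "\<bar>a + b\<bar> powr p \<le> ((1 + 1 / d) * \<bar>a\<bar>) powr p" using ab p by (intro powr_mono2) auto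
      also have "\<dots> = (1 + 1 / d) powr p * \<bar>a\<bar> powr p" using d by (subst powr_mult) auto
      finally have 1: "\<bar>a + b\<bar> powr p \<le> (1 + 1 / d) powr p * \<bar>a\<bar> powr p" .
      have "\<bar>b\<bar> powr p \<le> (1 / d * \<bar>a\<bar>) powr p" using b p by (intro powr_mono2) auto
      also have "\<dots> = (1 / d) powr p * \<bar>a\<bar> powr p" using d by (subst powr_mult) auto
      finally have 2: "\<bar>b\<bar> powr p \<le> (1 / d) powr p * \<bar>a\<bar> powr p" .
      have "0 \<le> e * \<bar>b\<bar> powr p" "0 \<le> \<bar>a + b\<bar> powr p" "0 \<le> \<bar>b\<bar> powr p" using e by auto
      then show ?thesis using 1 2 unfolding C_def distrib_right by linarith
    qed
  qed
qed

lemma Lcrit_add: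
  fixes u v :: "real ^ 'n \<Rightarrow> real"
  assumes N: "CARD('n) \<ge> 3" and "u \<in> Lcrit" "v \<in> Lcrit"
  shows "(\<lambda>x. u x + v x) \<in> Lcrit"
proof -
  let ?p = "crit_exp CARD('n)"
  have p: "?p \<ge> 1" using crit_exp_facts(1)[OF N] by simp
  obtain C where C: "C > 0" "\<And>a b. \<bar>\<bar>a + b\<bar> powr ?p - \<bar>b\<bar> powr ?p\<bar> \<le> 1 * \<bar>b\<bar> powr ?p + C * \<bar>a\<bar> powr ?p"
    using brezis_lieb_pointwise[OF p, of 1] by auto
  have uv: "u \<in> borel_measurable lebesgue" "v \<in> borel_measurable lebesgue"
    "integrable lebesgue (\<lambda>x. \<bar>u x\<bar> powr ?p)" "integrable lebesgue (\<lambda>x. \<bar>v x\<bar> powr ?p)"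
    using assms unfolding Lp_space_def by auto
  have "integrable lebesgue (\<lambda>x. \<bar>u x + v x\<bar> powr ?p)"
  proof (rule Bochner_Integration.integrable_bound)
    show "integrable lebesgue (\<lambda>x. 2 * \<bar>v x\<bar> powr ?p + C * \<bar>u x\<bar> powr ?p)" using uv by auto
    show "AE x in lebesgue. norm (\<bar>u x + v x\<bar> powr ?p) \<le> norm (2 * \<bar>v x\<bar> powr ?p + C * \<bar>u x\<bar> powr ?p)"
    proof (rule AE_I2)
      fix x
      have "\<bar>u x + v x\<bar> powr ?p \<le> 2 * \<bar>v x\<bar> powr ?p + C * \<bar>u x\<bar> powr ?p"
        using C(2)[of "u x" "v x"] by linarith
      then show "norm (\<bar>u x + v x\<bar> powr ?p) \<le> norm (2 * \<bar>v x\<bar> powr ?p + C * \<bar>u x\<bar> powr ?p)" by simp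
    qed
  qed (use uv in auto)
  then show ?thesis using uv unfolding Lp_space_def by auto
qed

text \<open>The defect is pointwise at most a small multiple of the power of \<open>w n\<close> plus
  a constant times that of u, so \<open>integral_tendsto_0_eps\<close> applies although
  \<open>w n\<close> need not tend to 0 in norm.\<close>

lemma brezis_lieb:
  fixes u :: "real ^ 'n \<Rightarrow> real"
  assumes N: "CARD('n) \<ge> 3" and u: "u \<in> Lcrit" and w: "\<And>n. w n \<in> Lcrit" "\<And>n. lp (w n) \<le> C"
    and lim: "AE x in lebesgue. (\<lambda>n. w n x) \<longlonglongrightarrow> 0"
  shows "(\<lambda>n. lp (\<lambda>x. u x + w n x) - lp u - lp (w n)) \<longlonglongrightarrow> 0"
proof -
  let ?p = "crit_exp CARD('n)"
  have p: "?p \<ge> 1" "?p > 0" using crit_exp_facts(1)[OF N] by auto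
  have ui: "integrable lebesgue (\<lambda>x. \<bar>u x\<bar> powr ?p)" and wi: "integrable lebesgue (\<lambda>x. \<bar>w n x\<bar> powr ?p)"
    and uwi: "integrable lebesgue (\<lambda>x. \<bar>u x + w n x\<bar> powr ?p)" for n
    using u w(1)[of n] Lcrit_add[OF N u w(1), of n] unfolding Lp_space_def by auto
  define f where "f n x = \<bar>\<bar>u x + w n x\<bar> powr ?p - \<bar>w n x\<bar> powr ?p - \<bar>u x\<bar> powr ?p\<bar>" for n x
  have f0: "(\<lambda>n. LINT x|lebesgue. f n x) \<longlonglongrightarrow> 0"
  proof (rule integral_tendsto_0_eps[where g = "\<lambda>n x. \<bar>w n x\<bar> powr ?p" and C = C])
    show "integrable lebesgue (f n)" for n unfolding f_def using ui wi uwi by auto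
    show "0 \<le> f n x" for n x unfolding f_def by simp
    show "AE x in lebesgue. (\<lambda>n. f n x) \<longlonglongrightarrow> 0"
      using lim
    proof eventually_elim
      case (elim x)
      have "(\<lambda>n. f n x) \<longlonglongrightarrow> \<bar>\<bar>u x + 0\<bar> powr ?p - \<bar>0\<bar> powr ?p - \<bar>u x\<bar> powr ?p\<bar>"
        unfolding f_def
        by (intro tendsto_rabs tendsto_diff tendsto_abs_powr tendsto_add tendsto_const elim p)
      then show ?case by simp
    qed
    show "(LINT x|lebesgue. \<bar>w n x\<bar> powr ?p) \<le> C" for n using w(2)[of n] unfolding lp_def .
    fix e :: real assume e: "e > 0"
    obtain K where K: "K > 0" "\<And>a b. \<bar>\<bar>a + b\<bar> powr ?p - \<bar>b\<bar> powr ?p\<bar> \<le> e * \<bar>b\<bar> powr ?p + K * \<bar>a\<bar> powr ?p"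
      using brezis_lieb_pointwise[OF p(1) e] by blast
    show "\<exists>h. integrable lebesgue h \<and> (\<forall>n x. f n x \<le> e * \<bar>w n x\<bar> powr ?p + h x)"
    proof (intro exI conjI allI)
      show "integrable lebesgue (\<lambda>x. (K + 1) * \<bar>u x\<bar> powr ?p)" using ui by auto
      fix n x
      have "0 \<le> \<bar>u x\<bar> powr ?p" by simp
      then show "f n x \<le> e * \<bar>w n x\<bar> powr ?p + (K + 1) * \<bar>u x\<bar> powr ?p"
        unfolding f_def distrib_right using K(2)[of "u x" "w n x"] by linarith
    qed
  qed (use wi in auto)
  have le: "norm (lp (\<lambda>x. u x + w n x) - lp u - lp (w n)) \<le> (LINT x|lebesgue. f n x)" for n
  proof -
    have "lp (\<lambda>x. u x + w n x) - lp u - lp (w n) = (LINT x|lebesgue. \<bar>u x + w n x\<bar> powr ?p - \<bar>w n x\<bar> powr ?p - \<bar>u x\<bar> powr ?p)"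
      unfolding lp_def using ui wi[of n] uwi[of n] by simp
    also have "norm \<dots> \<le> (LINT x|lebesgue. f n x)" unfolding f_def real_norm_def by (rule integral_abs_bound)
    finally show ?thesis .
  qed
  show ?thesis by (rule Lim_null_comparison[OF always_eventually f0]) (use le in blast)
qed

text \<open>The product is at most a small multiple of \<open>(w n x)^2\<close> plus a multiple of
  \<open>(g x)^2\<close>, the form required by \<open>integral_tendsto_0_eps\<close>.\<close>

lemma L2_bounded_AE_weak_0:
  assumes w: "\<And>n. w n \<in> L2" "\<And>n. nrm (w n) \<le> C" and lim: "AE x in lebesgue. (\<lambda>n. w n x) \<longlonglongrightarrow> 0" and g: "g \<in> L2"
  shows "(\<lambda>n. ip (w n) g) \<longlonglongrightarrow> 0"
proof -
  have i: "integrable lebesgue (\<lambda>x. w n x * g x)" for n by (rule L2_mult_integrable[OF w(1) g])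
  have "(\<lambda>n. LINT x|lebesgue. \<bar>w n x * g x\<bar>) \<longlonglongrightarrow> 0"
  proof (rule integral_tendsto_0_eps[where g = "\<lambda>n x. (w n x)\<^sup>2" and C = "C\<^sup>2"])
    show "integrable lebesgue (\<lambda>x. \<bar>w n x * g x\<bar>)" for n using i by auto
    show "AE x in lebesgue. (\<lambda>n. \<bar>w n x * g x\<bar>) \<longlonglongrightarrow> 0"
      using lim
    proof eventually_elim
      case (elim x)
      have "(\<lambda>n. \<bar>w n x * g x\<bar>) \<longlonglongrightarrow> \<bar>0 * g x\<bar>" by (intro tendsto_intros elim)
      then show ?case by simp
    qed
    show "integrable lebesgue (\<lambda>x. (w n x)\<^sup>2)" for n using w(1)[of n] by (simp add: L2_iff)
    show "(LINT x|lebesgue. (w n x)\<^sup>2) \<le> C\<^sup>2" for n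
      unfolding nrm_sq_int[symmetric] using w(2) by (intro power_mono) auto
    fix e :: real assume e: "e > 0"
    show "\<exists>h. integrable lebesgue h \<and> (\<forall>n x. \<bar>w n x * g x\<bar> \<le> e * (w n x)\<^sup>2 + h x)"
    proof (intro exI conjI allI)
      show "integrable lebesgue (\<lambda>x. (g x)\<^sup>2 / e)" using g by (simp add: L2_iff)
      fix n x
      have "2 * (sqrt e * \<bar>w n x\<bar>) * (\<bar>g x\<bar> / sqrt e) \<le> (sqrt e * \<bar>w n x\<bar>)\<^sup>2 + (\<bar>g x\<bar> / sqrt e)\<^sup>2"
        by (rule sum_squares_bound)
      then have "2 * \<bar>w n x * g x\<bar> \<le> e * (w n x)\<^sup>2 + (g x)\<^sup>2 / e"
        using e by (simp add: power_mult_distrib power_divide abs_mult)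
      then show "\<bar>w n x * g x\<bar> \<le> e * (w n x)\<^sup>2 + (g x)\<^sup>2 / e" by linarith
    qed
  qed auto
  then show ?thesis
  proof (rule Lim_null_comparison[rotated])
    show "\<forall>\<^sub>F n in sequentially. norm (ip (w n) g) \<le> (LINT x|lebesgue. \<bar>w n x * g x\<bar>)"
      unfolding ip_def real_norm_def using integral_abs_bound by (intro always_eventually allI)
  qed
qed

section \<open>Compactness\<close>

lemma bounded_diagonal:
  fixes f :: "nat \<Rightarrow> nat \<Rightarrow> real"
  assumes "\<And>k n. \<bar>f k n\<bar> \<le> B k"
  obtains r where "strict_mono (r :: nat \<Rightarrow> nat)" "\<And>k. convergent (\<lambda>n. f k (r n))"
proof -
  interpret subseqs "\<lambda>k s. convergent (\<lambda>n. f k (s n))"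
  proof
    fix k and s :: "nat \<Rightarrow> nat"
    have "bounded (range (\<lambda>n. f k (s n)))" using assms by (auto simp: bounded_iff)
    then obtain l r' where "strict_mono (r' :: nat \<Rightarrow> nat)" "((\<lambda>n. f k (s n)) \<circ> r') \<longlonglongrightarrow> l"
      using bounded_imp_convergent_subsequence by blast
    then show "\<exists>r'. strict_mono r' \<and> convergent (\<lambda>n. f k ((s \<circ> r') n))"
      by (auto simp: convergent_def o_def)
  qed
  have "convergent (\<lambda>n. f k (diagseq n))" for k
  proof -
    \<comment> \<open>Only the tail beyond k is known to refine the k-th subsequence; convergence
      ignores the earlier terms.\<close>
    have "convergent (\<lambda>n. f k ((diagseq \<circ> ((+) (Suc k))) n))"
    proof (rule diagseq_holds)
      fix r s :: "nat \<Rightarrow> nat" and n assume "strict_mono r" "convergent (\<lambda>m. f n (s m))"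
      then show "convergent (\<lambda>m. f n ((s \<circ> r) m))"
        using convergent_subseq_convergent[of "\<lambda>m. f n (s m)" r] by (simp add: o_def)
    qed
    then have "convergent (\<lambda>n. f k (diagseq (n + Suc k)))" by (simp add: o_def add.commute)
    then show ?thesis using convergent_ignore_initial_segment[of "\<lambda>n. f k (diagseq n)" "Suc k"] by simp
  qed
  then show ?thesis using that subseq_diagseq by blast
qed

text \<open>Moving the point of averaging moves the indicator of the cube, and translations of this
  indicator are continuous in L2. By Cauchy-Schwarz d works for all U in the ball
  simultaneously.\<close>

lemma avg_equicont:
  fixes x :: "real ^ 'n"
  assumes r: "r > 0" and e: "e > 0"
  obtains d where "d > 0" "\<And>U y. U \<in> L2 \<Longrightarrow> nrm U \<le> A \<Longrightarrow> dist y x < d \<Longrightarrow> \<bar>avg r U y - avg r U x\<bar> \<le> e * A"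
proof -
  let ?I = "\<lambda>h :: real ^ 'n. indicator (cube r) h :: real"
  have "\<forall>\<^sub>F h in at 0. dist (nrm (\<lambda>x. ?I (x + h) - ?I x)) 0 < e * r ^ CARD('n)"
    by (rule tendstoD[OF tr_continuous[OF cube_L2]]) (use e r in simp)
  then obtain d where d: "d > 0" "\<And>h. h \<noteq> 0 \<Longrightarrow> norm h < d \<Longrightarrow> nrm (\<lambda>x. ?I (x + h) - ?I x) < e * r ^ CARD('n)"
    unfolding eventually_at by auto
  have "\<bar>avg r U y - avg r U x\<bar> \<le> e * A" if U: "U \<in> L2" "nrm U \<le> A" and y: "dist y x < d" for U y
  proof (cases "y = x")
    case False
    have A0: "0 \<le> A" using U(2) nrm_nonneg[of U] by linarith
    have adj: "ip ?I (\<lambda>h. U (z + h)) = ip U (\<lambda>h. ?I (h - z))" for z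
      using tr_ip_adj[OF U(1) cube_L2, of z r] by (simp add: ip_commute add.commute)
    have L: "(\<lambda>h. ?I (h - z)) \<in> L2" for z using tr_L2[OF cube_L2[of r], of "- z"] by simp
    have "\<bar>avg r U y - avg r U x\<bar> = \<bar>ip U (\<lambda>h. ?I (h - y) - ?I (h - x))\<bar> / r ^ CARD('n)"
      unfolding avg_eq_ip adj using ip_diff_right[OF L[of y] L[of x] U(1)] r
      by (simp add: diff_divide_distrib[symmetric] abs_divide)
    also have "\<dots> \<le> (nrm U * nrm (\<lambda>h. ?I (h - y) - ?I (h - x))) / r ^ CARD('n)"
      using r by (intro divide_right_mono ip_le_nrm L2_diff L U) auto
    also have "nrm (\<lambda>h. ?I (h - y) - ?I (h - x)) = nrm (\<lambda>h. ?I (h + (x - y)) - ?I h)"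
      using tr_nrm[OF L2_diff[OF tr_L2[OF cube_L2[of r], of "x - y"] cube_L2[of r]], of "- x"] by (simp add: algebra_simps)
    also have "nrm U * \<dots> \<le> A * (e * r ^ CARD('n))"
      using d(2)[of "x - y"] False y U(2) A0
      by (intro mult_mono) (auto simp: dist_norm norm_minus_commute)
    finally show ?thesis using r by (simp add: divide_right_mono field_simps)
  next
    case True
    have "0 \<le> A" using U(2) nrm_nonneg order_trans by blast
    then show ?thesis using True e by simp
  qed
  then show ?thesis using that d(1) by blast
qed

text \<open>Averages of a bounded sequence converge at every point along a subsequence, and the
  sequence is uniformly close to its averages in L2. A positive integrable weight makes up for the
  infinite measure of the whole space, so only a.e. and weak convergence is claimed.\<close>

lemma H1_compactness:
  fixes U :: "nat \<Rightarrow> real ^ 'n \<Rightarrow> real"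
  assumes U: "\<And>n. U n \<in> H1" "\<And>n. nrm (U n) \<le> A" "\<And>n. gr (U n) \<le> B"
  obtains r W where "strict_mono (r :: nat \<Rightarrow> nat)" "W \<in> H1" "AE x in lebesgue. (\<lambda>n. U (r n) x) \<longlonglongrightarrow> W x"
    "nrm W \<le> A" "gr W \<le> B" "\<And>V. V \<in> H1 \<Longrightarrow> (\<lambda>n. grip (\<lambda>x. U (r n) x - W x) V) \<longlonglongrightarrow> 0"
proof -
  have UL: "U n \<in> L2" for n by (rule H1_L2[OF U(1)])
  have A0: "0 \<le> A" using U(2)[of 0] nrm_nonneg order_trans by blast
  have B0: "0 \<le> B" using U(3)[of 0] gr_nonneg order_trans by blast
  let ?N = "real CARD('n)"
  define \<rho> where "\<rho> j = inverse (real (Suc j))" for j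
  have \<rho>: "\<rho> j > 0" for j unfolding \<rho>_def by simp
  have \<rho>0: "\<rho> \<longlonglongrightarrow> 0" unfolding \<rho>_def by (rule LIMSEQ_inverse_real_of_nat)
  obtain D :: "(real ^ 'n) set" where D: "countable D" "\<And>X. open X \<Longrightarrow> X \<noteq> {} \<Longrightarrow> \<exists>d\<in>D. d \<in> X"
    by (rule countable_dense_setE) blast
  have D0: "D \<noteq> {}" using D(2)[of UNIV] by auto
  define M where "M j = A * sqrt (\<rho> j ^ CARD('n)) / \<rho> j ^ CARD('n)" for j
  have avgM: "\<bar>avg (\<rho> j) (U n) x\<bar> \<le> M j" for j n x
  proof -
    have "\<bar>avg (\<rho> j) (U n) x\<bar> \<le> nrm (U n) * sqrt (\<rho> j ^ CARD('n)) / \<rho> j ^ CARD('n)"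
      by (rule avg_le[OF UL \<rho>])
    also have "\<dots> \<le> M j" unfolding M_def using U(2) \<rho>[of j] by (intro divide_right_mono mult_right_mono) auto
    finally show ?thesis .
  qed
  \<comment> \<open>\<open>prod_decode\<close> enumerates the pairs of a radius and a point of the
    countable dense set, so that one diagonal sequence serves them all.\<close>
  obtain r where r: "strict_mono (r :: nat \<Rightarrow> nat)"
    and rc: "\<And>k. convergent (\<lambda>n. avg (\<rho> (fst (prod_decode k))) (U (r n)) (from_nat_into D (snd (prod_decode k))))"
    using bounded_diagonal[of "\<lambda>k n. avg (\<rho> (fst (prod_decode k))) (U n) (from_nat_into D (snd (prod_decode k)))" "\<lambda>k. M (fst (prod_decode k))"] avgM
    by blast
  have dconv: "convergent (\<lambda>n. avg (\<rho> j) (U (r n)) d)" if d: "d \<in> D" for d j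
  proof -
    obtain m where "from_nat_into D m = d" using from_nat_into_surj[OF D(1) d] by blast
    then show ?thesis using rc[of "prod_encode (j, m)"] by simp
  qed
  \<comment> \<open>Equicontinuity of the averages carries convergence from the dense set to all
    points.\<close>
  have aconv: "convergent (\<lambda>n. avg (\<rho> j) (U (r n)) x)" for x j
    unfolding Cauchy_convergent_iff[symmetric]
  proof (rule CauchyI)
    fix e :: real assume e: "e > 0"
    have "e / (4 * (A + 1)) > 0" using e A0 by simp
    from avg_equicont[OF \<rho>[of j] this, of A x] obtain d where d: "d > 0"
      "\<And>V y. V \<in> L2 \<Longrightarrow> nrm V \<le> A \<Longrightarrow> dist y x < d \<Longrightarrow> \<bar>avg (\<rho> j) V y - avg (\<rho> j) V x\<bar> \<le> e / (4 * (A + 1)) * A" by blast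
    obtain y where y: "y \<in> D" "y \<in> ball x d" using D(2)[of "ball x d"] d(1) by auto
    have small: "e / (4 * (A + 1)) * A \<le> e / 4"
    proof -
      have "A / (A + 1) \<le> 1" using A0 by simp
      then have "e / 4 * (A / (A + 1)) \<le> e / 4 * 1" using e by (intro mult_left_mono) auto
      then show ?thesis by simp
    qed
    have near: "\<bar>avg (\<rho> j) (U (r n)) y - avg (\<rho> j) (U (r n)) x\<bar> \<le> e / 4" for n
      using order_trans[OF d(2)[OF UL[of "r n"] U(2), of y] small] y(2) by (simp add: dist_commute)
    have "Cauchy (\<lambda>n. avg (\<rho> j) (U (r n)) y)" using dconv[OF y(1)] by (simp add: Cauchy_convergent_iff)
    then obtain n0 where n0: "\<And>m n. m \<ge> n0 \<Longrightarrow> n \<ge> n0 \<Longrightarrow> norm (avg (\<rho> j) (U (r m)) y - avg (\<rho> j) (U (r n)) y) < e / 4"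
      using CauchyD[of _ "e / 4"] e by fastforce
    have "norm (avg (\<rho> j) (U (r m)) x - avg (\<rho> j) (U (r n)) x) < e" if "m \<ge> n0" "n \<ge> n0" for m n
      using n0[OF that] near[of m] near[of n] e unfolding real_norm_def by argo
    then show "\<exists>M. \<forall>m\<ge>M. \<forall>n\<ge>M. norm (avg (\<rho> j) (U (r m)) x - avg (\<rho> j) (U (r n)) x) < e" by blast
  qed
  \<comment> \<open>A weight with positive values and finite integral: bounded functions times its
    root s are square integrable, and s can be divided out in the end.\<close>
  obtain \<omega> :: "real ^ 'n \<Rightarrow> real" where \<omega>: "\<omega> \<in> borel_measurable lborel" "\<And>x. \<omega> x > 0" "\<And>x. \<omega> x \<le> 1" "integrable lborel \<omega>"
    using sigma_finite_measure.obtain_positive_integrable_function[OF sigma_finite_lborel] by blast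
  define s where "s x = sqrt (\<omega> x)" for x
  have s: "s x > 0" "s x \<le> 1" "(s x)\<^sup>2 = \<omega> x" for x unfolding s_def using \<omega>(2,3)[of x] by (auto simp: less_imp_le)
  have sm: "s \<in> borel_measurable lebesgue" unfolding s_def using \<omega>(1) by (intro measurable_completion) simp
  have \<omega>i: "integrable lebesgue \<omega>" using \<omega>(1,4) by (subst integrable_completion) auto
  have sabs: "\<bar>s x\<bar> \<le> 1" for x using s(1,2)[of x] by simp
  have sL: "(\<lambda>x. s x * f x) \<in> L2" if "f \<in> L2" for f
    by (rule L2_bounded_mult[OF that sm sabs])
  have snrm: "nrm (\<lambda>x. s x * f x) \<le> nrm f" if "f \<in> L2" for f
    by (rule nrm_mono[OF that L2_meas[OF sL[OF that]]])
       (use sabs in \<open>auto simp: abs_mult intro!: AE_I2 mult_left_le_one_le\<close>)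
  define v where "v n x = s x * U (r n) x" for n x
  have vL: "v n \<in> L2" for n unfolding v_def by (rule sL[OF UL])
  \<comment> \<open>The distance to the averages is of order \<open>\<rho> j\<close> uniformly in n,
    and multiplication by s does not increase it. What remains is the weighted difference of
    averages.\<close>
  have Rj: "nrm (\<lambda>x. v m x - v n x) \<le> 2 * (\<rho> j * sqrt (?N * B)) + nrm (\<lambda>x. s x * (avg (\<rho> j) (U (r m)) x - avg (\<rho> j) (U (r n)) x))" for m n j
  proof -
    have pp: "(\<lambda>x. U k x - avg (\<rho> j) (U k) x) \<in> L2" "nrm (\<lambda>x. U k x - avg (\<rho> j) (U k) x) \<le> \<rho> j * sqrt (?N * B)" for k
    proof -
      show "(\<lambda>x. U k x - avg (\<rho> j) (U k) x) \<in> L2" by (rule pseudo_poincare(1)[OF U(1) \<rho>])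
      have "(nrm (\<lambda>x. U k x - avg (\<rho> j) (U k) x))\<^sup>2 \<le> (\<rho> j)\<^sup>2 * ?N * gr (U k)" by (rule pseudo_poincare(2)[OF U(1) \<rho>])
      also have "\<dots> \<le> (\<rho> j)\<^sup>2 * ?N * B" using U(3) by (intro mult_left_mono) auto
      also have "\<dots> = (\<rho> j * sqrt (?N * B))\<^sup>2" using B0 by (simp add: power_mult_distrib)
      finally show "nrm (\<lambda>x. U k x - avg (\<rho> j) (U k) x) \<le> \<rho> j * sqrt (?N * B)"
        by (rule power2_le_imp_le) (use \<rho>[of j] B0 in simp)
    qed
    have aL: "avg (\<rho> j) (U k) \<in> L2" for k using L2_diff[OF UL[of k] pp(1)[of k]] by simp
    let ?a = "\<lambda>x. s x * (U (r m) x - avg (\<rho> j) (U (r m)) x)"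
    let ?b = "\<lambda>x. s x * (U (r n) x - avg (\<rho> j) (U (r n)) x)"
    let ?c = "\<lambda>x. s x * (avg (\<rho> j) (U (r m)) x - avg (\<rho> j) (U (r n)) x)"
    have L: "?a \<in> L2" "?b \<in> L2" "?c \<in> L2" by (intro sL pp L2_diff aL)+
    have "(\<lambda>x. v m x - v n x) = (\<lambda>x. (?a x - ?b x) + ?c x)" unfolding v_def by (simp add: algebra_simps)
    then have "nrm (\<lambda>x. v m x - v n x) \<le> nrm (\<lambda>x. ?a x - ?b x) + nrm ?c" using nrm_triangle[OF L2_diff[OF L(1,2)] L(3)] by simp
    also have "nrm (\<lambda>x. ?a x - ?b x) \<le> nrm ?a + nrm ?b" by (rule nrm_triangle_diff[OF L(1,2)])
    also have "nrm ?a \<le> \<rho> j * sqrt (?N * B)" using snrm[OF pp(1)] pp(2) order_trans by blast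
    also have "nrm ?b \<le> \<rho> j * sqrt (?N * B)" using snrm[OF pp(1)] pp(2) order_trans by blast
    finally show ?thesis by simp
  qed
  \<comment> \<open>For a fixed radius the averages converge pointwise and are bounded by
    \<open>M j\<close>, so a multiple of \<open>\<omega>\<close> dominates the squares.\<close>
  have small: "\<exists>n0. \<forall>m\<ge>n0. \<forall>n\<ge>n0. nrm (\<lambda>x. s x * (avg (\<rho> j) (U (r m)) x - avg (\<rho> j) (U (r n)) x)) < e" if e: "e > 0" for j e
  proof -
    define L where "L x = lim (\<lambda>n. avg (\<rho> j) (U (r n)) x)" for x
    have Llim: "(\<lambda>n. avg (\<rho> j) (U (r n)) x) \<longlonglongrightarrow> L x" for x
      unfolding L_def using aconv convergent_LIMSEQ_iff by blast
    have am: "avg (\<rho> j) (U n) \<in> borel_measurable lebesgue" for n by (rule avg_meas[OF UL])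
    have Lm: "L \<in> borel_measurable lebesgue" by (rule borel_measurable_LIMSEQ_real[OF Llim am])
    have LM: "\<bar>L x\<bar> \<le> M j" for x
      using tendsto_rabs[OF Llim[of x]] avgM by (intro LIMSEQ_le_const2) auto
    have dom: "\<bar>(s x * (avg (\<rho> j) (U (r n)) x - L x))\<^sup>2\<bar> \<le> (2 * M j)\<^sup>2 * \<omega> x" for n x
    proof -
      have "\<bar>avg (\<rho> j) (U (r n)) x - L x\<bar> \<le> \<bar>2 * M j\<bar>" using avgM[of j "r n" x] LM[of x] by linarith
      then have "(avg (\<rho> j) (U (r n)) x - L x)\<^sup>2 \<le> (2 * M j)\<^sup>2" by (simp only: abs_le_square_iff)
      then show ?thesis using \<omega>(2)[of x] by (simp add: power_mult_distrib s(3) mult.commute mult_left_mono)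
    qed
    have m2: "(\<lambda>x. s x * (avg (\<rho> j) (U (r n)) x - L x)) \<in> borel_measurable lebesgue" for n
      by (intro borel_measurable_times borel_measurable_diff sm am Lm)
    have dL: "(\<lambda>x. s x * (avg (\<rho> j) (U (r n)) x - L x)) \<in> L2" for n
      unfolding L2_iff
    proof (rule conjI[OF m2])
      show "integrable lebesgue (\<lambda>x. (s x * (avg (\<rho> j) (U (r n)) x - L x))\<^sup>2)"
      proof (rule Bochner_Integration.integrable_bound)
        show "integrable lebesgue (\<lambda>x. (2 * M j)\<^sup>2 * \<omega> x)" using \<omega>i by auto
        show "AE x in lebesgue. norm ((s x * (avg (\<rho> j) (U (r n)) x - L x))\<^sup>2) \<le> norm ((2 * M j)\<^sup>2 * \<omega> x)"
          by (rule AE_I2, unfold real_norm_def, rule order_trans[OF dom]) simp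
      qed (use m2[of n] in simp)
    qed
    have "(\<lambda>n. LINT x|lebesgue. (s x * (avg (\<rho> j) (U (r n)) x - L x))\<^sup>2) \<longlonglongrightarrow> (LINT x|(lebesgue :: (real ^ 'n) measure). 0 :: real)"
    proof (rule integral_dominated_convergence[where w = "\<lambda>x. (2 * M j)\<^sup>2 * \<omega> x"])
      show "integrable lebesgue (\<lambda>x. (2 * M j)\<^sup>2 * \<omega> x)" using \<omega>i by auto
      show "AE x in lebesgue. (\<lambda>n. (s x * (avg (\<rho> j) (U (r n)) x - L x))\<^sup>2) \<longlonglongrightarrow> 0"
      proof (rule AE_I2)
        fix x
        have "(\<lambda>n. (s x * (avg (\<rho> j) (U (r n)) x - L x))\<^sup>2) \<longlonglongrightarrow> (s x * (L x - L x))\<^sup>2"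
          by (intro tendsto_intros Llim)
        then show "(\<lambda>n. (s x * (avg (\<rho> j) (U (r n)) x - L x))\<^sup>2) \<longlonglongrightarrow> 0" by simp
      qed
      show "AE x in lebesgue. norm ((s x * (avg (\<rho> j) (U (r n)) x - L x))\<^sup>2) \<le> (2 * M j)\<^sup>2 * \<omega> x" for n
        using dom by (intro AE_I2) simp
    qed (use m2 in auto)
    then have "(\<lambda>n. (nrm (\<lambda>x. s x * (avg (\<rho> j) (U (r n)) x - L x)))\<^sup>2) \<longlonglongrightarrow> 0" unfolding nrm_sq_int by simp
    moreover have "(e / 2)\<^sup>2 > 0" using e by simp
    ultimately obtain n0 where n0: "\<And>n. n \<ge> n0 \<Longrightarrow> (nrm (\<lambda>x. s x * (avg (\<rho> j) (U (r n)) x - L x)))\<^sup>2 < (e / 2)\<^sup>2"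
      using LIMSEQ_D[of _ 0 "(e / 2)\<^sup>2"] by fastforce
    have n1: "nrm (\<lambda>x. s x * (avg (\<rho> j) (U (r n)) x - L x)) < e / 2" if "n \<ge> n0" for n
      using power_less_imp_less_base[OF n0[OF that]] e by simp
    have "nrm (\<lambda>x. s x * (avg (\<rho> j) (U (r m)) x - avg (\<rho> j) (U (r n)) x)) < e" if "m \<ge> n0" "n \<ge> n0" for m n
    proof -
      have "(\<lambda>x. s x * (avg (\<rho> j) (U (r m)) x - avg (\<rho> j) (U (r n)) x))
        = (\<lambda>x. s x * (avg (\<rho> j) (U (r m)) x - L x) - s x * (avg (\<rho> j) (U (r n)) x - L x))" by (simp add: algebra_simps)
      then show ?thesis using nrm_triangle_diff[OF dL dL, of m n] n1[OF that(1)] n1[OF that(2)] by simp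
    qed
    then show ?thesis by blast
  qed
  have vC: "\<exists>n0. \<forall>m\<ge>n0. \<forall>n\<ge>n0. nrm (\<lambda>x. v m x - v n x) < e" if e: "e > 0" for e
  proof -
    have "(\<lambda>j. 2 * (\<rho> j * sqrt (?N * B))) \<longlonglongrightarrow> 2 * (0 * sqrt (?N * B))" by (intro tendsto_intros \<rho>0)
    then have "\<forall>\<^sub>F j in sequentially. 2 * (\<rho> j * sqrt (?N * B)) < e / 2"
      by (rule order_tendstoD) (use e in simp)
    then obtain j where j: "2 * (\<rho> j * sqrt (?N * B)) < e / 2" by (auto simp: eventually_sequentially)
    obtain n0 where n0: "\<And>m n. m \<ge> n0 \<Longrightarrow> n \<ge> n0 \<Longrightarrow> nrm (\<lambda>x. s x * (avg (\<rho> j) (U (r m)) x - avg (\<rho> j) (U (r n)) x)) < e / 2"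
      using small[of "e / 2" j] e by auto
    have "nrm (\<lambda>x. v m x - v n x) < e" if "m \<ge> n0" "n \<ge> n0" for m n
      using Rj[of m n j] j n0[OF that] by linarith
    then show ?thesis by blast
  qed
  obtain g q where g: "g \<in> L2" "strict_mono (q :: nat \<Rightarrow> nat)" "AE x in lebesgue. (\<lambda>n. v (q n) x) \<longlonglongrightarrow> g x"
    using L2_complete[OF vL vC] by blast
  define W where "W x = g x / s x" for x
  define R where "R = r \<circ> q"
  have R: "strict_mono R" unfolding R_def by (rule strict_mono_o[OF r g(2)])
  have Wlim: "AE x in lebesgue. (\<lambda>n. U (R n) x) \<longlonglongrightarrow> W x"
    using g(3)
  proof eventually_elim
    case (elim x)
    have "(\<lambda>n. v (q n) x / s x) \<longlonglongrightarrow> g x / s x" using s(1)[of x] by (intro tendsto_divide tendsto_const elim) simp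
    then show ?case using s(1)[of x] unfolding v_def W_def R_def by simp
  qed
  have Wm: "W \<in> borel_measurable lebesgue" unfolding W_def using L2_meas[OF g(1)] sm by simp
  have W2: "W \<in> L2" "nrm W \<le> A"
    using L2_fatou[of "\<lambda>n. U (R n)" A W] UL U(2) Wm Wlim by auto
  \<comment> \<open>The bounds on difference quotients pass to W by Fatou, and bounded difference
    quotients characterize H1.\<close>
  have WH: "W \<in> H1"
  proof (rule H1_dq[OF W2(1)])
    fix i and h :: real assume "h \<noteq> 0"
    show "nrm (dq i h W) \<le> sqrt B"
    proof (rule conjunct2[OF L2_fatou[of "\<lambda>n. dq i h (U (R n))"]])
      show "dq i h (U (R n)) \<in> L2" for n by (rule dq_L2[OF UL])
      show "nrm (dq i h (U (R n))) \<le> sqrt B" for n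
      proof -
        have "nrm (dq i h (U (R n))) \<le> nrm (weak_partial i (U (R n)))"
          by (intro dq_nrm_le UL wp_L2 wp_is U)
        also have "\<dots> \<le> sqrt (gr (U (R n)))"
          unfolding gr_eq_nrm by (intro real_le_rsqrt member_le_sum) auto
        also have "\<dots> \<le> sqrt B" using U(3) by simp
        finally show ?thesis .
      qed
      show "dq i h W \<in> borel_measurable lebesgue" by (intro L2_meas dq_L2 W2)
      show "AE x in lebesgue. (\<lambda>n. dq i h (U (R n)) x) \<longlonglongrightarrow> dq i h W x"
        using Wlim tr_AE[OF Wlim, of "axis i h"]
        unfolding dq_def by eventually_elim (use \<open>h \<noteq> 0\<close> in \<open>intro tendsto_intros\<close>)
    qed
  qed
  have wlim0: "AE x in lebesgue. (\<lambda>n. U (R n) x - W x) \<longlonglongrightarrow> 0"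
    using Wlim by eventually_elim (simp add: LIM_zero)
  have dL: "(\<lambda>x. U (R n) x - W x) \<in> L2" for n by (intro L2_diff UL W2)
  have dA: "nrm (\<lambda>x. U (R n) x - W x) \<le> 2 * A" for n
    using nrm_triangle_diff[OF UL[of "R n"] W2(1)] U(2)[of "R n"] W2(2) by linarith
  \<comment> \<open>Gradients are bounded in L2, so pairings with test functions suffice. There the
    derivative moves to the test function and a.e. convergence with bounded norms is enough.\<close>
  have weak: "(\<lambda>n. grip (\<lambda>x. U (R n) x - W x) V) \<longlonglongrightarrow> 0" if V: "V \<in> H1" for V
  proof -
    have "(\<lambda>n. ip (weak_partial i (\<lambda>x. U (R n) x - W x)) (weak_partial i V)) \<longlonglongrightarrow> 0" for i
    proof (rule L2_weak_tendsto_0[where S = test_functions and C = "sqrt B + nrm (weak_partial i W)"])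
      have dH: "(\<lambda>x. U (R n) x - W x) \<in> H1" for n by (intro H1_diff U WH)
      show "weak_partial i (\<lambda>x. U (R n) x - W x) \<in> L2" for n by (rule wp_L2[OF dH])
      show "nrm (weak_partial i (\<lambda>x. U (R n) x - W x)) \<le> sqrt B + nrm (weak_partial i W)" for n
      proof -
        let ?d = "\<lambda>x. weak_partial i (U (R n)) x + (-1) * weak_partial i W x"
        have L: "?d \<in> L2" by (intro L2_add L2_cmult wp_L2 U WH)
        have "is_weak_partial i (\<lambda>x. U (R n) x + (-1) * W x) ?d"
          by (intro is_weak_partial_add is_weak_partial_cmult UL W2 L2_cmult wp_L2 wp_is U WH)
        then have "AE x in lebesgue. weak_partial i (\<lambda>x. U (R n) x - W x) x = ?d x"
          using wp_unique[OF L, of i "\<lambda>x. U (R n) x + (-1) * W x"] by simp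
        then have "nrm (weak_partial i (\<lambda>x. U (R n) x - W x)) = nrm ?d"
          by (intro nrm_cong_AE L2_meas L wp_L2 dH)
        also have "\<dots> \<le> nrm (weak_partial i (U (R n))) + nrm (\<lambda>x. (-1) * weak_partial i W x)"
          by (intro nrm_triangle L2_cmult wp_L2 U WH)
        also have "nrm (\<lambda>x. (-1) * weak_partial i W x) = nrm (weak_partial i W)" unfolding nrm_cmult by simp
        also have "nrm (weak_partial i (U (R n))) \<le> sqrt (gr (U (R n)))"
          unfolding gr_eq_nrm by (intro real_le_rsqrt member_le_sum) auto
        also have "\<dots> \<le> sqrt B" using U(3) by simp
        finally show ?thesis by simp
      qed
      show "test_functions \<subseteq> L2" using test_L2 by blast
      show "AE x in lebesgue. w x = 0" if "w \<in> L2" "\<And>s. s \<in> test_functions \<Longrightarrow> ip w s = 0" for w :: "real ^ 'n \<Rightarrow> real"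
        using L2_orth_test that by blast
      show "weak_partial i V \<in> L2" by (rule wp_L2[OF V])
      fix \<phi> :: "real ^ 'n \<Rightarrow> real" assume p: "\<phi> \<in> test_functions"
      have "(\<lambda>n. - ip (\<lambda>x. U (R n) x - W x) (partial_deriv i \<phi>)) \<longlonglongrightarrow> - 0"
        by (intro tendsto_minus L2_bounded_AE_weak_0[OF dL dA wlim0] test_L2 partial_deriv_test p)
      moreover have "ip (weak_partial i (\<lambda>x. U (R n) x - W x)) \<phi> = - ip (\<lambda>x. U (R n) x - W x) (partial_deriv i \<phi>)" for n
        using wp_is[OF dH, of i n] p unfolding weak_partial_ip by simp
      ultimately show "(\<lambda>n. ip (weak_partial i (\<lambda>x. U (R n) x - W x)) \<phi>) \<longlonglongrightarrow> 0" by simp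
    qed
    then show ?thesis unfolding grip_def by (intro tendsto_null_sum)
  qed
  \<comment> \<open>Weak lower semicontinuity: test the weak convergence with W itself and apply
    Cauchy-Schwarz.\<close>
  have "gr W \<le> B"
  proof -
    have "(\<lambda>n. grip (U (R n)) W - gr W) \<longlonglongrightarrow> 0"
      using weak[OF WH] by (simp add: grip_diff_left[OF U(1) WH WH] gr_def)
    then have "(\<lambda>n. grip (U (R n)) W) \<longlonglongrightarrow> gr W" by (rule LIM_zero_cancel)
    moreover have "grip (U (R n)) W \<le> sqrt B * sqrt (gr W)" for n
    proof -
      have "grip (U (R n)) W \<le> sqrt (gr (U (R n))) * sqrt (gr W)" using grip_le[OF U(1) WH, of "R n"] by simp
      also have "\<dots> \<le> sqrt B * sqrt (gr W)" using U(3) by (intro mult_right_mono) auto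
      finally show ?thesis .
    qed
    ultimately have "gr W \<le> sqrt B * sqrt (gr W)" by (intro LIMSEQ_le_const2) auto
    then have "sqrt (gr W) * sqrt (gr W) \<le> sqrt B * sqrt (gr W)" by simp
    show ?thesis
    proof (cases "gr W = 0")
      case False
      then have "gr W > 0" using gr_nonneg[of W] by argo
      then have "sqrt (gr W) > 0" by simp
      then have "sqrt (gr W) \<le> sqrt B"
        using \<open>sqrt (gr W) * sqrt (gr W) \<le> sqrt B * sqrt (gr W)\<close> mult_right_le_imp_le by blast
      then show ?thesis by simp
    qed (use B0 in simp)
  qed
  then show ?thesis using that R WH Wlim W2(2) weak by blast
qed

section \<open>The energy functional\<close>

lemma Linf_meas: "f \<in> Linf_space \<Longrightarrow> f \<in> borel_measurable lebesgue"
  by (simp add: Linf_space_def)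

lemma Linf_norm_props:
  fixes f :: "real ^ 'n \<Rightarrow> real"
  assumes f: "f \<in> Linf_space"
  shows "0 \<le> Linf_norm f" "AE x in lebesgue. \<bar>f x\<bar> \<le> Linf_norm f"
proof -
  let ?S = "esssup lebesgue (\<lambda>x. ereal \<bar>f x\<bar>)"
  have ae: "AE x in lebesgue. ereal \<bar>f x\<bar> \<le> ?S" by (rule esssup_AE)
  have fin: "?S < \<infinity>" using f by (simp add: Linf_space_def)
  \<comment> \<open>The claim does not depend on x. Lebesgue measure is not null, so a constant
    statement true a.e. is true.\<close>
  have "AE x in (lebesgue :: (real ^ 'n) measure). 0 \<le> ?S" 
  proof (rule eventually_mono[OF ae])
    fix x assume "ereal \<bar>f x\<bar> \<le> ?S"
    then show "0 \<le> ?S" by (rule order_trans[rotated]) simp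
  qed
  then have "0 \<le> ?S" by (simp add: eventually_const_iff ae_filter_eq_bot_iff)
  then have eq: "ereal (Linf_norm f) = ?S" unfolding Linf_norm_def using fin by (intro ereal_real') auto
  show "0 \<le> Linf_norm f" using \<open>0 \<le> ?S\<close> unfolding eq[symmetric] by simp
  show "AE x in lebesgue. \<bar>f x\<bar> \<le> Linf_norm f" using ae unfolding eq[symmetric] by simp
qed

lemma Linf_norm_le:
  fixes f g :: "real ^ 'n \<Rightarrow> real"
  assumes f: "f \<in> Linf_space" and g: "g \<in> borel_measurable lebesgue" "\<And>x. \<bar>g x\<bar> \<le> C * \<bar>f x\<bar>" and C: "0 \<le> C"
  shows "g \<in> Linf_space"
proof -
  have "AE x in lebesgue. ereal \<bar>g x\<bar> \<le> ereal (C * Linf_norm f)"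
    using Linf_norm_props(2)[OF f]
  proof eventually_elim
    case (elim x)
    have "C * \<bar>f x\<bar> \<le> C * Linf_norm f" by (rule mult_left_mono[OF elim C])
    then show ?case using g(2)[of x] by simp
  qed
  then have "esssup lebesgue (\<lambda>x. ereal \<bar>g x\<bar>) \<le> ereal (C * Linf_norm f)"
    using g(1) by (intro esssup_I) auto
  then show ?thesis using g(1) by (auto simp: Linf_space_def intro: le_less_trans)
qed

lemma Lp_space_le:
  assumes f: "f \<in> Lp_space q" and q: "q > 0" and g: "g \<in> borel_measurable lebesgue" "AE x in lebesgue. \<bar>g x\<bar> \<le> C * \<bar>f x\<bar>" and C: "0 \<le> C"
  shows "g \<in> Lp_space q"
proof -
  have f': "f \<in> borel_measurable lebesgue" "integrable lebesgue (\<lambda>x. \<bar>f x\<bar> powr q)"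
    using f by (auto simp: Lp_space_def)
  have "integrable lebesgue (\<lambda>x. \<bar>g x\<bar> powr q)"
  proof (rule Bochner_Integration.integrable_bound)
    show "integrable lebesgue (\<lambda>x. C powr q * \<bar>f x\<bar> powr q)" using f' by auto
    show "AE x in lebesgue. norm (\<bar>g x\<bar> powr q) \<le> norm (C powr q * \<bar>f x\<bar> powr q)"
      using g(2)
    proof eventually_elim
      case (elim x)
      have "\<bar>g x\<bar> powr q \<le> (C * \<bar>f x\<bar>) powr q" using elim q by (intro powr_mono2) auto
      then show ?case using C by (simp add: powr_mult)
    qed
  qed (use g in auto)
  then show ?thesis using g by (simp add: Lp_space_def)
qed

definition vb :: "(real ^ 'n \<Rightarrow> real) \<Rightarrow> (real ^ 'n \<Rightarrow> real) \<Rightarrow> (real ^ 'n \<Rightarrow> real) \<Rightarrow> real" where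
  "vb V U \<phi> = (LINT x|lebesgue. V x * U x * \<phi> x)"

definition vq :: "(real ^ 'n \<Rightarrow> real) \<Rightarrow> (real ^ 'n \<Rightarrow> real) \<Rightarrow> real" where
  "vq V U = (LINT x|lebesgue. V x * (U x)\<^sup>2)"

definition nl :: "(real ^ 'n \<Rightarrow> real) \<Rightarrow> (real ^ 'n \<Rightarrow> real) \<Rightarrow> real" where
  "nl U \<phi> = (LINT x|lebesgue. \<bar>U x\<bar> powr (crit_exp CARD('n) - 2) * U x * \<phi> x)"

text \<open>The differential of the energy at U in the direction given by the second function; see
  \<open>energy_deriv\<close>.\<close>

definition de :: "(real ^ 'n \<Rightarrow> real) \<Rightarrow> (real ^ 'n \<Rightarrow> real) \<Rightarrow> (real ^ 'n \<Rightarrow> real) \<Rightarrow> real" where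
  "de V U \<phi> = grip U \<phi> + vb V U \<phi> - nl U \<phi>"

lemma DERIV_abs_powr:
  assumes p: "p > 1"
  shows "((\<lambda>s. \<bar>s\<bar> powr p) has_real_derivative p * (\<bar>s\<bar> powr (p - 2) * s)) (at s)"
proof (cases "s = 0")
  case True
  have "((\<lambda>h. (\<bar>0 + h\<bar> powr p - \<bar>0\<bar> powr p) / h) \<longlongrightarrow> 0) (at 0)"
  proof (rule Lim_null_comparison)
    show "\<forall>\<^sub>F h in at 0. norm ((\<bar>0 + h\<bar> powr p - \<bar>0\<bar> powr p) / h) \<le> \<bar>h\<bar> powr (p - 1)"
      unfolding eventually_at_filter using p by (intro always_eventually) (simp add: powr_diff)
    have "((\<lambda>h. \<bar>h\<bar> powr (p - 1)) \<longlongrightarrow> \<bar>0::real\<bar> powr (p - 1)) (at 0)"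
      by (rule tendsto_abs_powr) (use p in \<open>auto intro: tendsto_intros\<close>)
    then show "((\<lambda>h. \<bar>h\<bar> powr (p - 1)) \<longlongrightarrow> 0) (at (0::real))" using p by simp
  qed
  then show ?thesis using True by (simp add: DERIV_def)
next
  case False
  have *: "\<bar>s\<bar> powr (p - 2) * s = \<bar>s\<bar> powr (p - 1) * sgn s"
    using False by (simp add: powr_diff sgn_real_def power2_eq_square field_simps)
  have "((\<lambda>s. \<bar>s\<bar> powr p) has_real_derivative p * \<bar>s\<bar> powr (p - 1) * sgn s) (at s)"
  proof (cases "s > 0")
    case True
    have "((\<lambda>s. s powr p) has_real_derivative p * s powr (p - 1)) (at s)"
      using True by (rule has_real_derivative_powr)
    moreover have "\<forall>\<^sub>F x in nhds s. x powr p = \<bar>x\<bar> powr p"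
      using eventually_nhds_in_open[of "{0<..}" s] True by (auto elim!: eventually_mono)
    ultimately show ?thesis
      using True DERIV_cong_ev[of s s "\<lambda>s. s powr p" "\<lambda>s. \<bar>s\<bar> powr p" "p * s powr (p - 1)" "p * s powr (p - 1)"] by simp
  next
    case nl: False
    with False have s: "s < 0" by simp
    have "((\<lambda>s. (- s) powr p) has_real_derivative - (p * (- s) powr (p - 1))) (at s)"
      using s by (auto intro!: derivative_eq_intros)
    moreover have "\<forall>\<^sub>F x in nhds s. (- x) powr p = \<bar>x\<bar> powr p"
      using eventually_nhds_in_open[of "{..<0}" s] s by (auto elim!: eventually_mono)
    ultimately show ?thesis
      using s DERIV_cong_ev[of s s "\<lambda>s. (- s) powr p" "\<lambda>s. \<bar>s\<bar> powr p" "- (p * (- s) powr (p - 1))" "- (p * (- s) powr (p - 1))"] by simp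
  qed
  then show ?thesis unfolding * by (simp add: mult.assoc)
qed

text \<open>Replace both arguments by the larger one. The bound by pure p-th powers dominates the
  integrand of the differential without invoking conjugate exponents.\<close>

lemma abs_powr_prod_bound:
  fixes a b :: real
  assumes "p \<ge> 1"
  shows "\<bar>\<bar>a\<bar> powr (p - 2) * a * b\<bar> \<le> \<bar>a\<bar> powr p + \<bar>b\<bar> powr p"
proof -
  have "\<bar>\<bar>a\<bar> powr (p - 2) * a * b\<bar> \<le> (max \<bar>a\<bar> \<bar>b\<bar>) powr p"
  proof (cases "a = 0")
    case False
    have "\<bar>\<bar>a\<bar> powr (p - 2) * a * b\<bar> = \<bar>a\<bar> powr (p - 1) * \<bar>b\<bar>"
      using False by (simp add: abs_mult powr_diff power2_eq_square field_simps)
    also have "\<dots> \<le> (max \<bar>a\<bar> \<bar>b\<bar>) powr (p - 1) * max \<bar>a\<bar> \<bar>b\<bar>"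
      using assms by (intro mult_mono powr_mono2) auto
    also have "\<dots> = (max \<bar>a\<bar> \<bar>b\<bar>) powr p" using False by (simp add: powr_diff max_def)
    finally show ?thesis .
  qed simp
  also have "\<dots> \<le> \<bar>a\<bar> powr p + \<bar>b\<bar> powr p" by (simp add: max_def)
  finally show ?thesis .
qed

lemma sum_powr_bound:
  fixes a b :: real
  assumes "p \<ge> 0"
  shows "\<bar>a + b\<bar> powr p \<le> 2 powr p * (\<bar>a\<bar> powr p + \<bar>b\<bar> powr p)"
proof -
  have "\<bar>a + b\<bar> powr p \<le> (2 * max \<bar>a\<bar> \<bar>b\<bar>) powr p" using assms by (intro powr_mono2) auto
  also have "\<dots> = 2 powr p * (max \<bar>a\<bar> \<bar>b\<bar>) powr p" by (simp add: powr_mult)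
  also have "\<dots> \<le> 2 powr p * (\<bar>a\<bar> powr p + \<bar>b\<bar> powr p)" by (intro mult_left_mono) (simp_all add: max_def)
  finally show ?thesis .
qed

lemma H1_Lcrit:
  fixes U :: "real ^ 'n \<Rightarrow> real"
  assumes "CARD('n) \<ge> 3" "U \<in> H1"
  shows "U \<in> Lcrit"
  using sobolev(1)[OF assms] H1_meas[OF assms(2)] by (simp add: Lp_space_def)

lemma nl_integrable:
  fixes U \<phi> :: "real ^ 'n \<Rightarrow> real"
  assumes N: "CARD('n) \<ge> 3" and U: "U \<in> Lcrit" and p: "\<phi> \<in> Lcrit"
  shows "integrable lebesgue (\<lambda>x. \<bar>U x\<bar> powr (crit_exp CARD('n) - 2) * U x * \<phi> x)"
proof -
  let ?p = "crit_exp CARD('n)"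
  have p1: "?p \<ge> 1" using crit_exp_facts(1)[OF N] by simp
  have Ui: "U \<in> borel_measurable lebesgue" "integrable lebesgue (\<lambda>x. \<bar>U x\<bar> powr ?p)"
    "\<phi> \<in> borel_measurable lebesgue" "integrable lebesgue (\<lambda>x. \<bar>\<phi> x\<bar> powr ?p)"
    using U p by (auto simp: Lp_space_def)
  show ?thesis
  proof (rule Bochner_Integration.integrable_bound)
    show "integrable lebesgue (\<lambda>x. \<bar>U x\<bar> powr ?p + \<bar>\<phi> x\<bar> powr ?p)" using Ui by auto
    show "AE x in lebesgue. norm (\<bar>U x\<bar> powr (?p - 2) * U x * \<phi> x) \<le> norm (\<bar>U x\<bar> powr ?p + \<bar>\<phi> x\<bar> powr ?p)"
      using abs_powr_prod_bound[OF p1] by (intro AE_I2) simp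
  qed (use Ui in auto)
qed

lemma lp_deriv:
  fixes U \<phi> :: "real ^ 'n \<Rightarrow> real"
  assumes N: "CARD('n) \<ge> 3" and U: "U \<in> Lcrit" and p: "\<phi> \<in> Lcrit"
  shows "((\<lambda>t. lp (\<lambda>x. U x + t * \<phi> x)) has_real_derivative crit_exp CARD('n) * nl U \<phi>) (at 0)"
proof -
  let ?p = "crit_exp CARD('n)"
  have p1: "?p > 1" "?p \<ge> 1" "?p \<ge> 0" using crit_exp_facts(1)[OF N] by auto
  have Ui: "U \<in> borel_measurable lebesgue" "integrable lebesgue (\<lambda>x. \<bar>U x\<bar> powr ?p)"
    "\<phi> \<in> borel_measurable lebesgue" "integrable lebesgue (\<lambda>x. \<bar>\<phi> x\<bar> powr ?p)"
    using U p by (auto simp: Lp_space_def)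
  define k' where "k' t x = ?p * (\<bar>U x + t * \<phi> x\<bar> powr (?p - 2) * (U x + t * \<phi> x)) * \<phi> x" for t x
  define b where "b x = ?p * (2 powr ?p * (\<bar>U x\<bar> powr ?p + \<bar>\<phi> x\<bar> powr ?p) + \<bar>\<phi> x\<bar> powr ?p)" for x
  have "((\<lambda>t. LINT x|lebesgue. \<bar>U x + t * \<phi> x\<bar> powr ?p) has_real_derivative (LINT x|lebesgue. k' 0 x)) (at 0)"
  proof (rule DERIV_integral[where d = 1 and b = b])
    fix s x assume "\<bar>s - 0\<bar> < (1::real)"
    then have s: "\<bar>s\<bar> \<le> 1" by simp
    have "((\<lambda>s. U x + s * \<phi> x) has_real_derivative \<phi> x) (at s)" by (auto intro!: derivative_eq_intros)
    from DERIV_chain2[OF DERIV_abs_powr[OF p1(1)] this]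
    show "((\<lambda>s. \<bar>U x + s * \<phi> x\<bar> powr ?p) has_real_derivative k' s x) (at s)" unfolding k'_def .
    have "\<bar>k' s x\<bar> = ?p * \<bar>\<bar>U x + s * \<phi> x\<bar> powr (?p - 2) * (U x + s * \<phi> x) * \<phi> x\<bar>"
      unfolding k'_def using p1 by (simp add: abs_mult mult.assoc)
    also have "\<dots> \<le> ?p * (\<bar>U x + s * \<phi> x\<bar> powr ?p + \<bar>\<phi> x\<bar> powr ?p)"
      using p1 by (intro mult_left_mono abs_powr_prod_bound) auto
    also have "\<dots> \<le> b x"
      unfolding b_def
    proof (intro mult_left_mono add_right_mono)
      have "\<bar>U x + s * \<phi> x\<bar> powr ?p \<le> 2 powr ?p * (\<bar>U x\<bar> powr ?p + \<bar>s * \<phi> x\<bar> powr ?p)"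
        by (rule sum_powr_bound[OF p1(3)])
      also have "\<dots> \<le> 2 powr ?p * (\<bar>U x\<bar> powr ?p + \<bar>\<phi> x\<bar> powr ?p)"
        using s p1 by (intro mult_left_mono add_left_mono powr_mono2) (auto simp: abs_mult mult_left_le_one_le)
      finally show "\<bar>U x + s * \<phi> x\<bar> powr ?p \<le> 2 powr ?p * (\<bar>U x\<bar> powr ?p + \<bar>\<phi> x\<bar> powr ?p)" .
    qed (use p1 in simp)
    finally show "\<bar>k' s x\<bar> \<le> b x" .
  next
    show "integrable lebesgue b" unfolding b_def using Ui by auto
    show "integrable lebesgue (\<lambda>x. \<bar>U x + t * \<phi> x\<bar> powr ?p)" for t
    proof -
      have "(\<lambda>x. t * \<phi> x) \<in> Lcrit"
        by (rule Lp_space_le[OF p _ _ AE_I2, of _ "\<bar>t\<bar>"]) (use p1 Ui in \<open>auto simp: abs_mult\<close>)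
      from Lcrit_add[OF N U this] show ?thesis by (simp add: Lp_space_def)
    qed
    show "k' 0 \<in> borel_measurable lebesgue" unfolding k'_def using Ui by auto
  qed simp
  moreover have "(LINT x|lebesgue. k' 0 x) = ?p * nl U \<phi>"
    unfolding k'_def nl_def by (simp add: mult.assoc)
  ultimately show ?thesis unfolding lp_def by simp
qed

lemma lp_cmult: "lp (\<lambda>x. c * U x) = \<bar>c\<bar> powr crit_exp CARD('n) * lp (U :: real ^ 'n \<Rightarrow> real)"
  unfolding lp_def by (simp add: abs_mult powr_mult)

lemma nl_self: "CARD('n) \<ge> 3 \<Longrightarrow> nl U U = lp (U :: real ^ 'n \<Rightarrow> real)"
proof -
  assume N: "CARD('n) \<ge> 3"
  have "\<bar>a\<bar> powr (crit_exp CARD('n) - 2) * a * a = \<bar>a\<bar> powr crit_exp CARD('n)" for a :: real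
    by (cases "a = 0") (auto simp: powr_diff power2_eq_square)
  then show ?thesis unfolding nl_def lp_def by simp
qed

text \<open>The Sobolev constant for the squared norm in the critical space. In this quadratic form
  it combines with weights of exponent N/2.\<close>

definition sobS :: "nat \<Rightarrow> real" where
  "sobS N = sobK N powr (2 / crit_exp N)"

lemma sobS_nonneg: "0 \<le> sobS N"
  unfolding sobS_def by simp

lemma lp_le_gr:
  fixes U :: "real ^ 'n \<Rightarrow> real"
  assumes N: "CARD('n) \<ge> 3" and U: "U \<in> H1"
  shows "lp U powr (2 / crit_exp CARD('n)) \<le> sobS CARD('n) * gr U"
proof -
  have p: "crit_exp CARD('n) > 0" by (rule crit_exp_facts(5)[OF N])
  have "lp U powr (2 / crit_exp CARD('n)) \<le> (sobK CARD('n) * gr U powr (crit_exp CARD('n) / 2)) powr (2 / crit_exp CARD('n))"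
    using sobolev(2)[OF N U] p unfolding lp_def[symmetric] by (intro powr_mono2) auto
  also have "\<dots> = sobS CARD('n) * gr U"
    unfolding sobS_def using p by (simp add: powr_mult sobK_def powr_powr)
  finally show ?thesis .
qed

lemma lp_le_gr': "CARD('n) \<ge> 3 \<Longrightarrow> U \<in> H1 \<Longrightarrow> lp U \<le> sobK CARD('n) * gr (U :: real ^ 'n \<Rightarrow> real) powr (crit_exp CARD('n) / 2)"
  using sobolev(2) unfolding lp_def .

text \<open>The standing assumptions on V alone. Everything here holds for potentials of either sign
  and any size, so the locale can also be interpreted for multiples of V.\<close>

locale potential =
  fixes V V1 V2 :: "real ^ 'n \<Rightarrow> real"
  assumes N3: "CARD('n) \<ge> 3"
    and V_AE: "AE x in lebesgue. V x = V1 x + V2 x"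
    and V1: "V1 \<in> Lp_space (real CARD('n) / 2)"
    and V2: "V2 \<in> Linf_space"
    and V2_lim: "(V2 \<longlongrightarrow> 0) at_infinity"
begin

section \<open>Integrability, polarization and differentiation of the energy\<close>

lemma V1_meas: "V1 \<in> borel_measurable lebesgue"
  using V1 by (simp add: Lp_space_def)

lemma V_meas: "V \<in> borel_measurable lebesgue"
proof (rule borel_measurable_AE)
  show "(\<lambda>x. V1 x + V2 x) \<in> borel_measurable lebesgue" using V1_meas Linf_meas[OF V2] by simp
  show "AE x in lebesgue. V1 x + V2 x = V x" using V_AE by eventually_elim simp
qed

lemma V1_sq_integrable: "U \<in> H1 \<Longrightarrow> integrable lebesgue (\<lambda>x. V1 x * (U x)\<^sup>2)"
  by (rule holder_sq(1)[OF N3 V1 H1_Lcrit[OF N3]])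

lemma Linf_sq_integrable:
  assumes f: "f \<in> Linf_space" and U: "U \<in> L2"
  shows "integrable lebesgue (\<lambda>x. f x * (U x)\<^sup>2)"
proof (rule Bochner_Integration.integrable_bound)
  show "integrable lebesgue (\<lambda>x. Linf_norm f * (U x)\<^sup>2)" using U by (simp add: L2_iff)
  show "(\<lambda>x. f x * (U x)\<^sup>2) \<in> borel_measurable lebesgue" using L2_meas[OF U] Linf_meas[OF f] by auto
  show "AE x in lebesgue. norm (f x * (U x)\<^sup>2) \<le> norm (Linf_norm f * (U x)\<^sup>2)"
    using Linf_norm_props(2)[OF f]
    by eventually_elim (use Linf_norm_props(1)[OF f] in \<open>auto simp: abs_mult intro!: mult_right_mono\<close>)
qed

lemma Linf_sq_le:
  assumes f: "f \<in> Linf_space" and U: "U \<in> L2"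
  shows "(LINT x|lebesgue. f x * (U x)\<^sup>2) \<le> Linf_norm f * (nrm U)\<^sup>2"
proof -
  have "(LINT x|lebesgue. f x * (U x)\<^sup>2) \<le> (LINT x|lebesgue. Linf_norm f * (U x)\<^sup>2)"
  proof (rule integral_mono_AE[OF Linf_sq_integrable[OF assms]])
    show "integrable lebesgue (\<lambda>x. Linf_norm f * (U x)\<^sup>2)" using U by (simp add: L2_iff)
    show "AE x in lebesgue. f x * (U x)\<^sup>2 \<le> Linf_norm f * (U x)\<^sup>2"
      using Linf_norm_props(2)[OF f] by eventually_elim (auto intro!: mult_right_mono)
  qed
  then show ?thesis by (simp add: nrm_sq_int)
qed

lemma V_sq_integrable:
  assumes U: "U \<in> H1"
  shows "integrable lebesgue (\<lambda>x. V x * (U x)\<^sup>2)"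
proof -
  have "integrable lebesgue (\<lambda>x. V1 x * (U x)\<^sup>2 + V2 x * (U x)\<^sup>2)"
    by (intro Bochner_Integration.integrable_add V1_sq_integrable Linf_sq_integrable V2 H1_L2 U)
  then show ?thesis
  proof (rule integrable_cong_AE_imp)
    show "(\<lambda>x. V x * (U x)\<^sup>2) \<in> borel_measurable lebesgue" using V_meas H1_meas[OF U] by auto
    show "AE x in lebesgue. V1 x * (U x)\<^sup>2 + V2 x * (U x)\<^sup>2 = V x * (U x)\<^sup>2"
      using V_AE by eventually_elim (simp add: distrib_right)
  qed
qed

lemma V_mult_integrable:
  assumes U: "U \<in> H1" and p: "\<phi> \<in> H1"
  shows "integrable lebesgue (\<lambda>x. V x * U x * \<phi> x)"
proof (rule Bochner_Integration.integrable_bound)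
  show "integrable lebesgue (\<lambda>x. \<bar>V x * (U x)\<^sup>2\<bar> + \<bar>V x * (\<phi> x)\<^sup>2\<bar>)"
    using V_sq_integrable[OF U] V_sq_integrable[OF p] by auto
  show "(\<lambda>x. V x * U x * \<phi> x) \<in> borel_measurable lebesgue" using V_meas H1_meas[OF U] H1_meas[OF p] by auto
  show "AE x in lebesgue. norm (V x * U x * \<phi> x) \<le> norm (\<bar>V x * (U x)\<^sup>2\<bar> + \<bar>V x * (\<phi> x)\<^sup>2\<bar>)"
  proof (rule AE_I2)
    fix x
    have "2 * \<bar>U x\<bar> * \<bar>\<phi> x\<bar> \<le> (U x)\<^sup>2 + (\<phi> x)\<^sup>2" using sum_squares_bound[of "\<bar>U x\<bar>" "\<bar>\<phi> x\<bar>"] by simp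
    moreover have "0 \<le> \<bar>U x\<bar> * \<bar>\<phi> x\<bar>" by simp
    ultimately have "\<bar>U x\<bar> * \<bar>\<phi> x\<bar> \<le> (U x)\<^sup>2 + (\<phi> x)\<^sup>2" by linarith
    from mult_left_mono[OF this, of "\<bar>V x\<bar>"]
    show "norm (V x * U x * \<phi> x) \<le> norm (\<bar>V x * (U x)\<^sup>2\<bar> + \<bar>V x * (\<phi> x)\<^sup>2\<bar>)"
      by (simp add: abs_mult distrib_left mult.assoc)
  qed
qed

lemma vb_add_right: "U \<in> H1 \<Longrightarrow> \<phi> \<in> H1 \<Longrightarrow> \<psi> \<in> H1 \<Longrightarrow> vb V U (\<lambda>x. \<phi> x + \<psi> x) = vb V U \<phi> + vb V U \<psi>"
  unfolding vb_def distrib_left by (rule Bochner_Integration.integral_add) (rule V_mult_integrable; assumption)+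

lemma vb_cmult_right: "vb V U (\<lambda>x. c * \<phi> x) = c * vb V U \<phi>"
  unfolding vb_def by (simp add: mult.left_commute)

lemma vq_add:
  assumes "U \<in> H1" "\<phi> \<in> H1"
  shows "vq V (\<lambda>x. U x + \<phi> x) = vq V U + 2 * vb V U \<phi> + vq V \<phi>"
proof -
  have "vq V (\<lambda>x. U x + \<phi> x) = (LINT x|lebesgue. V x * (U x)\<^sup>2 + 2 * (V x * U x * \<phi> x) + V x * (\<phi> x)\<^sup>2)"
    unfolding vq_def by (intro Bochner_Integration.integral_cong) (auto simp: power2_sum algebra_simps)
  also have "\<dots> = vq V U + 2 * vb V U \<phi> + vq V \<phi>"
    unfolding vq_def vb_def using V_sq_integrable assms V_mult_integrable[OF assms] by simp
  finally show ?thesis .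
qed

lemma vq_cmult: "vq V (\<lambda>x. c * U x) = c\<^sup>2 * vq V U"
  unfolding vq_def power_mult_distrib by (simp only: mult.left_commute[of _ "c\<^sup>2"]) simp

lemma vb_self: "vb V U U = vq V U"
  unfolding vq_def vb_def by (simp add: power2_eq_square mult.assoc)

lemma nl_add_right: "(U :: real ^ 'n \<Rightarrow> real) \<in> H1 \<Longrightarrow> \<phi> \<in> H1 \<Longrightarrow> \<psi> \<in> H1 \<Longrightarrow> nl U (\<lambda>x. \<phi> x + \<psi> x) = nl U \<phi> + nl U \<psi>"
  unfolding nl_def distrib_left
  by (rule Bochner_Integration.integral_add) (rule nl_integrable[OF N3]; rule H1_Lcrit[OF N3]; assumption)+

lemma nl_cmult_right: "nl U (\<lambda>x. c * \<phi> x) = c * nl U \<phi>"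
  unfolding nl_def by (simp add: mult.left_commute)

lemma de_add_right: "U \<in> H1 \<Longrightarrow> \<phi> \<in> H1 \<Longrightarrow> \<psi> \<in> H1 \<Longrightarrow> de V U (\<lambda>x. \<phi> x + \<psi> x) = de V U \<phi> + de V U \<psi>"
  unfolding de_def by (simp add: grip_add_right vb_add_right nl_add_right)

lemma de_cmult_right: "U \<in> H1 \<Longrightarrow> \<phi> \<in> H1 \<Longrightarrow> de V U (\<lambda>x. c * \<phi> x) = c * de V U \<phi>"
  unfolding de_def by (simp add: grip_cmult_right vb_cmult_right nl_cmult_right right_diff_distrib distrib_left)

lemma de_self: "de V U U = gr U + vq V U - lp U"
  unfolding de_def by (simp add: gr_def vb_self nl_self[OF N3])

lemma energy_eq: "U \<in> H1 \<Longrightarrow> energy V U = 1 / 2 * gr U + 1 / 2 * vq V U - 1 / crit_exp CARD('n) * lp U"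
  unfolding energy_def by (simp add: weak_grad_integral vq_def lp_def)

lemma energy_deriv:
  assumes U: "U \<in> H1" and p: "\<phi> \<in> H1"
  shows "((\<lambda>t. energy V (\<lambda>x. U x + t * \<phi> x)) has_real_derivative de V U \<phi>) (at 0)"
proof -
  have eq: "energy V (\<lambda>x. U x + t * \<phi> x) = 1 / 2 * (gr U + 2 * (t * grip U \<phi>) + t\<^sup>2 * gr \<phi>)
      + 1 / 2 * (vq V U + 2 * (t * vb V U \<phi>) + t\<^sup>2 * vq V \<phi>) - 1 / crit_exp CARD('n) * lp (\<lambda>x. U x + t * \<phi> x)" for t
    using U p by (simp add: energy_eq H1_add H1_cmult gr_add gr_cmult grip_cmult_right vq_add vq_cmult vb_cmult_right)
  have p0: "crit_exp CARD('n) \<noteq> 0" using crit_exp_facts(5)[OF N3] by simp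
  show ?thesis
    unfolding eq de_def
    by (rule derivative_eq_intros lp_deriv[OF N3 H1_Lcrit[OF N3 U] H1_Lcrit[OF N3 p]] refl | simp add: p0)+
qed

lemma mass_sphere_iff: "U \<in> mass_sphere \<rho> \<longleftrightarrow> U \<in> H1 \<and> (nrm U)\<^sup>2 = \<rho>\<^sup>2"
  unfolding mass_sphere_def by (simp add: nrm_sq_int)

lemma critical_iff:
  "constrained_critical V \<rho> U \<longleftrightarrow> U \<in> mass_sphere \<rho> \<and> (\<forall>\<phi>\<in>H1. ip U \<phi> = 0 \<longrightarrow> de V U \<phi> = 0)"
proof -
  have "((\<lambda>t. energy V (\<lambda>x. U x + t * \<phi> x)) has_real_derivative 0) (at 0) \<longleftrightarrow> de V U \<phi> = 0"
    if "U \<in> H1" "\<phi> \<in> H1" for \<phi>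
    using energy_deriv[OF that] DERIV_unique[OF energy_deriv[OF that], of 0] by (intro iffI) simp_all
  then show ?thesis unfolding constrained_critical_def ip_def using mass_sphere_iff[of U \<rho>] by blast
qed

lemma solution_iff:
  "normalized_solution V \<rho> U \<mu> \<longleftrightarrow> U \<in> mass_sphere \<rho> \<and> (\<forall>\<phi>\<in>H1. de V U \<phi> = \<mu> * ip U \<phi>)"
proof -
  have "(LINT x|lebesgue. weak_grad U x \<bullet> weak_grad \<phi> x) = grip U \<phi>" if "U \<in> H1" "\<phi> \<in> H1" for \<phi>
    by (rule weak_grad_inner_integral[OF that])
  then show ?thesis
    unfolding normalized_solution_def de_def vb_def nl_def ip_def
    using mass_sphere_iff[of U \<rho>] by (simp add: diff_eq_eq cong: conj_cong)
qed

text \<open>The multiplier is found by testing with U. Any direction becomes tangent to the sphere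
  after subtracting its component along U, and the differential vanishes there.\<close>

lemma critical_imp_solution:
  assumes "constrained_critical V \<rho> U" and \<rho>: "\<rho> > 0"
  shows "normalized_solution V \<rho> U (de V U U / \<rho>\<^sup>2)"
proof -
  have U: "U \<in> H1" "(nrm U)\<^sup>2 = \<rho>\<^sup>2" and c: "\<And>\<phi>. \<phi> \<in> H1 \<Longrightarrow> ip U \<phi> = 0 \<Longrightarrow> de V U \<phi> = 0"
    using assms(1) unfolding critical_iff mass_sphere_iff by auto
  have "de V U \<phi> = de V U U / \<rho>\<^sup>2 * ip U \<phi>" if p: "\<phi> \<in> H1" for \<phi>
  proof -
    define c where "c = - (ip U \<phi> / \<rho>\<^sup>2)"
    have cU: "(\<lambda>x. c * U x) \<in> H1" by (rule H1_cmult[OF U(1)])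
    have "ip U (\<lambda>x. \<phi> x + c * U x) = ip U \<phi> + c * ip U U"
      by (simp add: ip_add_right[OF H1_L2[OF p] H1_L2[OF cU] H1_L2[OF U(1)]] ip_cmult_right)
    also have "\<dots> = 0" unfolding c_def using U(2) \<rho> by (simp add: nrm_sq)
    finally have "de V U (\<lambda>x. \<phi> x + c * U x) = 0" by (intro assms c H1_add p cU \<open>\<And>\<phi>. \<phi> \<in> H1 \<Longrightarrow> ip U \<phi> = 0 \<Longrightarrow> de V U \<phi> = 0\<close>)
    then have "de V U \<phi> + c * de V U U = 0" using U(1) p cU by (simp add: de_add_right de_cmult_right)
    then show ?thesis unfolding c_def by simp
  qed
  then show ?thesis unfolding solution_iff using assms(1) unfolding critical_iff by blast
qed

text \<open>Testing with U gives twice the energy minus a nonnegative multiple of the critical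
  integral, because the critical exponent exceeds 2.\<close>

lemma multiplier_neg:
  assumes U: "U \<in> H1" and E: "energy V U < 0"
  shows "de V U U < 0"
proof -
  have p: "crit_exp CARD('n) > 2" by (rule crit_exp_facts(1)[OF N3])
  have "de V U U = 2 * energy V U - (1 - 2 / crit_exp CARD('n)) * lp U"
    unfolding de_self energy_eq[OF U] by (simp add: algebra_simps)
  moreover have "0 \<le> (1 - 2 / crit_exp CARD('n)) * lp U" using p by simp
  ultimately show ?thesis using E by linarith
qed

text \<open>For a tangent direction, rescale \<open>U + t * \<phi>\<close> to the right mass. The
  factor is stationary at t = 0, so the derivative of the energy along this curve is the plain
  directional derivative.\<close>

lemma local_min_critical:
  assumes \<rho>: "\<rho> > 0" and U: "U \<in> mass_sphere \<rho>" "gr U < g"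
    and min: "\<And>\<Phi>. \<Phi> \<in> mass_sphere \<rho> \<Longrightarrow> gr \<Phi> < g \<Longrightarrow> energy V U \<le> energy V \<Phi>"
  shows "constrained_critical V \<rho> U"
  unfolding critical_iff
proof (intro conjI ballI impI U(1))
  fix \<phi> assume p: "\<phi> \<in> H1" and orth: "ip U \<phi> = 0"
  let ?p = "crit_exp CARD('n)"
  have UH: "U \<in> H1" and Un: "(nrm U)\<^sup>2 = \<rho>\<^sup>2" using U(1) mass_sphere_iff by auto
  \<comment> \<open>The squared norm of \<open>U + t * \<phi>\<close> is
    \<open>\<rho>\<^sup>2 * (1 + t\<^sup>2 * k)\<close> by orthogonality, so \<open>c t\<close>
    restores the mass. As \<open>c t\<close> is at most 1, rescaling does not raise the Dirichlet
    integral and the curve stays where U is minimal.\<close>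
  define k where "k = (nrm \<phi>)\<^sup>2 / \<rho>\<^sup>2"
  have k0: "0 \<le> k" unfolding k_def by simp
  define c where "c t = (1 + t\<^sup>2 * k) powr (- 1 / 2)" for t
  have pos: "1 + t\<^sup>2 * k > 0" for t using k0 by (simp add: add_pos_nonneg)
  define T where "T t x = U x + t * \<phi> x" for t x
  have TH: "T t \<in> H1" for t unfolding T_def[abs_def] by (intro H1_add H1_cmult UH p)
  have c2: "(c t)\<^sup>2 * (1 + t\<^sup>2 * k) = 1" for t
  proof -
    have "(c t)\<^sup>2 = (1 + t\<^sup>2 * k) powr (- 1)" unfolding c_def using pos[of t] by (subst powr_power) auto
    then show ?thesis using pos[of t] by (simp add: powr_minus)
  qed
  have c1: "0 < c t" "c t \<le> 1" for t
  proof -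
    show "0 < c t" unfolding c_def using pos[of t] by simp
    have "(1 + t\<^sup>2 * k) powr (- 1 / 2) \<le> 1 powr (- 1 / 2)"
      using k0 by (intro powr_mono2') auto
    then show "c t \<le> 1" unfolding c_def by simp
  qed
  define h where "h t = energy V (\<lambda>x. c t * T t x)" for t
  have mem: "(\<lambda>x. c t * T t x) \<in> mass_sphere \<rho>" for t
  proof -
    have "(nrm (T t))\<^sup>2 = (nrm U)\<^sup>2 + 2 * ip U (\<lambda>x. t * \<phi> x) + (nrm (\<lambda>x. t * \<phi> x))\<^sup>2"
      unfolding T_def by (intro nrm_sq_add L2_cmult H1_L2 UH p)
    also have "\<dots> = \<rho>\<^sup>2 * (1 + t\<^sup>2 * k)"
      using Un orth \<rho> unfolding k_def by (simp add: ip_cmult_right nrm_cmult power_mult_distrib distrib_left)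
    finally have "(nrm (\<lambda>x. c t * T t x))\<^sup>2 = \<rho>\<^sup>2 * ((c t)\<^sup>2 * (1 + t\<^sup>2 * k))"
      by (simp add: nrm_cmult power_mult_distrib)
    then show ?thesis unfolding mass_sphere_iff c2 using H1_cmult[OF TH] by simp
  qed
  have grT: "gr (T t) = gr U + 2 * (t * grip U \<phi>) + t\<^sup>2 * gr \<phi>" for t
    unfolding T_def using UH p by (simp add: gr_add gr_cmult grip_cmult_right H1_cmult)
  have heq: "h t = (c t)\<^sup>2 * (1 / 2 * (gr U + 2 * (t * grip U \<phi>) + t\<^sup>2 * gr \<phi>) + 1 / 2 * (vq V U + 2 * (t * vb V U \<phi>) + t\<^sup>2 * vq V \<phi>))
      - c t powr ?p * (1 / ?p * lp (\<lambda>x. U x + t * \<phi> x))" for t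
  proof -
    have vqT: "vq V (T t) = vq V U + 2 * (t * vb V U \<phi>) + t\<^sup>2 * vq V \<phi>"
      unfolding T_def using UH p by (simp add: vq_add vq_cmult vb_cmult_right H1_cmult)
    show ?thesis
      unfolding h_def energy_eq[OF H1_cmult[OF TH]] gr_cmult[OF TH] vq_cmult lp_cmult grT vqT
      using c1(1)[of t] by (simp add: T_def[abs_def] algebra_simps)
  qed
  have Dc: "(c has_real_derivative 0) (at 0)"
    unfolding c_def by (auto intro!: derivative_eq_intros simp: k0)
  have c0: "c 0 = 1" unfolding c_def by simp
  have p0: "?p > 0" by (rule crit_exp_facts(5)[OF N3])
  have Dcp: "((\<lambda>t. c t powr ?p) has_real_derivative 0) (at 0)"
    using DERIV_fun_powr[OF Dc, of ?p] c0 by simp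
  have Dc2: "((\<lambda>t. (c t)\<^sup>2) has_real_derivative 0) (at 0)"
    using DERIV_power[OF Dc, of 2] by simp
  have Dh: "(h has_real_derivative de V U \<phi>) (at 0)"
    unfolding heq[abs_def] de_def
    by (rule derivative_eq_intros Dc2 Dcp lp_deriv[OF N3 H1_Lcrit[OF N3 UH] H1_Lcrit[OF N3 p]] refl | use p0 c0 in simp)+
  have "((\<lambda>t. gr U + 2 * (t * grip U \<phi>) + t\<^sup>2 * gr \<phi>) \<longlongrightarrow> gr U + 2 * (0 * grip U \<phi>) + 0\<^sup>2 * gr \<phi>) (at 0)"
    by (intro tendsto_intros)
  then have "\<forall>\<^sub>F t in at 0. gr U + 2 * (t * grip U \<phi>) + t\<^sup>2 * gr \<phi> < g"
    by (rule order_tendstoD) (use U(2) in simp)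
  then obtain d where d: "d > 0" "\<And>t. t \<noteq> 0 \<Longrightarrow> \<bar>t\<bar> < d \<Longrightarrow> gr (T t) < g"
    unfolding eventually_at grT by auto
  have "h 0 \<le> h t" if t: "\<bar>0 - t\<bar> < d" for t
  proof (cases "t = 0")
    case False
    have "(c t)\<^sup>2 \<le> 1" using c1[of t] by (simp add: power_le_one)
    then have "gr (\<lambda>x. c t * T t x) \<le> gr (T t)"
      unfolding gr_cmult[OF TH] using mult_right_mono[of "(c t)\<^sup>2" 1 "gr (T t)"] by simp
    also have "\<dots> < g" using d(2)[of t] False t by simp
    finally have "energy V U \<le> h t" unfolding h_def by (intro min mem)
    moreover have "h 0 = energy V U" unfolding h_def c0 T_def by simp
    ultimately show ?thesis by simp
  qed simp
  then show "de V U \<phi> = 0" using DERIV_local_min[OF Dh d(1)] by blast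
qed

end

section \<open>Existence of a minimizer in a ball\<close>

lemma neg_part_abs: "\<bar>neg_part f x\<bar> \<le> \<bar>f x\<bar>" and neg_part_ge: "- f x \<le> neg_part f x" and neg_part_nonneg: "0 \<le> neg_part f x"
  unfolding neg_part_def by auto

lemma neg_part_meas: "f \<in> borel_measurable lebesgue \<Longrightarrow> neg_part f \<in> borel_measurable lebesgue"
  unfolding neg_part_def[abs_def] by simp

lemma Linf_indicator_Lp:
  fixes f :: "real ^ 'n \<Rightarrow> real"
  assumes f: "f \<in> Linf_space" and q: "q > 0"
  shows "(\<lambda>x. indicator (cball 0 M) x * f x) \<in> Lp_space q"
proof -
  have m: "(indicator (cball 0 M :: (real ^ 'n) set) :: _ \<Rightarrow> real) \<in> borel_measurable lebesgue"
    by (intro borel_measurable_indicator) auto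
  have i: "integrable lebesgue (\<lambda>x. indicator (cball 0 M :: (real ^ 'n) set) x :: real)"
  proof -
    have "emeasure lebesgue (cball 0 M :: (real ^ 'n) set) < \<infinity>"
      using emeasure_bounded_finite[OF bounded_cball] by simp
    then show ?thesis by (intro integrable_real_indicator) auto
  qed
  have "integrable lebesgue (\<lambda>x. \<bar>indicator (cball 0 M) x * f x\<bar> powr q)"
  proof (rule Bochner_Integration.integrable_bound)
    show "integrable lebesgue (\<lambda>x. Linf_norm f powr q * indicator (cball 0 M :: (real ^ 'n) set) x)" using i by simp
    have "(\<lambda>x. indicator (cball 0 M) x * f x) \<in> borel_measurable lebesgue"
      by (intro borel_measurable_times m Linf_meas f)
    then show "(\<lambda>x. \<bar>indicator (cball 0 M) x * f x\<bar> powr q) \<in> borel_measurable lebesgue" by simp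
    show "AE x in lebesgue. norm (\<bar>indicator (cball 0 M) x * f x\<bar> powr q) \<le> norm (Linf_norm f powr q * indicator (cball 0 M :: (real ^ 'n) set) x)"
      using Linf_norm_props(2)[OF f]
    proof eventually_elim
      case (elim x)
      have "\<bar>f x\<bar> powr q \<le> Linf_norm f powr q" using elim q by (intro powr_mono2) auto
      then show ?case using q by (auto simp: indicator_def)
    qed
  qed
  then show ?thesis
    using m Linf_meas[OF f] unfolding Lp_space_def by (auto intro!: borel_measurable_times)
qed

context potential
begin

lemma vq_ge:
  assumes U: "U \<in> H1"
  shows "- (Lp_norm (real CARD('n) / 2) (neg_part V1) * (sobS CARD('n) * gr U)) - Linf_norm (neg_part V2) * (nrm U)\<^sup>2 \<le> vq V U"
proof -
  have q: "real CARD('n) / 2 > 0" using N3 by simp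
  have n1: "neg_part V1 \<in> Lp_space (real CARD('n) / 2)"
    by (rule Lp_space_le[OF V1 q neg_part_meas[OF V1_meas] AE_I2, where C = 1]) (use neg_part_abs in auto)
  have n2: "neg_part V2 \<in> Linf_space"
    by (rule Linf_norm_le[OF V2 neg_part_meas[OF Linf_meas[OF V2]], of 1]) (use neg_part_abs in auto)
  have UC: "U \<in> Lcrit" by (rule H1_Lcrit[OF N3 U])
  have i1: "integrable lebesgue (\<lambda>x. neg_part V1 x * (U x)\<^sup>2)" by (rule holder_sq(1)[OF N3 n1 UC])
  have i2: "integrable lebesgue (\<lambda>x. neg_part V2 x * (U x)\<^sup>2)" by (rule Linf_sq_integrable[OF n2 H1_L2[OF U]])
  have "- vq V U = (LINT x|lebesgue. - (V x * (U x)\<^sup>2))" unfolding vq_def by simp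
  also have "\<dots> \<le> (LINT x|lebesgue. neg_part V1 x * (U x)\<^sup>2 + neg_part V2 x * (U x)\<^sup>2)"
  proof (rule integral_mono_AE)
    show "integrable lebesgue (\<lambda>x. - (V x * (U x)\<^sup>2))" using V_sq_integrable[OF U] by simp
    show "integrable lebesgue (\<lambda>x. neg_part V1 x * (U x)\<^sup>2 + neg_part V2 x * (U x)\<^sup>2)" using i1 i2 by simp
    show "AE x in lebesgue. - (V x * (U x)\<^sup>2) \<le> neg_part V1 x * (U x)\<^sup>2 + neg_part V2 x * (U x)\<^sup>2"
      using V_AE
    proof eventually_elim
      case (elim x)
      have "- V x \<le> neg_part V1 x + neg_part V2 x" using elim neg_part_ge[of V1 x] neg_part_ge[of V2 x] by linarith
      then have "- V x * (U x)\<^sup>2 \<le> (neg_part V1 x + neg_part V2 x) * (U x)\<^sup>2" by (intro mult_right_mono) auto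
      then show ?case by (simp add: distrib_right)
    qed
  qed
  also have "\<dots> = (LINT x|lebesgue. neg_part V1 x * (U x)\<^sup>2) + (LINT x|lebesgue. neg_part V2 x * (U x)\<^sup>2)"
    using i1 i2 by simp
  also have "(LINT x|lebesgue. neg_part V1 x * (U x)\<^sup>2) \<le> Lp_norm (real CARD('n) / 2) (neg_part V1) * lp U powr (2 / crit_exp CARD('n))"
    using holder_sq(2)[OF N3 n1 UC] neg_part_nonneg[of V1] by simp
  also have "\<dots> \<le> Lp_norm (real CARD('n) / 2) (neg_part V1) * (sobS CARD('n) * gr U)"
    by (intro mult_left_mono lp_le_gr[OF N3 U]) (simp add: Lp_norm_def)
  also have "(LINT x|lebesgue. neg_part V2 x * (U x)\<^sup>2) \<le> Linf_norm (neg_part V2) * (nrm U)\<^sup>2"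
    by (rule Linf_sq_le[OF n2 H1_L2[OF U]])
  finally show ?thesis by simp
qed

text \<open>The bounded part is cut at a large radius M: inside, it belongs to the space of exponent
  N/2 and joins V1; outside, it is uniformly small against bounded mass.\<close>

lemma V_abs_tendsto_0:
  assumes w: "\<And>n. w n \<in> H1" "\<And>n. nrm (w n) \<le> A" "\<And>n. gr (w n) \<le> B" and lim: "AE x in lebesgue. (\<lambda>n. w n x) \<longlonglongrightarrow> 0"
  shows "(\<lambda>n. LINT x|lebesgue. \<bar>V x\<bar> * (w n x)\<^sup>2) \<longlonglongrightarrow> 0"
proof (rule LIMSEQ_I)
  fix e :: real assume e: "e > 0"
  define d where "d = e / (2 * (A\<^sup>2 + 1))"
  have d: "d > 0" "d * A\<^sup>2 < e / 2"
  proof -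
    have "A\<^sup>2 + 1 > 0" by (simp add: add_nonneg_pos)
    then show "d > 0" "d * A\<^sup>2 < e / 2" unfolding d_def using e by (auto simp: field_simps)
  qed
  obtain M where M: "\<And>x. M \<le> norm x \<Longrightarrow> \<bar>V2 x\<bar> < d"
    using tendstoD[OF V2_lim d(1)] unfolding eventually_at_infinity by auto
  have q: "real CARD('n) / 2 > 0" using N3 by simp
  have wC: "w n \<in> Lcrit" for n by (rule H1_Lcrit[OF N3 w(1)])
  define K where "K = sobK CARD('n) * B powr (crit_exp CARD('n) / 2)"
  have lpK: "lp (w n) \<le> K" for n
  proof -
    have "lp (w n) \<le> sobK CARD('n) * gr (w n) powr (crit_exp CARD('n) / 2)" by (rule lp_le_gr'[OF N3 w(1)])
    also have "\<dots> \<le> K" unfolding K_def using w(3) crit_exp_facts(5)[OF N3]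
      by (intro mult_left_mono powr_mono2) (auto simp: sobK_def)
    finally show ?thesis .
  qed
  let ?V2 = "\<lambda>x. indicator (cball 0 M) x * V2 x"
  have V2L: "?V2 \<in> Lp_space (real CARD('n) / 2)" by (rule Linf_indicator_Lp[OF V2 q])
  have l1: "(\<lambda>n. LINT x|lebesgue. \<bar>V1 x\<bar> * (w n x)\<^sup>2) \<longlonglongrightarrow> 0"
    by (rule weighted_sq_tendsto_0[OF N3 V1 wC lpK lim])
  have l2: "(\<lambda>n. LINT x|lebesgue. \<bar>?V2 x\<bar> * (w n x)\<^sup>2) \<longlonglongrightarrow> 0"
    by (rule weighted_sq_tendsto_0[OF N3 V2L wC lpK lim])
  have "(\<lambda>n. (LINT x|lebesgue. \<bar>V1 x\<bar> * (w n x)\<^sup>2) + (LINT x|lebesgue. \<bar>?V2 x\<bar> * (w n x)\<^sup>2)) \<longlonglongrightarrow> 0"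
    using tendsto_add[OF l1 l2] by simp
  then obtain n0 where n0: "\<And>n. n \<ge> n0 \<Longrightarrow> \<bar>(LINT x|lebesgue. \<bar>V1 x\<bar> * (w n x)\<^sup>2) + (LINT x|lebesgue. \<bar>?V2 x\<bar> * (w n x)\<^sup>2)\<bar> < e / 2"
    using LIMSEQ_D[of _ 0 "e / 2"] e by fastforce
  have "norm ((LINT x|lebesgue. \<bar>V x\<bar> * (w n x)\<^sup>2) - 0) < e" if n: "n \<ge> n0" for n
  proof -
    have i1: "integrable lebesgue (\<lambda>x. \<bar>V1 x\<bar> * (w n x)\<^sup>2)"
      using integrable_abs[OF holder_sq(1)[OF N3 V1 wC, of n]] by (simp add: abs_mult)
    have i2: "integrable lebesgue (\<lambda>x. \<bar>?V2 x\<bar> * (w n x)\<^sup>2)"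
      using integrable_abs[OF holder_sq(1)[OF N3 V2L wC, of n]] by (simp add: abs_mult)
    have i3: "integrable lebesgue (\<lambda>x. d * (w n x)\<^sup>2)" using H1_L2[OF w(1)[of n]] by (simp add: L2_iff)
    have i0: "integrable lebesgue (\<lambda>x. \<bar>V x\<bar> * (w n x)\<^sup>2)"
      using integrable_abs[OF V_sq_integrable[OF w(1)[of n]]] by (simp add: abs_mult)
    have "(LINT x|lebesgue. \<bar>V x\<bar> * (w n x)\<^sup>2) \<le> (LINT x|lebesgue. \<bar>V1 x\<bar> * (w n x)\<^sup>2 + \<bar>?V2 x\<bar> * (w n x)\<^sup>2 + d * (w n x)\<^sup>2)"
    proof (rule integral_mono_AE[OF i0])
      show "integrable lebesgue (\<lambda>x. \<bar>V1 x\<bar> * (w n x)\<^sup>2 + \<bar>?V2 x\<bar> * (w n x)\<^sup>2 + d * (w n x)\<^sup>2)"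
        by (intro Bochner_Integration.integrable_add i1 i2 i3)
      show "AE x in lebesgue. \<bar>V x\<bar> * (w n x)\<^sup>2 \<le> \<bar>V1 x\<bar> * (w n x)\<^sup>2 + \<bar>?V2 x\<bar> * (w n x)\<^sup>2 + d * (w n x)\<^sup>2"
        using V_AE
      proof eventually_elim
        case (elim x)
        have "\<bar>V2 x\<bar> \<le> \<bar>?V2 x\<bar> + d"
          using M[of x] d(1) by (cases "norm x \<le> M") (auto simp: indicator_def)
        then have "\<bar>V x\<bar> \<le> \<bar>V1 x\<bar> + \<bar>?V2 x\<bar> + d" unfolding elim by linarith
        from mult_right_mono[OF this, of "(w n x)\<^sup>2"] show ?case by (simp add: distrib_right)
      qed
    qed
    also have "\<dots> = (LINT x|lebesgue. \<bar>V1 x\<bar> * (w n x)\<^sup>2) + (LINT x|lebesgue. \<bar>?V2 x\<bar> * (w n x)\<^sup>2) + d * (nrm (w n))\<^sup>2"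
      unfolding nrm_sq_int
      by (subst Bochner_Integration.integral_add[OF Bochner_Integration.integrable_add[OF i1 i2] i3],
          subst Bochner_Integration.integral_add[OF i1 i2]) simp
    also have "d * (nrm (w n))\<^sup>2 \<le> d * A\<^sup>2"
      using d(1) w(2) by (intro mult_left_mono power_mono) auto
    finally have "(LINT x|lebesgue. \<bar>V x\<bar> * (w n x)\<^sup>2) < e" using n0[OF n] d(2) by linarith
    moreover have "0 \<le> (LINT x|lebesgue. \<bar>V x\<bar> * (w n x)\<^sup>2)" by (intro Bochner_Integration.integral_nonneg) simp
    ultimately show ?thesis by simp
  qed
  then show "\<exists>n0. \<forall>n\<ge>n0. norm ((LINT x|lebesgue. \<bar>V x\<bar> * (w n x)\<^sup>2) - 0) < e" by blast
qed

text \<open>The cross term is split by Young's inequality with a small t on the fixed function W,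
  leaving a multiple of the quadratic term of \<open>w n\<close>, which tends to 0.\<close>

lemma vq_diff_tendsto_0:
  assumes w: "\<And>n. w n \<in> H1" "\<And>n. nrm (w n) \<le> A" "\<And>n. gr (w n) \<le> B" and lim: "AE x in lebesgue. (\<lambda>n. w n x) \<longlonglongrightarrow> 0"
    and W: "W \<in> H1"
  shows "(\<lambda>n. vq V (\<lambda>x. W x + w n x) - vq V W) \<longlonglongrightarrow> 0"
proof -
  let ?a = "\<lambda>n. LINT x|lebesgue. \<bar>V x\<bar> * (w n x)\<^sup>2"
  have a: "?a \<longlonglongrightarrow> 0" by (rule V_abs_tendsto_0[OF w lim])
  have a0: "0 \<le> ?a n" for n by (intro Bochner_Integration.integral_nonneg) simp
  have iw: "integrable lebesgue (\<lambda>x. \<bar>V x\<bar> * (w n x)\<^sup>2)" for n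
    using integrable_abs[OF V_sq_integrable[OF w(1)[of n]]] by (simp add: abs_mult)
  have iW: "integrable lebesgue (\<lambda>x. \<bar>V x\<bar> * (W x)\<^sup>2)"
    using integrable_abs[OF V_sq_integrable[OF W]] by (simp add: abs_mult)
  define b where "b = (LINT x|lebesgue. \<bar>V x\<bar> * (W x)\<^sup>2)"
  have b0: "0 \<le> b" unfolding b_def by (intro Bochner_Integration.integral_nonneg) simp
  have bound: "\<bar>vq V (\<lambda>x. W x + w n x) - vq V W\<bar> \<le> t * b + (1 + 1 / t) * ?a n" if t: "t > 0" for t n
  proof -
    have "\<bar>vq V (\<lambda>x. W x + w n x) - vq V W\<bar> = \<bar>LINT x|lebesgue. V x * (W x + w n x)\<^sup>2 - V x * (W x)\<^sup>2\<bar>"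
      unfolding vq_def using V_sq_integrable[OF H1_add[OF W w(1), of n]] V_sq_integrable[OF W] by simp
    also have "\<dots> \<le> (LINT x|lebesgue. \<bar>V x * (W x + w n x)\<^sup>2 - V x * (W x)\<^sup>2\<bar>)" by (rule integral_abs_bound)
    also have "\<dots> \<le> (LINT x|lebesgue. t * (\<bar>V x\<bar> * (W x)\<^sup>2) + (1 + 1 / t) * (\<bar>V x\<bar> * (w n x)\<^sup>2))"
    proof (rule integral_mono)
      show "integrable lebesgue (\<lambda>x. \<bar>V x * (W x + w n x)\<^sup>2 - V x * (W x)\<^sup>2\<bar>)"
        using V_sq_integrable[OF H1_add[OF W w(1), of n]] V_sq_integrable[OF W] by simp
      show "integrable lebesgue (\<lambda>x. t * (\<bar>V x\<bar> * (W x)\<^sup>2) + (1 + 1 / t) * (\<bar>V x\<bar> * (w n x)\<^sup>2))" using iW iw by simp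
      fix x
      have "2 * (sqrt t * \<bar>W x\<bar>) * (\<bar>w n x\<bar> / sqrt t) \<le> (sqrt t * \<bar>W x\<bar>)\<^sup>2 + (\<bar>w n x\<bar> / sqrt t)\<^sup>2"
        by (rule sum_squares_bound)
      then have y: "2 * \<bar>W x * w n x\<bar> \<le> t * (W x)\<^sup>2 + (w n x)\<^sup>2 / t"
        using t by (simp add: power_mult_distrib power_divide abs_mult)
      have "\<bar>V x * (W x + w n x)\<^sup>2 - V x * (W x)\<^sup>2\<bar> = \<bar>V x\<bar> * \<bar>2 * (W x * w n x) + (w n x)\<^sup>2\<bar>"
        unfolding abs_mult[symmetric] by (simp add: power2_sum algebra_simps)
      also have "\<dots> \<le> \<bar>V x\<bar> * (t * (W x)\<^sup>2 + (1 + 1 / t) * (w n x)\<^sup>2)"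
      proof (intro mult_left_mono)
        have "\<bar>2 * (W x * w n x) + (w n x)\<^sup>2\<bar> \<le> \<bar>2 * (W x * w n x)\<bar> + \<bar>(w n x)\<^sup>2\<bar>" by (rule abs_triangle_ineq)
        also have "\<dots> \<le> t * (W x)\<^sup>2 + (w n x)\<^sup>2 / t + (w n x)\<^sup>2" using y by simp
        finally show "\<bar>2 * (W x * w n x) + (w n x)\<^sup>2\<bar> \<le> t * (W x)\<^sup>2 + (1 + 1 / t) * (w n x)\<^sup>2" by (simp add: algebra_simps)
      qed simp
      finally show "\<bar>V x * (W x + w n x)\<^sup>2 - V x * (W x)\<^sup>2\<bar> \<le> t * (\<bar>V x\<bar> * (W x)\<^sup>2) + (1 + 1 / t) * (\<bar>V x\<bar> * (w n x)\<^sup>2)"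
        by (simp add: algebra_simps)
    qed
    also have "\<dots> = t * b + (1 + 1 / t) * ?a n" unfolding b_def using iW iw by simp
    finally show ?thesis .
  qed
  show ?thesis
  proof (rule LIMSEQ_I)
    fix e :: real assume e: "e > 0"
    define t where "t = e / (2 * (b + 1))"
    have t: "t > 0" "t * b < e / 2" unfolding t_def using e b0 by (auto simp: field_simps)
    have "(\<lambda>n. (1 + 1 / t) * ?a n) \<longlonglongrightarrow> (1 + 1 / t) * 0" by (intro tendsto_mult tendsto_const a)
    then have "\<forall>\<^sub>F n in sequentially. (1 + 1 / t) * ?a n < e / 2" by (rule order_tendstoD) (use e in simp)
    then obtain n0 where n0: "\<And>n. n \<ge> n0 \<Longrightarrow> (1 + 1 / t) * ?a n < e / 2" unfolding eventually_sequentially by blast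
    have "norm (vq V (\<lambda>x. W x + w n x) - vq V W - 0) < e" if "n \<ge> n0" for n
      using bound[OF t(1), of n] n0[OF that] t(2) unfolding real_norm_def diff_0_right by linarith
    then show "\<exists>n0. \<forall>n\<ge>n0. norm (vq V (\<lambda>x. W x + w n x) - vq V W - 0) < e" by blast
  qed
qed

text \<open>The quadratic terms scale by the square of t and the subtracted critical term by a
  higher power. Negative energy therefore only decreases when mass is added by scaling up.\<close>

lemma energy_cmult_le:
  assumes U: "U \<in> H1" and t: "t \<ge> 1"
  shows "energy V (\<lambda>x. t * U x) \<le> t\<^sup>2 * energy V U"
proof -
  let ?p = "crit_exp CARD('n)"
  have p: "?p > 2" by (rule crit_exp_facts(1)[OF N3])
  have "t powr 2 \<le> t powr ?p" using t p by (intro powr_mono) auto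
  then have "t\<^sup>2 \<le> t powr ?p" using t by simp
  then have "t\<^sup>2 * (1 / ?p * lp U) \<le> t powr ?p * (1 / ?p * lp U)" using p by (intro mult_right_mono) auto
  then show ?thesis
    using t by (simp add: energy_eq H1_cmult U gr_cmult vq_cmult lp_cmult algebra_simps)
qed

end

text \<open>g is the radius, in terms of the Dirichlet integral, of the region of minimization. The
  factor 4 leaves room for differences of two functions from this region.\<close>

locale small_potential = potential V V1 V2 for V V1 V2 :: "real ^ 'n \<Rightarrow> real" +
  fixes \<rho> g :: real
  assumes \<rho>: "\<rho> > 0" and g: "g > 0"
    and g_small: "sobK CARD('n) * (4 * g) powr (crit_exp CARD('n) / 2 - 1) \<le> crit_exp CARD('n) / 16"
    and V1_small: "Lp_norm (real CARD('n) / 2) (neg_part V1) * sobS CARD('n) \<le> 1 / 2"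
    and V2_small: "\<rho>\<^sup>2 * Linf_norm (neg_part V2) \<le> g / 8"
    and spec: "spectral_bottom V < 0"
begin

lemma lp_small:
  fixes U :: "real ^ 'n \<Rightarrow> real"
  assumes U: "U \<in> H1" "gr U \<le> 4 * g"
  shows "1 / crit_exp CARD('n) * lp U \<le> gr U / 16"
proof -
  let ?p = "crit_exp CARD('n)"
  have p: "?p > 2" by (rule crit_exp_facts(1)[OF N3])
  have "lp U \<le> sobK CARD('n) * gr U powr (?p / 2)" by (rule lp_le_gr'[OF N3 U(1)])
  also have "gr U powr (?p / 2) = gr U powr (?p / 2 - 1) * gr U"
    by (cases "gr U = 0") (simp_all add: powr_diff)
  also have "sobK CARD('n) * (gr U powr (?p / 2 - 1) * gr U) \<le> sobK CARD('n) * ((4 * g) powr (?p / 2 - 1) * gr U)"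
    using U(2) p by (intro mult_left_mono mult_right_mono powr_mono2) (auto simp: sobK_def)
  also have "\<dots> \<le> ?p / 16 * gr U"
    using mult_right_mono[OF g_small, of "gr U"] by (simp add: mult.assoc)
  finally show ?thesis using p by (simp add: field_simps)
qed

lemma neg2_nonneg: "0 \<le> Linf_norm (neg_part V2)"
  by (rule Linf_norm_props(1)[OF Linf_norm_le[OF V2 neg_part_meas[OF Linf_meas[OF V2]], of 1]])
     (use neg_part_abs in auto)

lemma vq_lower:
  assumes U: "U \<in> H1" "(nrm U)\<^sup>2 \<le> \<rho>\<^sup>2"
  shows "- (gr U / 2) - g / 8 \<le> vq V U"
proof -
  have "Lp_norm (real CARD('n) / 2) (neg_part V1) * (sobS CARD('n) * gr U) \<le> gr U / 2"
    using mult_right_mono[OF V1_small, of "gr U"] by (simp add: mult.assoc)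
  moreover have "Linf_norm (neg_part V2) * (nrm U)\<^sup>2 \<le> Linf_norm (neg_part V2) * \<rho>\<^sup>2"
    using U(2) neg2_nonneg by (intro mult_left_mono)
  ultimately show ?thesis using vq_ge[OF U(1)] V2_small by (simp add: mult.commute)
qed

text \<open>Half of the Dirichlet integral loses a quarter of it to V1, a sixteenth to the critical
  term and \<open>g / 16\<close> to V2. Where the Dirichlet integral equals g the energy is thus at
  least \<open>g / 8\<close>, the barrier around the minimizer.\<close>

lemma energy_lower:
  assumes U: "U \<in> H1" "(nrm U)\<^sup>2 \<le> \<rho>\<^sup>2" "gr U \<le> 4 * g"
  shows "3 / 16 * gr U - g / 16 \<le> energy V U"
  unfolding energy_eq[OF U(1)] using vq_lower[OF U(1,2)] lp_small[OF U(1,3)] by linarith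

text \<open>A trial function for the spectral bottom, scaled to the right mass. Its negative
  quadratic form, compared with \<open>vq_lower\<close>, already forces its Dirichlet integral below
  g.\<close>

lemma negative_energy_point:
  obtains U where "U \<in> mass_sphere \<rho>" "gr U \<le> g" "energy V U < 0"
proof -
  obtain \<phi> where p: "\<phi> \<in> H1" "(LINT x|lebesgue. (\<phi> x)\<^sup>2) = 1"
    "ereal (LINT x|lebesgue. (norm (weak_grad \<phi> x))\<^sup>2 + V x * (\<phi> x)\<^sup>2) < 0"
    using spec unfolding spectral_bottom_def INF_less_iff by blast
  have "(LINT x|lebesgue. (norm (weak_grad \<phi> x))\<^sup>2 + V x * (\<phi> x)\<^sup>2) = gr \<phi> + vq V \<phi>"
    unfolding vq_def weak_grad_integral[OF p(1), symmetric]
    by (rule Bochner_Integration.integral_add[OF weak_grad_integrable[OF p(1)] V_sq_integrable[OF p(1)]])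
  with p(3) have neg: "gr \<phi> + vq V \<phi> < 0" by simp
  let ?U = "\<lambda>x. \<rho> * \<phi> x"
  have UH: "?U \<in> H1" by (rule H1_cmult[OF p(1)])
  have Un: "(nrm ?U)\<^sup>2 = \<rho>\<^sup>2"
    using p(2) by (simp add: nrm_cmult power_mult_distrib nrm_sq_int[of \<phi>])
  have neg': "gr ?U + vq V ?U < 0"
    using neg \<rho> by (simp add: gr_cmult[OF p(1)] vq_cmult distrib_left[symmetric] mult_pos_neg)
  have "- (gr ?U / 2) - g / 8 \<le> vq V ?U" by (rule vq_lower[OF UH]) (simp add: Un)
  then have "gr ?U \<le> g" using neg' g by linarith
  moreover have "energy V ?U < 0"
  proof -
    have "0 \<le> 1 / crit_exp CARD('n) * lp ?U" using crit_exp_facts(5)[OF N3] by simp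
    then show ?thesis unfolding energy_eq[OF UH] using neg' by linarith
  qed
  ultimately show ?thesis using that[of ?U] UH Un by (simp add: mass_sphere_iff)
qed

lemma minimizer_exists:
  obtains U where "U \<in> mass_sphere \<rho>" "gr U < g" "energy V U < 0" "\<And>x. 0 \<le> U x"
    "\<And>\<Phi>. \<Phi> \<in> mass_sphere \<rho> \<Longrightarrow> gr \<Phi> \<le> g \<Longrightarrow> energy V U \<le> energy V \<Phi>"
proof -
  let ?p = "crit_exp CARD('n)"
  let ?S = "{U \<in> mass_sphere \<rho>. gr U \<le> g}"
  have p: "?p > 2" by (rule crit_exp_facts(1)[OF N3])
  define m where "m = Inf (energy V ` ?S)"
  have low: "- g / 16 \<le> energy V U" if "U \<in> ?S" for U
  proof -
    have "3 / 16 * gr U - g / 16 \<le> energy V U"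
      using that g by (intro energy_lower) (auto simp: mass_sphere_iff)
    then show ?thesis using gr_nonneg[of U] by linarith
  qed
  have bb: "bdd_below (energy V ` ?S)" using low by (intro bdd_belowI[of _ "- g / 16"]) auto
  obtain U0 where U0: "U0 \<in> ?S" "energy V U0 < 0" using negative_energy_point by blast
  have mle: "m \<le> energy V U" if "U \<in> ?S" for U
    unfolding m_def by (rule cINF_lower[OF bb that])
  have m0: "m < 0" using mle[OF U0(1)] U0(2) by simp
  have "\<exists>U\<in>?S. energy V U < m + 1 / (real n + 1)" for n
  proof -
    have "m < m + 1 / (real n + 1)" by simp
    then show ?thesis unfolding m_def using cINF_less_iff[OF _ bb] U0(1) by blast
  qed
  then have "\<forall>n. \<exists>U. U \<in> ?S \<and> energy V U < m + 1 / (real n + 1)" by blast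
  from choice[OF this] obtain U where U': "\<forall>n. U n \<in> ?S \<and> energy V (U n) < m + 1 / (real n + 1)" ..
  have U: "\<And>n. U n \<in> ?S" "\<And>n. energy V (U n) < m + 1 / (real n + 1)" using U' by blast+
  have UH: "U n \<in> H1" and Un: "(nrm (U n))\<^sup>2 = \<rho>\<^sup>2" and Ug: "gr (U n) \<le> g" for n
    using U(1)[of n] by (auto simp: mass_sphere_iff)
  have Un': "nrm (U n) \<le> \<rho>" for n using Un[of n] \<rho> by (simp add: power2_eq_iff_nonneg)
  obtain r W where r: "strict_mono (r :: nat \<Rightarrow> nat)" and W: "W \<in> H1"
    and lim: "AE x in lebesgue. (\<lambda>n. U (r n) x) \<longlonglongrightarrow> W x"
    and Wn: "nrm W \<le> \<rho>" "gr W \<le> g" and weak: "\<And>V. V \<in> H1 \<Longrightarrow> (\<lambda>n. grip (\<lambda>x. U (r n) x - W x) V) \<longlonglongrightarrow> 0"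
    by (rule H1_compactness[of U \<rho> g, OF UH Un' Ug]) blast
  define w where "w n x = U (r n) x - W x" for n x
  have wH: "w n \<in> H1" for n unfolding w_def[abs_def] by (intro H1_diff UH W)
  have Ueq: "(\<lambda>x. W x + w n x) = U (r n)" for n unfolding w_def by simp
  have wlim: "AE x in lebesgue. (\<lambda>n. w n x) \<longlonglongrightarrow> 0"
    using lim unfolding w_def by eventually_elim (simp add: LIM_zero)
  have wn: "nrm (w n) \<le> 2 * \<rho>" for n
    unfolding w_def using nrm_triangle_diff[OF H1_L2[OF UH[of "r n"]] H1_L2[OF W]] Un'[of "r n"] Wn(1) by linarith
  \<comment> \<open>Twice the root of g is the root of 4g; hence the factor in the hypothesis on
    g.\<close>
  have wg: "gr (w n) \<le> 4 * g" for n
  proof -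
    have "sqrt (gr (w n)) \<le> sqrt (gr (U (r n))) + sqrt (gr (\<lambda>x. (-1) * W x))"
      using gr_triangle[OF UH[of "r n"] H1_cmult[OF W, of "-1"]] unfolding w_def by simp
    also have "gr (\<lambda>x. (-1) * W x) = gr W" using gr_cmult[OF W, of "-1"] by simp
    also have "sqrt (gr (U (r n))) + sqrt (gr W) \<le> sqrt g + sqrt g"
      using Ug Wn(2) by (intro add_mono real_sqrt_le_mono)
    also have "sqrt g + sqrt g = sqrt (4 * g)" by (simp add: real_sqrt_mult)
    finally show ?thesis by simp
  qed
  have c1: "(\<lambda>n. 2 * grip W (w n)) \<longlonglongrightarrow> 0"
    using tendsto_mult_right_zero[OF weak[OF W], of 2] unfolding w_def[abs_def] by (simp add: grip_commute)
  have c2: "(\<lambda>n. vq V (\<lambda>x. W x + w n x) - vq V W) \<longlonglongrightarrow> 0"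
    by (rule vq_diff_tendsto_0[OF wH wn wg wlim W])
  have lpb: "lp (w n) \<le> ?p * g / 4" for n
  proof -
    have "1 / ?p * lp (w n) \<le> g / 4" using lp_small[OF wH wg, of n] wg[of n] by linarith
    then show ?thesis using p by (simp add: field_simps)
  qed
  have c3: "(\<lambda>n. lp (\<lambda>x. W x + w n x) - lp W - lp (w n)) \<longlonglongrightarrow> 0"
    by (rule brezis_lieb[OF N3 H1_Lcrit[OF N3 W] H1_Lcrit[OF N3 wH] lpb wlim])
  \<comment> \<open>Collects all cross terms between W and the remainder, including the whole
    potential term of the remainder. They vanish by weak convergence, by decay of the potential
    terms and by the Brezis-Lieb lemma, respectively.\<close>
  define \<delta> where "\<delta> n = 1 / 2 * (2 * grip W (w n)) + 1 / 2 * (vq V (\<lambda>x. W x + w n x) - vq V W)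
      - 1 / ?p * (lp (\<lambda>x. W x + w n x) - lp W - lp (w n))" for n
  have \<delta>0: "\<delta> \<longlonglongrightarrow> 0"
    using tendsto_diff[OF tendsto_add[OF tendsto_mult_right_zero[OF c1, of "1/2"] tendsto_mult_right_zero[OF c2, of "1/2"]] tendsto_mult_right_zero[OF c3, of "1 / ?p"]]
    unfolding \<delta>_def by simp
  \<comment> \<open>What is left of the remainder is half its Dirichlet integral minus its critical
    term, nonnegative since its Dirichlet integral is at most 4g.\<close>
  have le: "energy V W \<le> m + 1 / (real n + 1) - \<delta> n" for n
  proof -
    have "energy V (U (r n)) = energy V W + \<delta> n + (1 / 2 * gr (w n) - 1 / ?p * lp (w n))"
      unfolding \<delta>_def energy_eq[OF UH] energy_eq[OF W] Ueq
      using gr_add[OF W wH, of n] unfolding Ueq by (simp add: algebra_simps)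
    moreover have "1 / ?p * lp (w n) \<le> gr (w n) / 16" by (rule lp_small[OF wH wg])
    moreover have "energy V (U (r n)) \<le> m + 1 / (real n + 1)"
    proof -
      have "1 / (real (r n) + 1) \<le> 1 / (real n + 1)" using seq_suble[OF r, of n] by (simp add: frac_le)
      then show ?thesis using U(2)[of "r n"] by linarith
    qed
    ultimately show ?thesis using gr_nonneg[of "w n"] by linarith
  qed
  have "(\<lambda>n. m + 1 / (real n + 1) - \<delta> n) \<longlonglongrightarrow> m + 0 - 0"
    by (intro tendsto_diff tendsto_add tendsto_const \<delta>0)
       (use LIMSEQ_inverse_real_of_nat in \<open>simp add: inverse_eq_divide add.commute\<close>)
  then have Wm: "energy V W \<le> m" using le by (intro LIMSEQ_le_const) auto
  have WE: "energy V W < 0" using Wm m0 by simp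
  define \<tau> where "\<tau> = nrm W"
  \<comment> \<open>A vanishing limit would have nonnegative energy.\<close>
  have \<tau>0: "\<tau> > 0"
  proof (rule ccontr)
    assume "\<not> \<tau> > 0"
    then have "nrm W = 0" unfolding \<tau>_def using nrm_nonneg[of W] by linarith
    then have W0: "AE x in lebesgue. W x = 0" by (rule nrm_eq_0[OF H1_L2[OF W]])
    have "vq V W = (LINT x|(lebesgue :: (real ^ 'n) measure). 0)"
      unfolding vq_def using W0 V_meas H1_meas[OF W] by (intro integral_cong_AE) (auto elim!: eventually_mono)
    moreover have "lp W = (LINT x|(lebesgue :: (real ^ 'n) measure). 0)"
      unfolding lp_def using W0 H1_meas[OF W] by (intro integral_cong_AE) (auto elim!: eventually_mono)
    ultimately show False using WE unfolding energy_eq[OF W] using gr_nonneg[of W] by simp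
  qed
  have pos_at: "energy V u > 0" if "u \<in> H1" "(nrm u)\<^sup>2 \<le> \<rho>\<^sup>2" "gr u = g" for u
    using energy_lower[OF that(1,2)] that(3) g by simp
  define t where "t = \<rho> / \<tau>"
  have t1: "t \<ge> 1" unfolding t_def using Wn(1) \<tau>0 by (simp add: \<tau>_def)
  have tW: "(\<lambda>x. t * W x) \<in> mass_sphere \<rho>"
  proof -
    have "nrm (\<lambda>x. t * W x) = \<rho>"
      unfolding nrm_cmult t_def \<tau>_def[symmetric] using \<tau>0 \<rho> by simp
    then show ?thesis unfolding mass_sphere_iff using H1_cmult[OF W, of t] by simp
  qed
  \<comment> \<open>Otherwise some multiple of W with factor s between 1 and t meets the barrier,
    where the energy is positive, while scaling up from negative energy keeps it negative.\<close>
  have tg: "gr (\<lambda>x. t * W x) < g"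
  proof (rule ccontr)
    assume "\<not> ?thesis"
    then have ge: "g \<le> t\<^sup>2 * gr W" by (simp add: gr_cmult[OF W])
    then have gW: "gr W > 0" using g gr_nonneg[of W] by (cases "gr W = 0") (auto simp: less_le)
    define s where "s = sqrt (g / gr W)"
    have s2: "s\<^sup>2 = g / gr W" unfolding s_def using g gW by simp
    have s1: "s \<ge> 1" unfolding s_def using Wn(2) gW by simp
    have st: "s \<le> t"
    proof (rule power2_le_imp_le)
      show "s\<^sup>2 \<le> t\<^sup>2" unfolding s2 using ge gW by (simp add: field_simps)
    qed (use t1 in simp)
    have "energy V (\<lambda>x. s * W x) > 0"
    proof (rule pos_at)
      show "(\<lambda>x. s * W x) \<in> H1" by (rule H1_cmult[OF W])
      show "gr (\<lambda>x. s * W x) = g" using gW by (simp add: gr_cmult[OF W] s2)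
      have "s * \<tau> \<le> t * \<tau>" using st \<tau>0 by simp
      then have "s * \<tau> \<le> \<rho>" unfolding t_def using \<tau>0 by simp
      then show "(nrm (\<lambda>x. s * W x))\<^sup>2 \<le> \<rho>\<^sup>2" using s1 \<tau>0 by (intro power_mono) (auto simp: nrm_cmult \<tau>_def)
    qed
    moreover have "energy V (\<lambda>x. s * W x) \<le> s\<^sup>2 * energy V W" by (rule energy_cmult_le[OF W s1])
    moreover have "s\<^sup>2 * energy V W \<le> 0" using WE by (simp add: mult_nonneg_nonpos)
    ultimately show False by linarith
  qed
  have tm: "energy V (\<lambda>x. t * W x) \<le> m"
  proof -
    have "energy V (\<lambda>x. t * W x) \<le> t\<^sup>2 * energy V W" by (rule energy_cmult_le[OF W t1])
    also have "\<dots> \<le> 1 * energy V W" using WE t1 by (intro mult_right_mono_neg) (auto simp: one_le_power)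
    finally show ?thesis using Wm by simp
  qed
  \<comment> \<open>The modulus keeps mass, potential term and critical term and does not raise the
    Dirichlet integral, so a nonnegative minimizer results.\<close>
  define Z where "Z x = \<bar>t * W x\<bar>" for x
  have tWH: "(\<lambda>x. t * W x) \<in> H1" using tW by (simp add: mass_sphere_iff)
  have Zg: "gr Z \<le> gr (\<lambda>x. t * W x)" unfolding Z_def[abs_def] by (rule abs_H1(2)[OF tWH])
  have ZH: "Z \<in> H1" unfolding Z_def[abs_def] by (rule abs_H1(1)[OF tWH])
  have "nrm Z = nrm (\<lambda>x. t * W x)" unfolding nrm_def ip_def Z_def by simp
  then have ZM: "Z \<in> mass_sphere \<rho>" using tW ZH by (simp add: mass_sphere_iff)
  have ZE: "energy V Z \<le> m"
  proof -
    have "vq V Z = vq V (\<lambda>x. t * W x)" "lp Z = lp (\<lambda>x. t * W x)" unfolding vq_def lp_def Z_def by auto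
    then show ?thesis using tm Zg unfolding energy_eq[OF ZH] energy_eq[OF tWH] by simp
  qed
  show ?thesis
  proof (rule that[OF ZM])
    show "gr Z < g" using Zg tg by simp
    show "energy V Z < 0" using ZE m0 by simp
    show "0 \<le> Z x" for x unfolding Z_def by simp
    show "energy V Z \<le> energy V \<Phi>" if "\<Phi> \<in> mass_sphere \<rho>" "gr \<Phi> \<le> g" for \<Phi>
      using ZE mle[of \<Phi>] that by simp
  qed
qed

end

section \<open>Positivity\<close>

text \<open>A substitute for the chain rule: along a subsequence the difference quotients of U and
  of F converge a.e. to their weak derivatives, so an algebraic formula for the quotients of F
  identifies its weak derivative.\<close>

lemma wp_AE_limit:
  assumes U: "U \<in> H1" and F: "F \<in> H1"
    and lim: "\<And>x h. h \<longlonglongrightarrow> 0 \<Longrightarrow> (\<And>n. h n \<noteq> 0) \<Longrightarrow> (\<lambda>n. dq i (h n) U x) \<longlonglongrightarrow> weak_partial i U x \<Longrightarrow>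
      (\<lambda>n. dq i (h n) F x) \<longlonglongrightarrow> D x"
  shows "AE x in lebesgue. weak_partial i F x = D x"
proof -
  define h where "h n = inverse (real (Suc n))" for n
  have h: "h n \<noteq> 0" for n unfolding h_def by simp
  have h0: "h \<longlonglongrightarrow> 0" unfolding h_def by (rule LIMSEQ_inverse_real_of_nat)
  have hlim: "filterlim h (at 0) sequentially" unfolding filterlim_at using h h0 by auto
  have cU: "(\<lambda>n. nrm (\<lambda>x. dq i (h n) U x - weak_partial i U x)) \<longlonglongrightarrow> 0"
    by (rule filterlim_compose[OF dq_tendsto[OF H1_L2[OF U] wp_L2[OF U] wp_is[OF U]] hlim])
  have cF: "(\<lambda>n. nrm (\<lambda>x. dq i (h n) F x - weak_partial i F x)) \<longlonglongrightarrow> 0"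
    by (rule filterlim_compose[OF dq_tendsto[OF H1_L2[OF F] wp_L2[OF F] wp_is[OF F]] hlim])
  obtain r where r: "strict_mono (r :: nat \<Rightarrow> nat)" "AE x in lebesgue. (\<lambda>n. dq i (h (r n)) U x) \<longlonglongrightarrow> weak_partial i U x"
    by (rule nrm_tendsto_AE_subseq[OF dq_L2[OF H1_L2[OF U]] wp_L2[OF U] cU])
  have cF': "(\<lambda>n. nrm (\<lambda>x. dq i (h (r n)) F x - weak_partial i F x)) \<longlonglongrightarrow> 0"
    using LIMSEQ_subseq_LIMSEQ[OF cF r(1)] by (simp add: o_def)
  obtain q where q: "strict_mono (q :: nat \<Rightarrow> nat)" "AE x in lebesgue. (\<lambda>n. dq i (h (r (q n))) F x) \<longlonglongrightarrow> weak_partial i F x"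
    by (rule nrm_tendsto_AE_subseq[OF dq_L2[OF H1_L2[OF F]] wp_L2[OF F] cF'])
  show ?thesis
    using r(2) q(2)
  proof eventually_elim
    case (elim x)
    have "(\<lambda>n. dq i (h (r (q n))) U x) \<longlonglongrightarrow> weak_partial i U x"
      using LIMSEQ_subseq_LIMSEQ[OF elim(1) q(1)] by (simp add: o_def)
    moreover have "(\<lambda>n. h (r (q n))) \<longlonglongrightarrow> 0"
      using LIMSEQ_subseq_LIMSEQ[OF h0 strict_mono_o[OF r(1) q(1)]] by (simp add: o_def)
    ultimately have "(\<lambda>n. dq i (h (r (q n))) F x) \<longlonglongrightarrow> D x" using lim h by blast
    then show ?case using elim(2) LIMSEQ_unique by blast
  qed
qed

text \<open>Convergence of the quotients at x forces continuity at x along the shifts, which gives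
  the limits of denominators containing the shifted value.\<close>

lemma shift_tendsto:
  assumes "h \<longlonglongrightarrow> 0" "\<And>n. h n \<noteq> 0" "(\<lambda>n. dq i (h n) U x) \<longlonglongrightarrow> d"
  shows "(\<lambda>n. U (x + axis i (h n))) \<longlonglongrightarrow> U x"
proof -
  have "(\<lambda>n. U x + h n * dq i (h n) U x) \<longlonglongrightarrow> U x + 0 * d"
    by (intro tendsto_add tendsto_mult tendsto_const assms)
  then show ?thesis unfolding dq_def using assms(2) by simp
qed

lemma test_dq_tendsto:
  assumes p: "\<phi> \<in> test_functions" and h: "h \<longlonglongrightarrow> 0" "\<And>n. h n \<noteq> 0"
  shows "(\<lambda>n. dq i (h n) \<phi> x) \<longlonglongrightarrow> partial_deriv i \<phi> x"
proof -
  have hlim: "filterlim h (at 0) sequentially" unfolding filterlim_at using h by auto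
  have "((\<lambda>s. (\<phi> (x + axis i (0 + s)) - \<phi> (x + axis i 0)) / s) \<longlongrightarrow> partial_deriv i \<phi> x) (at 0)"
    using test_line_deriv[OF p, of x i 1 0] unfolding DERIV_def by simp
  from filterlim_compose[OF this hlim] show ?thesis unfolding dq_def by simp
qed

lemma bounded_loc_integrable:
  fixes g :: "real ^ 'n \<Rightarrow> real"
  assumes g: "g \<in> borel_measurable lebesgue" "\<And>x. \<bar>g x\<bar> \<le> B"
  shows "loc_integrable g"
  unfolding loc_integrable_def
proof (intro conjI allI g)
  fix R
  have "(\<lambda>x. g x * indicator (cball 0 R) x) \<in> L2" by (rule L2_bounded_mult[OF indicator_cball_L2 g])
  from L2_mult_integrable[OF this indicator_cball_L2[of R]]
  show "integrable lebesgue (\<lambda>x. indicator (cball 0 R) x * g x)"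
    by (rule Bochner_Integration.integrable_cong[THEN iffD1, rotated -1]) (auto simp: indicator_def)
qed

text \<open>The integral is invariant under translation, hence its derivative along the axis is
  zero.\<close>

lemma test_integral_partial:
  fixes \<phi> :: "real ^ 'n \<Rightarrow> real"
  assumes p: "\<phi> \<in> test_functions"
  shows "(LINT x|lebesgue. partial_deriv i \<phi> x) = 0"
proof -
  have loc: "loc_integrable (\<lambda>x :: real ^ 'n. 1)"
    by (rule bounded_loc_integrable[of _ 1]) auto
  have tr: "(LINT x|lebesgue. \<phi> (x - axis i s)) = (LINT x|lebesgue. \<phi> x)" for s
    using affine_integral[of 1 \<phi> "- axis i s"] test_meas[OF p] by simp
  have "((\<lambda>s. LINT x|lebesgue. 1 * \<phi> (x - axis i s)) has_real_derivative
      - (LINT x|lebesgue. 1 * partial_deriv i \<phi> (x - axis i 0))) (at 0)"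
    by (rule loc_translate_deriv[OF loc p])
  then have "((\<lambda>s. LINT x|lebesgue. \<phi> x) has_real_derivative - (LINT x|lebesgue. partial_deriv i \<phi> x)) (at (0::real))"
    unfolding mult_1 tr by simp
  then show ?thesis using DERIV_unique[OF _ DERIV_const] by fastforce
qed

lemma test_mult: "\<phi> \<in> test_functions \<Longrightarrow> \<psi> \<in> test_functions \<Longrightarrow> (\<lambda>x. \<phi> x * \<psi> x) \<in> test_functions"
  by (rule test_mult_Ck) (auto intro: test_Ck)

lemma test_is_weak_partial:
  fixes \<phi> :: "real ^ 'n \<Rightarrow> real"
  assumes p: "\<phi> \<in> test_functions"
  shows "is_weak_partial i \<phi> (partial_deriv i \<phi>)"
  unfolding weak_partial_ip
proof
  fix \<psi> :: "real ^ 'n \<Rightarrow> real" assume q: "\<psi> \<in> test_functions"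
  have "(LINT x|lebesgue. partial_deriv i (\<lambda>x. \<phi> x * \<psi> x) x) = 0"
    by (rule test_integral_partial[OF test_mult[OF p q]])
  then have "(LINT x|lebesgue. \<phi> x * partial_deriv i \<psi> x + partial_deriv i \<phi> x * \<psi> x) = 0"
    using partial_deriv_mult[of \<phi> \<psi> i] test_differentiable[OF p] test_differentiable[OF q] by simp
  then show "ip \<phi> (partial_deriv i \<psi>) = - ip (partial_deriv i \<phi>) \<psi>"
    unfolding ip_def
    using L2_mult_integrable[OF test_L2[OF p] test_L2[OF partial_deriv_test[OF q, of i]]]
      L2_mult_integrable[OF test_L2[OF partial_deriv_test[OF p, of i]] test_L2[OF q]] by simp
qed

lemma test_H1: "\<phi> \<in> test_functions \<Longrightarrow> \<phi> \<in> H1"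
  by (rule H1I[where g = "\<lambda>i. partial_deriv i \<phi>"]) (auto intro: test_L2 partial_deriv_test test_is_weak_partial)

text \<open>Makes the logarithmic test function of the positivity proof admissible. The bounds use
  only that the denominator stays above e.\<close>

lemma quotient_H1:
  fixes U :: "real ^ 'n \<Rightarrow> real"
  assumes U: "U \<in> H1" "\<And>x. 0 \<le> U x" and p: "\<phi> \<in> test_functions" and e: "e > 0"
  shows "(\<lambda>x. (\<phi> x)\<^sup>2 / (U x + e)) \<in> H1"
    "AE x in lebesgue. weak_partial i (\<lambda>x. (\<phi> x)\<^sup>2 / (U x + e)) x =
      2 * \<phi> x * partial_deriv i \<phi> x / (U x + e) - (\<phi> x)\<^sup>2 * weak_partial i U x / (U x + e)\<^sup>2"
proof -
  let ?F = "\<lambda>x. (\<phi> x)\<^sup>2 / (U x + e)"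
  have pos: "U x + e > 0" for x using U(2)[of x] e by simp
  have p2: "(\<lambda>x. (\<phi> x)\<^sup>2) \<in> test_functions" using test_mult[OF p p] by (simp add: power2_eq_square)
  have p2H: "(\<lambda>x. (\<phi> x)\<^sup>2) \<in> H1" by (rule test_H1[OF p2])
  have UL: "U \<in> L2" by (rule H1_L2[OF U(1)])
  obtain B where B: "B > 0" "\<And>x. \<bar>(\<phi> x)\<^sup>2\<bar> \<le> B" by (rule test_bounded[OF p2]) blast
  have inv: "\<bar>1 / (U x + e)\<bar> \<le> 1 / e" for x using U(2)[of x] e by (simp add: frac_le)
  have Fm: "(\<lambda>x. 1 / (U x + e)) \<in> borel_measurable lebesgue" using H1_meas[OF U(1)] by simp
  have FL: "?F \<in> L2"
    using L2_bounded_mult[OF H1_L2[OF p2H] Fm inv] by simp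
  \<comment> \<open>The discrete quotient rule, exact for every h; it yields both the H1 bound and
    the formula for the weak derivative.\<close>
  have dec: "dq i h ?F x = dq i h (\<lambda>x. (\<phi> x)\<^sup>2) x / (U (x + axis i h) + e)
      - (\<phi> x)\<^sup>2 * dq i h U x / ((U x + e) * (U (x + axis i h) + e))" if "h \<noteq> 0" for i h x
  proof -
    have "(b / q - a / p) / h = ((b - a) / h) / q - a * ((q - p) / h) / (p * q)" if "p > 0" "q > 0" for a b p q :: real
      using that \<open>h \<noteq> 0\<close> by (simp add: field_simps)
    from this[OF pos[of x] pos[of "x + axis i h"], of "(\<phi> (x + axis i h))\<^sup>2" "(\<phi> x)\<^sup>2"]
    show ?thesis by (simp only: dq_def add_diff_cancel_right)
  qed
  show FH: "?F \<in> H1"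
  proof (rule H1_dq[OF FL])
    fix i and h :: real assume h: "h \<noteq> 0"
    let ?G = "\<lambda>x. (1 / e) * \<bar>dq i h (\<lambda>x. (\<phi> x)\<^sup>2) x\<bar> + (B / e\<^sup>2) * \<bar>dq i h U x\<bar>"
    have L1: "dq i h (\<lambda>x. (\<phi> x)\<^sup>2) \<in> L2" "dq i h U \<in> L2" by (intro dq_L2 UL H1_L2 p2H)+
    have GL: "(\<lambda>x. (1 / e) * \<bar>dq i h (\<lambda>x. (\<phi> x)\<^sup>2) x\<bar>) \<in> L2" "(\<lambda>x. (B / e\<^sup>2) * \<bar>dq i h U x\<bar>) \<in> L2"
      by (intro L2_cmult L2_abs L1)+
    have nabs: "nrm (\<lambda>x. \<bar>f x\<bar>) = nrm f" for f :: "real ^ 'n \<Rightarrow> real" unfolding nrm_def ip_def by simp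
    have "nrm (dq i h ?F) \<le> nrm ?G"
    proof (rule nrm_mono[OF L2_add[OF GL] L2_meas[OF dq_L2[OF FL]] AE_I2])
      fix x
      have "\<bar>dq i h (\<lambda>x. (\<phi> x)\<^sup>2) x / (U (x + axis i h) + e)\<bar> \<le> 1 / e * \<bar>dq i h (\<lambda>x. (\<phi> x)\<^sup>2) x\<bar>"
        using mult_right_mono[OF inv[of "x + axis i h"], of "\<bar>dq i h (\<lambda>x. (\<phi> x)\<^sup>2) x\<bar>"] by (simp add: abs_mult abs_divide)
      moreover have "\<bar>(\<phi> x)\<^sup>2 * dq i h U x / ((U x + e) * (U (x + axis i h) + e))\<bar> \<le> B / e\<^sup>2 * \<bar>dq i h U x\<bar>"
      proof -
        have "e * e \<le> (U x + e) * (U (x + axis i h) + e)" using U(2) e by (intro mult_mono) auto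
        then have "B / ((U x + e) * (U (x + axis i h) + e)) \<le> B / e\<^sup>2"
          using B e pos by (simp add: power2_eq_square frac_le)
        moreover have "\<bar>(\<phi> x)\<^sup>2\<bar> / ((U x + e) * (U (x + axis i h) + e)) \<le> B / ((U x + e) * (U (x + axis i h) + e))"
          using B(2)[of x] pos[of x] pos[of "x + axis i h"] by (intro divide_right_mono) auto
        ultimately have "\<bar>(\<phi> x)\<^sup>2\<bar> / ((U x + e) * (U (x + axis i h) + e)) * \<bar>dq i h U x\<bar> \<le> B / e\<^sup>2 * \<bar>dq i h U x\<bar>"
          by (intro mult_right_mono) auto
        then show ?thesis using pos[of x] pos[of "x + axis i h"] by (simp add: abs_mult)
      qed
      ultimately have "\<bar>dq i h ?F x\<bar> \<le> ?G x" unfolding dec[OF h] by linarith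
      then show "\<bar>dq i h ?F x\<bar> \<le> \<bar>?G x\<bar>" by linarith
    qed
    also have "\<dots> \<le> nrm (\<lambda>x. (1 / e) * \<bar>dq i h (\<lambda>x. (\<phi> x)\<^sup>2) x\<bar>) + nrm (\<lambda>x. (B / e\<^sup>2) * \<bar>dq i h U x\<bar>)"
      by (rule nrm_triangle[OF GL])
    also have "\<dots> = 1 / e * nrm (dq i h (\<lambda>x. (\<phi> x)\<^sup>2)) + B / e\<^sup>2 * nrm (dq i h U)"
      unfolding nrm_cmult nabs using e B by simp
    also have "\<dots> \<le> 1 / e * nrm (weak_partial i (\<lambda>x. (\<phi> x)\<^sup>2)) + B / e\<^sup>2 * nrm (weak_partial i U)"
      using e B by (intro add_mono mult_left_mono dq_nrm_le H1_L2 wp_L2 wp_is U p2H) auto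
    finally show "nrm (dq i h ?F) \<le> 1 / e * nrm (weak_partial i (\<lambda>x. (\<phi> x)\<^sup>2)) + B / e\<^sup>2 * nrm (weak_partial i U)" .
  qed
  show "AE x in lebesgue. weak_partial i ?F x =
      2 * \<phi> x * partial_deriv i \<phi> x / (U x + e) - (\<phi> x)\<^sup>2 * weak_partial i U x / (U x + e)\<^sup>2"
  proof (rule wp_AE_limit[OF U(1) FH])
    fix x and h :: "nat \<Rightarrow> real" assume h: "h \<longlonglongrightarrow> 0" "\<And>n. h n \<noteq> 0" and d: "(\<lambda>n. dq i (h n) U x) \<longlonglongrightarrow> weak_partial i U x"
    have sh: "(\<lambda>n. U (x + axis i (h n))) \<longlonglongrightarrow> U x" by (rule shift_tendsto[OF h d])
    have pd: "partial_deriv i (\<lambda>x. (\<phi> x)\<^sup>2) x = 2 * \<phi> x * partial_deriv i \<phi> x"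
      using partial_deriv_mult[of \<phi> \<phi> i] test_differentiable[OF p] by (simp add: power2_eq_square)
    have "(\<lambda>n. dq i (h n) (\<lambda>x. (\<phi> x)\<^sup>2) x / (U (x + axis i (h n)) + e)
        - (\<phi> x)\<^sup>2 * dq i (h n) U x / ((U x + e) * (U (x + axis i (h n)) + e)))
      \<longlonglongrightarrow> 2 * \<phi> x * partial_deriv i \<phi> x / (U x + e) - (\<phi> x)\<^sup>2 * weak_partial i U x / ((U x + e) * (U x + e))"
      using test_dq_tendsto[OF p2 h, of i x, unfolded pd] pos[of x] by (intro tendsto_intros sh d) auto
    then show "(\<lambda>n. dq i (h n) ?F x) \<longlonglongrightarrow> 2 * \<phi> x * partial_deriv i \<phi> x / (U x + e) - (\<phi> x)\<^sup>2 * weak_partial i U x / (U x + e)\<^sup>2"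
      unfolding dec[OF h(2)] by (simp add: power2_eq_square)
  qed
qed

text \<open>As e tends to 0 these functions tend to the indicator of the set where U is positive;
  their gradients are what must be shown to vanish in the limit.\<close>

lemma saturate_H1:
  fixes U :: "real ^ 'n \<Rightarrow> real"
  assumes U: "U \<in> H1" "\<And>x. 0 \<le> U x" and e: "e > 0"
  shows "(\<lambda>x. U x / (U x + e)) \<in> H1"
    "AE x in lebesgue. weak_partial i (\<lambda>x. U x / (U x + e)) x = e * weak_partial i U x / (U x + e)\<^sup>2"
proof -
  \<comment> \<open>The maximum with 0 extends the map to a globally Lipschitz one; it changes
    nothing at the nonnegative values of U.\<close>
  let ?T = "\<lambda>s. max s 0 / (max s 0 + e)"
  let ?F = "\<lambda>x. U x / (U x + e)"
  have pos: "U x + e > 0" for x using U(2)[of x] e by simp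
  have key: "q / (q + e) - p / (p + e) = e * (q - p) / ((p + e) * (q + e))" if "0 \<le> p" "0 \<le> q" for p q :: real
  proof -
    have "p + e > 0" "q + e > 0" using that e by auto
    then show ?thesis by (simp add: field_simps)
  qed
  have "\<bar>?T a - ?T b\<bar> \<le> (1 / e) * \<bar>a - b\<bar>" for a b
  proof -
    let ?a = "max a 0" and ?b = "max b 0"
    have "e * e \<le> (?b + e) * (?a + e)" using e by (intro mult_mono) auto
    moreover have "0 < (?b + e) * (?a + e)" using e by (intro mult_pos_pos) auto
    ultimately have "e / ((?b + e) * (?a + e)) \<le> 1 / e" using e by (simp add: field_simps)
    moreover have "\<bar>?a - ?b\<bar> \<le> \<bar>a - b\<bar>" by auto
    ultimately have "e / ((?b + e) * (?a + e)) * \<bar>?a - ?b\<bar> \<le> (1 / e) * \<bar>a - b\<bar>"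
      using e by (intro mult_mono) auto
    moreover have "\<bar>?T a - ?T b\<bar> = e / ((?b + e) * (?a + e)) * \<bar>?a - ?b\<bar>"
      using key[of ?b ?a] e by (simp add: abs_mult)
    ultimately show ?thesis by simp
  qed
  then have "(\<lambda>x. ?T (U x)) \<in> H1" by (rule lipschitz_comp_H1[OF U(1)]) simp
  moreover have "max (U x) 0 = U x" for x using U(2)[of x] by simp
  ultimately show FH: "?F \<in> H1" by (simp only:)
  show "AE x in lebesgue. weak_partial i ?F x = e * weak_partial i U x / (U x + e)\<^sup>2"
  proof (rule wp_AE_limit[OF U(1) FH])
    fix x and h :: "nat \<Rightarrow> real" assume h: "h \<longlonglongrightarrow> 0" "\<And>n. h n \<noteq> 0" and d: "(\<lambda>n. dq i (h n) U x) \<longlonglongrightarrow> weak_partial i U x"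
    have sh: "(\<lambda>n. U (x + axis i (h n))) \<longlonglongrightarrow> U x" by (rule shift_tendsto[OF h d])
    have "(\<lambda>n. e * dq i (h n) U x / ((U x + e) * (U (x + axis i (h n)) + e))) \<longlonglongrightarrow> e * weak_partial i U x / ((U x + e) * (U x + e))"
      using pos[of x] by (intro tendsto_intros sh d) auto
    moreover have "dq i (h n) ?F x = e * dq i (h n) U x / ((U x + e) * (U (x + axis i (h n)) + e))" for n
      using key[OF U(2)[of x] U(2)[of "x + axis i (h n)"]] unfolding dq_def by simp
    ultimately show "(\<lambda>n. dq i (h n) ?F x) \<longlonglongrightarrow> e * weak_partial i U x / (U x + e)\<^sup>2"
      by (simp add: power2_eq_square)
  qed
qed

text \<open>A set whose indicator has vanishing distributional gradient is null or conull.\<close>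

lemma translation_invariant_indicator:
  fixes A :: "(real ^ 'n) set"
  assumes A: "A \<in> sets lebesgue"
    and z: "\<And>i \<phi>. \<phi> \<in> test_functions \<Longrightarrow> (LINT x|lebesgue. indicator A x * partial_deriv i \<phi> x) = 0"
  shows "(AE x in lebesgue. x \<in> A) \<or> (AE x in lebesgue. x \<notin> A)"
proof -
  let ?f = "\<lambda>x. indicator A x :: real"
  have fm: "?f \<in> borel_measurable lebesgue" using A by simp
  note loc = bounded_loc_integrable[where B = 1]
  have ax: "AE x in lebesgue. indicator A (x + axis i s) = (indicator A x :: real)" for i s
  proof -
    have d: "loc_integrable (\<lambda>x. ?f (x + axis i s) - ?f x)"
      by (rule loc) (use tr_meas[OF fm] fm in \<open>auto simp: indicator_def\<close>)
    have "AE x in lebesgue. ?f (x + axis i s) - ?f x = 0"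
    proof (rule fundamental_lemma[OF d])
      fix \<phi> :: "real ^ 'n \<Rightarrow> real" assume p: "\<phi> \<in> test_functions"
      \<comment> \<open>Pairing with a translated test function has zero derivative in the
        translation, so it is constant.\<close>
      define F where "F t = (LINT x|lebesgue. ?f x * \<phi> (x - axis i t))" for t
      have lf: "loc_integrable ?f" by (rule loc[OF fm]) (simp add: indicator_def)
      have tp: "(\<lambda>x. \<phi> (x - axis i t)) \<in> test_functions" for t
        using test_affine[OF p, of 1 "- axis i t"] by simp
      have "(F has_real_derivative 0) (at t)" for t
      proof -
        have "partial_deriv i (\<lambda>x. \<phi> (x - axis i t)) = (\<lambda>x. partial_deriv i \<phi> (x - axis i t))"
          using partial_deriv_tr[OF p, of i "- axis i t"] by simp
        then have "(LINT x|lebesgue. ?f x * partial_deriv i \<phi> (x - axis i t)) = 0"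
          using z[OF tp, of i t] by simp
        then show ?thesis using loc_translate_deriv[OF lf p, of i t] unfolding F_def by simp
      qed
      then have "F s = F 0" by (intro DERIV_isconst_all) blast
      moreover have "(LINT x|lebesgue. ?f (x + axis i s) * \<phi> x) = F s"
        using affine_integral[of 1 "\<lambda>x. ?f x * \<phi> (x - axis i s)" "axis i s"] fm test_meas[OF tp, of s]
        unfolding F_def by simp
      moreover have "integrable lebesgue (\<lambda>x. ?f (x + axis i s) * \<phi> x)"
        by (rule loc_integrable_test[OF loc p]) (use tr_meas[OF fm] in \<open>auto simp: indicator_def\<close>)
      moreover have "integrable lebesgue (\<lambda>x. ?f x * \<phi> x)" by (rule loc_integrable_test[OF lf p])
      ultimately show "(LINT x|lebesgue. (?f (x + axis i s) - ?f x) * \<phi> x) = 0"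
        unfolding left_diff_distrib by (simp add: F_def)
    qed
    then show ?thesis by simp
  qed
  \<comment> \<open>Arbitrary translations are composed of translations along the axes. The
    exceptional null set still depends on v.\<close>
  have vec: "AE x in lebesgue. ?f (x + v) = ?f x" for v
  proof -
    have "AE x in lebesgue. ?f (x + (\<Sum>i\<in>I. axis i (v $ i))) = ?f x" for I
    proof (induction I rule: infinite_finite_induct)
      case (insert j I)
      have "AE x in lebesgue. ?f ((x + (\<Sum>i\<in>I. axis i (v $ i))) + axis j (v $ j)) = ?f (x + (\<Sum>i\<in>I. axis i (v $ i)))"
        by (rule tr_AE[OF ax])
      with insert.IH show ?case
        by eventually_elim (use insert.hyps in \<open>simp add: add.assoc add.commute[of "axis j (v $ j)"]\<close>)
    qed simp_all
    moreover have "(\<Sum>i\<in>UNIV. axis i (v $ i)) = v" by (simp add: vec_eq_iff axis_def)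
    ultimately show ?thesis by metis
  qed
  obtain f' where f': "f' \<in> borel_measurable lborel" "AE x in lborel. ?f x = f' x"
    using completion_ex_borel_measurable_real[OF fm] by blast
  have [measurable]: "f' \<in> borel_measurable borel" using f'(1) by simp
  have ff: "AE x in lebesgue. ?f x = f' x" by (rule AE_completion[OF f'(2)])
  have vec': "AE x in lborel. f' (x + v) = f' x" for v
  proof -
    have "AE x in lebesgue. f' (x + v) = f' x"
      using vec[of v] ff tr_AE[OF ff, of v] by eventually_elim simp
    then show ?thesis unfolding AE_completion_iff .
  qed
  \<comment> \<open>Fubini exchanges the two null sets: for one suitable x the value at
    \<open>x + v\<close> equals that at x for almost every v, so the function is a.e.
    constant.\<close>
  have "AE v in lborel. AE x in lborel. f' (x + v) = f' x" using vec' by simp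
  then have "AE x in lborel. AE v in lborel. f' (x + v) = f' x"
    by (subst lborel_pair.AE_commute) measurable
  then have "AE x in lebesgue. AE v in lborel. f' (x + v) = f' x" by (rule AE_completion)
  with ff have both: "AE x in lebesgue. ?f x = f' x \<and> (AE v in lborel. f' (x + v) = f' x)" by eventually_elim simp
  have "\<exists>x. ?f x = f' x \<and> (AE v in lborel. f' (x + v) = f' x)"
  proof (rule ccontr)
    assume n: "\<not> ?thesis"
    have "AE x in (lebesgue :: (real ^ 'n) measure). False"
      by (rule eventually_mono[OF both]) (use n in blast)
    then show False by (simp add: eventually_False ae_filter_eq_bot_iff)
  qed
  then obtain x where x: "?f x = f' x" "AE v in lborel. f' (x + v) = f' x" by blast
  have "AE v in lebesgue. f' (x + v) = ?f x" using AE_completion[OF x(2)] x(1) by simp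
  from tr_AE'[OF this, of "- x"] have "AE v in lebesgue. f' v = ?f x" by simp
  with ff have "AE v in lebesgue. ?f v = ?f x" by eventually_elim simp
  then show ?thesis
    by (cases "x \<in> A") (auto simp: indicator_def split: if_splits elim: eventually_mono)
qed

context potential
begin

lemma nonneg_solution_pos:
  assumes U: "U \<in> H1" "\<And>x. 0 \<le> U x" "nrm U > 0" and eq: "\<And>\<phi>. \<phi> \<in> H1 \<Longrightarrow> de V U \<phi> = \<mu> * ip U \<phi>"
  shows "AE x in lebesgue. U x > 0"
proof -
  let ?A = "{x. U x > 0}"
  have Um: "U \<in> borel_measurable lebesgue" by (rule H1_meas[OF U(1)])
  have A: "?A \<in> sets lebesgue" using borel_measurable_less[of "\<lambda>x. 0" lebesgue U] Um by simp
  \<comment> \<open>The function \<phi> times the i-th derivative of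
    \<open>log (U + e)\<close>.\<close>
  define P where "P \<phi> i e x = \<phi> x * weak_partial i U x / (U x + e)" for \<phi> i e x
  have pos: "U x + e > 0" if "e > 0" for x e using U(2)[of x] that by simp
  have PL: "P \<phi> i e \<in> L2" if p: "\<phi> \<in> test_functions" and e: "e > 0" for \<phi> i e
  proof -
    obtain B where B: "B > 0" "\<And>x. \<bar>\<phi> x\<bar> \<le> B" by (rule test_bounded[OF p]) blast
    have "(\<lambda>x. (\<phi> x / (U x + e)) * weak_partial i U x) \<in> L2"
    proof (rule L2_bounded_mult[OF wp_L2[OF U(1)]])
      show "(\<lambda>x. \<phi> x / (U x + e)) \<in> borel_measurable lebesgue" using test_meas[OF p] Um by simp
      show "\<bar>\<phi> x / (U x + e)\<bar> \<le> B / e" for x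
        unfolding abs_divide using B(1) B(2)[of x] U(2)[of x] e by (intro frac_le) auto
    qed
    then show ?thesis unfolding P_def[abs_def] by simp
  qed
  have bound: "\<exists>C. \<forall>e>0. \<forall>i. nrm (P \<phi> i e) \<le> C" if p: "\<phi> \<in> test_functions" for \<phi>
  proof -
    have pH: "\<phi> \<in> H1" by (rule test_H1[OF p])
    have pL: "\<phi> \<in> L2" by (rule test_L2[OF p])
    define K where "K = 2 * (\<Sum>i\<in>UNIV. (nrm (partial_deriv i \<phi>))\<^sup>2) + \<bar>\<mu>\<bar> * (nrm \<phi>)\<^sup>2 + (LINT x|lebesgue. \<bar>V x\<bar> * (\<phi> x)\<^sup>2)"
    have main: "(\<Sum>i\<in>UNIV. (nrm (P \<phi> i e))\<^sup>2) \<le> 2 * K" if e: "e > 0" for e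
    proof -
      let ?F = "\<lambda>x. (\<phi> x)\<^sup>2 / (U x + e)"
      note FH = quotient_H1[OF U(1,2) p e]
      have dL: "partial_deriv i \<phi> \<in> L2" for i by (intro test_L2 partial_deriv_test p)
      have ui: "0 \<le> U x / (U x + e)" "U x / (U x + e) \<le> 1" for x using U(2)[of x] e by auto
      \<comment> \<open>Completing the square: the weak derivative of
        \<open>\<phi>\<^sup>2 / (U + e)\<close> paired with that of U contains minus the square of
        \<open>P\<close>, and Young's inequality spends only half of it.\<close>
      have tm: "ip (weak_partial i U) (weak_partial i ?F) \<le> 2 * (nrm (partial_deriv i \<phi>))\<^sup>2 - 1 / 2 * (nrm (P \<phi> i e))\<^sup>2" for i
      proof -
        have "ip (weak_partial i U) (weak_partial i ?F) = ip (weak_partial i U)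
            (\<lambda>x. 2 * \<phi> x * partial_deriv i \<phi> x / (U x + e) - (\<phi> x)\<^sup>2 * weak_partial i U x / (U x + e)\<^sup>2)"
          using FH(2)[of i] L2_meas[OF wp_L2[OF U(1), of i]] L2_meas[OF wp_L2[OF FH(1), of i]]
            test_meas[OF p] L2_meas[OF dL[of i]] Um by (intro ip_cong_AE) auto
        also have "\<dots> = (LINT x|lebesgue. 2 * (P \<phi> i e x * partial_deriv i \<phi> x) - (P \<phi> i e x)\<^sup>2)"
          unfolding ip_def P_def
          by (intro Bochner_Integration.integral_cong) (auto simp: power_divide power_mult_distrib power2_eq_square algebra_simps)
        also have "\<dots> = 2 * ip (P \<phi> i e) (partial_deriv i \<phi>) - (nrm (P \<phi> i e))\<^sup>2"
          unfolding ip_def nrm_sq_int using L2_mult_integrable[OF PL[OF p e] dL, of i i] PL[OF p e, of i]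
          by (simp add: L2_iff)
        also have "\<dots> \<le> 2 * (nrm (partial_deriv i \<phi>))\<^sup>2 - 1 / 2 * (nrm (P \<phi> i e))\<^sup>2"
        proof -
          have "ip (P \<phi> i e) (partial_deriv i \<phi>) \<le> nrm (P \<phi> i e) * nrm (partial_deriv i \<phi>)"
            using ip_le_nrm[OF PL[OF p e] dL, of i i] by simp
          moreover have "2 * (nrm (P \<phi> i e) / 2) * nrm (partial_deriv i \<phi>) \<le> (nrm (P \<phi> i e) / 2)\<^sup>2 + (nrm (partial_deriv i \<phi>))\<^sup>2"
            by (rule sum_squares_bound)
          ultimately show ?thesis by (simp add: power_divide)
        qed
        finally show ?thesis .
      qed
      have "grip U ?F \<le> (\<Sum>i\<in>UNIV. 2 * (nrm (partial_deriv i \<phi>))\<^sup>2 - 1 / 2 * (nrm (P \<phi> i e))\<^sup>2)"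
        unfolding grip_def by (intro sum_mono tm)
      also have "\<dots> = 2 * (\<Sum>i\<in>UNIV. (nrm (partial_deriv i \<phi>))\<^sup>2) - 1 / 2 * (\<Sum>i\<in>UNIV. (nrm (P \<phi> i e))\<^sup>2)"
        by (simp add: sum_subtractf sum_distrib_left)
      finally have g: "grip U ?F \<le> 2 * (\<Sum>i\<in>UNIV. (nrm (partial_deriv i \<phi>))\<^sup>2) - 1 / 2 * (\<Sum>i\<in>UNIV. (nrm (P \<phi> i e))\<^sup>2)" .
      have v: "vb V U ?F \<le> (LINT x|lebesgue. \<bar>V x\<bar> * (\<phi> x)\<^sup>2)"
        unfolding vb_def
      proof (rule integral_mono[OF V_mult_integrable[OF U(1) FH(1)]])
        show "integrable lebesgue (\<lambda>x. \<bar>V x\<bar> * (\<phi> x)\<^sup>2)"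
          using integrable_abs[OF V_sq_integrable[OF pH]] by (simp add: abs_mult)
        fix x
        have "V x * (\<phi> x)\<^sup>2 * (U x / (U x + e)) \<le> \<bar>V x\<bar> * (\<phi> x)\<^sup>2 * 1"
          using ui[of x] by (intro mult_mono) (auto intro: mult_right_mono)
        then show "V x * U x * ?F x \<le> \<bar>V x\<bar> * (\<phi> x)\<^sup>2" by (simp add: ac_simps)
      qed
      \<comment> \<open>The nonlinear term has the favourable sign and is dropped. The remaining
        terms involve U only through \<open>U x / (U x + e)\<close>, which lies between 0 and 1, so
        the bound is uniform in e.\<close>
      have n: "0 \<le> nl U ?F"
        unfolding nl_def using U(2) pos[OF e] by (intro Bochner_Integration.integral_nonneg) (simp add: less_imp_le)
      have m: "- (\<bar>\<mu>\<bar> * (nrm \<phi>)\<^sup>2) \<le> \<mu> * ip U ?F"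
      proof -
        have "0 \<le> ip U ?F" unfolding ip_def using U(2) pos[OF e] by (intro Bochner_Integration.integral_nonneg) (simp add: less_imp_le)
        moreover have "ip U ?F \<le> (nrm \<phi>)\<^sup>2"
          unfolding ip_def nrm_sq_int
        proof (rule integral_mono[OF L2_mult_integrable[OF H1_L2[OF U(1)] H1_L2[OF FH(1)]]])
          show "integrable lebesgue (\<lambda>x. (\<phi> x)\<^sup>2)" using pL by (simp add: L2_iff)
          fix x show "U x * ?F x \<le> (\<phi> x)\<^sup>2" using mult_left_mono[OF ui(2)[of x], of "(\<phi> x)\<^sup>2"] by (simp add: mult.commute)
        qed
        ultimately have "\<bar>\<mu>\<bar> * ip U ?F \<le> \<bar>\<mu>\<bar> * (nrm \<phi>)\<^sup>2" "- (\<bar>\<mu>\<bar> * ip U ?F) \<le> \<mu> * ip U ?F"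
          by (auto intro: mult_left_mono simp: abs_if mult_nonpos_nonneg)
        then show ?thesis by linarith
      qed
      have "grip U ?F + vb V U ?F - nl U ?F = \<mu> * ip U ?F" using eq[OF FH(1)] unfolding de_def .
      then show ?thesis using g v n m unfolding K_def by argo
    qed
    have "nrm (P \<phi> i e) \<le> sqrt (2 * K)" if e: "e > 0" for e i
    proof (rule real_le_rsqrt)
      have "(nrm (P \<phi> i e))\<^sup>2 \<le> (\<Sum>i\<in>UNIV. (nrm (P \<phi> i e))\<^sup>2)" by (intro member_le_sum) auto
      then show "(nrm (P \<phi> i e))\<^sup>2 \<le> 2 * K" using main[OF e] by linarith
    qed
    then show ?thesis by blast
  qed
  have "(AE x in lebesgue. x \<in> ?A) \<or> (AE x in lebesgue. x \<notin> ?A)"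
  proof (rule translation_invariant_indicator[OF A])
    fix i and \<phi> :: "real ^ 'n \<Rightarrow> real" assume p: "\<phi> \<in> test_functions"
    obtain C where C: "\<And>e. e > 0 \<Longrightarrow> nrm (P \<phi> i e) \<le> C" using bound[OF p] by blast
    have dp: "partial_deriv i \<phi> \<in> test_functions" by (rule partial_deriv_test[OF p])
    obtain R where R: "\<And>x. norm x > R \<Longrightarrow> \<phi> x = 0" by (rule test_support[OF p]) blast
    \<comment> \<open>Stands in for the constant 1, which is not square integrable; \<phi> vanishes
      outside this ball.\<close>
    let ?I = "\<lambda>x :: real ^ 'n. indicator (cball 0 R) x :: real"
    define e where "e n = inverse (real (Suc n))" for n
    have e: "e n > 0" for n unfolding e_def by simp
    have e0: "e \<longlonglongrightarrow> 0" unfolding e_def by (rule LIMSEQ_inverse_real_of_nat)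
    \<comment> \<open>Equal a.e. to \<phi> times the weak derivative of
      \<open>U x / (U x + e n)\<close>. Being at most \<open>P\<close> it is bounded in L2, and it
      tends to 0 a.e., hence weakly.\<close>
    define w where "w n x = (e n / (U x + e n)) * P \<phi> i (e n) x" for n x
    have wb: "\<bar>e n / (U x + e n)\<bar> \<le> 1" for n x using U(2)[of x] e[of n] by simp
    have wL: "w n \<in> L2" for n
      unfolding w_def[abs_def] by (rule L2_bounded_mult[OF PL[OF p e] _ wb]) (use Um in simp)
    have wC: "nrm (w n) \<le> C" for n
    proof -
      have "nrm (w n) \<le> nrm (P \<phi> i (e n))"
        by (rule nrm_mono[OF PL[OF p e] L2_meas[OF wL] AE_I2])
           (simp only: w_def abs_mult mult_left_le_one_le[OF abs_ge_zero abs_ge_zero wb])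
      then show ?thesis using C[OF e] order_trans by blast
    qed
    text \<open>On the zero set of \<open>U\<close> the gradient vanishes, since the bounded integrand equals \<open>(\<phi> \<partial>\<^sub>i U / e)\<^sup>2\<close> there.\<close>
    have zero: "AE x in lebesgue. U x = 0 \<longrightarrow> \<phi> x * weak_partial i U x = 0"
    proof -
      let ?Z = "\<lambda>x. indicator {x. U x = 0} x * (\<phi> x * weak_partial i U x)"
      have Zm: "?Z \<in> borel_measurable lebesgue"
      proof -
        have "{x. U x = 0} \<in> sets lebesgue" using borel_measurable_eq[of U lebesgue "\<lambda>x. 0"] Um by simp
        then show ?thesis using test_meas[OF p] L2_meas[OF wp_L2[OF U(1), of i]] by simp
      qed
      have Zle: "\<bar>?Z x\<bar> \<le> \<bar>e n * P \<phi> i (e n) x\<bar>" for n x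
      proof (cases "U x = 0")
        case True
        then show ?thesis using e[of n] unfolding P_def by simp
      qed simp
      have ZL: "?Z \<in> L2" by (rule L2_bound[OF L2_cmult[OF PL[OF p e]] Zm AE_I2[OF Zle]])
      have "nrm ?Z \<le> e n * C" for n
      proof -
        have "nrm ?Z \<le> nrm (\<lambda>x. e n * P \<phi> i (e n) x)"
          by (rule nrm_mono[OF L2_cmult[OF PL[OF p e]] Zm AE_I2[OF Zle]])
        also have "\<dots> = e n * nrm (P \<phi> i (e n))" unfolding nrm_cmult using e[of n] by simp
        also have "\<dots> \<le> e n * C" using C[OF e] e[of n] by (intro mult_left_mono) auto
        finally show ?thesis .
      qed
      moreover have "(\<lambda>n. e n * C) \<longlonglongrightarrow> 0" using tendsto_mult_left_zero[OF e0] .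
      ultimately have "nrm ?Z \<le> 0" by (intro LIMSEQ_le_const) auto
      then have "nrm ?Z = 0" using nrm_nonneg[of ?Z] by linarith
      from nrm_eq_0[OF ZL this] show ?thesis by eventually_elim (auto simp: indicator_def)
    qed
    have wlim: "AE x in lebesgue. (\<lambda>n. w n x) \<longlonglongrightarrow> 0"
      using zero
    proof eventually_elim
      case (elim x)
      show ?case
      proof (cases "U x = 0")
        case True
        then have "\<phi> x * weak_partial i U x = 0" using elim by blast
        then show ?thesis by (simp only: w_def P_def) simp
      next
        case False
        have "(\<lambda>n. (e n / (U x + e n)) * (\<phi> x * weak_partial i U x / (U x + e n))) \<longlonglongrightarrow> (0 / (U x + 0)) * (\<phi> x * weak_partial i U x / (U x + 0))"
          using False by (intro tendsto_intros e0) auto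
        then show ?thesis unfolding w_def P_def by simp
      qed
    qed
    have l1: "(\<lambda>n. ip (w n) ?I) \<longlonglongrightarrow> 0" by (rule L2_bounded_AE_weak_0[OF wL wC wlim indicator_cball_L2])
    let ?v = "\<lambda>n x. U x / (U x + e n)"
    have vH: "?v n \<in> H1" for n by (rule saturate_H1(1)[OF U(1,2) e])
    have eqn: "ip (?v n) (partial_deriv i \<phi>) = - ip (w n) ?I" for n
    proof -
      have "ip (?v n) (partial_deriv i \<phi>) = - ip (weak_partial i (?v n)) \<phi>"
        using wp_is[OF vH, of i n] p unfolding weak_partial_ip by simp
      also have "ip (weak_partial i (?v n)) \<phi> = (LINT x|lebesgue. e n * weak_partial i U x / (U x + e n)\<^sup>2 * \<phi> x)"
        unfolding ip_def using saturate_H1(2)[OF U(1,2) e, of i n] L2_meas[OF wp_L2[OF vH, of i n]]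
          L2_meas[OF wp_L2[OF U(1), of i]] Um test_meas[OF p]
        by (intro integral_cong_AE) (auto elim!: eventually_mono)
      also have "\<dots> = ip (w n) ?I"
        unfolding ip_def w_def P_def using R
        by (intro Bochner_Integration.integral_cong) (auto simp: indicator_def power2_eq_square not_le)
      finally show ?thesis .
    qed
    have "(\<lambda>n. ip (?v n) (partial_deriv i \<phi>)) \<longlonglongrightarrow> - 0" unfolding eqn by (intro tendsto_minus l1)
    moreover have "(\<lambda>n. ip (?v n) (partial_deriv i \<phi>)) \<longlonglongrightarrow> (LINT x|lebesgue. indicator ?A x * partial_deriv i \<phi> x)"
      unfolding ip_def
    proof (rule integral_dominated_convergence[where w = "\<lambda>x. \<bar>partial_deriv i \<phi> x\<bar>"])
      show "(\<lambda>x. indicator ?A x * partial_deriv i \<phi> x) \<in> borel_measurable lebesgue"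
        using A test_meas[OF dp] by simp
      show "(\<lambda>x. ?v n x * partial_deriv i \<phi> x) \<in> borel_measurable lebesgue" for n
        using Um test_meas[OF dp] by simp
      have "loc_integrable (\<lambda>x :: real ^ 'n. 1)"
        by (rule bounded_loc_integrable[of _ 1]) auto
      from loc_integrable_test[OF this dp] show "integrable lebesgue (\<lambda>x. \<bar>partial_deriv i \<phi> x\<bar>)" by simp
      show "AE x in lebesgue. (\<lambda>n. ?v n x * partial_deriv i \<phi> x) \<longlonglongrightarrow> indicator ?A x * partial_deriv i \<phi> x"
      proof (rule AE_I2)
        fix x
        have "(\<lambda>n. ?v n x) \<longlonglongrightarrow> indicator ?A x"
        proof (cases "U x = 0")
          case False
          then have "(\<lambda>n. ?v n x) \<longlonglongrightarrow> U x / (U x + 0)" by (intro tendsto_intros e0) auto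
          then show ?thesis using False U(2)[of x] by (simp add: less_le)
        qed simp
        then show "(\<lambda>n. ?v n x * partial_deriv i \<phi> x) \<longlonglongrightarrow> indicator ?A x * partial_deriv i \<phi> x"
          by (intro tendsto_mult tendsto_const)
      qed
      show "AE x in lebesgue. norm (?v n x * partial_deriv i \<phi> x) \<le> \<bar>partial_deriv i \<phi> x\<bar>" for n
      proof (rule AE_I2)
        fix x
        have "\<bar>?v n x\<bar> \<le> 1" using U(2)[of x] e[of n] by simp
        then show "norm (?v n x * partial_deriv i \<phi> x) \<le> \<bar>partial_deriv i \<phi> x\<bar>"
          by (simp only: real_norm_def abs_mult) (rule mult_left_le_one_le, auto)
      qed
    qed
    ultimately show "(LINT x|lebesgue. indicator ?A x * partial_deriv i \<phi> x) = 0"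
      using LIMSEQ_unique by fastforce
  qed
  then show ?thesis
  proof
    assume "AE x in lebesgue. x \<notin> ?A"
    then have "AE x in lebesgue. U x = 0" using U(2) by (auto elim!: eventually_mono simp: not_less intro: antisym)
    then have "nrm U = 0" by (rule nrm_AE_0[OF H1_L2[OF U(1)]])
    then show ?thesis using U(3) by simp
  qed simp
qed

end

section \<open>Dilations\<close>

lemma dil_weak_partial:
  fixes U :: "real ^ 'n \<Rightarrow> real"
  assumes c: "c > 0" and U: "U \<in> L2" "g \<in> L2" "is_weak_partial i U g"
  shows "is_weak_partial i (\<lambda>x. U (c *\<^sub>R x)) (\<lambda>x. c * g (c *\<^sub>R x))"
  unfolding weak_partial_ip
proof
  fix \<phi> :: "real ^ 'n \<Rightarrow> real" assume p: "\<phi> \<in> test_functions"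
  define \<eta> where "\<eta> x = \<phi> (inverse c *\<^sub>R x)" for x
  have e: "\<eta> \<in> test_functions" unfolding \<eta>_def using test_affine[OF p, of "inverse c" 0] c by simp
  have pe: "\<phi> = (\<lambda>x. \<eta> (c *\<^sub>R x + 0))" unfolding \<eta>_def using c by simp
  have d: "partial_deriv i \<phi> = (\<lambda>x. c * partial_deriv i \<eta> (c *\<^sub>R x + 0))"
    unfolding pe by (rule partial_deriv_affine) (use test_differentiable[OF e] in blast)
  have dil: "ip (\<lambda>x. u (c *\<^sub>R x)) (\<lambda>x. v (c *\<^sub>R x)) = ip u v / c ^ CARD('n)" if "u \<in> L2" "v \<in> L2" for u v :: "real ^ 'n \<Rightarrow> real"
    using affine_ip[of c u v 0] that c by simp
  have "ip (\<lambda>x. U (c *\<^sub>R x)) (partial_deriv i \<phi>) = c * (ip U (partial_deriv i \<eta>) / c ^ CARD('n))"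
    unfolding d ip_cmult_right using dil[OF U(1) test_L2[OF partial_deriv_test[OF e]], of i] by simp
  also have "\<dots> = - (c * (ip g \<eta> / c ^ CARD('n)))"
    using U(3) e unfolding weak_partial_ip by simp
  also have "\<dots> = - ip (\<lambda>x. c * g (c *\<^sub>R x)) \<phi>"
    unfolding ip_cmult_left using dil[OF U(2) test_L2[OF e]] pe by simp
  finally show "ip (\<lambda>x. U (c *\<^sub>R x)) (partial_deriv i \<phi>) = - ip (\<lambda>x. c * g (c *\<^sub>R x)) \<phi>" .
qed

lemma dil_L2: "f \<in> L2 \<Longrightarrow> c > 0 \<Longrightarrow> (\<lambda>x. f (c *\<^sub>R x)) \<in> L2"
  using affine_L2[of c f 0] by simp

lemma dil_nrm:
  fixes f :: "real ^ 'n \<Rightarrow> real"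
  assumes "f \<in> L2" "c > 0"
  shows "(nrm (\<lambda>x. f (c *\<^sub>R x)))\<^sup>2 = (nrm f)\<^sup>2 / c ^ CARD('n)"
  unfolding nrm_sq using affine_ip[of c f f 0] assms by simp

lemma dil_lp:
  fixes f :: "real ^ 'n \<Rightarrow> real"
  assumes "f \<in> borel_measurable lebesgue" "c > 0"
  shows "lp (\<lambda>x. f (c *\<^sub>R x)) = lp f / c ^ CARD('n)"
  unfolding lp_def using affine_integral[of c "\<lambda>x. \<bar>f x\<bar> powr crit_exp CARD('n)" 0] assms by simp

lemma
  fixes U :: "real ^ 'n \<Rightarrow> real"
  assumes c: "c > 0" and U: "U \<in> H1"
  shows dil_H1: "(\<lambda>x. U (c *\<^sub>R x)) \<in> H1"
    and dil_gr: "gr (\<lambda>x. U (c *\<^sub>R x)) = c\<^sup>2 * gr U / c ^ CARD('n)"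
proof -
  have L: "(\<lambda>x. c * weak_partial i U (c *\<^sub>R x)) \<in> L2" for i by (intro L2_cmult dil_L2 wp_L2 U c)
  have W: "is_weak_partial i (\<lambda>x. U (c *\<^sub>R x)) (\<lambda>x. c * weak_partial i U (c *\<^sub>R x))" for i
    by (intro dil_weak_partial c H1_L2 wp_L2 wp_is U)
  show "(\<lambda>x. U (c *\<^sub>R x)) \<in> H1"
    by (rule H1I[where g = "\<lambda>i x. c * weak_partial i U (c *\<^sub>R x)"]) (intro dil_L2 H1_L2 U c L W)+
  have "gr (\<lambda>x. U (c *\<^sub>R x)) = (\<Sum>i\<in>UNIV. (nrm (\<lambda>x. c * weak_partial i U (c *\<^sub>R x)))\<^sup>2)"
    by (rule gr_unique[OF L W])
  also have "\<dots> = (\<Sum>i\<in>UNIV. c\<^sup>2 * ((nrm (weak_partial i U))\<^sup>2 / c ^ CARD('n)))"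
    unfolding nrm_cmult power_mult_distrib dil_nrm[OF wp_L2[OF U] c] using c by simp
  also have "\<dots> = c\<^sup>2 * gr U / c ^ CARD('n)"
    unfolding gr_eq_nrm by (simp add: sum_distrib_left sum_divide_distrib)
  finally show "gr (\<lambda>x. U (c *\<^sub>R x)) = c\<^sup>2 * gr U / c ^ CARD('n)" .
qed

lemma derivative_sum_partial:
  fixes \<phi> :: "real ^ 'n \<Rightarrow> real"
  assumes "(\<phi> has_derivative D) (at x)"
  shows "D v = (\<Sum>i\<in>UNIV. v $ i * partial_deriv i \<phi> x)"
proof -
  have lin: "linear D" by (rule has_derivative_linear[OF assms])
  have "v = (\<Sum>i\<in>UNIV. (v $ i) *\<^sub>R axis i 1)" by (simp add: vec_eq_iff axis_def if_distrib cong: if_cong)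
  then have "D v = (\<Sum>i\<in>UNIV. (v $ i) *\<^sub>R D (axis i 1))"
    using linear_sum[OF lin] linear_scale[OF lin] by (metis (no_types, lifting) sum.cong)
  then show ?thesis using partial_deriv_eqI[OF assms] by simp
qed

text \<open>The dilation is transferred to the test function, differentiated there, and one
  integration by parts returns a derivative to U. Formally this differentiates U(cx) to the radial
  derivative of U.\<close>

lemma dil_test_deriv:
  fixes U :: "real ^ 'n \<Rightarrow> real"
  assumes U: "U \<in> H1" and p: "\<phi> \<in> test_functions" and c0: "c0 \<ge> 1"
  shows "((\<lambda>c. ip (\<lambda>x. U (c *\<^sub>R x)) \<phi>) has_real_derivative
    (\<Sum>i\<in>UNIV. ip (weak_partial i U) (\<lambda>y. y $ i * \<phi> (inverse c0 *\<^sub>R y))) / c0 ^ (CARD('n) + 1)) (at c0)"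
proof -
  let ?N = "CARD('n)"
  have UL: "U \<in> L2" by (rule H1_L2[OF U])
  have dp: "partial_deriv i \<phi> \<in> test_functions" for i by (rule partial_deriv_test[OF p])
  obtain R where R: "R > 0" "\<And>x. norm x > R \<Longrightarrow> \<phi> x = 0" by (rule test_support[OF p]) blast
  have Rd: "partial_deriv i \<phi> x = 0" if "norm x > R" for x i
  proof -
    have "\<forall>\<^sub>F y in nhds x. y \<in> {y. norm y > R}"
      by (intro eventually_nhds_in_open open_Collect_less continuous_intros) (use that in auto)
    then have ev: "\<forall>\<^sub>F y in at x. 0 = \<phi> y"
      unfolding eventually_at_filter by eventually_elim (simp add: R)
    have "((\<lambda>y. 0 :: real) has_derivative (\<lambda>h. 0)) (at x)" by simp
    then have "(\<phi> has_derivative (\<lambda>h. 0)) (at x)"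
      by (rule has_derivative_transform_eventually[OF _ ev]) (use R that in auto)
    then show ?thesis using partial_deriv_eqI by metis
  qed
  have "\<forall>i. \<exists>B. \<forall>x. \<bar>partial_deriv i \<phi> x\<bar> \<le> B" using test_bounded[OF dp] by metis
  from choice[OF this] obtain B where B: "\<And>i x. \<bar>partial_deriv i \<phi> x\<bar> \<le> B i" by blast
  have B0: "0 \<le> B i" for i using B[of i 0] by linarith
  define \<eta> where "\<eta> c y = \<phi> (inverse c *\<^sub>R y)" for c y
  have eT: "\<eta> c \<in> test_functions" if "c > 0" for c
    unfolding \<eta>_def using test_affine[OF p, of "inverse c" 0] that by simp
  have scal: "ip (\<lambda>x. U (c *\<^sub>R x)) \<phi> = (LINT y|lebesgue. U y * \<eta> c y) / c ^ ?N" if c: "c > 0" for c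
    using affine_ip[of c U "\<eta> c" 0] UL test_L2[OF eT[OF c]] c unfolding ip_def \<eta>_def by simp
  define k' where "k' c y = U y * (\<Sum>i\<in>UNIV. (- (inverse c * inverse c) * y $ i) * partial_deriv i \<phi> (inverse c *\<^sub>R y))" for c y
  \<comment> \<open>For c within 1/2 of \<open>c0 \<ge> 1\<close> the inverse square of c is at most
    4, and the dilated support lies in the ball of radius \<open>R * (c0 + 1)\<close>, which also
    bounds the coordinates.\<close>
  define Q where "Q = 4 * (R * (c0 + 1)) * (\<Sum>i\<in>UNIV. B i)"
  have DG: "((\<lambda>c. LINT y|lebesgue. U y * \<eta> c y) has_real_derivative (LINT y|lebesgue. k' c0 y)) (at c0)"
  proof (rule DERIV_integral[where d = "1/2" and b = "\<lambda>y. Q * \<bar>U y * indicator (cball 0 (R * (c0 + 1))) y\<bar>"])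
    fix c y assume "\<bar>c - c0\<bar> < (1/2 :: real)"
    then have c: "c > 1/2" "c < c0 + 1" using c0 unfolding abs_less_iff by linarith+
    obtain D where D: "(\<phi> has_derivative D) (at (inverse c *\<^sub>R y))"
      using test_differentiable[OF p] unfolding differentiable_def by blast
    have "((\<lambda>c. inverse c *\<^sub>R y) has_derivative (\<lambda>h. (- (inverse c * h * inverse c)) *\<^sub>R y)) (at c)"
      using c by (auto intro!: derivative_eq_intros)
    from has_derivative_compose[OF this D]
    have "((\<lambda>c. \<eta> c y) has_derivative (\<lambda>h. D ((- (inverse c * h * inverse c)) *\<^sub>R y))) (at c)" unfolding \<eta>_def .
    moreover have "D ((- (inverse c * h * inverse c)) *\<^sub>R y)
        = (\<Sum>i\<in>UNIV. (- (inverse c * inverse c) * y $ i) * partial_deriv i \<phi> (inverse c *\<^sub>R y)) * h" for h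
      unfolding derivative_sum_partial[OF D] sum_distrib_right by (intro sum.cong) auto
    ultimately have "((\<lambda>c. \<eta> c y) has_real_derivative (\<Sum>i\<in>UNIV. (- (inverse c * inverse c) * y $ i) * partial_deriv i \<phi> (inverse c *\<^sub>R y))) (at c)"
      by (simp add: has_field_derivative_def)
    from DERIV_cmult[OF this, of "U y"]
    show "((\<lambda>c. U y * \<eta> c y) has_real_derivative k' c y) (at c)" unfolding k'_def .
    show "\<bar>k' c y\<bar> \<le> Q * \<bar>U y * indicator (cball 0 (R * (c0 + 1))) y\<bar>"
    proof (cases "norm y \<le> R * (c0 + 1)")
      case True
      have ic: "\<bar>inverse c * inverse c\<bar> \<le> 4"
      proof -
        have "inverse c \<le> 2" using c(1) by (simp add: inverse_eq_divide field_simps)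
        then have "inverse c * inverse c \<le> 2 * 2" using c(1) by (intro mult_mono) auto
        then show ?thesis using c(1) by simp
      qed
      have "\<bar>\<Sum>i\<in>UNIV. (- (inverse c * inverse c) * y $ i) * partial_deriv i \<phi> (inverse c *\<^sub>R y)\<bar>
          \<le> (\<Sum>i\<in>UNIV. 4 * (R * (c0 + 1)) * B i)"
      proof (rule order_trans[OF sum_abs], rule sum_mono)
        fix i
        have "\<bar>y $ i\<bar> \<le> R * (c0 + 1)" using component_le_norm_cart[of y i] True by linarith
        then show "\<bar>(- (inverse c * inverse c) * y $ i) * partial_deriv i \<phi> (inverse c *\<^sub>R y)\<bar> \<le> 4 * (R * (c0 + 1)) * B i"
          unfolding abs_mult abs_minus_cancel
          using ic B[of i] B0[of i] R(1) c0 by (intro mult_mono) (auto simp: abs_mult)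
      qed
      also have "\<dots> = Q" unfolding Q_def by (simp add: sum_distrib_left)
      finally have "\<bar>k' c y\<bar> \<le> \<bar>U y\<bar> * Q" unfolding k'_def abs_mult by (rule mult_left_mono) simp
      then show ?thesis using True by (simp add: mult.commute)
    next
      case False
      have "R * c < norm y" using False R(1) c(2) mult_strict_left_mono[of c "c0 + 1" R] by linarith
      then have "norm (inverse c *\<^sub>R y) > R" using c(1) by (simp add: field_simps)
      then have "k' c y = 0" unfolding k'_def using Rd by simp
      then show ?thesis using False by simp
    qed
  next
    show "integrable lebesgue (\<lambda>y. Q * \<bar>U y * indicator (cball 0 (R * (c0 + 1))) y\<bar>)"
      using L2_mult_integrable[OF UL indicator_cball_L2] by auto
    show "integrable lebesgue (\<lambda>y. U y * \<eta> c y)" if "\<bar>c - c0\<bar> < 1/2" for c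
    proof -
      have "c > 0" using that c0 unfolding abs_less_iff by linarith
      then show ?thesis by (intro L2_mult_integrable UL test_L2 eT)
    qed
    have "(\<lambda>y. partial_deriv i \<phi> (inverse c0 *\<^sub>R y)) \<in> borel_measurable lebesgue" for i
      using affine_borel_measurable[OF test_meas[OF dp], of "inverse c0" i 0] c0 by simp
    moreover have "(\<lambda>y :: real ^ 'n. y $ i) \<in> borel_measurable lebesgue" for i
      by (intro continuous_lebesgue_measurable continuous_intros)
    ultimately show "k' c0 \<in> borel_measurable lebesgue" unfolding k'_def[abs_def]
      by (intro borel_measurable_times borel_measurable_sum L2_meas[OF UL] borel_measurable_const)
  qed simp
  have c0p: "c0 > 0" using c0 by simp
  have yT: "(\<lambda>y. y $ i * \<eta> c0 y) \<in> test_functions" for i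
    by (intro test_mult_Ck eT c0p Ck_coord)
  have pd\<eta>: "partial_deriv i (\<eta> c0) y = inverse c0 * partial_deriv i \<phi> (inverse c0 *\<^sub>R y)" for i y
    using partial_deriv_affine[of \<phi> i "inverse c0" 0] test_differentiable[OF p] unfolding \<eta>_def[abs_def] by simp
  \<comment> \<open>The i-th derivative of \<open>y $ i * \<eta> c0 y\<close> contributes an
    undifferentiated term. Summed over i these terms account for the derivative of the volume factor
    \<open>c ^ CARD('n)\<close>.\<close>
  have byparts: "(LINT y|lebesgue. U y * \<eta> c0 y) + (LINT y|lebesgue. U y * (y $ i * partial_deriv i (\<eta> c0) y))
      = - ip (weak_partial i U) (\<lambda>y. y $ i * \<eta> c0 y)" for i
  proof -
    have co: "(\<lambda>x :: real ^ 'n. x $ i) differentiable (at x)" for x using Ck_coord[of "Suc 0" i] by simp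
    have c1: "partial_deriv i (\<lambda>x :: real ^ 'n. x $ i) = (\<lambda>x. 1)"
      by (rule ext) (simp add: partial_deriv_eqI[OF bounded_linear_imp_has_derivative[OF bounded_linear_vec_nth]] axis_def)
    have pd: "partial_deriv i (\<lambda>y. y $ i * \<eta> c0 y) = (\<lambda>y. y $ i * partial_deriv i (\<eta> c0) y + \<eta> c0 y)"
      using partial_deriv_mult[of "\<lambda>x. x $ i" "\<eta> c0" i] co test_differentiable[OF eT[OF c0p]] unfolding c1 by simp
    have "ip U (partial_deriv i (\<lambda>y. y $ i * \<eta> c0 y)) = - ip (weak_partial i U) (\<lambda>y. y $ i * \<eta> c0 y)"
      using wp_is[OF U, of i] yT unfolding weak_partial_ip by blast
    moreover have "integrable lebesgue (\<lambda>y. U y * (y $ i * partial_deriv i (\<eta> c0) y))"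
      by (intro L2_mult_integrable UL test_L2 test_mult_Ck partial_deriv_test eT c0p Ck_coord)
    moreover have "integrable lebesgue (\<lambda>y. U y * \<eta> c0 y)" by (intro L2_mult_integrable UL test_L2 eT c0p)
    ultimately show ?thesis unfolding pd ip_def distrib_left by simp
  qed
  have k'eq: "(LINT y|lebesgue. k' c0 y) = - inverse c0 * (\<Sum>i\<in>UNIV. LINT y|lebesgue. U y * (y $ i * partial_deriv i (\<eta> c0) y))"
  proof -
    have "k' c0 y = - inverse c0 * (\<Sum>i\<in>UNIV. U y * (y $ i * partial_deriv i (\<eta> c0) y))" for y
      unfolding k'_def pd\<eta> sum_distrib_left by (intro sum.cong) auto
    moreover have "integrable lebesgue (\<lambda>y. U y * (y $ i * partial_deriv i (\<eta> c0) y))" for i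
      by (intro L2_mult_integrable UL test_L2 test_mult_Ck partial_deriv_test eT c0p Ck_coord)
    ultimately show ?thesis by (simp add: Bochner_Integration.integral_sum)
  qed
  define G where "G c = (LINT y|lebesgue. U y * \<eta> c y)" for c
  define G' where "G' = (LINT y|lebesgue. k' c0 y)"
  have "((\<lambda>c. G c / c ^ ?N) has_real_derivative (G' * c0 ^ ?N - G c0 * (real ?N * c0 ^ (?N - 1))) / (c0 ^ ?N * c0 ^ ?N)) (at c0)"
    using DG c0p unfolding G_def[symmetric] G'_def[symmetric] by (auto intro!: derivative_eq_intros)
  moreover have "\<forall>\<^sub>F c in nhds c0. G c / c ^ ?N = ip (\<lambda>x. U (c *\<^sub>R x)) \<phi>"
    using eventually_nhds_in_open[of "{0<..}" c0] c0p by (auto elim!: eventually_mono simp: scal G_def)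
  moreover have "(G' * c0 ^ ?N - G c0 * (real ?N * c0 ^ (?N - 1))) / (c0 ^ ?N * c0 ^ ?N)
      = (\<Sum>i\<in>UNIV. ip (weak_partial i U) (\<lambda>y. y $ i * \<phi> (inverse c0 *\<^sub>R y))) / c0 ^ (?N + 1)"
  proof -
    have S: "(\<Sum>i\<in>UNIV. ip (weak_partial i U) (\<lambda>y. y $ i * \<phi> (inverse c0 *\<^sub>R y))) = c0 * G' - real ?N * G c0"
    proof -
      have "(\<Sum>i\<in>UNIV. ip (weak_partial i U) (\<lambda>y. y $ i * \<eta> c0 y))
          = (\<Sum>i\<in>UNIV. - (G c0 + (LINT y|lebesgue. U y * (y $ i * partial_deriv i (\<eta> c0) y))))"
        using byparts unfolding G_def by (intro sum.cong) auto
      also have "\<dots> = - (real ?N * G c0) - (\<Sum>i\<in>UNIV. LINT y|lebesgue. U y * (y $ i * partial_deriv i (\<eta> c0) y))"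
        unfolding minus_add_distrib sum.distrib sum_negf by simp
      also have "(\<Sum>i\<in>UNIV. LINT y|lebesgue. U y * (y $ i * partial_deriv i (\<eta> c0) y)) = - c0 * G'"
        unfolding G'_def k'eq using c0p by simp
      finally show ?thesis unfolding \<eta>_def by simp
    qed
    obtain m where m: "?N = Suc m" by (metis not0_implies_Suc zero_less_card_finite less_irrefl)
    show ?thesis unfolding S m using c0p by (simp add: field_simps)
  qed
  ultimately show ?thesis
    using DERIV_cong_ev[of c0 c0 "\<lambda>c. G c / c ^ ?N" "\<lambda>c. ip (\<lambda>x. U (c *\<^sub>R x)) \<phi>"
        "(G' * c0 ^ ?N - G c0 * (real ?N * c0 ^ (?N - 1))) / (c0 ^ ?N * c0 ^ ?N)"] by simp
qed

text \<open>Mean value theorem in the dilation parameter, then Cauchy-Schwarz over coordinates and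
  space. The coordinates in the test function combine to the factor \<open>norm x\<close>.\<close>

lemma dil_diff_test:
  fixes U :: "real ^ 'n \<Rightarrow> real"
  assumes N: "CARD('n) \<ge> 3" and U: "U \<in> H1" and p: "\<phi> \<in> test_functions" and t: "t > 0"
  shows "\<bar>ip (\<lambda>x. U ((1 + t) *\<^sub>R x) - U x) \<phi>\<bar> \<le> t * sqrt (gr U) * nrm (\<lambda>x. norm x * \<phi> x)"
proof -
  let ?N = "CARD('n)"
  define F where "F c = ip (\<lambda>x. U (c *\<^sub>R x)) \<phi>" for c
  define F' where "F' c = (\<Sum>i\<in>UNIV. ip (weak_partial i U) (\<lambda>y. y $ i * \<phi> (inverse c *\<^sub>R y))) / c ^ (?N + 1)" for c
  have D: "(F has_real_derivative F' c) (at c)" if "c \<ge> 1" for c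
    unfolding F_def F'_def by (rule dil_test_deriv[OF U p that])
  have "\<exists>z. 1 < z \<and> z < 1 + t \<and> F (1 + t) - F 1 = (1 + t - 1) * F' z"
    by (rule MVT2) (use t D in auto)
  then obtain c where c: "1 < c" "F (1 + t) - F 1 = t * F' c" by auto
  have nT: "(\<lambda>x. norm x * \<phi> x) \<in> L2" by (intro test_mult_L2 p continuous_intros)
  define \<eta> where "\<eta> y = \<phi> (inverse c *\<^sub>R y)" for y
  have eT: "\<eta> \<in> test_functions" unfolding \<eta>_def using test_affine[OF p, of "inverse c" 0] c by simp
  have yL: "(\<lambda>y. y $ i * \<eta> y) \<in> L2" for i by (intro test_L2 test_mult_Ck eT Ck_coord)
  have sq: "(\<Sum>i\<in>UNIV. (nrm (\<lambda>y. y $ i * \<eta> y))\<^sup>2) = c\<^sup>2 * c ^ ?N * (nrm (\<lambda>x. norm x * \<phi> x))\<^sup>2"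
  proof -
    have i: "integrable lebesgue (\<lambda>y. (y $ i * \<eta> y)\<^sup>2)" for i using yL by (simp add: L2_iff)
    have "(\<Sum>i\<in>UNIV. (nrm (\<lambda>y. y $ i * \<eta> y))\<^sup>2) = (LINT y|lebesgue. (\<Sum>i\<in>UNIV. (y $ i * \<eta> y)\<^sup>2))"
      unfolding nrm_sq_int using i by (intro Bochner_Integration.integral_sum[symmetric]) auto
    also have "\<dots> = (LINT y|lebesgue. (norm y * \<eta> y)\<^sup>2)"
      unfolding power_mult_distrib sum_distrib_right[symmetric] power2_norm_eq_inner inner_vec_def
      by (simp add: power2_eq_square)
    also have "\<dots> = c ^ ?N * (LINT x|lebesgue. (norm (c *\<^sub>R x) * \<eta> (c *\<^sub>R x))\<^sup>2)"
    proof -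
      have m: "(\<lambda>y. (norm y * \<eta> y)\<^sup>2) \<in> borel_measurable lebesgue"
      proof (rule borel_measurable_power)
        have "continuous_on UNIV (norm :: real ^ 'n \<Rightarrow> real)" by (intro continuous_intros)
        from L2_meas[OF test_mult_L2[OF this eT]]
        show "(\<lambda>y. norm y * \<eta> y) \<in> borel_measurable lebesgue" .
      qed
      show ?thesis using affine_integral[OF _ m, of c 0] c by simp
    qed
    also have "(LINT x|lebesgue. (norm (c *\<^sub>R x) * \<eta> (c *\<^sub>R x))\<^sup>2) = c\<^sup>2 * (LINT x|lebesgue. (norm x * \<phi> x)\<^sup>2)"
      unfolding \<eta>_def using c by (simp add: power_mult_distrib mult.assoc)
    finally show ?thesis unfolding nrm_sq_int by (simp add: ac_simps)
  qed
  have "\<bar>\<Sum>i\<in>UNIV. ip (weak_partial i U) (\<lambda>y. y $ i * \<eta> y)\<bar>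
      \<le> (\<Sum>i\<in>UNIV. nrm (weak_partial i U) * nrm (\<lambda>y. y $ i * \<eta> y))"
    by (rule order_trans[OF sum_abs]) (intro sum_mono ip_le_nrm wp_L2 U yL)
  then have "\<bar>\<Sum>i\<in>UNIV. ip (weak_partial i U) (\<lambda>y. y $ i * \<eta> y)\<bar>\<^sup>2
      \<le> (\<Sum>i\<in>UNIV. nrm (weak_partial i U) * nrm (\<lambda>y. y $ i * \<eta> y))\<^sup>2" by (intro power_mono) auto
  also have "\<dots> \<le> gr U * (\<Sum>i\<in>UNIV. (nrm (\<lambda>y. y $ i * \<eta> y))\<^sup>2)"
    unfolding gr_eq_nrm by (rule Cauchy_Schwarz_ineq_sum)
  also have "\<dots> = (c\<^sup>2 * c ^ ?N) * (gr U * (nrm (\<lambda>x. norm x * \<phi> x))\<^sup>2)" unfolding sq by (simp add: ac_simps)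
  \<comment> \<open>As c is at least 1 the scaling factors cancel in favour of the bound, leaving a
    constant independent of the intermediate point.\<close>
  also have "\<dots> \<le> (c ^ (?N + 1))\<^sup>2 * (gr U * (nrm (\<lambda>x. norm x * \<phi> x))\<^sup>2)"
  proof (intro mult_right_mono)
    have "c\<^sup>2 * c ^ ?N \<le> c\<^sup>2 * (c ^ ?N * c ^ ?N)"
      using c(1) by (intro mult_left_mono) (auto simp: one_le_power)
    then show "c\<^sup>2 * c ^ ?N \<le> (c ^ (?N + 1))\<^sup>2" by (simp add: power2_eq_square ac_simps)
  qed simp
  also have "\<dots> = (c ^ (?N + 1) * (sqrt (gr U) * nrm (\<lambda>x. norm x * \<phi> x)))\<^sup>2" by (simp add: power_mult_distrib)
  finally have "\<bar>\<Sum>i\<in>UNIV. ip (weak_partial i U) (\<lambda>y. y $ i * \<eta> y)\<bar> \<le> c ^ (?N + 1) * (sqrt (gr U) * nrm (\<lambda>x. norm x * \<phi> x))"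
    by (rule power2_le_imp_le) (use c in simp)
  then have "\<bar>F' c\<bar> \<le> sqrt (gr U) * nrm (\<lambda>x. norm x * \<phi> x)"
    unfolding F'_def \<eta>_def abs_divide using c(1) by (simp add: divide_le_eq mult.commute)
  then have "\<bar>F (1 + t) - F 1\<bar> \<le> t * (sqrt (gr U) * nrm (\<lambda>x. norm x * \<phi> x))"
    unfolding c(2) abs_mult using t by (simp add: mult_left_mono)
  moreover have "F (1 + t) - F 1 = ip (\<lambda>x. U ((1 + t) *\<^sub>R x) - U x) \<phi>"
    unfolding F_def using ip_diff_left[OF dil_L2[OF H1_L2[OF U]] H1_L2[OF U] test_L2[OF p], of "1 + t"] t by simp
  ultimately show ?thesis by (simp add: mult.assoc)
qed

text \<open>Formally the increment is t times the radial derivative of U, and division by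
  \<open>norm x\<close> leaves only the gradient. The proof is by duality: the increment is tested
  with an approximation of itself divided by the square of \<open>norm x\<close>.\<close>

lemma dil_diff_bound:
  fixes U :: "real ^ 'n \<Rightarrow> real"
  assumes N: "CARD('n) \<ge> 3" and U: "U \<in> H1" and t: "t > 0"
  shows "(\<lambda>x. (U ((1 + t) *\<^sub>R x) - U x) / norm x) \<in> L2 \<and>
    nrm (\<lambda>x. (U ((1 + t) *\<^sub>R x) - U x) / norm x) \<le> t * sqrt (gr U)"
proof -
  define \<delta> where "\<delta> x = U ((1 + t) *\<^sub>R x) - U x" for x
  define A where "A = t * sqrt (gr U)"
  have A0: "0 \<le> A" unfolding A_def using t by simp
  have dL: "\<delta> \<in> L2" unfolding \<delta>_def using t by (intro L2_diff dil_L2 H1_L2 U) auto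
  have nm: "(\<lambda>x :: real ^ 'n. norm x) \<in> borel_measurable lebesgue" by (intro continuous_lebesgue_measurable continuous_intros)
  \<comment> \<open>Cut off near the origin, where the quotient is not yet known to be square
    integrable; Fatou removes the cut-off.\<close>
  define q where "q j x = (if norm x \<ge> inverse (real (Suc j)) then \<delta> x / norm x else 0)" for j and x :: "real ^ 'n"
  have qprop: "q j \<in> L2 \<and> nrm (q j) \<le> A" for j
  proof -
    let ?r = "inverse (real (Suc j))"
    have r: "?r > 0" by simp
    define m where "m x = (if norm x \<ge> ?r then 1 else 0 :: real)" for x :: "real ^ 'n"
    have mm: "m \<in> borel_measurable lebesgue"
    proof -
      have "{x :: real ^ 'n. ?r \<le> norm x} \<in> sets borel" by (intro borel_closed closed_Collect_le continuous_intros)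
      then have "(indicator {x :: real ^ 'n. ?r \<le> norm x} :: _ \<Rightarrow> real) \<in> borel_measurable lebesgue"
        by (intro borel_measurable_indicator) auto
      moreover have "m = indicator {x. ?r \<le> norm x}" unfolding m_def by (auto simp: indicator_def)
      ultimately show ?thesis by simp
    qed
    \<comment> \<open>Chosen so that its pairing with the increment is the squared norm of
      \<open>q j\<close>, while \<open>norm x\<close> times it is \<open>q j\<close> itself. Testing
      with it would give the bound at once, were it a test function.\<close>
    let ?g = "\<lambda>x. m x / (norm x)\<^sup>2 * \<delta> x"
    let ?w = "\<lambda>x :: real ^ 'n. sqrt (1 + (norm x)\<^sup>2)"
    have inv: "m x / norm x \<le> inverse ?r" "0 \<le> m x / norm x" for x
    proof -
      show "m x / norm x \<le> inverse ?r"
      proof (cases "?r \<le> norm x")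
        case True
        from le_imp_inverse_le[OF this r] show ?thesis using True unfolding m_def by (simp only: if_True divide_inverse mult_1)
      qed (use r in \<open>simp add: m_def\<close>)
      show "0 \<le> m x / norm x" unfolding m_def by simp
    qed
    have gL: "?g \<in> L2"
    proof (rule L2_bounded_mult[OF dL, where C = "inverse ?r * inverse ?r"])
      show "(\<lambda>x. m x / (norm x)\<^sup>2) \<in> borel_measurable lebesgue" using mm nm by simp
      fix x
      have "m x / (norm x)\<^sup>2 = (m x / norm x) * (m x / norm x)" unfolding m_def by (auto simp: power2_eq_square)
      moreover have "\<dots> \<le> inverse ?r * inverse ?r" using inv by (intro mult_mono) auto
      ultimately show "\<bar>m x / (norm x)\<^sup>2\<bar> \<le> inverse ?r * inverse ?r" using inv(2)[of x] by (simp add: m_def)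
    qed
    have qL: "q j \<in> L2"
    proof -
      have "(\<lambda>x. m x / norm x * \<delta> x) \<in> L2"
        by (rule L2_bounded_mult[OF dL, where C = "inverse ?r"]) (use mm nm inv in \<open>auto simp: m_def\<close>)
      moreover have "(\<lambda>x. m x / norm x * \<delta> x) = q j" unfolding q_def m_def by auto
      ultimately show ?thesis by simp
    qed
    have nq: "(\<lambda>x. norm x * ?g x) = q j" unfolding q_def m_def by (auto simp: power2_eq_square fun_eq_iff)
    have wg: "(\<lambda>x. ?w x * ?g x) \<in> L2"
    proof (rule L2_bound[OF L2_add[OF L2_abs[OF gL] L2_abs[OF qL]]])
      show "(\<lambda>x. ?w x * ?g x) \<in> borel_measurable lebesgue"
        using nm mm L2_meas[OF dL] by (intro borel_measurable_times) auto
      show "AE x in lebesgue. \<bar>?w x * ?g x\<bar> \<le> \<bar>\<bar>?g x\<bar> + \<bar>q j x\<bar>\<bar>"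
      proof (rule AE_I2)
        fix x
        have "?w x \<le> 1 + norm x" by (rule real_le_lsqrt) (auto simp: power2_sum)
        then have "?w x * \<bar>?g x\<bar> \<le> (1 + norm x) * \<bar>?g x\<bar>" by (intro mult_right_mono) auto
        moreover have "norm x * \<bar>?g x\<bar> = \<bar>q j x\<bar>" using fun_cong[OF nq, of x] by (metis abs_mult abs_norm_cancel)
        ultimately have "?w x * \<bar>?g x\<bar> \<le> \<bar>?g x\<bar> + \<bar>q j x\<bar>" by (simp only: distrib_right mult_1)
        moreover have "\<bar>?w x * ?g x\<bar> = ?w x * \<bar>?g x\<bar>" by (simp only: abs_mult) simp
        ultimately show "\<bar>?w x * ?g x\<bar> \<le> \<bar>\<bar>?g x\<bar> + \<bar>q j x\<bar>\<bar>" using abs_ge_self order_trans by metis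
      qed
    qed
    have key: "(nrm (q j))\<^sup>2 \<le> A * nrm (q j) + e * (A + nrm \<delta>)" if e: "e > 0" for e
    proof -
      \<comment> \<open>The weight dominates both 1 and \<open>norm x\<close>, so \<phi> is close to
        \<open>?g\<close> and \<open>norm x * \<phi> x\<close> is close to \<open>q j\<close>, with
        the same error.\<close>
      obtain \<phi> where p: "\<phi> \<in> test_functions" "nrm (\<lambda>x. ?w x * ?g x - ?w x * \<phi> x) < e"
      proof (rule test_dense_weighted[OF _ _ wg e])
        show "continuous_on UNIV ?w" by (intro continuous_intros)
        show "?w x \<noteq> 0" for x
        proof -
          have "1 + (norm x)\<^sup>2 > 0" by (simp add: add_pos_nonneg)
          then show ?thesis by simp
        qed
      qed blast
      have pL: "\<phi> \<in> L2" by (rule test_L2[OF p(1)])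
      have nL: "(\<lambda>x. norm x * \<phi> x) \<in> L2" by (intro test_mult_L2 p continuous_intros)
      have wL: "(\<lambda>x. ?w x * ?g x - ?w x * \<phi> x) \<in> L2" by (intro L2_diff wg test_mult_L2 p continuous_intros)
      have w1: "1 \<le> ?w x" "norm x \<le> ?w x" for x by (auto intro!: real_le_rsqrt)
      have n1: "nrm (\<lambda>x. ?g x - \<phi> x) < e"
      proof -
        have "nrm (\<lambda>x. ?g x - \<phi> x) \<le> nrm (\<lambda>x. ?w x * ?g x - ?w x * \<phi> x)"
        proof (rule nrm_mono[OF wL L2_meas[OF L2_diff[OF gL pL]] AE_I2])
          fix x
          have "1 * \<bar>?g x - \<phi> x\<bar> \<le> ?w x * \<bar>?g x - \<phi> x\<bar>" using w1(1) by (intro mult_right_mono) auto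
          also have "\<dots> = \<bar>?w x * (?g x - \<phi> x)\<bar>" by (simp only: abs_mult) simp
          finally show "\<bar>?g x - \<phi> x\<bar> \<le> \<bar>?w x * ?g x - ?w x * \<phi> x\<bar>" by (simp only: right_diff_distrib mult_1)
        qed
        then show ?thesis using p(2) by simp
      qed
      have n2: "nrm (\<lambda>x. q j x - norm x * \<phi> x) < e"
      proof -
        have "nrm (\<lambda>x. q j x - norm x * \<phi> x) \<le> nrm (\<lambda>x. ?w x * ?g x - ?w x * \<phi> x)"
        proof (rule nrm_mono[OF wL L2_meas[OF L2_diff[OF qL nL]] AE_I2])
          fix x
          have "q j x - norm x * \<phi> x = norm x * (?g x - \<phi> x)" using fun_cong[OF nq, of x] by (simp only: right_diff_distrib)
          then have "\<bar>q j x - norm x * \<phi> x\<bar> = norm x * \<bar>?g x - \<phi> x\<bar>" by (simp only: abs_mult abs_norm_cancel)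
          also have "\<dots> \<le> ?w x * \<bar>?g x - \<phi> x\<bar>" using w1(2) by (intro mult_right_mono) auto
          also have "\<dots> = \<bar>?w x * (?g x - \<phi> x)\<bar>" by (simp only: abs_mult) simp
          finally show "\<bar>q j x - norm x * \<phi> x\<bar> \<le> \<bar>?w x * ?g x - ?w x * \<phi> x\<bar>" by (simp only: right_diff_distrib)
        qed
        then show ?thesis using p(2) by simp
      qed
      have "(nrm (q j))\<^sup>2 = ip \<delta> ?g"
        unfolding nrm_sq_int ip_def
        by (intro Bochner_Integration.integral_cong) (auto simp: q_def m_def power2_eq_square)
      also have "\<dots> = ip \<delta> \<phi> + ip \<delta> (\<lambda>x. ?g x - \<phi> x)" using ip_diff_right[OF gL pL dL] by simp
      finally have 1: "(nrm (q j))\<^sup>2 = ip \<delta> \<phi> + ip \<delta> (\<lambda>x. ?g x - \<phi> x)" .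
      have 2: "ip \<delta> \<phi> \<le> A * nrm (\<lambda>x. norm x * \<phi> x)"
        using dil_diff_test[OF N U p(1) t] unfolding \<delta>_def A_def by (simp add: abs_le_iff)
      have "nrm (\<lambda>x. norm x * \<phi> x) \<le> nrm (q j) + e"
        using nrm_diff_abs[OF qL nL] n2 by linarith
      from mult_left_mono[OF this A0] have 3: "A * nrm (\<lambda>x. norm x * \<phi> x) \<le> A * nrm (q j) + A * e"
        by (simp only: distrib_left)
      have 4: "ip \<delta> (\<lambda>x. ?g x - \<phi> x) \<le> nrm \<delta> * e"
        using ip_le_nrm[OF dL L2_diff[OF gL pL]] mult_left_mono[OF less_imp_le[OF n1], of "nrm \<delta>"] by (simp add: abs_le_iff)
      show ?thesis using 1 2 3 4 by (simp add: distrib_left mult.commute)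
    qed
    have "((\<lambda>e. A * nrm (q j) + e * (A + nrm \<delta>)) \<longlongrightarrow> A * nrm (q j) + 0 * (A + nrm \<delta>)) (at_right 0)" by (intro tendsto_intros)
    then have "(nrm (q j))\<^sup>2 \<le> A * nrm (q j) + 0 * (A + nrm \<delta>)"
      by (rule tendsto_lowerbound) (use key in \<open>auto simp: eventually_at_filter\<close>)
    then have "nrm (q j) * nrm (q j) \<le> A * nrm (q j)" by (simp add: power2_eq_square)
    then have "nrm (q j) \<le> A"
    proof (cases "nrm (q j) = 0")
      case False
      then have "nrm (q j) > 0" using nrm_nonneg[of "q j"] by argo
      then show ?thesis using \<open>nrm (q j) * nrm (q j) \<le> A * nrm (q j)\<close> mult_right_le_imp_le by blast
    qed (use A0 in simp)
    then show ?thesis using qL by blast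
  qed
  show ?thesis
    unfolding \<delta>_def[symmetric] A_def[symmetric]
  proof (rule L2_fatou[of q])
    show "q n \<in> L2" "nrm (q n) \<le> A" for n using qprop by auto
    show "(\<lambda>x. \<delta> x / norm x) \<in> borel_measurable lebesgue" using L2_meas[OF dL] nm by simp
    show "AE x in lebesgue. (\<lambda>n. q n x) \<longlonglongrightarrow> \<delta> x / norm x"
    proof (rule AE_I2)
      fix x
      show "(\<lambda>n. q n x) \<longlonglongrightarrow> \<delta> x / norm x"
      proof (cases "x = 0")
        case True then show ?thesis unfolding q_def by simp
      next
        case False
        then have "norm x > 0" by simp
        from order_tendstoD(2)[OF LIMSEQ_inverse_real_of_nat this]
        have "\<forall>\<^sub>F n in sequentially. q n x = \<delta> x / norm x" by eventually_elim (simp add: q_def)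
        then show ?thesis by (rule tendsto_eventually)
      qed
    qed
  qed
qed

section \<open>The Pohozaev inequality\<close>

lemma MVT_between:
  fixes f :: "real \<Rightarrow> real"
  assumes "\<And>s. (f has_real_derivative f' s) (at s)"
  obtains c where "min a b \<le> c" "c \<le> max a b" "f b - f a = (b - a) * f' c"
proof (cases a b rule: linorder_cases)
  case less
  from MVT2[OF less, of f f'] assms obtain c where "a < c" "c < b" "f b - f a = (b - a) * f' c" by blast
  then show ?thesis using less by (intro that[of c]) auto
next
  case greater
  from MVT2[OF greater, of f f'] assms obtain c where c: "b < c" "c < a" "f a - f b = (a - b) * f' c" by blast
  then have "f b - f a = (b - a) * f' c" by (simp add: left_diff_distrib)
  then show ?thesis using greater c by (intro that[of c]) auto
qed (use that[of a] in auto)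

lemma DERIV_abs_powr_mult:
  assumes q: "q > 0"
  shows "((\<lambda>s. \<bar>s\<bar> powr q * s) has_real_derivative (q + 1) * \<bar>s\<bar> powr q) (at s)"
proof (cases s "0 :: real" rule: linorder_cases)
  case equal
  have "((\<lambda>h. \<bar>h\<bar> powr q) \<longlongrightarrow> \<bar>0::real\<bar> powr q) (at 0)"
    by (rule tendsto_abs_powr) (use q in \<open>auto intro: tendsto_intros\<close>)
  then have "((\<lambda>h. \<bar>h\<bar> powr q) \<longlongrightarrow> 0) (at (0::real))" using q by simp
  moreover have "\<forall>\<^sub>F h in at (0::real). \<bar>h\<bar> powr q = (\<bar>0 + h\<bar> powr q * (0 + h) - \<bar>0\<bar> powr q * 0) / h"
    by (simp add: eventually_at_filter)
  ultimately have "((\<lambda>h. (\<bar>0 + h\<bar> powr q * (0 + h) - \<bar>0\<bar> powr q * 0) / h) \<longlongrightarrow> 0) (at (0::real))"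
    by (rule Lim_transform_eventually)
  then show ?thesis using equal by (simp add: DERIV_def)
next
  case greater
  have "((\<lambda>s. s powr (q + 1)) has_real_derivative (q + 1) * s powr q) (at s)"
    using has_real_derivative_powr[OF greater, of "q + 1"] by simp
  moreover have "\<forall>\<^sub>F x in nhds s. x powr (q + 1) = \<bar>x\<bar> powr q * x"
    using eventually_nhds_in_open[of "{0<..}" s] greater by (auto elim!: eventually_mono simp: powr_add)
  ultimately show ?thesis
    using greater DERIV_cong_ev[of s s "\<lambda>s. s powr (q + 1)" "\<lambda>s. \<bar>s\<bar> powr q * s" "(q + 1) * s powr q" "(q + 1) * s powr q"] by simp
next
  case less
  have "((\<lambda>s. - ((- s) powr (q + 1))) has_real_derivative (q + 1) * (- s) powr q) (at s)"
    using less by (auto intro!: derivative_eq_intros)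
  moreover have "\<forall>\<^sub>F x in nhds s. - ((- x) powr (q + 1)) = \<bar>x\<bar> powr q * x"
    using eventually_nhds_in_open[of "{..<0}" s] less by (auto elim!: eventually_mono simp: powr_add)
  ultimately show ?thesis
    using less DERIV_cong_ev[of s s "\<lambda>s. - ((- s) powr (q + 1))" "\<lambda>s. \<bar>s\<bar> powr q * s" "(q + 1) * (- s) powr q" "(q + 1) * (- s) powr q"] by simp
qed

text \<open>Two applications of the mean value theorem, to the power and to its derivative. An upper
  bound by the end point values of the second derivative avoids expanding around an intermediate
  point.\<close>

lemma abs_powr_second_order:
  fixes a b :: real
  assumes p: "p > 2"
  shows "\<bar>b\<bar> powr p \<le> \<bar>a\<bar> powr p + p * (\<bar>a\<bar> powr (p - 2) * a * (b - a))
    + p * (p - 1) * ((\<bar>a\<bar> powr (p - 2) + \<bar>b\<bar> powr (p - 2)) * (b - a)\<^sup>2)"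
proof -
  let ?f = "\<lambda>s :: real. \<bar>s\<bar> powr (p - 2) * s"
  have "((\<lambda>s. \<bar>s\<bar> powr p) has_real_derivative p * ?f s) (at s)" for s
    using DERIV_abs_powr[of p s] p by simp
  then obtain c where c: "min a b \<le> c" "c \<le> max a b" "\<bar>b\<bar> powr p - \<bar>a\<bar> powr p = (b - a) * (p * ?f c)"
    by (rule MVT_between)
  have "(?f has_real_derivative (p - 1) * \<bar>s\<bar> powr (p - 2)) (at s)" for s
    using DERIV_abs_powr_mult[of "p - 2" s] p by simp
  then obtain d where d: "min a c \<le> d" "d \<le> max a c" "?f c - ?f a = (c - a) * ((p - 1) * \<bar>d\<bar> powr (p - 2))"
    by (rule MVT_between)
  have D: "\<bar>d\<bar> powr (p - 2) \<le> \<bar>a\<bar> powr (p - 2) + \<bar>b\<bar> powr (p - 2)"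
  proof -
    have "\<bar>d\<bar> \<le> max \<bar>a\<bar> \<bar>b\<bar>" using c(1,2) d(1,2) by (auto simp: min_def max_def split: if_splits)
    then have "\<bar>d\<bar> powr (p - 2) \<le> max \<bar>a\<bar> \<bar>b\<bar> powr (p - 2)" using p by (intro powr_mono2) auto
    also have "\<dots> \<le> \<bar>a\<bar> powr (p - 2) + \<bar>b\<bar> powr (p - 2)" by (simp add: max_def)
    finally show ?thesis .
  qed
  \<comment> \<open>The intermediate point c lies between a and b, so the product has a sign and is
    at most the full square.\<close>
  have m: "0 \<le> (b - a) * (c - a)" "(b - a) * (c - a) \<le> (b - a)\<^sup>2"
  proof -
    have "(a \<le> c \<and> c \<le> b) \<or> (b \<le> c \<and> c \<le> a)" using c(1,2) by (auto simp: min_def max_def split: if_splits)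
    then show "0 \<le> (b - a) * (c - a)" "(b - a) * (c - a) \<le> (b - a)\<^sup>2"
      unfolding power2_eq_square by (auto intro: mult_left_mono mult_left_mono_neg simp: zero_le_mult_iff)
  qed
  have "\<bar>b\<bar> powr p - \<bar>a\<bar> powr p - p * (?f a * (b - a)) = p * ((b - a) * (?f c - ?f a))"
    unfolding c(3) by (simp add: algebra_simps)
  also have "\<dots> = p * (p - 1) * (\<bar>d\<bar> powr (p - 2) * ((b - a) * (c - a)))" unfolding d(3) by simp
  also have "\<dots> \<le> p * (p - 1) * ((\<bar>a\<bar> powr (p - 2) + \<bar>b\<bar> powr (p - 2)) * (b - a)\<^sup>2)"
    using p m by (intro mult_left_mono mult_mono D) auto
  finally show ?thesis by simp
qed

lemma Lp_tail_tendsto_0: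
  fixes a :: "real ^ 'n \<Rightarrow> real"
  assumes a: "a \<in> Lp_space q" and q: "q > 0" and e: "e > 0"
  obtains K M where "K \<ge> 0" "M \<ge> 0"
    "(\<lambda>x. if \<bar>a x\<bar> \<le> K \<and> norm x \<le> M then 0 else a x) \<in> Lp_space q"
    "Lp_norm q (\<lambda>x. if \<bar>a x\<bar> \<le> K \<and> norm x \<le> M then 0 else a x) \<le> e"
proof -
  define b where "b n x = (if \<bar>a x\<bar> \<le> real n \<and> norm x \<le> real n then 0 else a x)" for n :: nat and x
  have am[measurable]: "a \<in> borel_measurable lebesgue" and ai: "integrable lebesgue (\<lambda>x. \<bar>a x\<bar> powr q)"
    using a by (auto simp: Lp_space_def)
  have nm[measurable]: "(\<lambda>x :: real ^ 'n. norm x) \<in> borel_measurable lebesgue"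
    by (intro continuous_lebesgue_measurable continuous_intros)
  have bm: "b n \<in> borel_measurable lebesgue" for n unfolding b_def[abs_def] by measurable
  have bL: "b n \<in> Lp_space q" for n
    by (rule Lp_space_le[OF a q bm AE_I2, of _ 1]) (auto simp: b_def)
  have "(\<lambda>n. LINT x|lebesgue. \<bar>b n x\<bar> powr q) \<longlonglongrightarrow> (LINT x|(lebesgue :: (real ^ 'n) measure). 0)"
  proof (rule integral_dominated_convergence[where w = "\<lambda>x. \<bar>a x\<bar> powr q"])
    show "AE x in lebesgue. (\<lambda>n. \<bar>b n x\<bar> powr q) \<longlonglongrightarrow> 0"
    proof (rule AE_I2)
      fix x
      obtain n0 where n0: "max \<bar>a x\<bar> (norm x) \<le> real n0" using real_arch_simple by blast
      have "\<forall>\<^sub>F n in sequentially. \<bar>b n x\<bar> powr q = 0"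
        using eventually_ge_at_top[of n0]
      proof eventually_elim
        case (elim n)
        then have "real n0 \<le> real n" by simp
        then have "\<bar>a x\<bar> \<le> real n" "norm x \<le> real n" using n0 by auto
        then show ?case by (simp add: b_def)
      qed
      then show "(\<lambda>n. \<bar>b n x\<bar> powr q) \<longlonglongrightarrow> 0" by (rule tendsto_eventually)
    qed
    show "AE x in lebesgue. norm (\<bar>b n x\<bar> powr q) \<le> \<bar>a x\<bar> powr q" for n
      by (rule AE_I2) (simp add: b_def)
  qed (use bm ai in auto)
  then have "(\<lambda>n. Lp_norm q (b n)) \<longlonglongrightarrow> 0 powr (1 / q)"
    unfolding Lp_norm_def using q
    by (intro tendsto_powr2 tendsto_const) (auto intro!: always_eventually Bochner_Integration.integral_nonneg)
  then have "\<forall>\<^sub>F n in sequentially. Lp_norm q (b n) < e" by (rule order_tendstoD) (use q e in simp)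
  then obtain n where "Lp_norm q (b n) < e" unfolding eventually_sequentially by blast
  then show ?thesis using bL[of n] by (intro that[of "real n" "real n"]) (auto simp: b_def[abs_def])
qed

text \<open>The part of the weight that is large or far away has small norm and costs only a small
  share of the Dirichlet integral. On the rest the weight is bounded and x is in a ball, where w is
  controlled by \<open>w x / norm x\<close>. The constants are uniform in dilations of the weight by
  c at least 1, which do not increase its norm.\<close>

lemma weight_split:
  fixes a :: "real ^ 'n \<Rightarrow> real"
  assumes N: "CARD('n) \<ge> 3" and a: "a \<in> Lp_space (real CARD('n) / 2)" and e: "e > 0"
  obtains K where "K \<ge> 0" "\<forall>c\<ge>1. \<forall>w\<in>H1. (\<lambda>x. w x / norm x) \<in> L2 \<longrightarrow>
    integrable lebesgue (\<lambda>x. \<bar>a (c *\<^sub>R x)\<bar> * (w x)\<^sup>2) \<and>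
    (LINT x|lebesgue. \<bar>a (c *\<^sub>R x)\<bar> * (w x)\<^sup>2) \<le> e * gr w + K * (nrm (\<lambda>x. w x / norm x))\<^sup>2"
proof -
  let ?q = "real CARD('n) / 2"
  define s where "s = sobS CARD('n)"
  have s: "0 \<le> s" unfolding s_def by (rule sobS_nonneg)
  have q: "?q > 0" using N by simp
  have es: "e / (s + 1) > 0" using e s by simp
  obtain K M where K: "K \<ge> 0" "M \<ge> 0"
    and b: "(\<lambda>x. if \<bar>a x\<bar> \<le> K \<and> norm x \<le> M then 0 else a x) \<in> Lp_space ?q"
    "Lp_norm ?q (\<lambda>x. if \<bar>a x\<bar> \<le> K \<and> norm x \<le> M then 0 else a x) \<le> e / (s + 1)"
    by (rule Lp_tail_tendsto_0[OF a q es])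
  define b where "b x = (if \<bar>a x\<bar> \<le> K \<and> norm x \<le> M then 0 else a x)" for x
  note b = b[folded b_def]
  show ?thesis
  proof (rule that[of "K * M\<^sup>2"], goal_cases)
    case 2
    show ?case
    proof (intro allI ballI impI)
      fix c
      fix c and w :: "real ^ 'n \<Rightarrow> real" assume c: "c \<ge> (1 :: real)" and w: "w \<in> H1" and wL: "(\<lambda>x. w x / norm x) \<in> L2"
      have dil: "(\<lambda>x. f (c *\<^sub>R x)) \<in> Lp_space ?q \<and> Lp_norm ?q (\<lambda>x. f (c *\<^sub>R x)) \<le> Lp_norm ?q f"
        if f: "f \<in> Lp_space ?q" for f :: "real ^ 'n \<Rightarrow> real"
      proof -
        have f': "f \<in> borel_measurable lebesgue" "integrable lebesgue (\<lambda>x. \<bar>f x\<bar> powr ?q)"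
          using f by (auto simp: Lp_space_def)
        have c0: "c \<noteq> 0" using c by simp
        have m: "(\<lambda>x. f (c *\<^sub>R x)) \<in> borel_measurable lebesgue"
          using affine_borel_measurable[OF f'(1) c0, of 0] by simp
        have i: "integrable lebesgue (\<lambda>x. \<bar>f (c *\<^sub>R x)\<bar> powr ?q)"
          using affine_integrable_iff[OF c0, of "\<lambda>x. \<bar>f x\<bar> powr ?q" 0] f' by simp
        have "(LINT x|lebesgue. \<bar>f (c *\<^sub>R x)\<bar> powr ?q) = (LINT x|lebesgue. \<bar>f x\<bar> powr ?q) / c ^ CARD('n)"
          using affine_integral[OF c0, of "\<lambda>x. \<bar>f x\<bar> powr ?q" 0] f' c by simp
        also have "\<dots> \<le> (LINT x|lebesgue. \<bar>f x\<bar> powr ?q) / 1"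
          using c by (intro divide_left_mono) (auto simp: one_le_power intro: Bochner_Integration.integral_nonneg)
        finally have "Lp_norm ?q (\<lambda>x. f (c *\<^sub>R x)) \<le> Lp_norm ?q f"
          unfolding Lp_norm_def using q by (intro powr_mono2) (auto intro: Bochner_Integration.integral_nonneg)
        then show ?thesis using m i by (simp add: Lp_space_def)
      qed
      have wC: "w \<in> Lcrit" by (rule H1_Lcrit[OF N w])
      have ia: "integrable lebesgue (\<lambda>x. \<bar>a (c *\<^sub>R x)\<bar> * (w x)\<^sup>2)"
        using integrable_abs[OF holder_sq(1)[OF N conjunct1[OF dil[OF a]] wC]] by (simp add: abs_mult)
      have ib: "integrable lebesgue (\<lambda>x. \<bar>b (c *\<^sub>R x)\<bar> * (w x)\<^sup>2)"
        using integrable_abs[OF holder_sq(1)[OF N conjunct1[OF dil[OF b(1)]] wC]] by (simp add: abs_mult)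
      have iw: "integrable lebesgue (\<lambda>x. K * M\<^sup>2 * (w x / norm x)\<^sup>2)" using wL unfolding L2_iff by simp
      have "(LINT x|lebesgue. \<bar>a (c *\<^sub>R x)\<bar> * (w x)\<^sup>2) \<le> (LINT x|lebesgue. \<bar>b (c *\<^sub>R x)\<bar> * (w x)\<^sup>2 + K * M\<^sup>2 * (w x / norm x)\<^sup>2)"
      proof (rule integral_mono_AE[OF ia])
        show "integrable lebesgue (\<lambda>x. \<bar>b (c *\<^sub>R x)\<bar> * (w x)\<^sup>2 + K * M\<^sup>2 * (w x / norm x)\<^sup>2)" using ib iw by simp
        \<comment> \<open>At the origin \<open>w x / norm x\<close> is 0 by convention, so the
          pointwise bound is stated off this null point.\<close>
        have "AE x in lebesgue. x \<noteq> (0 :: real ^ 'n)" using AE_completion[OF AE_lborel_singleton] .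
        then show "AE x in lebesgue. \<bar>a (c *\<^sub>R x)\<bar> * (w x)\<^sup>2 \<le> \<bar>b (c *\<^sub>R x)\<bar> * (w x)\<^sup>2 + K * M\<^sup>2 * (w x / norm x)\<^sup>2"
        proof eventually_elim
          case (elim x)
          show ?case
          proof (cases "\<bar>a (c *\<^sub>R x)\<bar> \<le> K \<and> norm (c *\<^sub>R x) \<le> M")
            case True
            have "norm x \<le> c * norm x" using c mult_right_mono[of 1 c "norm x"] by simp
            then have "norm x \<le> M" using True c by simp
            then have "(norm x)\<^sup>2 \<le> M\<^sup>2" by (intro power_mono) auto
            then have "(norm x)\<^sup>2 * (w x / norm x)\<^sup>2 \<le> M\<^sup>2 * (w x / norm x)\<^sup>2" by (intro mult_right_mono) auto
            then have "(w x)\<^sup>2 \<le> M\<^sup>2 * (w x / norm x)\<^sup>2" using elim by (simp add: power_divide)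
            then have "\<bar>a (c *\<^sub>R x)\<bar> * (w x)\<^sup>2 \<le> K * (M\<^sup>2 * (w x / norm x)\<^sup>2)"
              using True K by (intro mult_mono) auto
            then show ?thesis using True by (simp add: b_def mult.assoc)
          next
            case False
            have "b (c *\<^sub>R x) = a (c *\<^sub>R x)" unfolding b_def by (rule if_not_P[OF False])
            then show ?thesis using K by simp
          qed
        qed
      qed
      also have "\<dots> = (LINT x|lebesgue. \<bar>b (c *\<^sub>R x)\<bar> * (w x)\<^sup>2) + K * M\<^sup>2 * (nrm (\<lambda>x. w x / norm x))\<^sup>2"
        unfolding nrm_sq_int using ib iw by (simp add: Bochner_Integration.integral_add)
      also have "(LINT x|lebesgue. \<bar>b (c *\<^sub>R x)\<bar> * (w x)\<^sup>2) \<le> e * gr w"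
      proof -
        have "(LINT x|lebesgue. \<bar>b (c *\<^sub>R x)\<bar> * (w x)\<^sup>2)
            \<le> Lp_norm ?q (\<lambda>x. b (c *\<^sub>R x)) * lp w powr (2 / crit_exp CARD('n))"
          by (rule holder_sq(2)[OF N conjunct1[OF dil[OF b(1)]] wC])
        also have "\<dots> \<le> e / (s + 1) * (s * gr w)"
          unfolding s_def
        proof (intro mult_mono lp_le_gr N w)
          show "Lp_norm ?q (\<lambda>x. b (c *\<^sub>R x)) \<le> e / (sobS CARD('n) + 1)"
            using dil[OF b(1)] b(2) unfolding s_def by linarith
        qed (use e s in \<open>auto simp: s_def\<close>)
        also have "\<dots> \<le> e * gr w"
        proof -
          have "s / (s + 1) * (e * gr w) \<le> 1 * (e * gr w)" using s e by (intro mult_right_mono) auto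
          then show ?thesis by (simp add: mult.left_commute)
        qed
        finally show ?thesis .
      qed
      finally show "integrable lebesgue (\<lambda>x. \<bar>a (c *\<^sub>R x)\<bar> * (w x)\<^sup>2) \<and>
        (LINT x|lebesgue. \<bar>a (c *\<^sub>R x)\<bar> * (w x)\<^sup>2) \<le> e * gr w + K * M\<^sup>2 * (nrm (\<lambda>x. w x / norm x))\<^sup>2"
        using ia by simp
    qed
  qed (use K in simp)
qed

context potential
begin

text \<open>The equation is tested with the dilation increment of U. Scaling gives the gradient,
  mass and critical terms of the dilated function exactly, and the resulting nonnegative function h
  vanishes at t = 0, so its right derivative there is nonnegative.\<close>

lemma pohozaev:
  assumes U: "U \<in> H1" and sol: "\<And>\<phi>. \<phi> \<in> H1 \<Longrightarrow> de V U \<phi> = \<mu> * ip U \<phi>" and \<mu>: "\<mu> \<le> 0"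
    and W: "(\<lambda>x. V x * norm x * U x) \<in> L2"
  shows "lp U \<le> gr U + real CARD('n) / 2 * vq V U + nrm (\<lambda>x. V x * norm x * U x) * sqrt (gr U)"
proof -
  let ?p = "crit_exp CARD('n)" and ?N = "CARD('n)"
  define w where "w = nrm (\<lambda>x. V x * norm x * U x)"
  have p: "?p > 2" by (rule crit_exp_facts(1)[OF N3])
  have UL: "U \<in> L2" by (rule H1_L2[OF U])
  have Um: "U \<in> borel_measurable lebesgue" by (rule H1_meas[OF U])
  have UC: "U \<in> Lcrit" by (rule H1_Lcrit[OF N3 U])
  define a where "a x = \<bar>U x\<bar> powr (?p - 2)" for x
  have aL: "a \<in> Lp_space (real ?N / 2)"
  proof -
    have e: "(?p - 2) * real ?N / 2 = ?p" unfolding crit_exp_facts(2)[OF N3] using N3 by simp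
    show ?thesis using UC unfolding Lp_space_def a_def[abs_def] by (auto simp: powr_powr e)
  qed
  \<comment> \<open>Two weights, at U and at the dilated U, each with factor p - 1, must together
    cost exactly half of the Dirichlet integral of the increment.\<close>
  define e where "e = 1 / (4 * (?p - 1))"
  have e: "e > 0" "(?p - 1) * e = 1 / 4" unfolding e_def using p by (auto simp: field_simps)
  obtain K where K: "K \<ge> 0" "\<forall>c\<ge>1. \<forall>w\<in>H1. (\<lambda>x. w x / norm x) \<in> L2 \<longrightarrow>
    integrable lebesgue (\<lambda>x. \<bar>a (c *\<^sub>R x)\<bar> * (w x)\<^sup>2) \<and>
    (LINT x|lebesgue. \<bar>a (c *\<^sub>R x)\<bar> * (w x)\<^sup>2) \<le> e * gr w + K * (nrm (\<lambda>x. w x / norm x))\<^sup>2"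
    by (rule weight_split[OF N3 aL e(1)])
  define L where "L = 2 * (?p - 1) * K * gr U"
  \<comment> \<open>The tested equation after all estimates: exact scaling terms, the potential term
    to first order, and an error of second order in t.\<close>
  define h where "h t = 1 / 2 * gr U * ((1 + t)\<^sup>2 / (1 + t) ^ ?N - 1) + t * (w * sqrt (gr U))
    - lp U / ?p * (1 / (1 + t) ^ ?N - 1) - \<mu> / 2 * (nrm U)\<^sup>2 * (1 / (1 + t) ^ ?N - 1) + L * t\<^sup>2" for t
  have h_nonneg: "0 \<le> h t" if t: "t > 0" for t
  proof -
    define D where "D x = U ((1 + t) *\<^sub>R x)" for x
    define \<delta> where "\<delta> x = D x - U x" for x
    have DH: "D \<in> H1" unfolding D_def[abs_def] using t by (intro dil_H1 U) simp
    have grD: "gr D = (1 + t)\<^sup>2 * gr U / (1 + t) ^ ?N" unfolding D_def[abs_def] using t by (intro dil_gr U) simp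
    have lpD: "lp D = lp U / (1 + t) ^ ?N" unfolding D_def[abs_def] using t by (intro dil_lp Um) simp
    have nD: "(nrm D)\<^sup>2 = (nrm U)\<^sup>2 / (1 + t) ^ ?N" unfolding D_def[abs_def] using t by (intro dil_nrm UL) simp
    have \<delta>H: "\<delta> \<in> H1" unfolding \<delta>_def[abs_def] by (intro H1_diff DH U)
    have \<delta>L: "\<delta> \<in> L2" by (rule H1_L2[OF \<delta>H])
    have \<delta>C: "\<delta> \<in> Lcrit" by (rule H1_Lcrit[OF N3 \<delta>H])
    have DC: "D \<in> Lcrit" by (rule H1_Lcrit[OF N3 DH])
    have D\<delta>: "D = (\<lambda>x. U x + \<delta> x)" unfolding \<delta>_def by simp
    have q: "(\<lambda>x. \<delta> x / norm x) \<in> L2" "nrm (\<lambda>x. \<delta> x / norm x) \<le> t * sqrt (gr U)"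
      using dil_diff_bound[OF N3 U t] unfolding \<delta>_def D_def by auto
    have q2: "(nrm (\<lambda>x. \<delta> x / norm x))\<^sup>2 \<le> t\<^sup>2 * gr U"
      using power_mono[OF q(2) nrm_nonneg, of 2] by (simp add: power_mult_distrib)
    \<comment> \<open>Polarization yields minus half the Dirichlet integral of the increment, the
      reserve against the remainder of the nonlinearity.\<close>
    have G: "grip U \<delta> = 1 / 2 * (gr D - gr U - gr \<delta>)" unfolding D\<delta> gr_add[OF U \<delta>H] by simp
    have I: "ip U \<delta> = 1 / 2 * ((nrm D)\<^sup>2 - (nrm U)\<^sup>2 - (nrm \<delta>)\<^sup>2)" unfolding D\<delta> nrm_sq_add[OF UL \<delta>L] by simp
    have vb: "vb V U \<delta> \<le> t * (w * sqrt (gr U))"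
    proof -
      have "AE x in lebesgue. x \<noteq> (0 :: real ^ 'n)" using AE_completion[OF AE_lborel_singleton] .
      then have "AE x in lebesgue. V x * U x * \<delta> x = (V x * norm x * U x) * (\<delta> x / norm x)"
        by eventually_elim simp
      then have "vb V U \<delta> = ip (\<lambda>x. V x * norm x * U x) (\<lambda>x. \<delta> x / norm x)"
        unfolding vb_def ip_def
        by (intro integral_cong_AE borel_measurable_times V_meas Um L2_meas[OF \<delta>L] L2_meas[OF W] L2_meas[OF q(1)])
      also have "\<dots> \<le> w * nrm (\<lambda>x. \<delta> x / norm x)"
        unfolding w_def using ip_le_nrm[OF W q(1)] by (simp add: abs_le_iff)
      also have "\<dots> \<le> w * (t * sqrt (gr U))" by (intro mult_left_mono q(2)) (simp add: w_def)
      finally show ?thesis by (simp add: ac_simps)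
    qed
    have nl: "lp D \<le> lp U + ?p * nl U \<delta> + ?p * (1 / 2 * gr \<delta> + L * t\<^sup>2)"
    proof -
      have a1: "integrable lebesgue (\<lambda>x. \<bar>a x\<bar> * (\<delta> x)\<^sup>2)" "(LINT x|lebesgue. \<bar>a x\<bar> * (\<delta> x)\<^sup>2) \<le> e * gr \<delta> + K * (t\<^sup>2 * gr U)"
        using K(2)[rule_format, of 1, OF _ \<delta>H q(1)] mult_left_mono[OF q2 K(1)] by auto
      have a2: "integrable lebesgue (\<lambda>x. \<bar>a ((1 + t) *\<^sub>R x)\<bar> * (\<delta> x)\<^sup>2)" "(LINT x|lebesgue. \<bar>a ((1 + t) *\<^sub>R x)\<bar> * (\<delta> x)\<^sup>2) \<le> e * gr \<delta> + K * (t\<^sup>2 * gr U)"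
        using K(2)[rule_format, of "1 + t", OF _ \<delta>H q(1)] mult_left_mono[OF q2 K(1)] t by auto
      have iU: "integrable lebesgue (\<lambda>x. \<bar>U x\<bar> powr ?p)" and iD: "integrable lebesgue (\<lambda>x. \<bar>D x\<bar> powr ?p)"
        using UC DC by (auto simp: Lp_space_def)
      have inl: "integrable lebesgue (\<lambda>x. \<bar>U x\<bar> powr (?p - 2) * U x * \<delta> x)" by (rule nl_integrable[OF N3 UC \<delta>C])
      have "lp D \<le> (LINT x|lebesgue. \<bar>U x\<bar> powr ?p + ?p * (\<bar>U x\<bar> powr (?p - 2) * U x * \<delta> x)
          + ?p * (?p - 1) * (\<bar>a x\<bar> * (\<delta> x)\<^sup>2 + \<bar>a ((1 + t) *\<^sub>R x)\<bar> * (\<delta> x)\<^sup>2))"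
        unfolding lp_def
      proof (rule integral_mono[OF iD])
        show "integrable lebesgue (\<lambda>x. \<bar>U x\<bar> powr ?p + ?p * (\<bar>U x\<bar> powr (?p - 2) * U x * \<delta> x)
          + ?p * (?p - 1) * (\<bar>a x\<bar> * (\<delta> x)\<^sup>2 + \<bar>a ((1 + t) *\<^sub>R x)\<bar> * (\<delta> x)\<^sup>2))"
          using iU inl a1(1) a2(1) by (intro Bochner_Integration.integrable_add integrable_mult_right) auto
        show "\<bar>D x\<bar> powr ?p \<le> \<bar>U x\<bar> powr ?p + ?p * (\<bar>U x\<bar> powr (?p - 2) * U x * \<delta> x)
          + ?p * (?p - 1) * (\<bar>a x\<bar> * (\<delta> x)\<^sup>2 + \<bar>a ((1 + t) *\<^sub>R x)\<bar> * (\<delta> x)\<^sup>2)" for x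
          using abs_powr_second_order[OF p, of "D x" "U x"] unfolding \<delta>_def a_def D_def[symmetric]
          by (simp add: distrib_right)
      qed
      also have "\<dots> = lp U + ?p * nl U \<delta> + ?p * (?p - 1) *
          ((LINT x|lebesgue. \<bar>a x\<bar> * (\<delta> x)\<^sup>2) + (LINT x|lebesgue. \<bar>a ((1 + t) *\<^sub>R x)\<bar> * (\<delta> x)\<^sup>2))"
      proof -
        note i2 = integrable_mult_right[OF inl, of ?p]
        note i3 = integrable_mult_right[OF Bochner_Integration.integrable_add[OF a1(1) a2(1)], of "?p * (?p - 1)"]
        show ?thesis
          unfolding lp_def nl_def
          by (simp only: Bochner_Integration.integral_add[OF Bochner_Integration.integrable_add[OF iU i2] i3]
              Bochner_Integration.integral_add[OF iU i2] Bochner_Integration.integral_add[OF a1(1) a2(1)] integral_mult_right_zero)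
      qed
      also have "\<dots> \<le> lp U + ?p * nl U \<delta> + ?p * (?p - 1) * (2 * (e * gr \<delta> + K * (t\<^sup>2 * gr U)))"
        using a1(2) a2(2) p by (intro add_left_mono mult_left_mono) auto
      also have "?p * (?p - 1) * (2 * (e * gr \<delta> + K * (t\<^sup>2 * gr U))) = ?p * (2 * ((?p - 1) * e) * gr \<delta> + L * t\<^sup>2)"
        unfolding L_def by (simp add: algebra_simps)
      finally show ?thesis unfolding e(2) by simp
    qed
    have nl': "(lp D - lp U) / ?p - 1 / 2 * gr \<delta> - L * t\<^sup>2 \<le> nl U \<delta>"
    proof -
      have "lp D - lp U \<le> ?p * (nl U \<delta> + 1 / 2 * gr \<delta> + L * t\<^sup>2)" using nl by (simp add: algebra_simps)
      then have "(lp D - lp U) / ?p \<le> nl U \<delta> + 1 / 2 * gr \<delta> + L * t\<^sup>2" using p by (simp add: divide_le_eq mult.commute)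
      then show ?thesis by linarith
    qed
    \<comment> \<open>The squared norm of the increment enters with the sign of the multiplier, so
      it can be discarded when \<open>\<mu> \<le> 0\<close>.\<close>
    have \<mu>': "\<mu> / 2 * ((nrm D)\<^sup>2 - (nrm U)\<^sup>2) \<le> \<mu> * ip U \<delta>"
    proof -
      have "\<mu> / 2 * (nrm \<delta>)\<^sup>2 \<le> 0" using \<mu> by (simp add: mult_nonpos_nonneg)
      then show ?thesis unfolding I by (simp add: algebra_simps)
    qed
    have "grip U \<delta> + vb V U \<delta> - nl U \<delta> = \<mu> * ip U \<delta>" using sol[OF \<delta>H] unfolding de_def .
    then have "0 \<le> 1 / 2 * (gr D - gr U) + t * (w * sqrt (gr U)) - (lp D - lp U) / ?p
        - \<mu> / 2 * ((nrm D)\<^sup>2 - (nrm U)\<^sup>2) + L * t\<^sup>2"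
      using vb nl' \<mu>' unfolding G by argo
    also have "\<dots> = h t" unfolding h_def grD lpD nD by (simp add: algebra_simps diff_divide_distrib)
    finally show ?thesis .
  qed
  have D1: "((\<lambda>t. 1 / (1 + t) ^ ?N) has_real_derivative - real ?N) (at 0)"
    by (auto intro!: derivative_eq_intros)
  have D2: "((\<lambda>t. (1 + t)\<^sup>2 / (1 + t) ^ ?N) has_real_derivative 2 - real ?N) (at 0)"
    by (auto intro!: derivative_eq_intros)
  define h' where "h' = 1 / 2 * gr U * (2 - real ?N) + w * sqrt (gr U) + lp U / ?p * real ?N + \<mu> / 2 * (nrm U)\<^sup>2 * real ?N"
  have Dh: "(h has_real_derivative h') (at 0)"
    unfolding h_def[abs_def] h'_def
    by (rule derivative_eq_intros D1 D2 refl | (simp; fail) | (simp add: algebra_simps; fail))+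
  have h0: "h 0 = 0" unfolding h_def by simp
  have "0 \<le> h'"
  proof (rule ccontr)
    assume "\<not> 0 \<le> h'"
    then have "h' < 0" by simp
    from DERIV_neg_dec_right[OF Dh this] obtain d where d: "d > 0" "\<And>t. 0 < t \<Longrightarrow> t < d \<Longrightarrow> h (0 + t) < h 0" by blast
    then have "h (0 + d / 2) < h 0" by simp
    then show False using h_nonneg[of "d / 2"] d(1) h0 by simp
  qed
  \<comment> \<open>Testing the equation with U itself eliminates the multiplier.\<close>
  moreover have "\<mu> / 2 * (nrm U)\<^sup>2 * real ?N = (gr U + vq V U - lp U) / 2 * real ?N"
    using sol[OF U] unfolding nrm_sq de_self by simp
  moreover have "lp U / ?p * real ?N = lp U * ((real ?N - 2) / 2)" unfolding crit_exp_def using N3 by simp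
  ultimately have "0 \<le> 1 / 2 * gr U * (2 - real ?N) + w * sqrt (gr U) + lp U * ((real ?N - 2) / 2) + (gr U + vq V U - lp U) / 2 * real ?N"
    unfolding h'_def by argo
  then show ?thesis unfolding w_def[symmetric] by (simp add: field_simps)
qed

text \<open>The square of W1 lies in the space of exponent N/2, so the weighted square integrability
  is an instance of the estimate for potentials.\<close>

lemma weight_L2:
  fixes W1 W2 :: "real ^ 'n \<Rightarrow> real"
  assumes W: "AE x in lebesgue. V x * norm x = W1 x + W2 x"
    and W1: "W1 \<in> Lp_space (real CARD('n))" and W2: "W2 \<in> Linf_space" and U: "U \<in> H1"
  shows "(\<lambda>x. V x * norm x * U x) \<in> L2"
    and "nrm (\<lambda>x. V x * norm x * U x) \<le> Lp_norm (real CARD('n)) W1 * sqrt (sobS CARD('n) * gr U) + Linf_norm W2 * nrm U"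
proof -
  let ?N = "real CARD('n)"
  have N: "?N > 0" using N3 by simp
  have UL: "U \<in> L2" by (rule H1_L2[OF U])
  have W1m: "W1 \<in> borel_measurable lebesgue" using W1 by (simp add: Lp_space_def)
  have W2m: "W2 \<in> borel_measurable lebesgue" by (rule Linf_meas[OF W2])
  have sqL: "(\<lambda>x. (W1 x)\<^sup>2) \<in> Lp_space (?N / 2)"
    using W1 W1m by (simp only: Lp_space_def mem_Collect_eq sq_powr_half borel_measurable_power simp_thms)
  have "Lp_norm (?N / 2) (\<lambda>x. (W1 x)\<^sup>2) = ((LINT x|lebesgue. \<bar>W1 x\<bar> powr ?N) powr (1 / ?N))\<^sup>2"
    unfolding Lp_norm_def sq_powr_half using N by (simp add: power2_eq_square powr_add[symmetric])
  then have sqn: "Lp_norm (?N / 2) (\<lambda>x. (W1 x)\<^sup>2) = (Lp_norm ?N W1)\<^sup>2" unfolding Lp_norm_def .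
  have l1: "(\<lambda>x. W1 x * U x) \<in> L2"
    using holder_sq(1)[OF N3 sqL H1_Lcrit[OF N3 U]] W1m L2_meas[OF UL] by (simp add: L2_iff power_mult_distrib)
  have "(nrm (\<lambda>x. W1 x * U x))\<^sup>2 \<le> (Lp_norm ?N W1)\<^sup>2 * lp U powr (2 / crit_exp CARD('n))"
    using holder_sq(2)[OF N3 sqL H1_Lcrit[OF N3 U]] unfolding nrm_sq_int sqn by (simp add: power_mult_distrib)
  also have "\<dots> \<le> (Lp_norm ?N W1)\<^sup>2 * (sobS CARD('n) * gr U)"
    by (intro mult_left_mono lp_le_gr N3 U) simp
  also have "\<dots> = (Lp_norm ?N W1 * sqrt (sobS CARD('n) * gr U))\<^sup>2"
    by (simp add: power_mult_distrib sobS_nonneg)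
  finally have n1: "nrm (\<lambda>x. W1 x * U x) \<le> Lp_norm ?N W1 * sqrt (sobS CARD('n) * gr U)"
    by (rule power2_le_imp_le) (simp add: Lp_norm_def sobS_nonneg)
  have ae2: "AE x in lebesgue. \<bar>W2 x * U x\<bar> \<le> \<bar>Linf_norm W2 * U x\<bar>"
    using Linf_norm_props(2)[OF W2]
    by eventually_elim (use Linf_norm_props(1)[OF W2] in \<open>auto simp: abs_mult intro!: mult_right_mono\<close>)
  have m2: "(\<lambda>x. W2 x * U x) \<in> borel_measurable lebesgue" using W2m L2_meas[OF UL] by simp
  have l2: "(\<lambda>x. W2 x * U x) \<in> L2" by (rule L2_bound[OF L2_cmult[OF UL] m2 ae2])
  have n2: "nrm (\<lambda>x. W2 x * U x) \<le> Linf_norm W2 * nrm U"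
    using nrm_mono[OF L2_cmult[OF UL] m2 ae2] Linf_norm_props(1)[OF W2] by (simp add: nrm_cmult)
  have ae: "AE x in lebesgue. V x * norm x * U x = W1 x * U x + W2 x * U x"
    using W by eventually_elim (simp add: distrib_right)
  have "(\<lambda>x :: real ^ 'n. norm x) \<in> borel_measurable lebesgue"
    by (intro continuous_lebesgue_measurable continuous_intros)
  then have m: "(\<lambda>x. V x * norm x * U x) \<in> borel_measurable lebesgue"
    using V_meas L2_meas[OF UL] by simp
  have ae': "AE x in lebesgue. \<bar>V x * norm x * U x\<bar> \<le> \<bar>W1 x * U x + W2 x * U x\<bar>"
    using ae by eventually_elim simp
  show "(\<lambda>x. V x * norm x * U x) \<in> L2" by (rule L2_bound[OF L2_add[OF l1 l2] m ae'])
  have "nrm (\<lambda>x. V x * norm x * U x) \<le> nrm (\<lambda>x. W1 x * U x + W2 x * U x)"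
    by (rule nrm_mono[OF L2_add[OF l1 l2] m ae'])
  also have "\<dots> \<le> nrm (\<lambda>x. W1 x * U x) + nrm (\<lambda>x. W2 x * U x)" by (rule nrm_triangle[OF l1 l2])
  finally show "nrm (\<lambda>x. V x * norm x * U x) \<le> Lp_norm ?N W1 * sqrt (sobS CARD('n) * gr U) + Linf_norm W2 * nrm U"
    using n1 n2 by linarith
qed

text \<open>The lower bound \<open>vq_ge\<close> applied to the potential \<open>- c * V\<close>,
  whose negative part is the positive part of \<open>c * V\<close>.\<close>

lemma vq_cmult_le:
  assumes U: "U \<in> H1"
  shows "c * vq V U \<le> Lp_norm (real CARD('n) / 2) (pos_part (\<lambda>x. c * V1 x)) * (sobS CARD('n) * gr U)
    + Linf_norm (pos_part (\<lambda>x. c * V2 x)) * (nrm U)\<^sup>2"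
proof -
  interpret cV: potential "\<lambda>x. - c * V x" "\<lambda>x. - c * V1 x" "\<lambda>x. - c * V2 x"
  proof
    show "AE x in lebesgue. - c * V x = - c * V1 x + - c * V2 x"
      using V_AE by eventually_elim (simp add: algebra_simps)
    show "(\<lambda>x. - c * V1 x) \<in> Lp_space (real CARD('n) / 2)"
      by (rule Lp_space_le[OF V1 _ _ AE_I2, of _ "\<bar>c\<bar>"]) (use N3 V1_meas in \<open>auto simp: abs_mult\<close>)
    show "(\<lambda>x. - c * V2 x) \<in> Linf_space"
      by (rule Linf_norm_le[OF V2, of _ "\<bar>c\<bar>"]) (use Linf_meas[OF V2] in \<open>auto simp: abs_mult\<close>)
    show "((\<lambda>x. - c * V2 x) \<longlongrightarrow> 0) at_infinity" using tendsto_mult_right_zero[OF V2_lim] .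
  qed (rule N3)
  have "neg_part (\<lambda>x. - c * f x) = pos_part (\<lambda>x. c * f x)" for f :: "real ^ 'n \<Rightarrow> real"
    unfolding neg_part_def[abs_def] pos_part_def[abs_def] by simp
  moreover have "vq (\<lambda>x. - c * V x) U = - (c * vq V U)" unfolding vq_def by (simp add: mult.assoc)
  ultimately show ?thesis using cV.vq_ge[OF U] by simp
qed

text \<open>Negative energy bounds gradient and potential terms by the critical term, and the
  Pohozaev inequality bounds the critical term back. The smallness conditions make this impossible
  once the Dirichlet integral exceeds g.\<close>

lemma critical_negative_energy_gr_le:
  fixes W1 W2 :: "real ^ 'n \<Rightarrow> real"
  assumes \<rho>: "\<rho> > 0" and g: "g > 0" and U: "constrained_critical V \<rho> U" and E: "energy V U < 0"
    and W: "AE x in lebesgue. V x * norm x = W1 x + W2 x"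
    and W1: "W1 \<in> Lp_space (real CARD('n))" and W2: "W2 \<in> Linf_space"
    and a: "Lp_norm (real CARD('n) / 2) (pos_part (\<lambda>x. (real CARD('n) - 4) * V1 x)) \<le> A"
      "Lp_norm (real CARD('n)) W1 \<le> A" "A * (sobS CARD('n) + sqrt (sobS CARD('n))) \<le> 1 / real CARD('n)"
    and b: "\<rho>\<^sup>2 * Linf_norm (pos_part (\<lambda>x. (real CARD('n) - 4) * V2 x)) \<le> B"
      "\<rho> * Linf_norm W2 \<le> B" "B * (1 / g + 1 / sqrt g) \<le> 1 / real CARD('n)"
  shows "gr U \<le> g"
proof (rule ccontr)
  let ?N = "real CARD('n)" and ?p = "crit_exp CARD('n)" and ?w = "nrm (\<lambda>x. V x * norm x * U x)"
  assume "\<not> gr U \<le> g"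
  then have gU: "gr U > g" by simp
  define s where "s = sobS CARD('n)"
  have s: "0 \<le> s" unfolding s_def by (rule sobS_nonneg)
  define r where "r = sqrt (gr U)"
  have r: "r > 0" "r * r = gr U" "r\<^sup>2 = gr U" unfolding r_def using gU g by auto
  have UH: "U \<in> H1" and Un: "(nrm U)\<^sup>2 = \<rho>\<^sup>2" using U unfolding critical_iff mass_sphere_iff by auto
  have nU: "nrm U = \<rho>" using Un \<rho> power2_eq_iff_nonneg[of "nrm U" \<rho>] by simp
  have N: "?N \<ge> 3" using N3 by simp
  have p: "?p > 2" "1 / ?p = (?N - 2) / (2 * ?N)" by (rule crit_exp_facts(1)[OF N3]) (simp add: crit_exp_def)
  have A0: "0 \<le> A" using a(2) by (rule order_trans[rotated]) (simp add: Lp_norm_def)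
  have B0: "0 \<le> B" using b(2) \<rho> Linf_norm_props(1)[OF W2] by (intro order_trans[OF _ b(2)]) simp
  have "de V U \<phi> = de V U U / \<rho>\<^sup>2 * ip U \<phi>" if "\<phi> \<in> H1" for \<phi>
    using critical_imp_solution[OF U \<rho>] that unfolding solution_iff by blast
  moreover have "de V U U / \<rho>\<^sup>2 \<le> 0" using multiplier_neg[OF UH E] \<rho> by (intro divide_nonpos_nonneg) auto
  ultimately have P: "lp U \<le> gr U + ?N / 2 * vq V U + ?w * r"
    unfolding r_def by (intro pohozaev UH weight_L2(1)[OF W W1 W2 UH])
  have v: "(?N - 4) * vq V U \<le> A * (s * gr U) + B"
  proof -
    have "(?N - 4) * vq V U \<le> Lp_norm (?N / 2) (pos_part (\<lambda>x. (?N - 4) * V1 x)) * (s * gr U)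
      + Linf_norm (pos_part (\<lambda>x. (?N - 4) * V2 x)) * \<rho>\<^sup>2"
      using vq_cmult_le[OF UH, of "?N - 4"] unfolding s_def Un .
    moreover have "Lp_norm (?N / 2) (pos_part (\<lambda>x. (?N - 4) * V1 x)) * (s * gr U) \<le> A * (s * gr U)"
      using s by (intro mult_right_mono a(1)) auto
    ultimately show ?thesis using b(1) by (simp add: mult.commute)
  qed
  have w: "?w * r \<le> A * sqrt s * gr U + B * r"
  proof -
    have "?w \<le> Lp_norm ?N W1 * (sqrt s * r) + Linf_norm W2 * \<rho>"
      using weight_L2(2)[OF W W1 W2 UH] unfolding r_def s_def real_sqrt_mult nU .
    also have "\<dots> \<le> A * (sqrt s * r) + B"
      using s r b(2) by (intro add_mono mult_right_mono a(2)) (auto simp: mult.commute)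
    finally have "?w * r \<le> (A * (sqrt s * r) + B) * r" using r by (intro mult_right_mono) auto
    also have "\<dots> = A * sqrt s * gr U + B * r" unfolding r(2)[symmetric] by (simp add: algebra_simps)
    finally show ?thesis .
  qed
  have "1 / ?p * lp U \<le> 1 / ?p * (gr U + ?N / 2 * vq V U + ?w * r)" using p(1) by (intro mult_left_mono P) auto
  also have "\<dots> = (?N - 2) / (2 * ?N) * gr U + (?N - 2) / 4 * vq V U + 1 / ?p * (?w * r)"
    unfolding distrib_left p(2) using N by (simp add: field_simps)
  finally have "1 / ?p * lp U \<le> (?N - 2) / (2 * ?N) * gr U + (?N - 2) / 4 * vq V U + 1 / ?p * (?w * r)" .
  \<comment> \<open>The gradient terms leave the coefficient 1/N, and the potential terms leave
    (N-2)/4 - 1/2 = (N-4)/4.\<close>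
  then have "gr U / ?N < 1 / 4 * ((?N - 4) * vq V U) + 1 / ?p * (?w * r)"
  proof -
    have "(?N - 2) / (2 * ?N) * gr U = gr U / 2 - gr U / ?N" using N by (simp add: field_simps)
    moreover have "(?N - 2) / 4 * vq V U = 1 / 4 * ((?N - 4) * vq V U) + vq V U / 2" by (simp add: field_simps)
    ultimately show ?thesis
      using E \<open>1 / ?p * lp U \<le> (?N - 2) / (2 * ?N) * gr U + (?N - 2) / 4 * vq V U + 1 / ?p * (?w * r)\<close>
      unfolding energy_eq[OF UH] by linarith
  qed
  also have "\<dots> \<le> 1 / 4 * (A * (s * gr U) + B) + 1 / 2 * (A * sqrt s * gr U + B * r)"
  proof (intro add_mono mult_left_mono v)
    have "0 \<le> ?w * r" using r by simp
    then have "1 / ?p * (?w * r) \<le> 1 / 2 * (?w * r)" using p(1) by (intro mult_right_mono) (auto simp: field_simps)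
    also have "\<dots> \<le> 1 / 2 * (A * sqrt s * gr U + B * r)" by (rule mult_left_mono[OF w]) simp
    finally show "1 / ?p * (?w * r) \<le> 1 / 2 * (A * sqrt s * gr U + B * r)" .
  qed simp
  also have "\<dots> \<le> 1 / 2 * (A * (s + sqrt s) * gr U) + 1 / 2 * (B + B * r)"
  proof -
    have "0 \<le> A * (s * gr U)" using A0 s by simp
    then show ?thesis using B0 by (simp add: field_simps)
  qed
  also have "A * (s + sqrt s) * gr U \<le> 1 / ?N * gr U" unfolding s_def by (intro mult_right_mono a(3)) simp
  \<comment> \<open>Terms without the full Dirichlet integral are absorbed through the assumption
    that it exceeds g. This is why B is measured against \<open>1 / g + 1 / sqrt g\<close>.\<close>
  also have "B + B * r \<le> 1 / ?N * gr U"
  proof -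
    have "1 \<le> gr U / g" using gU g by simp
    moreover have "r \<le> gr U / sqrt g"
    proof -
      have "sqrt g \<le> r" unfolding r_def using gU by simp
      then have "r * sqrt g \<le> r * r" using r by (intro mult_left_mono) auto
      then show ?thesis using g r by (simp add: field_simps)
    qed
    ultimately have "B * 1 + B * r \<le> B * (gr U / g) + B * (gr U / sqrt g)" using B0 by (intro add_mono mult_left_mono)
    also have "\<dots> = B * (1 / g + 1 / sqrt g) * gr U" by (simp add: algebra_simps)
    also have "\<dots> \<le> 1 / ?N * gr U" by (intro mult_right_mono b(3)) simp
    finally show ?thesis by simp
  qed
  finally show False by simp
qed

end

section \<open>Normalized ground states\<close>

lemma H1_norm_ge_gr: "U \<in> H1 \<Longrightarrow> sqrt (gr U) \<le> H1_norm U"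
  unfolding H1_norm_def by (simp add: weak_grad_integral)

text \<open>The root of the Dirichlet integral is Lipschitz for the H1 norm, so a small H1 ball
  around U stays in the region where U is minimal.\<close>

lemma (in potential) local_minimizerI:
  assumes U: "U \<in> mass_sphere \<rho>" "gr U < g"
    and min: "\<And>\<Phi>. \<Phi> \<in> mass_sphere \<rho> \<Longrightarrow> gr \<Phi> \<le> g \<Longrightarrow> energy V U \<le> energy V \<Phi>"
  shows "local_minimizer V \<rho> U"
  unfolding local_minimizer_def
proof (intro conjI exI[of _ "sqrt g - sqrt (gr U)"] ballI impI U(1))
  show "sqrt g - sqrt (gr U) > 0" using U(2) by simp
  fix \<Phi> assume P: "\<Phi> \<in> mass_sphere \<rho>" "H1_norm (\<lambda>x. \<Phi> x - U x) < sqrt g - sqrt (gr U)"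
  have H: "U \<in> H1" "\<Phi> \<in> H1" using U(1) P(1) mass_sphere_iff by auto
  have "sqrt (gr \<Phi>) \<le> sqrt (gr U) + sqrt (gr (\<lambda>x. \<Phi> x - U x))"
    using gr_triangle[OF H(1) H1_diff[OF H(2,1)]] by simp
  also have "\<dots> < sqrt g" using H1_norm_ge_gr[OF H1_diff[OF H(2,1)]] P(2) by linarith
  finally show "energy V U \<le> energy V \<Phi>" using P(1) by (intro min) auto
qed

theorem theorem1p3:
  assumes "CARD('n::finite) \<ge> 3"
  shows "\<exists>C0>0. \<exists>C1>0. \<exists>C2>0.
    \<forall>\<rho>>0. \<forall>V V1 V2 W1 W2 :: real ^ 'n \<Rightarrow> real.
      (AE x in lebesgue. V x = V1 x + V2 x) \<longrightarrow>
      (AE x in lebesgue. V x * norm x = W1 x + W2 x) \<longrightarrow>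
      V1 \<in> Lp_space (real CARD('n) / 2) \<longrightarrow>
      W1 \<in> Lp_space (real CARD('n)) \<longrightarrow>
      V2 \<in> Linf_space \<longrightarrow>
      W2 \<in> Linf_space \<longrightarrow>
      ((\<lambda>x. \<bar>V2 x\<bar> + \<bar>W2 x\<bar>) \<longlongrightarrow> 0) at_infinity \<longrightarrow>
      spectral_bottom V < 0 \<longrightarrow>
      max (Lp_norm (real CARD('n) / 2) (neg_part V1)) (\<rho>\<^sup>2 * Linf_norm (neg_part V2)) < C0 \<longrightarrow>
      (\<exists>U \<mu>. normalized_solution V \<rho> U \<mu> \<and> local_minimizer V \<rho> U \<and>
        energy V U < 0 \<and> \<mu> < 0 \<and> (AE x in lebesgue. U x > 0)) \<and>
      (max (Lp_norm (real CARD('n) / 2) (pos_part (\<lambda>x. (real CARD('n) - 4) * V1 x)))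
           (Lp_norm (real CARD('n)) W1) < C1 \<longrightarrow>
       max (\<rho>\<^sup>2 * Linf_norm (pos_part (\<lambda>x. (real CARD('n) - 4) * V2 x)))
           (\<rho> * Linf_norm W2) < C2 \<longrightarrow>
       (\<exists>U \<mu>. normalized_solution V \<rho> U \<mu> \<and> local_minimizer V \<rho> U \<and>
         energy V U < 0 \<and> \<mu> < 0 \<and> (AE x in lebesgue. U x > 0) \<and>
         normalized_ground_state V \<rho> U))"
proof -
  let ?N = "real CARD('n)"
  define p K s where "p = crit_exp CARD('n)" and "K = sobK CARD('n)" and "s = sobS CARD('n)"
  have N: "?N > 0" using assms by simp
  have p: "p > 2" unfolding p_def by (rule crit_exp_facts(1)[OF assms])
  have K: "0 \<le> K" unfolding K_def sobK_def by simp
  have s: "0 \<le> s" unfolding s_def by (rule sobS_nonneg)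
  \<comment> \<open>Solves \<open>(4 * g) powr (p / 2 - 1) = p / (16 * (K + 1))\<close>; the added 1
    covers the bare knowledge \<open>K \<ge> 0\<close>. As p and K depend only on the dimension, so
    does g.\<close>
  define g where "g = (p / (16 * (K + 1))) powr (1 / (p / 2 - 1)) / 4"
  have g: "g > 0" unfolding g_def using p K by simp
  have gp: "K * (4 * g) powr (p / 2 - 1) \<le> p / 16"
  proof -
    have "K * (4 * g) powr (p / 2 - 1) = K / (K + 1) * (p / 16)"
      unfolding g_def using p K by (simp add: powr_powr)
    also have "\<dots> \<le> 1 * (p / 16)" using p K by (intro mult_right_mono) auto
    finally show ?thesis by simp
  qed
  \<comment> \<open>The first entry keeps V1 from using more than half of the Dirichlet form, the
    second is the bound required of V2.\<close>
  define C0 where "C0 = min (1 / (2 * (s + 1))) (g / 8)"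
  \<comment> \<open>A and B are the constants of the ground state part; each enters the
    contradiction in \<open>critical_negative_energy_gr_le\<close> with half of the share
    1/N.\<close>
  define A where "A = 1 / (?N * (s + sqrt s + 1))"
  define B where "B = 1 / (?N * (1 / g + 1 / sqrt g))"
  have pos: "C0 > 0" "A > 0" "B > 0"
  proof -
    show "C0 > 0" unfolding C0_def using s g by simp
    have "s + sqrt s + 1 > 0" using s by (intro add_nonneg_pos) auto
    then show "A > 0" unfolding A_def using N by simp
    have "1 / g + 1 / sqrt g > 0" using g by (intro add_pos_pos) auto
    then show "B > 0" unfolding B_def using N by simp
  qed
  have A: "A * (s + sqrt s) \<le> 1 / ?N"
  proof -
    have "s + sqrt s + 1 > 0" using s by (intro add_nonneg_pos) auto
    then have "(s + sqrt s) / (s + sqrt s + 1) \<le> 1" by simp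
    then have "(s + sqrt s) / (s + sqrt s + 1) / ?N \<le> 1 / ?N" using N by (intro divide_right_mono) auto
    then show ?thesis unfolding A_def by (simp add: mult.commute)
  qed
  have B: "B * (1 / g + 1 / sqrt g) \<le> 1 / ?N"
  proof -
    have "1 / g + 1 / sqrt g > 0" using g by (intro add_pos_pos) auto
    then have "1 / (?N * y) * y = 1 / ?N" if "y = 1 / g + 1 / sqrt g" for y using that by simp
    then show ?thesis unfolding B_def by simp
  qed
  \<comment> \<open>One and the same U serves both parts; the additional smallness only adds the
    ground state property.\<close>
  have main: "\<exists>U \<mu>. normalized_solution V \<rho> U \<mu> \<and> local_minimizer V \<rho> U \<and> energy V U < 0 \<and> \<mu> < 0 \<and>
      (AE x in lebesgue. U x > 0) \<and>
      (max (Lp_norm (?N / 2) (pos_part (\<lambda>x. (?N - 4) * V1 x))) (Lp_norm ?N W1) < A \<longrightarrow>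
       max (\<rho>\<^sup>2 * Linf_norm (pos_part (\<lambda>x. (?N - 4) * V2 x))) (\<rho> * Linf_norm W2) < B \<longrightarrow>
       normalized_ground_state V \<rho> U)"
    if \<rho>: "\<rho> > 0" and V: "AE x in lebesgue. V x = V1 x + V2 x"
      and W: "AE x in lebesgue. V x * norm x = W1 x + W2 x"
      and V1: "V1 \<in> Lp_space (?N / 2)" and W1: "W1 \<in> Lp_space ?N" and V2: "V2 \<in> Linf_space" and W2: "W2 \<in> Linf_space"
      and lim: "((\<lambda>x. \<bar>V2 x\<bar> + \<bar>W2 x\<bar>) \<longlongrightarrow> 0) at_infinity" and spec: "spectral_bottom V < 0"
      and small: "max (Lp_norm (?N / 2) (neg_part V1)) (\<rho>\<^sup>2 * Linf_norm (neg_part V2)) < C0"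
    for \<rho> and V V1 V2 W1 W2 :: "real ^ 'n \<Rightarrow> real"
  proof -
    interpret small_potential V V1 V2 \<rho> g
    proof
      show "(V2 \<longlongrightarrow> 0) at_infinity"
        by (rule Lim_null_comparison[OF _ lim]) auto
      show "sobK CARD('n) * (4 * g) powr (crit_exp CARD('n) / 2 - 1) \<le> crit_exp CARD('n) / 16"
        using gp unfolding K_def p_def .
      have "Lp_norm (?N / 2) (neg_part V1) \<le> 1 / (2 * (s + 1))" "\<rho>\<^sup>2 * Linf_norm (neg_part V2) \<le> g / 8"
        using small unfolding C0_def by auto
      then have "Lp_norm (?N / 2) (neg_part V1) * s \<le> 1 / (2 * (s + 1)) * s" using s by (intro mult_right_mono) auto
      also have "\<dots> \<le> 1 / 2" using s by (simp add: field_simps)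
      finally show "Lp_norm (?N / 2) (neg_part V1) * sobS CARD('n) \<le> 1 / 2" unfolding s_def .
      show "\<rho>\<^sup>2 * Linf_norm (neg_part V2) \<le> g / 8" by fact
    qed (rule assms V V1 V2 \<rho> g spec)+
    obtain U where U: "U \<in> mass_sphere \<rho>" "gr U < g" "energy V U < 0" "\<And>x. 0 \<le> U x"
      and min: "\<And>\<Phi>. \<Phi> \<in> mass_sphere \<rho> \<Longrightarrow> gr \<Phi> \<le> g \<Longrightarrow> energy V U \<le> energy V \<Phi>"
      using minimizer_exists by metis
    have UH: "U \<in> H1" and Un: "(nrm U)\<^sup>2 = \<rho>\<^sup>2" using U(1) mass_sphere_iff by auto
    have crit: "constrained_critical V \<rho> U"
      by (rule local_min_critical[OF \<rho> U(1,2)]) (rule min, auto)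
    define \<mu> where "\<mu> = de V U U / \<rho>\<^sup>2"
    have sol: "normalized_solution V \<rho> U \<mu>" unfolding \<mu>_def by (rule critical_imp_solution[OF crit \<rho>])
    have \<mu>: "\<mu> < 0" unfolding \<mu>_def using multiplier_neg[OF UH U(3)] \<rho> by (simp add: divide_neg_pos)
    have "nrm U > 0" using Un \<rho> nrm_nonneg[of U] by (cases "nrm U = 0") auto
    then have Upos: "AE x in lebesgue. U x > 0"
      using nonneg_solution_pos[OF UH U(4)] sol unfolding solution_iff by blast
    have "normalized_ground_state V \<rho> U"
      if C1: "max (Lp_norm (?N / 2) (pos_part (\<lambda>x. (?N - 4) * V1 x))) (Lp_norm ?N W1) < A"
        and C2: "max (\<rho>\<^sup>2 * Linf_norm (pos_part (\<lambda>x. (?N - 4) * V2 x))) (\<rho> * Linf_norm W2) < B"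
    proof -
      \<comment> \<open>A critical point of nonnegative energy lies above U anyway. One of negative
        energy has Dirichlet integral at most g and therefore takes part in the
        minimization.\<close>
      have le: "energy V U \<le> energy V \<Phi>" if c: "constrained_critical V \<rho> \<Phi>" for \<Phi>
      proof (cases "energy V \<Phi> < 0")
        case True
        have "gr \<Phi> \<le> g"
        proof (rule critical_negative_energy_gr_le[OF \<rho> g c True W W1 W2])
          show "A * (sobS CARD('n) + sqrt (sobS CARD('n))) \<le> 1 / ?N" using A unfolding s_def .
        qed (use C1 C2 B in auto)
        then show ?thesis using c unfolding critical_iff by (intro min) auto
      qed (use U(3) in simp)
      have "(INF \<Phi>\<in>{\<Phi>. constrained_critical V \<rho> \<Phi>}. ereal (energy V \<Phi>)) = ereal (energy V U)"
        by (rule antisym; intro INF_lower INF_greatest) (use crit le in auto)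
      then show ?thesis unfolding normalized_ground_state_def using crit by simp
    qed
    then show ?thesis using sol local_minimizerI[OF U(1,2) min] U(3) \<mu> Upos by blast
  qed
  show ?thesis
  proof (rule exI[of _ C0], rule conjI[OF pos(1)], rule exI[of _ A], rule conjI[OF pos(2)],
      rule exI[of _ B], rule conjI[OF pos(3)], intro conjI allI impI, goal_cases)
    case (1 \<rho> V V1 V2 W1 W2)
    from main[OF 1(1-10)] show ?case by blast
  next
    case (2 \<rho> V V1 V2 W1 W2)
    from main[OF 2(1-10)] 2(11,12) show ?case by blast
  qed
qed

end
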